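(* Let $\alpha>0$ and let $X=(X_t)_{t\in\mathbb{R}}$ be a two-sided real-valued Lévy process which is not a deterministic linear drift and which satisfies $\mathbb{E}[|X_1|]<\infty$ and $|\mathbb{E}[X_1]|<\alpha$. Let $M$ be the $\alpha$-Lipschitz minorant of $X$, $\mathcal{Z}=\{t\in\mathbb{R}:M_t=X_t\wedge X_{t-}\}$ and $D=\inf(\mathcal{Z}\cap(0,\infty))$. Let $\tilde X$ be the Markov (Hunt) process whose law under $\tilde{\mathbb{P}}^x$ is that of $(x+X_t+\alpha t)_{t\ge0}$, and suppose that $0$ is regular for $(0,\infty)$ for $\tilde X$. Then the process $(X_{t+D}-X_D)_{t\ge0}$ is independent of $(X_t,\,-\infty<t\le D)$. Moreover, the process $(X_{t+D}-X_D+\alpha t)_{t\ge0}$ is Markovian with transition functions $(\breve H_t)_{t\ge0}$ and some family of entrance laws $(\breve Q_t)_{t\ge0}$, where, for $t\ge0$ and $x,y>0$, $$\breve H_t(x,dy)=\tilde{\mathbb{P}}^x\{\tilde X_t\in dy,\ t<\breve T\}\,\frac{\tilde{\mathbb{P}}^y\{\breve T=\infty\}}{\tilde{\mathbb{P}}^x\{\breve T=\infty\}},\qquad \breve T=\inf\{t>0:\tilde X_t\wedge\tilde X_{t-}<0\}.$$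
   Context: A two-sided Lévy process is a real-valued process indexed by $\mathbb{R}$ with càdlàg paths, stationary independent increments and value $0$ at time $0$. "Not a deterministic linear drift" means that there is no $a\in\mathbb{R}$ with $X_t=at$ for all $t$. The conditions $\mathbb{E}[|X_1|]<\infty$, $|\mathbb{E}[X_1]|<\alpha$ ensure that almost surely the path of $X$ has an $\alpha$-Lipschitz minorant $M$, the greatest function with $M\le X$ and $|M_s-M_t|\le\alpha|s-t|$ for all $s,t$; explicitly $M_t=\inf\{X_s+\alpha|t-s|:s\in\mathbb{R}\}$. The random set $\mathcal{Z}$ is a.s. closed, and $D<\infty$ a.s. "$0$ is regular for $(0,\infty)$ for $\tilde X$" means $\inf\{t>0:\tilde X_t>0\}=0$, $\tilde{\mathbb{P}}^0$-almost surely. The process $(X_t,-\infty<t\le D)$ is understood as the process killed just after $D$: it generates the same $\sigma$-field as $(\bar X_t)_{t\in\mathbb{R}}$, where $\bar X_t=X_t$ for $t\le D$ and $\bar X_t=\partial$ (an isolated cemetery point) for $t>D$. Saying that a process $(Y_t)_{t\ge0}$ is Markovian with transition functions $(\breve H_t)$ and entrance laws $(\breve Q_t)$ means that $\mathbb{P}\{Y_t\in A\}=\breve Q_t(A)$ for all $t$ and $\mathbb{P}\{Y_t\in A\mid Y_u,\,0\le u\le s\}=\breve H_{t-s}(Y_s,A)$ for $0<s<t$. *)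

theory Defs
  imports "HOL-Probability.Probability"
begin

definition cadlag_on :: "real set \<Rightarrow> (real \<Rightarrow> real) \<Rightarrow> bool" where
  "cadlag_on I f \<longleftrightarrow> (\<forall>t\<in>I. (f \<longlongrightarrow> f t) (at t within I \<inter> {t<..}) \<and>
                           (\<exists>l. (f \<longlongrightarrow> l) (at t within I \<inter> {..<t})))"

definition left_limit :: "(real \<Rightarrow> real) \<Rightarrow> real \<Rightarrow> real" where
  "left_limit f t = Lim (at_left t) f"

definition two_sided_levy :: "'a measure \<Rightarrow> (real \<Rightarrow> 'a \<Rightarrow> real) \<Rightarrow> bool" where
  "two_sided_levy M X \<longleftrightarrow>
     prob_space M \<and>
     (\<forall>t. X t \<in> borel_measurable M) \<and>
     (\<forall>\<omega>\<in>space M. X 0 \<omega> = 0 \<and> cadlag_on UNIV (\<lambda>t. X t \<omega>)) \<and>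
     (\<forall>s t. s \<le> t \<longrightarrow>
        distr M borel (\<lambda>\<omega>. X t \<omega> - X s \<omega>) = distr M borel (X (t - s))) \<and>
     (\<forall>(n::nat) (t::nat \<Rightarrow> real). (\<forall>i<n. t i \<le> t (Suc i)) \<longrightarrow>
        prob_space.indep_vars M (\<lambda>_. borel) (\<lambda>i \<omega>. X (t (Suc i)) \<omega> - X (t i) \<omega>) {..<n})"

text \<open>The minorant is the greatest element, for the pointwise order, of the set of
  \<open>\<alpha>\<close>-Lipschitz functions below the path.\<close>

definition is_lipschitz_minorant :: "real \<Rightarrow> (real \<Rightarrow> real) \<Rightarrow> (real \<Rightarrow> real) \<Rightarrow> bool" where
  "is_lipschitz_minorant \<alpha> f m \<longleftrightarrow>
     \<alpha>-lipschitz_on UNIV m \<and> m \<le> f \<and> (\<forall>g. \<alpha>-lipschitz_on UNIV g \<and> g \<le> f \<longrightarrow> g \<le> m)"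

lemma is_lipschitz_minorant_INF:
  fixes f :: "real \<Rightarrow> real"
  assumes "0 \<le> \<alpha>" and bdd: "\<And>t. bdd_below (range (\<lambda>s. f s + \<alpha> * \<bar>t - s\<bar>))"
  shows "is_lipschitz_minorant \<alpha> f (\<lambda>t. INF s. f s + \<alpha> * \<bar>t - s\<bar>)"
proof -
  let ?g = "\<lambda>u. INF s. f s + \<alpha> * \<bar>u - s\<bar>"
  have step: "?g u \<le> ?g v + \<alpha> * \<bar>u - v\<bar>" for u v
  proof -
    have "?g u - \<alpha> * \<bar>u - v\<bar> \<le> ?g v"
    proof (rule cINF_greatest)
      fix s
      have "?g u \<le> f s + \<alpha> * \<bar>u - s\<bar>"
        using bdd by (rule cINF_lower) simp
      also have "\<alpha> * \<bar>u - s\<bar> \<le> \<alpha> * (\<bar>v - s\<bar> + \<bar>u - v\<bar>)"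
        using \<open>0 \<le> \<alpha>\<close> by (intro mult_left_mono) auto
      finally show "?g u - \<alpha> * \<bar>u - v\<bar> \<le> f s + \<alpha> * \<bar>v - s\<bar>"
        by (simp add: algebra_simps)
    qed simp
    then show ?thesis by simp
  qed
  have "\<alpha>-lipschitz_on UNIV ?g"
  proof (rule lipschitz_onI)
    fix u v
    show "dist (?g u) (?g v) \<le> \<alpha> * dist u v"
      using step[of u v] step[of v u] by (simp add: dist_real_def abs_minus_commute abs_le_iff)
  qed fact
  moreover have "?g \<le> f"
  proof (rule le_funI)
    fix u
    show "?g u \<le> f u" using cINF_lower[OF bdd, of u u] by simp
  qed
  moreover have "h \<le> ?g" if h: "\<alpha>-lipschitz_on UNIV h" "h \<le> f" for h
  proof (intro le_funI cINF_greatest)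
    fix u s
    have "\<bar>h u - h s\<bar> \<le> \<alpha> * \<bar>u - s\<bar>"
      using lipschitz_onD[OF h(1), of u s] by (simp add: dist_real_def)
    then show "h u \<le> f s + \<alpha> * \<bar>u - s\<bar>"
      using le_funD[OF h(2), of s] by linarith
  qed simp
  ultimately show ?thesis by (simp add: is_lipschitz_minorant_def)
qed

lemma is_lipschitz_minorant_eq_INF:
  fixes f :: "real \<Rightarrow> real"
  assumes m: "is_lipschitz_minorant \<alpha> f m"
  shows "m t = (INF s. f s + \<alpha> * \<bar>t - s\<bar>)"
proof -
  have lip: "\<alpha>-lipschitz_on UNIV m" and "m \<le> f"
    using m by (auto simp: is_lipschitz_minorant_def)
  have "m u \<le> f s + \<alpha> * \<bar>u - s\<bar>" for u s
  proof -
    have "\<bar>m u - m s\<bar> \<le> \<alpha> * \<bar>u - s\<bar>"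
      using lipschitz_onD[OF lip, of u s] by (simp add: dist_real_def)
    then show ?thesis
      using le_funD[OF \<open>m \<le> f\<close>, of s] by linarith
  qed
  then have "bdd_below (range (\<lambda>s. f s + \<alpha> * \<bar>u - s\<bar>))" for u
    by (intro bdd_belowI2[of _ "m u"])
  with lipschitz_on_nonneg[OF lip]
  have "is_lipschitz_minorant \<alpha> f (\<lambda>t. INF s. f s + \<alpha> * \<bar>t - s\<bar>)"
    by (rule is_lipschitz_minorant_INF)
  with m have "m = (\<lambda>t. INF s. f s + \<alpha> * \<bar>t - s\<bar>)"
    unfolding is_lipschitz_minorant_def by (intro antisym) blast+
  then show ?thesis by (rule fun_cong)
qed

text \<open>On the null set of paths that have no minorant, the contact set is empty.\<close>

definition contact_set :: "real \<Rightarrow> (real \<Rightarrow> real) \<Rightarrow> real set" where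
  "contact_set \<alpha> f =
     {t. \<exists>m. is_lipschitz_minorant \<alpha> f m \<and> m t = min (f t) (left_limit f t)}"

text \<open>The set below is almost surely nonempty for the Levy processes in question; where it is empty,
  the value is the fixed real number \<open>Inf {}\<close>.\<close>

definition contact_time :: "real \<Rightarrow> (real \<Rightarrow> real) \<Rightarrow> real" where
  "contact_time \<alpha> f = Inf (contact_set \<alpha> f \<inter> {0<..})"

text \<open>The \<open>\<sigma>\<close>-field on \<open>space M\<close> generated by the \<open>N\<close>-valued process \<open>(Y t)\<close>, \<open>t \<in> I\<close>.\<close>

definition process_algebra ::
    "'a measure \<Rightarrow> 'i set \<Rightarrow> 'b measure \<Rightarrow> ('i \<Rightarrow> 'a \<Rightarrow> 'b) \<Rightarrow> 'a measure" where
  "process_algebra M I N Y =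
     vimage_algebra (space M) (\<lambda>\<omega>. \<lambda>t\<in>I. Y t \<omega>) (PiM I (\<lambda>_. N))"

text \<open>The Borel \<open>\<sigma>\<close>-field of the real line with an isolated cemetery point \<open>None\<close> added.\<close>

definition cemetery_borel :: "real option measure" where
  "cemetery_borel = sigma UNIV {B. Some -` B \<in> sets borel}"

definition killed_after :: "('a \<Rightarrow> real) \<Rightarrow> (real \<Rightarrow> 'a \<Rightarrow> real) \<Rightarrow> real \<Rightarrow> 'a \<Rightarrow> real option" where
  "killed_after D X t \<omega> = (if t \<le> D \<omega> then Some (X t \<omega>) else None)"

text \<open>Canonical space of cadlag paths on \<open>[0,\<infinity>)\<close> with the coordinate \<open>\<sigma>\<close>-field. On it,
  \<open>drift_law M X \<alpha> x\<close> is the law of \<open>(x + X\<^sub>t + \<alpha>t)\<close>, \<open>t \<ge> 0\<close>, and the coordinate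
  process \<open>w t\<close> has that law.\<close>

definition cadlag_space :: "(real \<Rightarrow> real) measure" where
  "cadlag_space = restrict_space (PiM {0..} (\<lambda>_. borel)) {w. cadlag_on {0..} w}"

definition drift_law ::
    "'a measure \<Rightarrow> (real \<Rightarrow> 'a \<Rightarrow> real) \<Rightarrow> real \<Rightarrow> real \<Rightarrow> (real \<Rightarrow> real) measure" where
  "drift_law M X \<alpha> x = distr M cadlag_space (\<lambda>\<omega>. \<lambda>t\<in>{0..}. x + X t \<omega> + \<alpha> * t)"

definition regular_for_positive :: "(real \<Rightarrow> real) measure \<Rightarrow> bool" where
  "regular_for_positive P0 \<longleftrightarrow> (AE w in P0. Inf {ereal t | t. t > 0 \<and> w t > 0} = 0)"

definition exit_time :: "(real \<Rightarrow> real) \<Rightarrow> ereal" where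
  "exit_time w = Inf {ereal t | t. t > 0 \<and> min (w t) (left_limit w t) < 0}"

definition survival_prob :: "(real \<Rightarrow> (real \<Rightarrow> real) measure) \<Rightarrow> real \<Rightarrow> real" where
  "survival_prob P x = measure (P x) {w \<in> space (P x). exit_time w = \<infinity>}"

definition killed_law :: "(real \<Rightarrow> (real \<Rightarrow> real) measure) \<Rightarrow> real \<Rightarrow> real \<Rightarrow> real measure" where
  "killed_law P t x =
     distr (density (P x) (indicator {w. ereal t < exit_time w})) borel (\<lambda>w. w t)"

text \<open>The state space is \<open>(0,\<infinity>)\<close>: the kernel is carried by it, and is extended by the null
  measure to starting points outside it.\<close>

definition H_kernel :: "(real \<Rightarrow> (real \<Rightarrow> real) measure) \<Rightarrow> real \<Rightarrow> real \<Rightarrow> real measure" where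
  "H_kernel P t x =
     (if 0 < x
      then density (killed_law P t x)
             (\<lambda>y. indicator {0<..} y * ennreal (survival_prob P y / survival_prob P x))
      else null_measure borel)"

definition entrance_laws :: "(real \<Rightarrow> real \<Rightarrow> real measure) \<Rightarrow> (real \<Rightarrow> real measure) \<Rightarrow> bool" where
  "entrance_laws H Q \<longleftrightarrow>
     (\<forall>t\<ge>0. prob_space (Q t) \<and> sets (Q t) = sets borel) \<and>
     (\<forall>s>0. \<forall>t\<ge>0. \<forall>A\<in>sets borel.
        emeasure (Q (s + t)) A = (\<integral>\<^sup>+ x. emeasure (H t x) A \<partial>Q s))"

definition markovian ::
    "'a measure \<Rightarrow> (real \<Rightarrow> 'a \<Rightarrow> real) \<Rightarrow> (real \<Rightarrow> real \<Rightarrow> real measure) \<Rightarrow>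
     (real \<Rightarrow> real measure) \<Rightarrow> bool" where
  "markovian M Y H Q \<longleftrightarrow>
     (\<forall>t\<ge>0. Y t \<in> borel_measurable M \<and> distr M borel (Y t) = Q t) \<and>
     (\<forall>s t. 0 < s \<and> s < t \<longrightarrow> (\<forall>A\<in>sets borel.
        AE \<omega> in M.
          real_cond_exp M (process_algebra M {0..s} borel Y) (indicator (Y t -` A \<inter> space M)) \<omega>
            = measure (H (t - s) (Y s \<omega>)) A))"

end

theory Submission imports Defs "HOL-Real_Asymp.Real_Asymp"
begin

text \<open>
  Put \<open>W\<^sub>t = X\<^sub>t + \<alpha>t\<close> and \<open>V\<^sub>t = X\<^sub>t - \<alpha>t\<close>. A time \<open>t\<close> is a contact time exactly when
  \<open>min X\<^sub>t X\<^sub>t\<^sub>-\<close> is at most \<open>X\<^sub>s + \<alpha>|t - s|\<close> for all \<open>s\<close>, that is, when the value at \<open>t\<close> (the smaller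
  one-sided limit) is a minimum of \<open>V\<close> over the past of \<open>t\<close> and of \<open>W\<close> over its future. Let \<open>c\<close> be
  the infimum of \<open>V\<close> over \<open>(-\<infinity>, 0]\<close> and \<open>S\<close> the first time after \<open>0\<close> at which \<open>V\<close> is down to \<open>c\<close>. No contact
  is possible in \<open>(0, S)\<close>, and \<open>D\<close> turns out to be the unique point at which \<open>W\<close> attains its
  minimum over \<open>[S, \<infinity>)\<close>. Seen from \<open>D\<close>, the process \<open>W\<close> is therefore a Levy process that starts
  at its minimum, which is why the transition kernel is the \<open>h\<close>-transform by the probability of never
  becoming negative, and why nothing else of the past of \<open>D\<close> enters the law of the future.

  The time \<open>D\<close> is not a stopping time, so this is made precise on the dyadic lattices. Let \<open>T\<^sub>n\<close> be the first
  lattice time \<open>k/2\<^sup>n\<close> which is past \<open>S\<close> and below which \<open>W\<close> never falls again at a later lattice time. For each \<open>k\<close> the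
  event \<open>T\<^sub>n = k/2\<^sup>n\<close> is the intersection of an event of the past of \<open>k/2\<^sup>n\<close> with the event that the
  increments after \<open>k/2\<^sup>n\<close> stay nonnegative along the lattice. Past and future increments are
  independent, so the sum over \<open>k\<close> factorises: the path after \<open>T\<^sub>n\<close> is independent of the path
  before \<open>T\<^sub>n\<close> (\<open>lattice_independence\<close>), and its law is that of the process conditioned to be
  nonnegative on the lattice, which is Markovian (\<open>lattice_markov\<close>).

  It remains to let \<open>n\<close> tend to infinity. The paths are good enough (\<open>AE_good_path\<close>) for \<open>T\<^sub>n\<close> to
  converge to \<open>D\<close> and \<open>X\<close> at \<open>T\<^sub>n\<close> to \<open>X\<^sub>D\<close>: the drift towards the two ends makes all infima finite, and
  regularity of \<open>0\<close> rules out ties between infima of \<open>W\<close> over different time sets and upward jumps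
  at the minimum, and large jumps are too rare for an upward jump at \<open>S\<close>. Times after and before \<open>D\<close> are first
  shifted by a small \<open>\<delta>\<close>: since a path has countably many jumps, Fubini's theorem gives that for almost every
  \<open>\<delta>\<close> the path is almost surely continuous at the shifted times. Right continuity and the absence of
  fixed jumps then allow \<open>\<delta>\<close> to tend to \<open>0\<close>. This yields the independence and the Markov identity on cylinder
  events (\<open>independence_cylinder\<close>, \<open>markov_cylinder\<close>). The kernel in the limit is continuous in its starting point \<open>x > 0\<close>
  because the infimum of \<open>W\<close> over \<open>[0, \<infinity>)\<close> has no atom at \<open>-x\<close> (\<open>AE_future_inf_no_atom\<close>), and it is
  identified with the kernel of the theorem in \<open>emeasure_H_kernel\<close>.
\<close>

section \<open>Laws of processes and the past of a Levy process\<close>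

abbreviation path_space :: "(real \<Rightarrow> real) measure" where
 "path_space \<equiv> PiM UNIV (\<lambda>_. borel)"

lemma increasing_enumeration:
 fixes F :: "real set"
 assumes "finite F" "F \<noteq> {}"
 shows "\<exists>(n::nat) (t :: nat \<Rightarrow> real) (pos :: real \<Rightarrow> nat). card F = Suc n \<and>
  (\<forall>i j. i < j \<longrightarrow> j \<le> n \<longrightarrow> t i < t j) \<and> (\<forall>x\<in>F. pos x \<le> n \<and> t (pos x) = x)"
proof -
 let ?xs = "sorted_list_of_set F"
 have len: "length ?xs = card F" using assms by simp
 have pos: "card F > 0" using assms by (simp add: card_gt_0_iff)
 have ex: "\<forall>x\<in>F. \<exists>i\<le>card F - 1. ?xs ! i = x"
 proof
  fix x assume "x \<in> F"
  then have "x \<in> set ?xs" using assms by simp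
  then obtain i where "i < length ?xs" "?xs ! i = x" by (auto simp: in_set_conv_nth)
  then show "\<exists>i\<le>card F - 1. ?xs ! i = x" using len by (intro exI[of _ i]) auto
 qed
 then obtain p where p: "\<forall>x\<in>F. p x \<le> card F - 1 \<and> ?xs ! (p x) = x" by metis
 have "?xs ! i < ?xs ! j" if "i < j" "j \<le> card F - 1" for i j
  using sorted_wrt_nth_less[OF strict_sorted_list_of_set[of F], of i j] len pos that by simp
 with p pos show ?thesis
  by (intro exI[of _ "card F - 1"] exI[of _ "\<lambda>i. ?xs ! i"] exI[of _ p]) auto
qed

lemma process_measurable_path_space:
 assumes "\<And>t. Y t \<in> borel_measurable N"
 shows "(\<lambda>\<xi> t. Y t \<xi>) \<in> measurable N path_space"
 by (rule measurable_PiM_single') (use assms in auto)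

lemma path_space_eval[measurable]: "(\<lambda>w. w t) \<in> borel_measurable path_space"
 by (rule measurable_component_singleton) simp

text \<open>The increments between neighbouring points of a finite time set determine the values
there, as both processes start at 0; independent increments with equal laws have equal joint laws.
The points 0 and 1 are added to the time set so that there is at least one increment.\<close>
lemma (in prob_space) process_law_eqI:
 fixes A B :: "real \<Rightarrow> 'a \<Rightarrow> real"
 assumes [measurable]: "\<And>t. A t \<in> borel_measurable M" "\<And>t. B t \<in> borel_measurable M"
  and zero: "\<And>\<xi>. \<xi> \<in> space M \<Longrightarrow> A 0 \<xi> = 0" "\<And>\<xi>. \<xi> \<in> space M \<Longrightarrow> B 0 \<xi> = 0"
  and indA: "\<And>(n::nat) t. (\<forall>i<n. t i \<le> t (Suc i)) \<Longrightarrow>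
    indep_vars (\<lambda>_. borel) (\<lambda>i \<xi>. A (t (Suc i)) \<xi> - A (t i) \<xi>) {..<n}"
  and indB: "\<And>(n::nat) t. (\<forall>i<n. t i \<le> t (Suc i)) \<Longrightarrow>
    indep_vars (\<lambda>_. borel) (\<lambda>i \<xi>. B (t (Suc i)) \<xi> - B (t i) \<xi>) {..<n}"
  and incr: "\<And>s t. s \<le> t \<Longrightarrow>
    distr M borel (\<lambda>\<xi>. A t \<xi> - A s \<xi>) = distr M borel (\<lambda>\<xi>. B t \<xi> - B s \<xi>)"
 shows "distr M path_space (\<lambda>\<xi> t. A t \<xi>) = distr M path_space (\<lambda>\<xi> t. B t \<xi>)"
proof (rule measure_eqI_PiM_infinite)
 have mA: "(\<lambda>\<xi> t. A t \<xi>) \<in> measurable M path_space"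
  and mB: "(\<lambda>\<xi> t. B t \<xi>) \<in> measurable M path_space"
  by (intro process_measurable_path_space; simp)+
 show "finite_measure (distr M path_space (\<lambda>\<xi> t. A t \<xi>))"
  by (intro finite_measure_distr mA)
 fix C :: "real \<Rightarrow> real set" and J :: "real set"
 assume J: "finite J" and C: "\<And>i. i \<in> J \<Longrightarrow> C i \<in> sets borel"
 have fin: "finite (insert 0 (insert 1 J))" "insert 0 (insert 1 J) \<noteq> {}" using J by auto
 obtain n :: nat and t :: "nat \<Rightarrow> real" and pos :: "real \<Rightarrow> nat"
   where card: "card (insert 0 (insert 1 J)) = Suc n" and t_all: "\<forall>i j. i < j \<longrightarrow> j \<le> n \<longrightarrow> t i < t j"
   and pos_all: "\<forall>x\<in>insert 0 (insert 1 J). pos x \<le> n \<and> t (pos x) = x"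
   using increasing_enumeration[OF fin] by (elim exE conjE)
  have t: "t i < t j" if "i < j" "j \<le> n" for i j using t_all that by simp
  have pos: "pos x \<le> n" "t (pos x) = x" if "x \<in> insert 0 (insert 1 J)" for x using bspec[OF pos_all that] by blast+
 have "card {0, 1::real} \<le> card (insert 0 (insert 1 J))"
  using J by (intro card_mono) auto
 then have n: "0 < n" using card by simp
 have t': "\<forall>i<n. t i \<le> t (Suc i)" using t by (simp add: less_imp_le)
 let ?P = "PiM {..<n} (\<lambda>_. borel) :: (nat \<Rightarrow> real) measure"
 define G where "G = {v \<in> space ?P. \<forall>j\<in>J. (\<Sum>k<pos j. v k) - (\<Sum>k<pos 0. v k) \<in> C j}"
 have G: "G \<in> sets ?P"
 proof -
  have "(\<lambda>v. v k) \<in> borel_measurable ?P" if "k < n" for k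
   using that by (intro measurable_component_singleton) auto
  then have "(\<lambda>v. (\<Sum>k<pos j. v k) - (\<Sum>k<pos 0. v k)) \<in> borel_measurable ?P" if "j \<in> J" for j
   using that pos(1)[of j] pos(1)[of 0] by (intro borel_measurable_diff borel_measurable_sum) auto
  from measurable_sets[OF this C] have "{v \<in> space ?P. (\<Sum>k<pos j. v k) - (\<Sum>k<pos 0. v k) \<in> C j} \<in> sets ?P"
   if "j \<in> J" for j using that by (auto simp: vimage_def Int_def conj_commute)
  then show ?thesis
   unfolding G_def using J by (cases "J = {}") (auto intro: sets.sets_Collect_finite_All')
 qed
 have key: "emeasure (distr M path_space (\<lambda>\<xi> t. Y t \<xi>)) (prod_emb UNIV (\<lambda>_. borel) J (Pi\<^sub>E J C))
   = emeasure (PiM {..<n} (\<lambda>i. distr M borel (\<lambda>\<xi>. Y (t (Suc i)) \<xi> - Y (t i) \<xi>))) G"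
  if [measurable]: "\<And>t. Y t \<in> borel_measurable M" and Y0: "\<And>\<xi>. \<xi> \<in> space M \<Longrightarrow> Y 0 \<xi> = 0"
  and ind: "\<And>(n::nat) t. (\<forall>i<n. t i \<le> t (Suc i)) \<Longrightarrow>
    indep_vars (\<lambda>_. borel) (\<lambda>i \<xi>. Y (t (Suc i)) \<xi> - Y (t i) \<xi>) {..<n}" for Y
 proof -
  let ?I = "\<lambda>\<xi>. \<lambda>i\<in>{..<n}. Y (t (Suc i)) \<xi> - Y (t i) \<xi>"
  have mI: "?I \<in> measurable M ?P" by measurable
  have "(\<lambda>\<xi> t. Y t \<xi>) -` prod_emb UNIV (\<lambda>_. borel) J (Pi\<^sub>E J C) \<inter> space M = ?I -` G \<inter> space M"
  proof -
   have "(\<Sum>k<pos j. ?I \<xi> k) - (\<Sum>k<pos 0. ?I \<xi> k) = Y j \<xi>" if "j \<in> J" "\<xi> \<in> space M" for j \<xi>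
   proof -
    have *: "(\<Sum>k<pos x. ?I \<xi> k) = Y x \<xi> - Y (t 0) \<xi>" if "x \<in> insert 0 (insert 1 J)" for x
    proof -
     have "(\<Sum>k<pos x. ?I \<xi> k) = (\<Sum>k<pos x. Y (t (Suc k)) \<xi> - Y (t k) \<xi>)"
      using pos(1)[OF that] by (intro sum.cong) auto
     also have "\<dots> = Y (t (pos x)) \<xi> - Y (t 0) \<xi>"
      by (rule sum_lessThan_telescope)
     finally show ?thesis using pos(2)[OF that] by simp
    qed
    show ?thesis using *[of j] *[of 0] that Y0 by simp
   qed
   then show ?thesis
    using mI by (auto simp: G_def prod_emb_def PiE_iff extensional_def space_PiM)
  qed
  moreover have "prod_emb UNIV (\<lambda>_. borel) J (Pi\<^sub>E J C) \<in> sets path_space"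
  proof -
   have "{w \<in> space path_space. \<forall>j\<in>J. w j \<in> C j} \<in> sets path_space"
    using J measurable_sets[OF path_space_eval C]
    by (cases "J = {}") (auto simp: vimage_def Int_def conj_commute intro!: sets.sets_Collect_finite_All')
   also have "{w \<in> space path_space. \<forall>j\<in>J. w j \<in> C j} = prod_emb UNIV (\<lambda>_. borel) J (Pi\<^sub>E J C)"
    by (auto simp: prod_emb_def PiE_iff space_PiM)
   finally show ?thesis .
  qed
  moreover have "distr M ?P ?I = PiM {..<n} (\<lambda>i. distr M borel (\<lambda>\<xi>. Y (t (Suc i)) \<xi> - Y (t i) \<xi>))"
  proof (rule indep_vars_iff_distr_eq_PiM'[THEN iffD1])
   show "{..<n} \<noteq> {}" using n by auto
   show "indep_vars (\<lambda>_. borel) (\<lambda>i \<xi>. Y (t (Suc i)) \<xi> - Y (t i) \<xi>) {..<n}" by (rule ind[OF t'])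
  qed simp
  moreover have "emeasure (distr M ?P ?I) G = emeasure M (?I -` G \<inter> space M)"
   by (rule emeasure_distr[OF mI G])
  moreover have "emeasure (distr M path_space (\<lambda>\<xi> t. Y t \<xi>)) (prod_emb UNIV (\<lambda>_. borel) J (Pi\<^sub>E J C))
    = emeasure M ((\<lambda>\<xi> t. Y t \<xi>) -` prod_emb UNIV (\<lambda>_. borel) J (Pi\<^sub>E J C) \<inter> space M)"
   by (rule emeasure_distr) (auto intro: process_measurable_path_space calculation)
  ultimately show ?thesis by (simp only:)
 qed
 have "PiM {..<n} (\<lambda>i. distr M borel (\<lambda>\<xi>. A (t (Suc i)) \<xi> - A (t i) \<xi>))
   = PiM {..<n} (\<lambda>i. distr M borel (\<lambda>\<xi>. B (t (Suc i)) \<xi> - B (t i) \<xi>))"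
  using t' by (intro PiM_cong refl incr) auto
 with key[of A, OF _ zero(1) indA] key[of B, OF _ zero(2) indB]
 show "emeasure (distr M path_space (\<lambda>\<xi> t. A t \<xi>)) (prod_emb UNIV (\<lambda>_. borel) J (Pi\<^sub>E J C))
   = emeasure (distr M path_space (\<lambda>\<xi> t. B t \<xi>)) (prod_emb UNIV (\<lambda>_. borel) J (Pi\<^sub>E J C))"
  by simp
qed simp_all

text \<open>The usual generator of the process algebra, with values restricted to a generator E of
the state space, so that only half-lines have to be considered later.\<close>
definition cylinder_events where
 "cylinder_events M I E Y =
  {{\<xi>\<in>space M. \<forall>j\<in>J. Y j \<xi> \<in> A j} | J A. finite J \<and> J \<subseteq> I \<and> (\<forall>j\<in>J. A j \<in> E)}"

lemma cylinder_events_subset: "cylinder_events M I E Y \<subseteq> Pow (space M)"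
 by (auto simp: cylinder_events_def)

lemma Int_stable_cylinder_events:
 assumes "Int_stable E"
 shows "Int_stable (cylinder_events M I E Y)"
proof (rule Int_stableI)
 fix a b assume "a \<in> cylinder_events M I E Y" "b \<in> cylinder_events M I E Y"
 then obtain J A K B where
  a: "a = {\<xi>\<in>space M. \<forall>j\<in>J. Y j \<xi> \<in> A j}" "finite J" "J \<subseteq> I" "\<forall>j\<in>J. A j \<in> E" and
  b: "b = {\<xi>\<in>space M. \<forall>j\<in>K. Y j \<xi> \<in> B j}" "finite K" "K \<subseteq> I" "\<forall>j\<in>K. B j \<in> E"
  unfolding cylinder_events_def by blast
 define C where "C j = (if j \<in> J then if j \<in> K then A j \<inter> B j else A j else B j)" for j
 have "a \<inter> b = {\<xi>\<in>space M. \<forall>j\<in>J \<union> K. Y j \<xi> \<in> C j}"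
  unfolding a b C_def by (auto split: if_splits)
 moreover have "\<forall>j\<in>J \<union> K. C j \<in> E"
  using a b Int_stableD[OF assms] by (auto simp: C_def)
 ultimately show "a \<inter> b \<in> cylinder_events M I E Y"
  unfolding cylinder_events_def using a b
  by (intro CollectI exI[of _ "J \<union> K"] exI[of _ C]) auto
qed

lemma space_process_algebra[simp]: "space (process_algebra M I N Y) = space M"
 by (simp add: process_algebra_def)

lemma measurable_process_algebra:
 assumes "\<And>i \<xi>. i \<in> I \<Longrightarrow> \<xi> \<in> space M \<Longrightarrow> Y i \<xi> \<in> space N" and "i \<in> I"
 shows "Y i \<in> measurable (process_algebra M I N Y) N"
proof -
 have "(\<lambda>\<xi>. \<lambda>t\<in>I. Y t \<xi>) \<in> measurable (process_algebra M I N Y) (PiM I (\<lambda>_. N))"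
  unfolding process_algebra_def by (rule measurable_vimage_algebra1) (use assms(1) in \<open>auto simp: space_PiM\<close>)
 from measurable_compose[OF this measurable_component_singleton[OF \<open>i \<in> I\<close>]]
 show ?thesis using \<open>i \<in> I\<close> by simp
qed

lemma sets_process_algebra_subset:
 assumes "space A = space M" "\<And>i. i \<in> I \<Longrightarrow> Y i \<in> measurable A N"
 shows "sets (process_algebra M I N Y) \<subseteq> sets A"
 unfolding process_algebra_def
 by (rule sets_image_in_sets) (use assms in \<open>auto intro!: measurable_restrict\<close>)

lemma sets_process_algebra:
 assumes Y: "\<And>i \<xi>. i \<in> I \<Longrightarrow> \<xi> \<in> space M \<Longrightarrow> Y i \<xi> \<in> space N"
  and E: "sets N = sigma_sets (space N) E" "E \<subseteq> Pow (space N)"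
 shows "sets (process_algebra M I N Y) = sigma_sets (space M) (cylinder_events M I E Y)"
proof
 let ?S = "sigma (space M) (cylinder_events M I E Y)"
 have "Y i \<in> measurable ?S N" if i: "i \<in> I" for i
 proof (rule measurable_sigma_sets[OF E])
  show "Y i \<in> space ?S \<rightarrow> space N" using Y i by (auto simp: cylinder_events_subset)
  fix A assume "A \<in> E"
  then have "Y i -` A \<inter> space M \<in> cylinder_events M I E Y"
   unfolding cylinder_events_def using i
   by (intro CollectI exI[of _ "{i}"] exI[of _ "\<lambda>_. A"]) auto
  then show "Y i -` A \<inter> space ?S \<in> sets ?S"
   by (simp add: cylinder_events_subset space_measure_of)
 qed
 from sets_process_algebra_subset[of ?S M I Y N, OF _ this]
 show "sets (process_algebra M I N Y) \<subseteq> sigma_sets (space M) (cylinder_events M I E Y)"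
  by (simp add: cylinder_events_subset)
next
 have *: "{\<xi>\<in>space M. \<forall>j\<in>J. Y j \<xi> \<in> A j} \<in> sets (process_algebra M I N Y)"
  if "finite J" "J \<subseteq> I" "\<forall>j\<in>J. A j \<in> E" for J A
 proof -
  have "{\<xi>\<in>space M. Y j \<xi> \<in> A j} \<in> sets (process_algebra M I N Y)" if j: "j \<in> J" for j
  proof -
   have "A j \<in> sets N" using j \<open>\<forall>j\<in>J. A j \<in> E\<close> E by auto
   from measurable_sets[OF measurable_process_algebra[of I M Y N j, OF Y] this]
   show ?thesis using j \<open>J \<subseteq> I\<close> by (auto simp: vimage_def Int_def conj_commute)
  qed
  note meas = this
  have "{\<xi>\<in>space (process_algebra M I N Y). \<forall>j\<in>J. Y j \<xi> \<in> A j} \<in> sets (process_algebra M I N Y)"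
  proof (cases "J = {}")
   case True
   have "space (process_algebra M I N Y) \<in> sets (process_algebra M I N Y)" by (rule sets.top)
   then show ?thesis using True by simp
  next
   case False
   show ?thesis
    by (rule sets.sets_Collect_finite_All'[OF _ \<open>finite J\<close> False]) (use meas in simp)
  qed
  then show ?thesis by simp
 qed
 then have "cylinder_events M I E Y \<subseteq> sets (process_algebra M I N Y)"
  unfolding cylinder_events_def by blast
 from sets.sigma_sets_subset[OF this]
 show "sigma_sets (space M) (cylinder_events M I E Y) \<subseteq> sets (process_algebra M I N Y)" by simp
qed

locale levy_process =
 fixes M :: "'a measure" and X :: "real \<Rightarrow> 'a \<Rightarrow> real"
 assumes levy: "two_sided_levy M X"
begin

sublocale prob_space M
 using levy by (simp add: two_sided_levy_def)

lemma X_measurable[measurable]: "X t \<in> borel_measurable M"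
 using levy by (simp add: two_sided_levy_def)

lemma X_0[simp]: "\<xi> \<in> space M \<Longrightarrow> X 0 \<xi> = 0"
 using levy by (simp add: two_sided_levy_def)

lemma X_cadlag: "\<xi> \<in> space M \<Longrightarrow> cadlag_on UNIV (\<lambda>t. X t \<xi>)"
 using levy by (simp add: two_sided_levy_def)

lemma X_stationary: "s \<le> t \<Longrightarrow> distr M borel (\<lambda>\<xi>. X t \<xi> - X s \<xi>) = distr M borel (X (t - s))"
 using levy unfolding two_sided_levy_def by blast

lemma X_indep_increments:
 "(\<forall>i<n. t i \<le> t (Suc i)) \<Longrightarrow>
  indep_vars (\<lambda>_. borel) (\<lambda>i \<xi>. X (t (Suc i)) \<xi> - X (t i) \<xi>) {..<n::nat}"
 using levy unfolding two_sided_levy_def by blast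

definition past :: "real \<Rightarrow> 'a measure" where
 "past u = process_algebra M {..u} borel X"

text \<open>The increments after u, as a function on the whole line that is frozen at negative
times: one path space then serves all starting times.\<close>
definition fut :: "real \<Rightarrow> 'a \<Rightarrow> real \<Rightarrow> real" where
 "fut u \<xi> = (\<lambda>t. X (u + max 0 t) \<xi> - X u \<xi>)"

lemma space_past[simp]: "space (past u) = space M"
 by (simp add: past_def)

lemma X_past[measurable (raw)]: "s \<le> u \<Longrightarrow> X s \<in> borel_measurable (past u)"
 unfolding past_def by (rule measurable_process_algebra) auto

lemma sets_past_mono: "u \<le> v \<Longrightarrow> sets (past u) \<subseteq> sets (past v)"
 by (subst (1) past_def, rule sets_process_algebra_subset) (auto intro!: X_past)

lemma sets_past_subset: "sets (past u) \<subseteq> sets M"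
 unfolding past_def by (rule sets_process_algebra_subset) auto

lemma measurable_past_mono: "f \<in> measurable (past u) N \<Longrightarrow> u \<le> v \<Longrightarrow> f \<in> measurable (past v) N"
 by (rule measurable_mono[THEN subsetD, OF order_refl refl sets_past_mono[of u v]]) auto

lemma measurable_past_M: "f \<in> measurable (past u) N \<Longrightarrow> f \<in> measurable M N"
 by (rule measurable_mono[THEN subsetD, OF order_refl refl sets_past_subset[of u]]) auto

lemma fut_measurable[measurable]: "fut u \<in> measurable M path_space"
 using process_measurable_path_space[of "\<lambda>t \<xi>. X (u + max 0 t) \<xi> - X u \<xi>" M]
 by (simp add: fut_def[abs_def])

lemma fut_law: "distr M path_space (fut u) = distr M path_space (fut 0)"
proof -
 let ?Y = "\<lambda>u t \<xi>. X (u + max 0 t) \<xi> - X u \<xi>"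
 have ind: "indep_vars (\<lambda>_. borel) (\<lambda>i \<xi>. ?Y u (t (Suc i)) \<xi> - ?Y u (t i) \<xi>) {..<n}"
  if "\<forall>i<n. t i \<le> t (Suc i)" for n :: nat and t u
 proof -
  have "indep_vars (\<lambda>_. borel) (\<lambda>i \<xi>. X (u + max 0 (t (Suc i))) \<xi> - X (u + max 0 (t i)) \<xi>) {..<n}"
   using X_indep_increments[of n "\<lambda>i. u + max 0 (t i)"] that by fastforce
  then show ?thesis by simp
 qed
 have "distr M path_space (\<lambda>\<xi> t. ?Y u t \<xi>) = distr M path_space (\<lambda>\<xi> t. ?Y 0 t \<xi>)"
 proof (rule process_law_eqI)
  fix s t :: real assume "s \<le> t"
  then show "distr M borel (\<lambda>\<xi>. ?Y u t \<xi> - ?Y u s \<xi>) = distr M borel (\<lambda>\<xi>. ?Y 0 t \<xi> - ?Y 0 s \<xi>)"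
   using X_stationary[of "u + max 0 s" "u + max 0 t"] X_stationary[of "max 0 s" "max 0 t"]
   by (simp add: max.coboundedI2)
  next
  fix n :: nat and t :: "nat \<Rightarrow> real" assume t: "\<forall>i<n. t i \<le> t (Suc i)"
  show "indep_vars (\<lambda>_. borel) (\<lambda>i \<xi>. ?Y u (t (Suc i)) \<xi> - ?Y u (t i) \<xi>) {..<n}"
   "indep_vars (\<lambda>_. borel) (\<lambda>i \<xi>. ?Y 0 (t (Suc i)) \<xi> - ?Y 0 (t i) \<xi>) {..<n}"
   by (rule ind[OF t])+
 qed simp_all
 then show ?thesis by (simp add: fut_def[abs_def])
qed

definition backward :: "real \<Rightarrow> 'a \<Rightarrow> real \<Rightarrow> real" where
 "backward u \<xi> = (\<lambda>t. X u \<xi> - X (u - max 0 t) \<xi>)"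

lemma backward_measurable[measurable]: "backward u \<in> measurable M path_space"
 using process_measurable_path_space[of "\<lambda>t \<xi>. X u \<xi> - X (u - max 0 t) \<xi>" M]
 by (simp add: backward_def[abs_def])

lemma backward_law: "distr M path_space (backward u) = distr M path_space (fut 0)"
proof -
 let ?Y = "\<lambda>t \<xi>. X u \<xi> - X (u - max 0 t) \<xi>"
 let ?Z = "\<lambda>t \<xi>. X (0 + max 0 t) \<xi> - X 0 \<xi>"
 have "distr M path_space (\<lambda>\<xi> t. ?Y t \<xi>) = distr M path_space (\<lambda>\<xi> t. ?Z t \<xi>)"
 proof (rule process_law_eqI)
  fix s t :: real assume "s \<le> t"
  then have "distr M borel (\<lambda>\<xi>. X (u - max 0 s) \<xi> - X (u - max 0 t) \<xi>) = distr M borel (X (u - max 0 s - (u - max 0 t)))"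
   "distr M borel (\<lambda>\<xi>. X (max 0 t) \<xi> - X (max 0 s) \<xi>) = distr M borel (X (max 0 t - max 0 s))"
   by (intro X_stationary; simp add: max.coboundedI2)+
  moreover have "u - max 0 s - (u - max 0 t) = max 0 t - max 0 s" by simp
  moreover have "(\<lambda>\<xi>. ?Y t \<xi> - ?Y s \<xi>) = (\<lambda>\<xi>. X (u - max 0 s) \<xi> - X (u - max 0 t) \<xi>)"
   "(\<lambda>\<xi>. ?Z t \<xi> - ?Z s \<xi>) = (\<lambda>\<xi>. X (max 0 t) \<xi> - X (max 0 s) \<xi>)"
   by (auto simp: algebra_simps)
  ultimately show "distr M borel (\<lambda>\<xi>. ?Y t \<xi> - ?Y s \<xi>) = distr M borel (\<lambda>\<xi>. ?Z t \<xi> - ?Z s \<xi>)"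
   by (simp only:)
 next
  fix n :: nat and t :: "nat \<Rightarrow> real" assume t: "\<forall>i<n. t i \<le> t (Suc i)"
  define r where "r i = u - max 0 (t (n - i))" for i
  have "r i \<le> r (Suc i)" if "i < n" for i
  proof -
   have "n - i = Suc (n - Suc i)" "n - Suc i < n" using that by auto
   then have "t (n - Suc i) \<le> t (n - i)" using t by metis
   then show ?thesis by (auto simp: r_def)
  qed
  then have "indep_vars (\<lambda>_. borel) (\<lambda>i \<xi>. X (r (Suc i)) \<xi> - X (r i) \<xi>) {..<n}"
   by (intro X_indep_increments) auto
  then have "indep_vars (\<lambda>j. PiM {n - Suc j} (\<lambda>_. borel))
    (\<lambda>j \<xi>. \<lambda>i\<in>{n - Suc j}. X (r (Suc i)) \<xi> - X (r i) \<xi>) {..<n}"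
   by (rule indep_vars_restrict) (auto simp: disjoint_family_on_def)
  then have 1: "indep_vars (\<lambda>_. borel) (\<lambda>j \<xi>. (\<lambda>v. v (n - Suc j))
    (\<lambda>i\<in>{n - Suc j}. X (r (Suc i)) \<xi> - X (r i) \<xi>)) {..<n}" (is "indep_vars _ ?F _")
   by (rule indep_vars_compose2) (auto intro: measurable_component_singleton)
  have 2: "?F i = (\<lambda>\<xi>. ?Y (t (Suc i)) \<xi> - ?Y (t i) \<xi>)" if "i \<in> {..<n}" for i
  proof -
   from that have *: "n - Suc (n - Suc i) = i" "Suc (n - Suc i) = n - i" "n - (n - i) = i" "n - (n - Suc i) = Suc i" by auto
   have "r (Suc (n - Suc i)) = u - max 0 (t i)" "r (n - Suc i) = u - max 0 (t (Suc i))"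
    unfolding r_def * by simp_all
   then show ?thesis by (auto simp: fun_eq_iff)
  qed
  show "indep_vars (\<lambda>_. borel) (\<lambda>i \<xi>. ?Y (t (Suc i)) \<xi> - ?Y (t i) \<xi>) {..<n}"
   by (rule iffD1[OF indep_vars_cong 1]) (rule refl 2 | assumption)+
 next
  fix n :: nat and t :: "nat \<Rightarrow> real" assume t: "\<forall>i<n. t i \<le> t (Suc i)"
  have "indep_vars (\<lambda>_. borel) (\<lambda>i \<xi>. X (0 + max 0 (t (Suc i))) \<xi> - X (0 + max 0 (t i)) \<xi>) {..<n}"
   using X_indep_increments[of n "\<lambda>i. 0 + max 0 (t i)"] t by fastforce
  moreover have "(\<lambda>i \<xi>. ?Z (t (Suc i)) \<xi> - ?Z (t i) \<xi>)
    = (\<lambda>i \<xi>. X (0 + max 0 (t (Suc i))) \<xi> - X (0 + max 0 (t i)) \<xi>)" by (auto simp: fun_eq_iff)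
  ultimately show "indep_vars (\<lambda>_. borel) (\<lambda>i \<xi>. ?Z (t (Suc i)) \<xi> - ?Z (t i) \<xi>) {..<n}" by (simp only:)
 qed simp_all
 then show ?thesis by (simp add: fut_def[abs_def] backward_def[abs_def])
qed

end

section \<open>Independence of past and future\<close>

context levy_process begin

lemma indep_past_fut:
 assumes u: "0 \<le> u"
 shows "indep_set (sets (past u)) {fut u -` C \<inter> space M | C. C \<in> sets path_space}"
proof -
 let ?GA = "cylinder_events M {..u} (sets borel) X"
 let ?GB = "cylinder_events M UNIV (sets borel) (\<lambda>t \<xi>. fut u \<xi> t)"
 have sA: "sets (past u) = sigma_sets (space M) ?GA"
  unfolding past_def by (rule sets_process_algebra) (auto simp: sets.sigma_sets_eq[of borel, simplified])
 have "process_algebra M UNIV borel (\<lambda>t \<xi>. fut u \<xi> t) = vimage_algebra (space M) (fut u) path_space"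
  by (simp add: process_algebra_def restrict_def)
 moreover have "sets (process_algebra M UNIV borel (\<lambda>t \<xi>. fut u \<xi> t)) = sigma_sets (space M) ?GB"
  by (rule sets_process_algebra) (auto simp: sets.sigma_sets_eq[of borel, simplified])
 ultimately have sB: "{fut u -` C \<inter> space M | C. C \<in> sets path_space} = sigma_sets (space M) ?GB"
  by (simp add: sets_vimage_algebra2 space_PiM)
 have fut_t[measurable]: "(\<lambda>\<xi>. fut u \<xi> t) \<in> borel_measurable M" for t
  by (simp add: fut_def)
 have "indep_set ?GA ?GB"
 proof (rule indep_setI)
  have "?GA \<subseteq> sets (past u)" unfolding sA by auto
  then show "?GA \<subseteq> events" using sets_past_subset by blast
  have "?GB \<subseteq> sets (process_algebra M UNIV borel (\<lambda>t \<xi>. fut u \<xi> t))"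
   unfolding \<open>sets (process_algebra M UNIV borel (\<lambda>t \<xi>. fut u \<xi> t)) = sigma_sets (space M) ?GB\<close> by auto
  then show "?GB \<subseteq> events" using sets_process_algebra_subset[of M M UNIV "\<lambda>t \<xi>. fut u \<xi> t" borel] fut_t by blast
 next
  fix a b assume "a \<in> ?GA" "b \<in> ?GB"
  then obtain J A K B where
   a: "a = {\<xi>\<in>space M. \<forall>j\<in>J. X j \<xi> \<in> A j}" "finite J" "J \<subseteq> {..u}" "\<forall>j\<in>J. A j \<in> sets borel" and
   b: "b = {\<xi>\<in>space M. \<forall>j\<in>K. fut u \<xi> j \<in> B j}" "finite K" "\<forall>j\<in>K. B j \<in> sets borel"
   unfolding cylinder_events_def by blast
  define F where "F = insert 0 (insert u (J \<union> (\<lambda>k. u + max 0 k) ` K))"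
  have fin: "finite F" "F \<noteq> {}" using a b by (auto simp: F_def)
  obtain n :: nat and t :: "nat \<Rightarrow> real" and pos :: "real \<Rightarrow> nat"
   where card: "card (F) = Suc n" and t_all: "\<forall>i j. i < j \<longrightarrow> j \<le> n \<longrightarrow> t i < t j"
   and pos_all: "\<forall>x\<in>F. pos x \<le> n \<and> t (pos x) = x"
   using increasing_enumeration[OF fin] by (elim exE conjE)
  have t: "t i < t j" if "i < j" "j \<le> n" for i j using t_all that by simp
  have pos: "pos x \<le> n" "t (pos x) = x" if "x \<in> F" for x using bspec[OF pos_all that] by blast+
  have t': "\<forall>i<n. t i \<le> t (Suc i)" using t by (simp add: less_imp_le)
  have pos_mono: "pos x \<le> pos y" if "x \<in> F" "y \<in> F" "x \<le> y" for x y
  proof (rule ccontr)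
   assume "\<not> pos x \<le> pos y"
   then have "t (pos y) < t (pos x)" using pos(1)[OF \<open>x \<in> F\<close>] by (intro t) auto
   then show False using pos(2)[OF \<open>x \<in> F\<close>] pos(2)[OF \<open>y \<in> F\<close>] \<open>x \<le> y\<close> by simp
  qed
  let ?I = "\<lambda>i \<xi>. X (t (Suc i)) \<xi> - X (t i) \<xi>"
  let ?L = "{..<pos u}" let ?R = "{pos u..<n}"
  let ?PL = "PiM ?L (\<lambda>_. borel) :: (nat \<Rightarrow> real) measure"
  let ?PR = "PiM ?R (\<lambda>_. borel) :: (nat \<Rightarrow> real) measure"
  have uF: "u \<in> F" "0 \<in> F" by (auto simp: F_def)
  have ind: "indep_var ?PL (\<lambda>\<xi>. \<lambda>i\<in>?L. ?I i \<xi>) ?PR (\<lambda>\<xi>. \<lambda>i\<in>?R. ?I i \<xi>)"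
   by (rule indep_var_restrict[OF X_indep_increments[OF t']]) (use pos(1)[OF uF(1)] in auto)
  define G where "G = {v \<in> space ?PL. \<forall>j\<in>J. (\<Sum>k<pos j. v k) - (\<Sum>k<pos 0. v k) \<in> A j}"
  define H where "H = {v \<in> space ?PR. \<forall>j\<in>K. (\<Sum>k=pos u..<pos (u + max 0 j). v k) \<in> B j}"
  have JF: "j \<in> F" "pos j \<le> pos u" if "j \<in> J" for j
  proof -
   show "j \<in> F" using that by (auto simp: F_def)
   then show "pos j \<le> pos u" using pos_mono[of j u] uF a that by auto
  qed
  have KF: "u + max 0 j \<in> F" "pos (u + max 0 j) \<le> n" "pos u \<le> pos (u + max 0 j)" if "j \<in> K" for j
  proof -
   show *: "u + max 0 j \<in> F" using that by (auto simp: F_def)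
   then show "pos (u + max 0 j) \<le> n" "pos u \<le> pos (u + max 0 j)"
    using pos(1) pos_mono[of u "u + max 0 j"] uF by auto
  qed
  have p0: "pos 0 \<le> pos u" using pos_mono[OF uF(2,1)] u by simp
  have G: "G \<in> sets ?PL"
  proof -
   have "(\<lambda>v. v k) \<in> borel_measurable ?PL" if "k < pos u" for k
    using that by (intro measurable_component_singleton) auto
   then have "(\<lambda>v. (\<Sum>k<pos j. v k) - (\<Sum>k<pos 0. v k)) \<in> borel_measurable ?PL" if "j \<in> J" for j
    using JF[OF that] p0 by (intro borel_measurable_diff borel_measurable_sum) auto
   from measurable_sets[OF this] have "{v \<in> space ?PL. (\<Sum>k<pos j. v k) - (\<Sum>k<pos 0. v k) \<in> A j} \<in> sets ?PL"
    if "j \<in> J" for j using that a by (auto simp: vimage_def Int_def conj_commute)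
   then show ?thesis
    unfolding G_def using a by (cases "J = {}") (auto intro: sets.sets_Collect_finite_All')
  qed
  have H: "H \<in> sets ?PR"
  proof -
   have "(\<lambda>v. v k) \<in> borel_measurable ?PR" if "k \<in> {pos u..<n}" for k
    using that by (intro measurable_component_singleton) auto
   then have "(\<lambda>v. (\<Sum>k=pos u..<pos (u + max 0 j). v k)) \<in> borel_measurable ?PR" if "j \<in> K" for j
    using KF[OF that] by (intro borel_measurable_sum) auto
   from measurable_sets[OF this] have "{v \<in> space ?PR. (\<Sum>k=pos u..<pos (u + max 0 j). v k) \<in> B j} \<in> sets ?PR"
    if "j \<in> K" for j using that b by (auto simp: vimage_def Int_def conj_commute)
   then show ?thesis
    unfolding H_def using b by (cases "K = {}") (auto intro: sets.sets_Collect_finite_All')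
  qed
  have mL: "(\<lambda>\<xi>. \<lambda>i\<in>?L. ?I i \<xi>) \<in> measurable M ?PL" and mR: "(\<lambda>\<xi>. \<lambda>i\<in>?R. ?I i \<xi>) \<in> measurable M ?PR"
   by measurable
  have aG: "a = (\<lambda>\<xi>. \<lambda>i\<in>?L. ?I i \<xi>) -` G \<inter> space M"
  proof -
   have "(\<Sum>k<pos j. (\<lambda>i\<in>?L. ?I i \<xi>) k) - (\<Sum>k<pos 0. (\<lambda>i\<in>?L. ?I i \<xi>) k) = X j \<xi>"
    if "j \<in> J" "\<xi> \<in> space M" for j \<xi>
   proof -
    have *: "(\<Sum>k<pos x. (\<lambda>i\<in>?L. ?I i \<xi>) k) = X x \<xi> - X (t 0) \<xi>" if "x \<in> F" "pos x \<le> pos u" for x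
    proof -
     have "(\<Sum>k<pos x. (\<lambda>i\<in>?L. ?I i \<xi>) k) = (\<Sum>k<pos x. ?I k \<xi>)"
      using that by (intro sum.cong) auto
     also have "\<dots> = X (t (pos x)) \<xi> - X (t 0) \<xi>"
      by (rule sum_lessThan_telescope)
     finally show ?thesis using pos(2)[OF that(1)] by simp
    qed
    show ?thesis using *[of j] *[of 0] that JF p0 uF by simp
   qed
   then show ?thesis
    using mL unfolding a(1) G_def by (auto simp: space_PiM PiE_iff extensional_def)
  qed
  have bH: "b = (\<lambda>\<xi>. \<lambda>i\<in>?R. ?I i \<xi>) -` H \<inter> space M"
  proof -
   have "(\<Sum>k=pos u..<pos (u + max 0 j). (\<lambda>i\<in>?R. ?I i \<xi>) k) = fut u \<xi> j" if "j \<in> K" for j \<xi>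
   proof -
    have "(\<Sum>k=pos u..<pos (u + max 0 j). (\<lambda>i\<in>?R. ?I i \<xi>) k) = (\<Sum>k=pos u..<pos (u + max 0 j). ?I k \<xi>)"
     using KF[OF that] by (intro sum.cong) auto
    also have "\<dots> = X (t (pos (u + max 0 j))) \<xi> - X (t (pos u)) \<xi>"
     using KF[OF that] by (intro sum_Suc_diff') auto
    finally show ?thesis using KF[OF that] pos(2) uF by (simp add: fut_def)
   qed
   then show ?thesis
    using mR unfolding b(1) H_def by (auto simp: space_PiM PiE_iff extensional_def)
  qed
  have "a \<inter> b = (\<lambda>x. (\<lambda>i\<in>?L. ?I i x, \<lambda>i\<in>?R. ?I i x)) -` (G \<times> H) \<inter> space M"
   unfolding aG bH by auto
  then show "prob (a \<inter> b) = prob a * prob b"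
   using indep_varD[OF ind G H] aG bH by simp
 qed
 moreover have "Int_stable (sets (borel :: real measure))" by (rule sets.Int_stable)
 ultimately have "indep_set (sigma_sets (space M) ?GA) (sigma_sets (space M) ?GB)"
  by (intro indep_set_sigma_sets Int_stable_cylinder_events)
 then show ?thesis unfolding sA sB by simp
qed

lemma emeasure_fut:
 assumes "C \<in> sets path_space"
 shows "emeasure M {\<xi>\<in>space M. fut u \<xi> \<in> C} = emeasure M {\<xi>\<in>space M. fut 0 \<xi> \<in> C}"
proof -
 have "emeasure (distr M path_space (fut u)) C = emeasure (distr M path_space (fut 0)) C"
  using fut_law[of u] by (rule arg_cong)
 moreover have "{\<xi>\<in>space M. fut v \<xi> \<in> C} = fut v -` C \<inter> space M" for v by auto
 ultimately show ?thesis using assms by (simp add: emeasure_distr)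
qed

lemma emeasure_backward:
 assumes "C \<in> sets path_space"
 shows "emeasure M {\<xi>\<in>space M. backward u \<xi> \<in> C} = emeasure M {\<xi>\<in>space M. fut 0 \<xi> \<in> C}"
proof -
 have "emeasure (distr M path_space (backward u)) C = emeasure (distr M path_space (fut 0)) C"
  by (simp only: backward_law)
 moreover have "{\<xi>\<in>space M. fut v \<xi> \<in> C} = fut v -` C \<inter> space M"
  "{\<xi>\<in>space M. backward v \<xi> \<in> C} = backward v -` C \<inter> space M" for v by auto
 ultimately show ?thesis using assms by (simp add: emeasure_distr)
qed

lemma prob_past_fut:
 assumes u: "0 \<le> u" and A: "A \<in> sets (past u)" and C: "C \<in> sets path_space"
 shows "prob (A \<inter> {\<xi>\<in>space M. fut u \<xi> \<in> C}) = prob A * prob {\<xi>\<in>space M. fut 0 \<xi> \<in> C}"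
proof -
 have eq: "fut u -` C \<inter> space M = {\<xi>\<in>space M. fut u \<xi> \<in> C}" by auto
 have "prob (A \<inter> (fut u -` C \<inter> space M)) = prob A * prob (fut u -` C \<inter> space M)"
  by (rule indep_setD[OF indep_past_fut[OF u] A]) (use C in blast)
 moreover have "prob {\<xi>\<in>space M. fut u \<xi> \<in> C} = prob {\<xi>\<in>space M. fut 0 \<xi> \<in> C}"
  using emeasure_fut[OF C, of u] by (simp add: measure_def)
 ultimately show ?thesis unfolding eq by simp
qed

text \<open>Freezing: the past of u may be held fixed while the increments after u are integrated
out by themselves. The integrand is a function of the point and of an increment path, which takes
the place of conditional expectations.\<close>
lemma nn_integral_fut_past:
 assumes u: "0 \<le> u" and F: "(\<lambda>p. F (fst p) (snd p)) \<in> borel_measurable (past u \<Otimes>\<^sub>M path_space)"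
 shows "(\<integral>\<^sup>+\<xi>. F \<xi> (fut u \<xi>) \<partial>M) = (\<integral>\<^sup>+\<xi>. (\<integral>\<^sup>+\<xi>'. F \<xi> (fut 0 \<xi>') \<partial>M) \<partial>M)"
proof -
 let ?L = "distr M path_space (fut 0)"
 have id: "(\<lambda>\<xi>. \<xi>) \<in> measurable M (past u)"
  using sets_past_subset sets.sets_into_space[of _ "past u"] by (auto simp: measurable_def Int_absorb2)
 interpret P: prob_space "distr M (past u) (\<lambda>\<xi>. \<xi>)" by (rule prob_space_distr[OF id])
 interpret L: prob_space ?L by (rule prob_space_distr) simp
 have pair: "(\<lambda>x. (x, fut u x)) \<in> measurable M (past u \<Otimes>\<^sub>M path_space)"
  using id by simp
 have eq: "distr M (past u) (\<lambda>\<xi>. \<xi>) \<Otimes>\<^sub>M ?L = distr M (past u \<Otimes>\<^sub>M path_space) (\<lambda>x. (x, fut u x))"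
 proof (rule pair_measure_eqI)
  show "sigma_finite_measure (distr M (past u) (\<lambda>\<xi>. \<xi>))" "sigma_finite_measure ?L" ..
  show "sets (distr M (past u) (\<lambda>\<xi>. \<xi>) \<Otimes>\<^sub>M ?L) = sets (distr M (past u \<Otimes>\<^sub>M path_space) (\<lambda>x. (x, fut u x)))"
   unfolding sets_distr by (intro sets_pair_measure_cong) auto
  fix A C assume A: "A \<in> sets (distr M (past u) (\<lambda>\<xi>. \<xi>))" and C: "C \<in> sets ?L"
  have "emeasure (distr M (past u) (\<lambda>\<xi>. \<xi>)) A = prob A"
   using A id sets.sets_into_space[of A "past u"] by (simp add: emeasure_distr Int_absorb2 emeasure_eq_measure)
  moreover have "emeasure ?L C = prob {\<xi>\<in>space M. fut 0 \<xi> \<in> C}"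
  proof -
   have "{\<xi>\<in>space M. fut 0 \<xi> \<in> C} = fut 0 -` C \<inter> space M" by auto
   then show ?thesis using C by (simp add: emeasure_distr emeasure_eq_measure)
  qed
  moreover have "emeasure (distr M (past u \<Otimes>\<^sub>M path_space) (\<lambda>x. (x, fut u x))) (A \<times> C)
    = prob (A \<inter> {\<xi>\<in>space M. fut u \<xi> \<in> C})"
  proof -
   have "(\<lambda>x. (x, fut u x)) -` (A \<times> C) \<inter> space M = A \<inter> {\<xi>\<in>space M. fut u \<xi> \<in> C}"
    using A sets.sets_into_space[of A "past u"] by auto
   then show ?thesis using A C by (subst emeasure_distr[OF pair]) (auto simp: emeasure_eq_measure)
  qed
  ultimately show "emeasure (distr M (past u) (\<lambda>\<xi>. \<xi>)) A * emeasure ?L C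
    = emeasure (distr M (past u \<Otimes>\<^sub>M path_space) (\<lambda>x. (x, fut u x))) (A \<times> C)"
   using A C prob_past_fut[OF u, of A C] by (simp add: ennreal_mult)
 qed
 have sets_eq: "sets (distr M (past u) (\<lambda>\<xi>. \<xi>) \<Otimes>\<^sub>M ?L) = sets (past u \<Otimes>\<^sub>M path_space)"
  by (intro sets_pair_measure_cong) auto
 have F': "(\<lambda>p. F (fst p) (snd p)) \<in> borel_measurable (distr M (past u) (\<lambda>\<xi>. \<xi>) \<Otimes>\<^sub>M ?L)"
  using F by (simp cong: measurable_cong_sets add: sets_eq)
 have "(\<integral>\<^sup>+\<xi>. F \<xi> (fut u \<xi>) \<partial>M) = (\<integral>\<^sup>+p. F (fst p) (snd p) \<partial>distr M (past u \<Otimes>\<^sub>M path_space) (\<lambda>x. (x, fut u x)))"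
  using F by (subst nn_integral_distr[OF pair]) simp_all
 also have "\<dots> = (\<integral>\<^sup>+p. F (fst p) (snd p) \<partial>(distr M (past u) (\<lambda>\<xi>. \<xi>) \<Otimes>\<^sub>M ?L))"
  by (simp add: eq)
 also have "\<dots> = (\<integral>\<^sup>+\<xi>. \<integral>\<^sup>+w. F \<xi> w \<partial>?L \<partial>distr M (past u) (\<lambda>\<xi>. \<xi>))"
  using L.nn_integral_fst[OF F'] by simp
 also have "\<dots> = (\<integral>\<^sup>+\<xi>. \<integral>\<^sup>+w. F \<xi> w \<partial>?L \<partial>M)"
 proof (rule nn_integral_distr[OF id])
  show "(\<lambda>\<xi>. \<integral>\<^sup>+w. F \<xi> w \<partial>?L) \<in> borel_measurable (distr M (past u) (\<lambda>\<xi>. \<xi>))"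
   using L.borel_measurable_nn_integral_fst[OF F'] by simp
 qed
 also have "\<dots> = (\<integral>\<^sup>+\<xi>. (\<integral>\<^sup>+\<xi>'. F \<xi> (fut 0 \<xi>') \<partial>M) \<partial>M)"
 proof (rule nn_integral_cong)
  fix \<xi> assume "\<xi> \<in> space M"
  then have "(\<lambda>w. (\<xi>, w)) \<in> measurable path_space (past u \<Otimes>\<^sub>M path_space)" by simp
  from measurable_compose[OF this F] have "(\<lambda>w. F \<xi> w) \<in> borel_measurable path_space" by simp
  then show "(\<integral>\<^sup>+w. F \<xi> w \<partial>?L) = (\<integral>\<^sup>+\<xi>'. F \<xi> (fut 0 \<xi>') \<partial>M)"
   by (subst nn_integral_distr) auto
 qed
 finally show ?thesis .
qed

text \<open>Split according to the first k at which \<open>A k\<close> occurs. This is an event of the past of that time, and the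
event of the future has there the same conditional probability as at time 0.\<close>
lemma
 assumes h: "0 \<le> h" and A: "\<And>k::nat. A k \<in> sets (past (real k * h))" and C: "\<And>k. C k \<in> sets path_space"
 defines "B \<equiv> \<lambda>k. {\<xi>\<in>space M. fut (real k * h) \<xi> \<in> C k}"
 shows first_passage_lower:
   "(\<And>k. \<beta> \<le> prob {\<xi>\<in>space M. fut 0 \<xi> \<in> C k}) \<Longrightarrow> \<beta> * prob (\<Union>k. A k) \<le> prob (\<Union>k. A k \<inter> B k)"
  and first_passage_upper:
   "(\<And>k. prob {\<xi>\<in>space M. fut 0 \<xi> \<in> C k} \<le> \<beta>) \<Longrightarrow> prob (\<Union>k. disjointed A k \<inter> B k) \<le> \<beta> * prob (\<Union>k. A k)"
proof -
 have A': "A k \<in> events" for k using A sets_past_subset by blast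
 have dA: "disjointed A k \<in> sets (past (real k * h))" for k
 proof -
  have "A i \<in> sets (past (real k * h))" if "i < k" for i
   using A[of i] sets_past_mono[of "real i * h" "real k * h"] h that by (auto simp: mult_right_mono)
  then show ?thesis unfolding disjointed_def using A by (intro sets.Diff sets.finite_UN) auto
 qed
 have dA': "disjointed A k \<in> events" for k using dA sets_past_subset by blast
 have B: "B k \<in> events" for k
 proof -
  have "B k = fut (real k * h) -` C k \<inter> space M" by (auto simp: B_def)
  then show ?thesis using measurable_sets[OF fut_measurable C] by simp
 qed
 have p: "prob (disjointed A k \<inter> B k) = prob (disjointed A k) * prob {\<xi>\<in>space M. fut 0 \<xi> \<in> C k}" for k
  unfolding B_def using h by (intro prob_past_fut dA C) simp
 have s1: "(\<lambda>k. prob (disjointed A k \<inter> B k)) sums prob (\<Union>k. disjointed A k \<inter> B k)"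
 proof (rule finite_measure_UNION)
  show "range (\<lambda>k. disjointed A k \<inter> B k) \<subseteq> events" using dA' B by auto
  show "disjoint_family (\<lambda>k. disjointed A k \<inter> B k)"
   using disjoint_family_disjointed[of A] unfolding disjoint_family_on_def by blast
 qed
 have s2: "(\<lambda>k. prob (disjointed A k)) sums prob (\<Union>k. A k)"
  using finite_measure_UNION[of "disjointed A"] dA' disjoint_family_disjointed[of A]
  by (auto simp: UN_disjointed_eq)
 show "\<beta> * prob (\<Union>k. A k) \<le> prob (\<Union>k. A k \<inter> B k)" if "\<And>k. \<beta> \<le> prob {\<xi>\<in>space M. fut 0 \<xi> \<in> C k}"
 proof -
  have "\<beta> * prob (\<Union>k. A k) \<le> prob (\<Union>k. disjointed A k \<inter> B k)"
   by (rule sums_le[OF _ sums_mult[OF s2] s1]) (simp only: p, subst mult.commute, intro mult_left_mono that measure_nonneg)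
  also have "\<dots> \<le> prob (\<Union>k. A k \<inter> B k)"
   using A' B disjointed_subset[of A] by (intro finite_measure_mono UN_mono) auto
  finally show ?thesis .
 qed
 show "prob (\<Union>k. disjointed A k \<inter> B k) \<le> \<beta> * prob (\<Union>k. A k)" if "\<And>k. prob {\<xi>\<in>space M. fut 0 \<xi> \<in> C k} \<le> \<beta>"
  by (rule sums_le[OF _ s1 sums_mult[OF s2]]) (simp only: p, subst (2) mult.commute, intro mult_left_mono that measure_nonneg)
qed

end

section \<open>Cadlag functions\<close>

lemma cadlag_tendsto_right: "cadlag_on UNIV f \<Longrightarrow> (f \<longlongrightarrow> f t) (at_right t)"
 by (simp add: cadlag_on_def)

lemma cadlag_tendsto_left: "cadlag_on UNIV f \<Longrightarrow> (f \<longlongrightarrow> left_limit f t) (at_left t)"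
 unfolding cadlag_on_def left_limit_def using tendsto_Lim[OF trivial_limit_at_left_real]
 by (metis IntI UNIV_I inf_top_left)

lemma left_limit_eq: "(f \<longlongrightarrow> l) (at_left t) \<Longrightarrow> left_limit f t = l"
 unfolding left_limit_def by (rule tendsto_Lim) simp_all

lemma cadlag_right_eps:
 assumes "cadlag_on UNIV f" "0 < e"
 obtains d :: real where "0 < d" "\<And>s. t \<le> s \<Longrightarrow> s < t + d \<Longrightarrow> \<bar>f s - f t\<bar> < e"
proof -
 from tendstoD[OF cadlag_tendsto_right[OF assms(1)] assms(2), of t]
 obtain b where "t < b" "\<forall>y>t. y < b \<longrightarrow> dist (f y) (f t) < e"
  unfolding eventually_at_right_field by blast
 then show thesis using assms(2)
  by (intro that[of "b - t"]) (auto simp: dist_real_def le_less)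
qed

lemma cadlag_left_eps:
 assumes "cadlag_on UNIV f" "0 < e"
 obtains d :: real where "0 < d" "\<And>s. t - d < s \<Longrightarrow> s < t \<Longrightarrow> \<bar>f s - left_limit f t\<bar> < e"
proof -
 from tendstoD[OF cadlag_tendsto_left[OF assms(1)] assms(2), of t]
 obtain b where "b < t" "\<forall>y>b. y < t \<longrightarrow> dist (f y) (left_limit f t) < e"
  unfolding eventually_at_left_field by blast
 then show thesis by (intro that[of "t - b"]) (auto simp: dist_real_def)
qed

lemma cadlag_lower_eps:
 assumes f: "cadlag_on UNIV f" and "0 < e"
 obtains d :: real where "0 < d" "\<And>s. \<bar>s - t\<bar> < d \<Longrightarrow> min (f t) (left_limit f t) - e < f s"
proof -
 obtain d1 where "0 < d1" and d1: "\<And>s. t \<le> s \<Longrightarrow> s < t + d1 \<Longrightarrow> \<bar>f s - f t\<bar> < e"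
  using cadlag_right_eps[OF assms, of t] by metis
 obtain d2 where "0 < d2" and d2: "\<And>s. t - d2 < s \<Longrightarrow> s < t \<Longrightarrow> \<bar>f s - left_limit f t\<bar> < e"
  using cadlag_left_eps[OF assms, of t] by metis
 show thesis
 proof (rule that[of "min d1 d2"])
  fix s assume "\<bar>s - t\<bar> < min d1 d2"
  then show "min (f t) (left_limit f t) - e < f s"
   using d1[of s] d2[of s] by (cases "t \<le> s") auto
 qed (use \<open>0 < d1\<close> \<open>0 < d2\<close> in simp)
qed

lemma cadlag_rat_right:
 assumes "cadlag_on UNIV f" "0 < e" "t < u"
 obtains q :: rat where "t < of_rat q" "of_rat q < u" "\<bar>f (of_rat q) - f t\<bar> < e"
proof -
 obtain d where "0 < d" and d: "\<And>s. t \<le> s \<Longrightarrow> s < t + d \<Longrightarrow> \<bar>f s - f t\<bar> < e"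
  using cadlag_right_eps[OF assms(1,2), of t] by metis
 obtain q :: rat where "t < of_rat q" "of_rat q < min u (t + d)"
  using of_rat_dense[of t "min u (t + d)"] \<open>t < u\<close> \<open>0 < d\<close> by auto
 then show thesis using d[of "of_rat q"] by (intro that[of q]) auto
qed

lemma cadlag_rat_left:
 assumes "cadlag_on UNIV f" "0 < e" "u < t"
 obtains q :: rat where "u < of_rat q" "of_rat q < t" "\<bar>f (of_rat q) - left_limit f t\<bar> < e"
proof -
 obtain d where "0 < d" and d: "\<And>s. t - d < s \<Longrightarrow> s < t \<Longrightarrow> \<bar>f s - left_limit f t\<bar> < e"
  using cadlag_left_eps[OF assms(1,2), of t] by metis
 obtain q :: rat where "max u (t - d) < of_rat q" "of_rat q < t"
  using of_rat_dense[of "max u (t - d)" t] \<open>u < t\<close> \<open>0 < d\<close> by auto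
 then show thesis using d[of "of_rat q"] by (intro that[of q]) auto
qed

lemma cadlag_add_linear:
 assumes "cadlag_on UNIV f"
 shows "cadlag_on UNIV (\<lambda>t. f t + c * t)" "left_limit (\<lambda>t. f t + c * t) t = left_limit f t + c * t"
proof -
 have R: "((\<lambda>t. f t + c * t) \<longlongrightarrow> f t + c * t) (at_right t)" for t
  by (intro tendsto_add cadlag_tendsto_right[OF assms] tendsto_mult tendsto_const tendsto_ident_at)
 have L: "((\<lambda>t. f t + c * t) \<longlongrightarrow> left_limit f t + c * t) (at_left t)" for t
  by (intro tendsto_add cadlag_tendsto_left[OF assms] tendsto_mult tendsto_const tendsto_ident_at)
 show "cadlag_on UNIV (\<lambda>t. f t + c * t)" using R L by (auto simp: cadlag_on_def)
 show "left_limit (\<lambda>t. f t + c * t) t = left_limit f t + c * t" by (rule left_limit_eq[OF L])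
qed

lemma cadlag_diff_linear:
 assumes "cadlag_on UNIV f"
 shows "cadlag_on UNIV (\<lambda>t. f t - c * t)" "left_limit (\<lambda>t. f t - c * t) t = left_limit f t - c * t"
 using cadlag_add_linear[OF assms, of "-c"] by simp_all

lemma cadlag_uminus: "cadlag_on UNIV f \<Longrightarrow> cadlag_on UNIV (\<lambda>t. - f t)"
 unfolding cadlag_on_def by (blast intro: tendsto_minus)

lemma left_limit_ge:
 assumes f: "cadlag_on UNIV f" and "r < t" and ge: "\<And>s. r < s \<Longrightarrow> s < t \<Longrightarrow> m \<le> f s"
 shows "m \<le> left_limit f t"
proof (rule tendsto_lowerbound[OF cadlag_tendsto_left[OF f, of t]])
 show "\<forall>\<^sub>F s in at_left t. m \<le> f s"
  unfolding eventually_at_left_field using \<open>r < t\<close> ge by blast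
qed simp

lemma cadlag_bounded:
 assumes f: "cadlag_on UNIV f"
 shows "\<exists>B. \<forall>s\<in>{a..b}. \<bar>f s\<bar> \<le> B"
proof (cases "a \<le> b")
 case True
 show ?thesis
 proof (rule Bolzano[OF True, of "\<lambda>a b. \<exists>B. \<forall>s\<in>{a..b}. \<bar>f s\<bar> \<le> B"])
  fix a b c :: real assume "\<exists>B. \<forall>s\<in>{a..b}. \<bar>f s\<bar> \<le> B" "\<exists>B. \<forall>s\<in>{b..c}. \<bar>f s\<bar> \<le> B"
  then obtain B C where "\<forall>s\<in>{a..b}. \<bar>f s\<bar> \<le> B" "\<forall>s\<in>{b..c}. \<bar>f s\<bar> \<le> C" by blast
  then show "\<exists>B. \<forall>s\<in>{a..c}. \<bar>f s\<bar> \<le> B"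
   by (intro exI[of _ "max B C"]) (auto simp: le_max_iff_disj)
 next
  fix x
  obtain d1 where "0 < d1" and d1: "\<And>s. x \<le> s \<Longrightarrow> s < x + d1 \<Longrightarrow> \<bar>f s - f x\<bar> < 1"
   using cadlag_right_eps[OF f, of 1 x] by (metis zero_less_one)
  obtain d2 where "0 < d2" and d2: "\<And>s. x - d2 < s \<Longrightarrow> s < x \<Longrightarrow> \<bar>f s - left_limit f x\<bar> < 1"
   using cadlag_left_eps[OF f, of 1 x] by (metis zero_less_one)
  have "\<bar>f s\<bar> \<le> \<bar>f x\<bar> + \<bar>left_limit f x\<bar> + 1" if "a \<le> x" "x \<le> b" "b - a < min d1 d2" "s \<in> {a..b}" for a b s
   using d1[of s] d2[of s] that by (cases "x \<le> s") auto
  then show "\<exists>d>0. \<forall>a b. a \<le> x \<and> x \<le> b \<and> b - a < d \<longrightarrow> (\<exists>B. \<forall>s\<in>{a..b}. \<bar>f s\<bar> \<le> B)"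
   using \<open>0 < d1\<close> \<open>0 < d2\<close> by (intro exI[of _ "min d1 d2"]) (meson min_less_iff_conj)
 qed
qed auto

text \<open>Otherwise each point would have a neighbourhood on which the function exceeds the
infimum by a fixed amount, and by bisection so would the whole interval.\<close>
lemma cadlag_attains_inf:
 assumes f: "cadlag_on UNIV f" and ab: "a \<le> b"
 obtains t where "a \<le> t" "t \<le> b"
  "(\<forall>s\<in>{a..b}. f t \<le> f s) \<or> (a < t \<and> (\<forall>s\<in>{a..b}. left_limit f t \<le> f s))"
proof -
 have "\<exists>t. a \<le> t \<and> t \<le> b \<and> ((\<forall>s\<in>{a..b}. f t \<le> f s) \<or> (a < t \<and> (\<forall>s\<in>{a..b}. left_limit f t \<le> f s)))"
 proof (rule ccontr)
 assume "\<not> ?thesis"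
 then have no: "\<not> ((\<forall>s\<in>{a..b}. f t \<le> f s) \<or> (a < t \<and> (\<forall>s\<in>{a..b}. left_limit f t \<le> f s)))"
  if "a \<le> t" "t \<le> b" for t using that by blast
 define m where "m = Inf (f ` {a..b})"
 obtain B where B: "\<forall>s\<in>{a..b}. \<bar>f s\<bar> \<le> B" using cadlag_bounded[OF f] by blast
 have bdd: "bdd_below (f ` {a..b})" using B by (intro bdd_belowI2[of _ "-B"]) force
 have m: "m \<le> f s" if "s \<in> {a..b}" for s unfolding m_def using that bdd by (intro cInf_lower) auto
 have gt: "m < x" if "\<not> (\<forall>s\<in>{a..b}. x \<le> f s)" for x using that m by force
 have "\<exists>e>0. \<forall>s\<in>{a..b}. s \<in> {a..b} \<longrightarrow> m + e \<le> f s"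
 proof (rule Bolzano[OF ab, of "\<lambda>u v. \<exists>e>0. \<forall>s\<in>{u..v}. s \<in> {a..b} \<longrightarrow> m + e \<le> f s"])
  fix u v w assume "\<exists>e>0. \<forall>s\<in>{u..v}. s \<in> {a..b} \<longrightarrow> m + e \<le> f s" "\<exists>e>0. \<forall>s\<in>{v..w}. s \<in> {a..b} \<longrightarrow> m + e \<le> f s"
  then obtain e1 e2 where "e1 > 0" "e2 > 0" "\<forall>s\<in>{u..v}. s \<in> {a..b} \<longrightarrow> m + e1 \<le> f s" "\<forall>s\<in>{v..w}. s \<in> {a..b} \<longrightarrow> m + e2 \<le> f s"
   by blast
  then show "\<exists>e>0. \<forall>s\<in>{u..w}. s \<in> {a..b} \<longrightarrow> m + e \<le> f s"
   by (intro exI[of _ "min e1 e2"]) (force simp: min_def)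
 next
  fix x assume x: "a \<le> x" "x \<le> b"
  define e1 where "e1 = f x - m"
  have "e1 > 0" using gt[of "f x"] no[OF x] by (auto simp: e1_def)
  obtain d1 where "0 < d1" and d1: "\<And>s. x \<le> s \<Longrightarrow> s < x + d1 \<Longrightarrow> \<bar>f s - f x\<bar> < e1 / 2"
   using cadlag_right_eps[OF f, of "e1/2" x] \<open>e1 > 0\<close> by auto
  have "\<exists>e2>0. \<exists>d2>0. \<forall>s. x - d2 < s \<longrightarrow> s < x \<longrightarrow> s \<in> {a..b} \<longrightarrow> m + e2 \<le> f s"
  proof (cases "a < x")
   case True
   define e2 where "e2 = left_limit f x - m"
   have "e2 > 0" using gt[of "left_limit f x"] no[OF x] True by (auto simp: e2_def)
   obtain d2 where "0 < d2" and d2: "\<And>s. x - d2 < s \<Longrightarrow> s < x \<Longrightarrow> \<bar>f s - left_limit f x\<bar> < e2 / 2"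
    using cadlag_left_eps[OF f, of "e2/2" x] \<open>e2 > 0\<close> by auto
   have "m + e2 / 2 \<le> f s" if "x - d2 < s" "s < x" for s
    using d2[OF that] unfolding e2_def by (simp add: field_simps abs_if split: if_splits)
   then show ?thesis using \<open>0 < d2\<close> \<open>e2 > 0\<close> by (intro exI[of _ "e2/2"]) auto
  next
   case False
   then show ?thesis using x by (intro exI[of _ 1] conjI) auto
  qed
  then obtain e2 d2 where e2: "e2 > 0" "d2 > 0" and d2: "\<forall>s. x - d2 < s \<longrightarrow> s < x \<longrightarrow> s \<in> {a..b} \<longrightarrow> m + e2 \<le> f s"
   by blast
  have R: "m + e1 / 2 \<le> f s" if "x \<le> s" "s < x + d1" for s
   using d1[OF that] unfolding e1_def by (simp add: field_simps abs_if split: if_splits)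
  have "m + min (e1/2) e2 \<le> f s"
   if "u \<le> x" "x \<le> v" "v - u < min d1 d2" "s \<in> {u..v}" "s \<in> {a..b}" for u v s
  proof (cases "x \<le> s")
   case True then show ?thesis using R[of s] that by auto
  next
   case False then show ?thesis using d2[rule_format, of s] that by auto
  qed
  then show "\<exists>d>0. \<forall>u v. u \<le> x \<and> x \<le> v \<and> v - u < d \<longrightarrow> (\<exists>e>0. \<forall>s\<in>{u..v}. s \<in> {a..b} \<longrightarrow> m + e \<le> f s)"
   using \<open>0 < d1\<close> e2 \<open>e1 > 0\<close> by (intro exI[of _ "min d1 d2"] conjI allI impI exI[of _ "min (e1/2) e2"]) auto
 qed
 then obtain e where e: "e > 0" "\<forall>s\<in>{a..b}. m + e \<le> f s" by blast
 then have "m + e \<le> m" unfolding m_def using ab by (intro cInf_greatest) (auto simp: m_def[symmetric])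
 with e show False by simp
 qed
 then show thesis using that by blast
qed

lemma cadlag_inf_on_ray:
 assumes f: "cadlag_on UNIV f" and lim: "filterlim f at_top at_top"
 obtains t where "a \<le> t" "(\<forall>s\<ge>a. f t \<le> f s) \<or> (a < t \<and> (\<forall>s\<ge>a. left_limit f t \<le> f s))"
proof -
 from lim have "eventually (\<lambda>s. f a \<le> f s) at_top" by (simp add: filterlim_at_top)
 then obtain b0 where b0: "\<And>s. b0 \<le> s \<Longrightarrow> f a \<le> f s" unfolding eventually_at_top_linorder by blast
 define b where "b = max a b0"
 obtain t where t: "a \<le> t" "t \<le> b" and
  inf: "(\<forall>s\<in>{a..b}. f t \<le> f s) \<or> (a < t \<and> (\<forall>s\<in>{a..b}. left_limit f t \<le> f s))"
  using cadlag_attains_inf[OF f, of a b] unfolding b_def by auto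
 have *: "x \<le> f s" if x: "\<forall>s\<in>{a..b}. x \<le> f s" and "a \<le> s" for x s
 proof (cases "s \<le> b")
  case False
  have "a \<in> {a..b}" by (simp add: b_def)
  then have "x \<le> f a" using x by blast
  also have "f a \<le> f s" using False by (intro b0) (simp add: b_def)
  finally show ?thesis .
 qed (use that in auto)
 show thesis
  using inf * t(1) by (intro that[of t]) blast+
qed

lemma contact_set_iff:
 assumes f: "cadlag_on UNIV f" and "0 \<le> \<alpha>"
 shows "t \<in> contact_set \<alpha> f \<longleftrightarrow> (\<forall>s. min (f t) (left_limit f t) \<le> f s + \<alpha> * \<bar>t - s\<bar>)"
proof
 assume "t \<in> contact_set \<alpha> f"
 then obtain m where m: "is_lipschitz_minorant \<alpha> f m" and mt: "m t = min (f t) (left_limit f t)"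
  by (auto simp: contact_set_def)
 have lip: "\<alpha>-lipschitz_on UNIV m" and "m \<le> f"
  using m by (auto simp: is_lipschitz_minorant_def)
 have "m t \<le> f s + \<alpha> * \<bar>t - s\<bar>" for s
  using lipschitz_onD[OF lip, of t s] le_funD[OF \<open>m \<le> f\<close>, of s] by (simp add: dist_real_def)
 then show "\<forall>s. min (f t) (left_limit f t) \<le> f s + \<alpha> * \<bar>t - s\<bar>" by (simp add: mt)
next
 assume le: "\<forall>s. min (f t) (left_limit f t) \<le> f s + \<alpha> * \<bar>t - s\<bar>"
 define x where "x = min (f t) (left_limit f t)"
 have bdd: "bdd_below (range (\<lambda>s. f s + \<alpha> * \<bar>u - s\<bar>))" for u
 proof (rule bdd_belowI2[of _ "x - \<alpha> * \<bar>t - u\<bar>"])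
  fix s
  have "\<alpha> * \<bar>t - s\<bar> \<le> \<alpha> * (\<bar>t - u\<bar> + \<bar>u - s\<bar>)" using \<open>0 \<le> \<alpha>\<close> by (intro mult_left_mono) auto
  then show "x - \<alpha> * \<bar>t - u\<bar> \<le> f s + \<alpha> * \<bar>u - s\<bar>" using le[rule_format, of s] by (simp add: x_def algebra_simps)
 qed
 let ?m = "\<lambda>t. INF s. f s + \<alpha> * \<bar>t - s\<bar>"
 have m: "is_lipschitz_minorant \<alpha> f ?m" by (rule is_lipschitz_minorant_INF[OF \<open>0 \<le> \<alpha>\<close> bdd])
 then have lip: "\<alpha>-lipschitz_on UNIV ?m" and "?m \<le> f"
  by (auto simp: is_lipschitz_minorant_def)
 have "x \<le> ?m t" by (rule cINF_greatest) (use le in \<open>auto simp: x_def\<close>)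
 moreover have "?m t \<le> f t" using \<open>?m \<le> f\<close> by (rule le_funD)
 moreover have "?m t \<le> left_limit f t"
 proof (rule tendsto_le[OF _ cadlag_tendsto_left[OF f]])
  have "continuous_on UNIV ?m" by (rule lipschitz_on_continuous_on[OF lip])
  then have "isCont ?m t" by (simp add: continuous_on_eq_continuous_at)
  then show "(?m \<longlongrightarrow> ?m t) (at_left t)"
   unfolding isCont_def by (rule tendsto_mono[OF at_le[OF subset_UNIV]])
 qed (use le_funD[OF \<open>?m \<le> f\<close>] in auto)
 ultimately have "?m t = min (f t) (left_limit f t)" by (simp add: x_def min_def split: if_splits)
 with m show "t \<in> contact_set \<alpha> f" unfolding contact_set_def by blast
qed

section \<open>The contact time of a good path\<close>

text \<open>This says that \<open>V\<close> has come down to \<open>c\<close> by time u, for a good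
path and rational u. Only rational times occur, so that it is visibly an event of the past of u. The
strictly positive a keeps a possible contact at 0 itself from counting.\<close>
definition hit :: "real \<Rightarrow> (real \<Rightarrow> real) \<Rightarrow> real \<Rightarrow> bool" where
 "hit \<alpha> f u \<longleftrightarrow> (\<exists>a::rat. 0 < a \<and> of_rat a < u \<and> (\<forall>m::nat. \<exists>s::rat. a \<le> s \<and> of_rat s \<le> u \<and>
  (\<forall>r::rat. r \<le> 0 \<longrightarrow> f (of_rat s) - \<alpha> * of_rat s \<le> f (of_rat r) - \<alpha> * of_rat r + 1 / Suc m)))"

definition lattice_stop :: "real \<Rightarrow> (real \<Rightarrow> real) \<Rightarrow> nat \<Rightarrow> nat \<Rightarrow> bool" where
 "lattice_stop \<alpha> f n k \<longleftrightarrow> hit \<alpha> f (real k / 2 ^ n) \<and>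
  (\<forall>j\<ge>k. f (real k / 2 ^ n) + \<alpha> * (real k / 2 ^ n) \<le> f (real j / 2 ^ n) + \<alpha> * (real j / 2 ^ n))"

text \<open>The properties of a single path that make the lattice approximation work. In the last
three, an infimum of \<open>W\<close> over times at which \<open>V\<close> has reached its level is
not shared by the times before and after a rational q, an upward jump is preceded by values of
\<open>W\<close> below its left limit, and \<open>V\<close> does not jump up at the first time at
which its left limit is down to \<open>c\<close>.\<close>
locale good_path =
 fixes \<alpha> :: real and f :: "real \<Rightarrow> real"
 assumes alpha: "0 < \<alpha>" and f: "cadlag_on UNIV f" and f0: "f 0 = 0" and left0: "left_limit f 0 = f 0"
  and up: "filterlim (\<lambda>t. f t + \<alpha> * t) at_top at_top"
  and left_bdd: "\<exists>B. \<forall>r\<le>0. B \<le> f r - \<alpha> * r"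
  and down: "\<And>B. \<exists>t>0. f t - \<alpha> * t < B"
  and no_tie: "\<And>q m. \<lbrakk>\<And>s::rat. 0 < s \<Longrightarrow> s < q \<Longrightarrow> hit \<alpha> f (of_rat s) \<Longrightarrow> m \<le> f (of_rat s) + \<alpha> * of_rat s;
    \<And>e. 0 < e \<Longrightarrow> \<exists>s::rat. 0 < s \<and> s < q \<and> hit \<alpha> f (of_rat s) \<and> f (of_rat s) + \<alpha> * of_rat s < m + e;
    \<And>s::rat. q \<le> s \<Longrightarrow> m \<le> f (of_rat s) + \<alpha> * of_rat s;
    \<And>e. 0 < e \<Longrightarrow> \<exists>s::rat. q \<le> s \<and> f (of_rat s) + \<alpha> * of_rat s < m + e\<rbrakk> \<Longrightarrow> False"
  and jump_dip: "\<And>t r. 0 < t \<Longrightarrow> left_limit f t < f t \<Longrightarrow> r < t \<Longrightarrow>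
    \<exists>s. r < s \<and> s < t \<and> f s + \<alpha> * s < left_limit f t + \<alpha> * t"
  and no_jump_hit: "\<And>t. \<lbrakk>0 < t; \<And>r. r \<le> 0 \<Longrightarrow> left_limit f t - \<alpha> * t \<le> f r - \<alpha> * r;
    \<And>s. 0 < s \<Longrightarrow> s < t \<Longrightarrow> \<exists>r\<le>0. f r - \<alpha> * r < min (f s) (left_limit f s) - \<alpha> * s\<rbrakk>
    \<Longrightarrow> f t \<le> left_limit f t"
begin

definition "W t = f t + \<alpha> * t"
definition "V t = f t - \<alpha> * t"
definition "lW t = left_limit f t + \<alpha> * t"
definition "lV t = left_limit f t - \<alpha> * t"

lemma W: "cadlag_on UNIV W" "left_limit W t = lW t"
 using cadlag_add_linear[OF f, of \<alpha>] by (simp_all add: W_def[abs_def] lW_def)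

lemma V: "cadlag_on UNIV V" "left_limit V t = lV t"
 using cadlag_diff_linear[OF f, of \<alpha>] by (simp_all add: V_def[abs_def] lV_def)

lemma V_W: "V t = W t - 2 * \<alpha> * t" "lV t = lW t - 2 * \<alpha> * t"
 by (simp_all add: V_def W_def lV_def lW_def)

definition "c = Inf (V ` {..0})"

lemma c_le: "r \<le> 0 \<Longrightarrow> c \<le> V r"
 using left_bdd unfolding c_def V_def by (intro cInf_lower) (auto simp: bdd_below_def)

lemma le_c: "(\<And>r. r \<le> 0 \<Longrightarrow> x \<le> V r) \<Longrightarrow> x \<le> c"
 unfolding c_def by (rule cInf_greatest) auto

lemma c_less: "c < x \<Longrightarrow> \<exists>r\<le>0. V r < x"
 using le_c[of x] by force

lemma c_nonpos: "c \<le> 0"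
 using c_le[of 0] by (simp add: V_def f0)

definition "hits = {t. 0 < t \<and> min (V t) (lV t) \<le> c}"
definition "S = Inf hits"

lemma hits_nonempty: "hits \<noteq> {}"
proof -
 obtain t where "0 < t" "V t < c" using down[of c] by (auto simp: V_def)
 then show ?thesis unfolding hits_def by (auto intro!: exI[of _ t])
qed

lemma hits_bdd: "bdd_below hits"
 by (rule bdd_belowI[of _ 0]) (auto simp: hits_def)

lemma S_le: "t \<in> hits \<Longrightarrow> S \<le> t"
 unfolding S_def by (rule cInf_lower[OF _ hits_bdd])

lemma S_nonneg: "0 \<le> S"
 unfolding S_def by (rule cInf_greatest[OF hits_nonempty]) (auto simp: hits_def)

lemma hits_near_S: "S < u \<Longrightarrow> \<exists>t\<in>hits. t < u"
 unfolding S_def using cInf_lessD[OF hits_nonempty] by blast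

lemma min_V_S_le:
 assumes "0 < e"
 shows "min (V S) (lV S) - e \<le> c"
proof -
 obtain d where "0 < d" and d: "\<And>s. \<bar>s - S\<bar> < d \<Longrightarrow> min (V S) (left_limit V S) - e < V s"
  using cadlag_lower_eps[OF V(1) assms, of S] by blast
 obtain t where t: "t \<in> hits" "t < S + d" using hits_near_S[of "S + d"] \<open>0 < d\<close> by auto
 have "S \<le> t" using S_le t by simp
 have "min (V S) (lV S) - e \<le> V t" using d[of t] \<open>S \<le> t\<close> t by (simp add: V(2))
 moreover have "min (V S) (lV S) - e \<le> left_limit V t"
 proof (rule left_limit_ge[OF V(1), of "S - d"])
  show "S - d < t" using \<open>0 < d\<close> \<open>S \<le> t\<close> by simp
  fix s assume "S - d < s" "s < t"
  then show "min (V S) (lV S) - e \<le> V s" using d[of s] t by (simp add: V(2) abs_less_iff)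
 qed
 ultimately show ?thesis using t(1) by (auto simp: hits_def V(2) min_def split: if_splits)
qed

lemma V_before_S: "0 < s \<Longrightarrow> s < S \<Longrightarrow> c < V s" "0 < s \<Longrightarrow> s < S \<Longrightarrow> c < lV s"
 using S_le[of s] by (force simp: hits_def)+

text \<open>If the level were reached only by the left limit at \<open>S\<close>, the path would
jump upwards there.\<close>
lemma at_S: "V S \<le> c" "f S \<le> left_limit f S"
proof -
 have "V S \<le> c \<and> f S \<le> left_limit f S"
 proof (cases "S = 0")
  case True
  have *: "- e \<le> c" if "0 < e" for e using min_V_S_le[OF that] True left0 by (simp add: V_def lV_def f0)
  have "0 \<le> c"
  proof (rule ccontr)
   assume "\<not> 0 \<le> c"
   then show False using *[of "- c / 2"] by simp
  qed
  then show ?thesis using True left0 c_nonpos by (simp add: V_def f0)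
 next
  case False
  then have "0 < S" using S_nonneg by simp
  have "min (V S) (lV S) \<le> c" by (rule field_le_epsilon) (use min_V_S_le in \<open>simp add: algebra_simps\<close>)
  moreover have "f S \<le> left_limit f S" if "lV S \<le> c"
  proof (rule no_jump_hit[OF \<open>0 < S\<close>])
   fix r :: real assume "r \<le> 0"
   then show "left_limit f S - \<alpha> * S \<le> f r - \<alpha> * r" using c_le[of r] that by (simp add: V_def lV_def)
  next
   fix s assume "0 < s" "s < S"
   then have "c < min (V s) (lV s)" using V_before_S by simp
   from c_less[OF this] show "\<exists>r\<le>0. f r - \<alpha> * r < min (f s) (left_limit f s) - \<alpha> * s"
    by (auto simp: V_def lV_def)
  qed
  ultimately show ?thesis by (cases "lV S \<le> c") (auto simp: V_def lV_def)
 qed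
 then show "V S \<le> c" "f S \<le> left_limit f S" by auto
qed

text \<open>A convergent sequence of near-minimisers in \<open>[a, u]\<close> shows that the event
forces a hit; conversely, near a hitting time there are rational times with almost the same value of
\<open>V\<close>.\<close>
lemma hit_iff: "hit \<alpha> f (of_rat u) \<longleftrightarrow> 0 < u \<and> S \<le> of_rat u"
proof
 assume "hit \<alpha> f (of_rat u)"
 then obtain a :: rat where a: "0 < a" "a < u" and
  ex: "\<And>m::nat. \<exists>s::rat. a \<le> s \<and> s \<le> u \<and> (\<forall>r::rat. r \<le> 0 \<longrightarrow> V (of_rat s) \<le> V (of_rat r) + 1 / Suc m)"
  unfolding hit_def V_def by (auto simp: of_rat_less of_rat_less_eq)
 have inf: "\<exists>s. of_rat a \<le> s \<and> s \<le> of_rat u \<and> V s \<le> c + 1 / Suc m" for m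
 proof -
  obtain s :: rat where s: "a \<le> s" "s \<le> u" and le: "\<And>r::rat. r \<le> 0 \<Longrightarrow> V (of_rat s) \<le> V (of_rat r) + 1 / Suc m"
   using ex[of m] by blast
  have "V (of_rat s) - 1 / Suc m \<le> c"
  proof (rule le_c)
   fix r :: real assume "r \<le> 0"
   show "V (of_rat s) - 1 / Suc m \<le> V r"
   proof (cases "r = 0")
    case True then show ?thesis using le[of 0] by simp
   next
    case False
    show ?thesis
    proof (rule field_le_epsilon)
     fix e :: real assume "0 < e"
     obtain q :: rat where "r < of_rat q" "of_rat q < (0::real)" "\<bar>V (of_rat q) - V r\<bar> < e"
      using cadlag_rat_right[OF V(1) \<open>0 < e\<close>, of r 0] False \<open>r \<le> 0\<close> by auto
     then show "V (of_rat s) - 1 / Suc m \<le> V r + e" using le[of q] by simp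
    qed
   qed
  qed
  then show ?thesis using s by (intro exI[of _ "of_rat s"]) (simp add: of_rat_less_eq)
 qed
 obtain t where t: "of_rat a \<le> t" "t \<le> of_rat u" and
  min: "(\<forall>s\<in>{of_rat a..of_rat u}. V t \<le> V s) \<or> (of_rat a < t \<and> (\<forall>s\<in>{of_rat a..of_rat u}. left_limit V t \<le> V s))"
  by (rule cadlag_attains_inf[OF V(1), of "of_rat a" "of_rat u"]) (use a in \<open>auto simp: of_rat_less_eq\<close>)
 have le: "x \<le> c" if "\<forall>s\<in>{of_rat a..of_rat u}. x \<le> V s" for x
 proof (rule field_le_epsilon)
  fix e :: real assume "0 < e"
  then obtain m where "1 / Suc m < e" using nat_approx_posE by blast
  with inf[of m] that show "x \<le> c + e" by force
 qed
 have "min (V t) (lV t) \<le> c" using min le[of "V t"] le[of "left_limit V t"] V(2)[of t] by auto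
 moreover have "0 < t" using t(1) a(1) by (meson less_le_trans zero_less_of_rat_iff)
 ultimately have "t \<in> hits" by (simp add: hits_def)
 then show "0 < u \<and> S \<le> of_rat u" using S_le[of t] t a by auto
next
 assume u: "0 < u \<and> S \<le> of_rat u"
 have ex: "\<exists>t\<le>of_rat u. t \<in> hits"
 proof (cases "S = of_rat u")
  case True
  then have "0 < S" using u by simp
  then have "S \<in> hits" using at_S(1) by (simp add: hits_def)
  then show ?thesis using True by auto
 next
  case False
  then have "S < of_rat u" using u by simp
  then obtain t where "t \<in> hits" "t < of_rat u" using hits_near_S by blast
  then show ?thesis by (intro exI[of _ t]) simp
 qed
 then obtain t where t: "t \<le> of_rat u" "0 < t" "min (V t) (lV t) \<le> c" by (auto simp: hits_def)
 obtain a :: rat where a: "0 < (of_rat a :: real)" "of_rat a < t" using of_rat_dense[of 0 t] t by auto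
 have "\<exists>s::rat. a \<le> s \<and> s \<le> u \<and> V (of_rat s) \<le> c + 1 / Suc m" for m
 proof (cases "V t \<le> c")
  case True
  show ?thesis
  proof (cases "t = of_rat u")
   case eq: True
   have "(of_rat a::real) \<le> of_rat u" using a eq by simp
   then have "a \<le> u" by (simp add: of_rat_less_eq)
   moreover have "V (of_rat u) \<le> c + 1 / Suc m"
    using True eq by (simp add: add_increasing2)
   ultimately show ?thesis by auto
  next
   case False
   obtain q :: rat where q: "t < of_rat q" "of_rat q < (of_rat u::real)" "\<bar>V (of_rat q) - V t\<bar> < 1 / Suc m"
    using cadlag_rat_right[OF V(1), of "1 / Suc m" t "of_rat u"] False t by auto
   have "(of_rat a::real) < of_rat q" using a q by linarith
   then show ?thesis using q True by (intro exI[of _ q]) (auto simp: of_rat_less)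
  qed
 next
  case False
  then have lc: "left_limit V t \<le> c" using t V(2) by auto
  obtain q :: rat where q: "of_rat a < (of_rat q::real)" "of_rat q < t" "\<bar>V (of_rat q) - left_limit V t\<bar> < 1 / Suc m"
   using cadlag_rat_left[OF V(1), of "1 / Suc m" "of_rat a" t] a by auto
  have "(of_rat q::real) < of_rat u" using t q by linarith
  then show ?thesis using q lc by (intro exI[of _ q]) (auto simp: of_rat_less)
 qed
 moreover have "V (of_rat s) \<le> V (of_rat r) + 1 / Suc m"
  if "V (of_rat s) \<le> c + 1 / Suc m" "r \<le> 0" for s r :: rat and m
  using c_le[of "of_rat r"] that by (simp add: of_rat_le_0_iff)
 ultimately have "\<exists>s::rat. a \<le> s \<and> s \<le> u \<and> (\<forall>r::rat. r \<le> 0 \<longrightarrow> V (of_rat s) \<le> V (of_rat r) + 1 / Suc m)" for m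
  by meson
 moreover have "(of_rat a::real) < of_rat u" using a t by linarith
 ultimately show "hit \<alpha> f (of_rat u)"
  unfolding hit_def V_def using a by (intro exI[of _ a]) (auto simp: of_rat_less_eq)
qed

lemma hit_lattice: "hit \<alpha> f (real k / 2 ^ n) \<longleftrightarrow> 0 < k \<and> S \<le> real k / 2 ^ n"
 using hit_iff[of "of_nat k / 2 ^ n"] by (simp add: of_rat_divide of_rat_power zero_less_divide_iff)

text \<open>\<open>W\<close> tends to infinity, so the infimum over \<open>[S, \<infinity>)\<close>
is approached on a compact interval. If only a left limit attained it, the path would jump upwards
there, and it would have dipped below that left limit before.\<close>
lemma argmin_exists: "\<exists>t\<ge>S. (\<forall>s\<ge>S. W t \<le> W s) \<and> f t \<le> left_limit f t"
proof -
 have "filterlim W at_top at_top" using up by (simp add: W_def[abs_def])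
 then obtain t where t: "S \<le> t" and min: "(\<forall>s\<ge>S. W t \<le> W s) \<or> (S < t \<and> (\<forall>s\<ge>S. left_limit W t \<le> W s))"
  using cadlag_inf_on_ray[OF W(1), of S] by blast
 have dip: "f t \<le> left_limit f t" if St: "S < t" and le: "\<forall>s\<ge>S. lW t \<le> W s"
 proof (rule ccontr)
  assume "\<not> ?thesis"
  then obtain s where s: "S < s" "s < t" "f s + \<alpha> * s < left_limit f t + \<alpha> * t"
   using jump_dip[of t S] St S_nonneg by auto
  with le[rule_format, of s] show False by (simp add: W_def lW_def)
 qed
 show ?thesis
 proof (cases "(\<forall>s\<ge>S. W t \<le> W s)")
  case True
  have "f t \<le> left_limit f t"
  proof (cases "t = S")
   case True then show ?thesis using at_S by simp
  next
   case False
   then have "S < t" using t by simp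
   show ?thesis
   proof (rule ccontr)
    assume n: "\<not> ?thesis"
    then obtain s where "S < s" "s < t" "f s + \<alpha> * s < left_limit f t + \<alpha> * t"
     using jump_dip[of t S] \<open>S < t\<close> S_nonneg by auto
    with True[rule_format, of s] n show False by (simp add: W_def)
   qed
  qed
  then show ?thesis using t True by blast
 next
  case False
  then have *: "S < t" "\<forall>s\<ge>S. lW t \<le> W s" using min by (auto simp: W(2))
  from dip[OF this] have "W t \<le> lW t" by (simp add: W_def lW_def)
  then show ?thesis using * dip[OF *] by (intro exI[of _ t]) (auto intro: order_trans)
 qed
qed

definition "T = (SOME t. S \<le> t \<and> (\<forall>s\<ge>S. W t \<le> W s) \<and> f t \<le> left_limit f t)"

lemma T: "S \<le> T" "S \<le> s \<Longrightarrow> W T \<le> W s" "f T \<le> left_limit f T"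
 using someI_ex[OF argmin_exists] unfolding T_def by auto

lemma lW_ge: "S < s \<Longrightarrow> W T \<le> lW s"
 using left_limit_ge[OF W(1), of S s "W T"] T(2) by (simp add: W(2))

text \<open>A rational q between two minimisers would see the same infimum of \<open>W\<close> on
both sides.\<close>
lemma argmin_unique:
 assumes t1: "S \<le> t1" "W t1 = W T \<or> (S < t1 \<and> lW t1 = W T)"
  and t2: "S \<le> t2" "W t2 = W T \<or> (S < t2 \<and> lW t2 = W T)"
  and "t1 < t2"
 shows False
proof -
 obtain q :: rat where q: "t1 < of_rat q" "of_rat q < t2" using of_rat_dense[OF \<open>t1 < t2\<close>] by blast
 have pos: "0 < s \<and> hit \<alpha> f (of_rat s)" if "S < of_rat s" for s :: rat
 proof -
  have "0 < (of_rat s :: real)" using that S_nonneg by linarith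
  then show ?thesis using that hit_iff by simp
 qed
 show False
 proof (rule no_tie[of q "W T"])
  fix s :: rat assume "hit \<alpha> f (of_rat s)"
  then show "W T \<le> f (of_rat s) + \<alpha> * of_rat s" using T(2)[of "of_rat s"] hit_iff by (simp add: W_def)
 next
  fix s :: rat assume "q \<le> s"
  then have "(of_rat q :: real) \<le> of_rat s" by (simp add: of_rat_less_eq)
  then have "S \<le> of_rat s" using t1 q by linarith
  then show "W T \<le> f (of_rat s) + \<alpha> * of_rat s" using T(2)[of "of_rat s"] by (simp add: W_def)
 next
  fix e :: real assume "0 < e"
  obtain s :: rat where s: "S < of_rat s" "of_rat s < (of_rat q::real)" "W (of_rat s) < W T + e"
  proof (cases "W t1 = W T")
   case True
   obtain s :: rat where "t1 < of_rat s" "of_rat s < (of_rat q::real)" "\<bar>W (of_rat s) - W t1\<bar> < e"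
    using cadlag_rat_right[OF W(1) \<open>0 < e\<close> q(1)] by blast
   then show thesis using t1(1) True by (intro that[of s]) auto
  next
   case False
   then have lt: "S < t1" "lW t1 = W T" using t1 by auto
   obtain s :: rat where "S < of_rat s" "of_rat s < t1" "\<bar>W (of_rat s) - left_limit W t1\<bar> < e"
    using cadlag_rat_left[OF W(1) \<open>0 < e\<close> lt(1)] by blast
   then show thesis using q(1) lt W(2)[of t1] by (intro that[of s]) auto
  qed
  then show "\<exists>s::rat. 0 < s \<and> s < q \<and> hit \<alpha> f (of_rat s) \<and> f (of_rat s) + \<alpha> * of_rat s < W T + e"
   using pos[of s] by (auto simp: of_rat_less W_def intro!: exI[of _ s])
 next
  fix e :: real assume "0 < e"
  obtain s :: rat where s: "of_rat q < (of_rat s::real)" "W (of_rat s) < W T + e"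
  proof (cases "W t2 = W T")
   case True
   obtain s :: rat where "t2 < of_rat s" "of_rat s < t2 + 1" "\<bar>W (of_rat s) - W t2\<bar> < e"
    using cadlag_rat_right[OF W(1) \<open>0 < e\<close>, of t2 "t2 + 1"] by auto
   then show thesis using q True by (intro that[of s]) auto
  next
   case False
   then have lt: "lW t2 = W T" using t2 by auto
   obtain s :: rat where "of_rat q < (of_rat s::real)" "of_rat s < t2" "\<bar>W (of_rat s) - left_limit W t2\<bar> < e"
    using cadlag_rat_left[OF W(1) \<open>0 < e\<close> q(2)] by blast
   then show thesis using lt W(2)[of t2] by (intro that[of s]) auto
  qed
  then show "\<exists>s::rat. q \<le> s \<and> f (of_rat s) + \<alpha> * of_rat s < W T + e"
   by (auto simp: of_rat_less W_def intro!: exI[of _ s])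
 qed
qed

lemma W_gt: "S \<le> s \<Longrightarrow> s \<noteq> T \<Longrightarrow> W T < W s"
 using argmin_unique[of s T] argmin_unique[of T s] T(1) T(2)[of s] by force

lemma lW_gt: "S < s \<Longrightarrow> s \<noteq> T \<Longrightarrow> W T < lW s"
 using argmin_unique[of s T] argmin_unique[of T s] T(1) lW_ge[of s] by force

text \<open>Uniqueness of the minimiser is made uniform by compactness and by the growth of
\<open>W\<close>.\<close>
lemma separated:
 assumes "0 < e"
 shows "\<exists>g>0. \<forall>s\<ge>S. e \<le> \<bar>s - T\<bar> \<longrightarrow> W T + g \<le> W s"
proof -
 have "\<exists>g>0. \<forall>s\<ge>T + e. W T + g \<le> W s"
 proof -
  have "filterlim W at_top at_top" using up by (simp add: W_def[abs_def])
  then obtain t where t: "T + e \<le> t" "(\<forall>s\<ge>T+e. W t \<le> W s) \<or> (T + e < t \<and> (\<forall>s\<ge>T+e. left_limit W t \<le> W s))"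
   using cadlag_inf_on_ray[OF W(1), of "T + e"] by blast
  have "W T < W t" "W T < lW t" using t(1) assms T(1) by (auto intro!: W_gt lW_gt)
  then show ?thesis
   using t(2) by (intro exI[of _ "min (W t - W T) (lW t - W T)"]) (auto simp: W(2) min_le_iff_disj)
 qed
 then obtain g1 where g1: "g1 > 0" "\<forall>s\<ge>T + e. W T + g1 \<le> W s" by blast
 have "\<exists>g>0. \<forall>s\<in>{S..T - e}. W T + g \<le> W s"
 proof (cases "S \<le> T - e")
  case True
  then obtain t where t: "S \<le> t" "t \<le> T - e" "(\<forall>s\<in>{S..T-e}. W t \<le> W s) \<or> (S < t \<and> (\<forall>s\<in>{S..T-e}. left_limit W t \<le> W s))"
   using cadlag_attains_inf[OF W(1) True] by blast
  have "W T < W t" using t assms by (intro W_gt) auto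
  moreover have "S < t \<Longrightarrow> W T < lW t" using t assms by (intro lW_gt) auto
  ultimately show ?thesis
   using t(3) by (elim disjE) (auto intro: exI[of _ "W t - W T"], auto intro!: exI[of _ "lW t - W T"] simp: W(2))
 qed (auto intro: exI[of _ 1])
 then obtain g2 where g2: "g2 > 0" "\<forall>s\<in>{S..T - e}. W T + g2 \<le> W s" by blast
 show ?thesis
 proof (intro exI[of _ "min g1 g2"] conjI allI impI)
  fix s assume "S \<le> s" "e \<le> \<bar>s - T\<bar>"
  then have "s \<ge> T + e \<or> s \<in> {S..T - e}" by auto
  then show "W T + min g1 g2 \<le> W s" using g1 g2 by fastforce
 qed (use g1 g2 in simp)
qed

lemma contactI:
 assumes "\<And>s. s \<le> t \<Longrightarrow> min (f t) (left_limit f t) - \<alpha> * t \<le> V s"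
  and "\<And>s. t \<le> s \<Longrightarrow> min (f t) (left_limit f t) + \<alpha> * t \<le> W s"
 shows "t \<in> contact_set \<alpha> f"
 unfolding contact_set_iff[OF f less_imp_le[OF alpha]]
proof
 fix s
 show "min (f t) (left_limit f t) \<le> f s + \<alpha> * \<bar>t - s\<bar>"
 proof (cases "s \<le> t")
  case True then show ?thesis using assms(1)[OF True] by (simp add: V_def algebra_simps)
 next
  case False then show ?thesis using assms(2)[of s] by (simp add: W_def algebra_simps)
 qed
qed

text \<open>Before \<open>T\<close> the function \<open>V\<close> is at least as large as at
\<open>T\<close>: for times in \<open>[S, T]\<close> since \<open>V\<close> is \<open>W\<close>
minus an increasing function, and for times before \<open>S\<close> since those values are at least
\<open>c\<close>.\<close>
lemma T_contact: "T \<in> contact_set \<alpha> f"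
proof (rule contactI)
 fix s assume "T \<le> s"
 then show "min (f T) (left_limit f T) + \<alpha> * T \<le> W s"
  using T(2)[of s] T(1) T(3) by (simp add: W_def)
next
 fix s assume sT: "s \<le> T"
 have "2 * \<alpha> * S \<le> 2 * \<alpha> * T" using alpha T(1) by simp
 then have VT: "V T \<le> V S" using T(2)[of S] by (simp add: V_W)
 have "V T \<le> V s"
 proof (cases "S \<le> s")
  case True
  have "2 * \<alpha> * s \<le> 2 * \<alpha> * T" using alpha sT by simp
  then show ?thesis using T(2)[OF True] by (simp add: V_W)
 next
  case False
  have "c \<le> V s" using V_before_S(1)[of s] c_le[of s] False by (cases "s \<le> 0") auto
  then show ?thesis using VT at_S(1) by linarith
 qed
 then show "min (f T) (left_limit f T) - \<alpha> * T \<le> V s"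
  by (simp add: V_def min_def)
qed

text \<open>At a contact time \<open>V\<close> is down to \<open>c\<close>, so the time is past
\<open>S\<close>; but at a time in \<open>[S, T)\<close> the smaller value \<open>W T\<close> still
lies in the future.\<close>
lemma contact_ge_T:
 assumes t: "t \<in> contact_set \<alpha> f" "0 < t"
 shows "T \<le> t"
proof (rule ccontr)
 assume "\<not> T \<le> t"
 then have "t < T" by simp
 have le: "min (f t) (left_limit f t) \<le> f s + \<alpha> * \<bar>t - s\<bar>" for s
  using t(1) unfolding contact_set_iff[OF f less_imp_le[OF alpha]] by blast
 have "min (V t) (lV t) \<le> c"
 proof (rule le_c)
  fix r :: real assume "r \<le> 0"
  then show "min (V t) (lV t) \<le> V r" using le[of r] t(2) by (simp add: V_def lV_def algebra_simps min_def split: if_splits)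
 qed
 then have "S \<le> t" using t(2) by (intro S_le) (simp add: hits_def)
 have "W T < W t" using W_gt \<open>S \<le> t\<close> \<open>t < T\<close> by simp
 moreover have "W T < lW t"
 proof (cases "S = t")
  case True
  then have "W t \<le> lW t" using at_S(2) by (simp add: W_def lW_def)
  then show ?thesis using calculation by simp
 next
  case False then show ?thesis using lW_gt \<open>S \<le> t\<close> \<open>t < T\<close> by simp
 qed
 moreover have "min (W t) (lW t) \<le> W T"
  using le[of T] \<open>t < T\<close> by (simp add: W_def lW_def algebra_simps min_def split: if_splits)
 ultimately show False by (simp add: min_def split: if_splits)
qed

text \<open>The contact time is an infimum over strictly positive times. If the minimum is at 0,
that infimum is still 0 because there are contact times arbitrarily close to 0.\<close>
lemma contact_near_0:
 assumes T0: "T = 0" and e: "0 < e"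
 shows "\<exists>t\<in>contact_set \<alpha> f. 0 < t \<and> t < e"
proof -
 have S0: "S = 0" using T(1) S_nonneg T0 by simp
 have c0: "c = 0" using at_S(1) c_nonpos by (simp add: S0 V_def f0)
 have WT: "W T = 0" by (simp add: T0 W_def f0)
 obtain g where g: "g > 0" "\<And>s. e / 2 \<le> s \<Longrightarrow> g \<le> W s"
 proof -
  obtain g where "g > 0" and *: "\<forall>s\<ge>S. e / 2 \<le> \<bar>s - T\<bar> \<longrightarrow> W T + g \<le> W s" using separated[of "e/2"] e by auto
  have "g \<le> W s" if "e / 2 \<le> s" for s
   using *[rule_format, of s] that e WT by (simp add: S0 T0)
  then show thesis using \<open>g > 0\<close> that by blast
 qed
 obtain d where d: "0 < d" "\<And>s. 0 \<le> s \<Longrightarrow> s < 0 + d \<Longrightarrow> \<bar>W s - W 0\<bar> < g"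
  using cadlag_right_eps[OF W(1) \<open>g > 0\<close>, of 0] by metis
 obtain t1 where t1: "t1 \<in> hits" "t1 < min d e" using hits_near_S[of "min d e"] S0 d e by auto
 then have "0 < t1" "min (V t1) (lV t1) \<le> 0" by (auto simp: hits_def c0)
 have "\<exists>u. 0 < u \<and> u \<le> t1 \<and> (\<forall>s\<le>t1. min (V u) (lV u) \<le> V s)"
 proof -
  obtain u where u: "0 \<le> u" "u \<le> t1" "(\<forall>s\<in>{0..t1}. V u \<le> V s) \<or> (0 < u \<and> (\<forall>s\<in>{0..t1}. left_limit V u \<le> V s))"
   using cadlag_attains_inf[OF V(1), of 0 t1] \<open>0 < t1\<close> by auto
  show ?thesis
  proof (cases "u = 0")
   case True
   then have *: "0 \<le> V s" if "s \<in> {0..t1}" for s using u(3) that by (auto simp: V_def f0)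
   have "min (V t1) (lV t1) \<le> V s" if "s \<le> t1" for s
    using *[of s] c_le[of s] that \<open>min (V t1) (lV t1) \<le> 0\<close> by (cases "0 \<le> s") (auto simp: c0)
   then show ?thesis using \<open>0 < t1\<close> by blast
  next
   case False
   have *: "min (V u) (lV u) \<le> V s" if "s \<in> {0..t1}" for s using u(3) that by (auto simp: V(2) min_le_iff_disj)
   then have "min (V u) (lV u) \<le> 0" using *[of 0] \<open>0 < t1\<close> by (simp add: V_def f0)
   then have "min (V u) (lV u) \<le> V s" if "s \<le> t1" for s
    using *[of s] c_le[of s] that by (cases "0 \<le> s") (auto simp: c0)
   then show ?thesis using u False by (intro exI[of _ u]) auto
  qed
 qed
 then obtain u where u: "0 < u" "u \<le> t1" "\<And>s. s \<le> t1 \<Longrightarrow> min (V u) (lV u) \<le> V s" by blast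
 have "\<exists>v\<ge>u. (\<forall>s\<ge>u. min (W v) (lW v) \<le> W s) \<and> min (W v) (lW v) \<le> lW u"
 proof -
  have "filterlim W at_top at_top" using up by (simp add: W_def[abs_def])
  then obtain v where v: "u \<le> v" "(\<forall>s\<ge>u. W v \<le> W s) \<or> (u < v \<and> (\<forall>s\<ge>u. left_limit W v \<le> W s))"
   using cadlag_inf_on_ray[OF W(1), of u] by blast
  have v': "min (W v) (lW v) \<le> W s" if "u \<le> s" for s using v(2) that by (auto simp: W(2) min_le_iff_disj)
  show ?thesis
  proof (cases "lW u \<le> min (W v) (lW v)")
   case True
   then have "min (W u) (lW u) \<le> W s" if "u \<le> s" for s using v'[OF that] by (auto simp: min_le_iff_disj)
   then show ?thesis by (intro exI[of _ u]) auto
  next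
   case False
   then show ?thesis using v(1) v' by (intro exI[of _ v]) auto
  qed
 qed
 then obtain v where v: "u \<le> v" "\<And>s. u \<le> s \<Longrightarrow> min (W v) (lW v) \<le> W s" "min (W v) (lW v) \<le> lW u" by blast
 have "2 * \<alpha> * u \<le> 2 * \<alpha> * v" using alpha v(1) by simp
 moreover have "min (V u) (lV u) = min (W u) (lW u) - 2 * \<alpha> * u" "min (V v) (lV v) = min (W v) (lW v) - 2 * \<alpha> * v"
  by (auto simp: V_W min_def)
 moreover have "min (W v) (lW v) \<le> min (W u) (lW u)" using v(2)[of u] v(3) by simp
 ultimately have Vle: "min (V v) (lV v) \<le> min (V u) (lV u)" by linarith
 have mm: "min (f v) (left_limit f v) - \<alpha> * v = min (V v) (lV v)" "min (f v) (left_limit f v) + \<alpha> * v = min (W v) (lW v)"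
  by (auto simp: V_def lV_def W_def lW_def min_def)
 have "v \<in> contact_set \<alpha> f"
 proof (rule contactI; unfold mm)
  fix s assume "v \<le> s" then show "min (W v) (lW v) \<le> W s" using v by auto
 next
  fix s assume sv: "s \<le> v"
  show "min (V v) (lV v) \<le> V s"
  proof (cases "s \<le> u")
   case True
   then show ?thesis using u(2) u(3)[of s] Vle by linarith
  next
   case False
   have "2 * \<alpha> * s \<le> 2 * \<alpha> * v" using alpha sv by simp
   then show ?thesis using v(2)[of s] False \<open>min (V v) (lV v) = _\<close> by (simp add: V_W(1))
  qed
 qed
 moreover have "v < e"
 proof (rule ccontr)
  assume "\<not> v < e"
  then have "g \<le> W v" "g \<le> left_limit W v"
   using g(2) e by (auto intro!: left_limit_ge[OF W(1), of "e/2"])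
  moreover have "W u < g" using d(2)[of u] u t1 by (simp add: W_def f0)
  ultimately show False using v(2)[of u] by (auto simp: W(2))
 qed
 ultimately show ?thesis using u v by (intro bexI[of _ v]) auto
qed

theorem contact_time_eq: "contact_time \<alpha> f = T"
proof (cases "T = 0")
 case False
 then have "0 < T" using T(1) S_nonneg by simp
 then show ?thesis
  unfolding contact_time_def using T_contact contact_ge_T by (intro cInf_eq_minimum) auto
next
 case True
 show ?thesis
  unfolding contact_time_def
 proof (rule cInf_eq_non_empty)
  show "contact_set \<alpha> f \<inter> {0<..} \<noteq> {}" using contact_near_0[OF True, of 1] by auto
  fix y assume y: "\<And>x. x \<in> contact_set \<alpha> f \<inter> {0<..} \<Longrightarrow> y \<le> x"
  show "y \<le> T"
  proof (rule ccontr)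
   assume "\<not> y \<le> T"
   then show False using contact_near_0[OF True, of y] y True by force
  qed
 qed (use True in auto)
qed

lemma T_nonneg: "0 \<le> T" using T(1) S_nonneg by simp

lemma W_after_T: "T < s \<Longrightarrow> W T < W s" using W_gt[of s] T(1) by simp

lemma lattice_stop_exists:
 obtains k where "lattice_stop \<alpha> f n k"
  "\<And>j. lattice_stop \<alpha> f n j \<Longrightarrow> k \<le> j" "k = (LEAST k. lattice_stop \<alpha> f n k)"
  "S \<le> real k / 2 ^ n" "\<And>j. 0 < j \<Longrightarrow> S \<le> real j / 2 ^ n \<Longrightarrow> W (real k / 2 ^ n) \<le> W (real j / 2 ^ n)"
proof -
 define a where "a j = W (real j / 2 ^ n)" for j
 define K where "K = {j. hit \<alpha> f (real j / 2 ^ n)}"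
 have K: "j \<in> K \<longleftrightarrow> 0 < j \<and> S \<le> real j / 2 ^ n" for j by (simp add: K_def hit_lattice)
 have K_up: "i \<in> K" if "j \<in> K" "j \<le> i" for i j
 proof -
  have "real j / 2 ^ n \<le> real i / 2 ^ n" using that by (simp add: divide_right_mono)
  then show ?thesis using that unfolding K by linarith
 qed
 have "filterlim (\<lambda>j. real j / 2 ^ n) at_top sequentially"
  by real_asymp
 then have lim: "filterlim a at_top sequentially"
  unfolding a_def W_def by (rule filterlim_compose[OF up])
 obtain k0 where k0: "k0 \<in> K"
 proof -
  obtain k where "S * 2 ^ n < real k" using reals_Archimedean2 by blast
  then have "S \<le> real (Suc k) / 2 ^ n" by (simp add: field_simps)
  then show thesis by (intro that[of "Suc k"]) (simp add: K)
 qed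
 from lim have "eventually (\<lambda>j. a k0 \<le> a j) sequentially" by (simp add: filterlim_at_top)
 then obtain N where N: "\<And>j. N \<le> j \<Longrightarrow> a k0 \<le> a j" by (auto simp: eventually_sequentially)
 define F where "F = K \<inter> {..max N k0}"
 have F: "finite F" "k0 \<in> F" using k0 by (auto simp: F_def)
 define k where "k = arg_min_on a F"
 have k: "k \<in> F" "\<And>j. j \<in> F \<Longrightarrow> a k \<le> a j"
  using arg_min_if_finite[of F a] F unfolding k_def by (auto simp: not_less)
 have kK: "k \<in> K" using k by (simp add: F_def)
 have kmin: "a k \<le> a j" if "j \<in> K" for j
 proof (cases "j \<le> max N k0")
  case False
  then have "N \<le> j" by simp
  then show ?thesis using N[of j] k(2)[OF F(2)] by linarith
 qed (use that k in \<open>auto simp: F_def\<close>)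
 have "lattice_stop \<alpha> f n k"
  using kK kmin K_up[OF kK] by (auto simp: lattice_stop_def K_def a_def W_def)
 define l where "l = (LEAST k. lattice_stop \<alpha> f n k)"
 have l: "lattice_stop \<alpha> f n l" unfolding l_def using \<open>lattice_stop \<alpha> f n k\<close> by (rule LeastI)
 have l_le: "l \<le> j" if "lattice_stop \<alpha> f n j" for j unfolding l_def using that by (rule Least_le)
 have lK: "l \<in> K" using l by (simp add: lattice_stop_def K_def)
 have "a l \<le> a k" using l l_le[OF \<open>lattice_stop \<alpha> f n k\<close>] by (simp add: lattice_stop_def a_def W_def)
 then have "W (real l / 2 ^ n) \<le> W (real j / 2 ^ n)" if "0 < j" "S \<le> real j / 2 ^ n" for j
  using kmin[of j] that K[of j] by (simp add: a_def)
 then show thesis using l l_le lK K[of l] by (intro that[of l]) (auto simp: l_def)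
qed

definition "lat n = real (LEAST k. lattice_stop \<alpha> f n k) / 2 ^ n"

lemma lat: "S \<le> lat n" "0 < j \<Longrightarrow> S \<le> real j / 2 ^ n \<Longrightarrow> W (lat n) \<le> W (real j / 2 ^ n)"
 by (rule lattice_stop_exists[of n]; simp add: lat_def)+

text \<open>Right continuity at the minimiser gives lattice points just to its right at which
\<open>W\<close> is almost minimal, and the lattice minimum is no larger.\<close>
lemma lat_upper:
 assumes e: "0 < e"
 shows "eventually (\<lambda>n. W (lat n) < W T + e) sequentially"
proof -
 obtain d where d: "0 < d" "\<And>s. T \<le> s \<Longrightarrow> s < T + d \<Longrightarrow> \<bar>W s - W T\<bar> < e"
  using cadlag_right_eps[OF W(1) e, of T] by metis
 have "(\<lambda>n. 1 / 2 ^ n :: real) \<longlonglongrightarrow> 0" by real_asymp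
 then have "eventually (\<lambda>n. 1 / 2 ^ n < d) sequentially" using order_tendstoD(2)[of _ 0 sequentially d] d by auto
 then show ?thesis
 proof eventually_elim
  case (elim n)
  define j where "j = nat \<lfloor>T * 2 ^ n\<rfloor> + 1"
  have T0: "0 \<le> T * 2 ^ n" using T_nonneg by simp
  have "real j = of_int \<lfloor>T * 2 ^ n\<rfloor> + 1" using T0 by (simp add: j_def of_nat_nat)
  then have "T * 2 ^ n < real j" "real j \<le> T * 2 ^ n + 1" by linarith+
  then have j: "T < real j / 2 ^ n" "real j / 2 ^ n \<le> T + 1 / 2 ^ n" by (simp_all add: field_simps)
  have "W (lat n) \<le> W (real j / 2 ^ n)" by (rule lat(2)) (use j T(1) in \<open>auto simp: j_def\<close>)
  also have "\<dots> < W T + e" using d(2)[of "real j / 2 ^ n"] j elim by simp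
  finally show ?case .
 qed
qed

lemma lat_tendsto: "lat \<longlonglongrightarrow> T"
proof (rule tendstoI)
 fix e :: real assume "0 < e"
 then obtain g where g: "g > 0" "\<And>s. S \<le> s \<Longrightarrow> e \<le> \<bar>s - T\<bar> \<Longrightarrow> W T + g \<le> W s"
  using separated by blast
 from lat_upper[OF g(1)] show "eventually (\<lambda>n. dist (lat n) T < e) sequentially"
 proof eventually_elim
  case (elim n)
  then show ?case using g(2)[OF lat(1), of n] by (force simp: dist_real_def)
 qed
qed

lemma f_lat_tendsto: "(\<lambda>n. f (lat n)) \<longlonglongrightarrow> f T"
proof -
 have "(\<lambda>n. W (lat n)) \<longlonglongrightarrow> W T"
 proof (rule tendstoI)
  fix e :: real assume "0 < e"
  from lat_upper[OF this] show "eventually (\<lambda>n. dist (W (lat n)) (W T) < e) sequentially"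
  proof eventually_elim
   case (elim n)
   then show ?case using T(2)[OF lat(1)[of n]] by (simp add: dist_real_def)
  qed
 qed
 then have "(\<lambda>n. W (lat n) - \<alpha> * lat n) \<longlonglongrightarrow> W T - \<alpha> * T"
  by (intro tendsto_diff tendsto_mult tendsto_const lat_tendsto)
 then show ?thesis by (simp add: W_def)
qed

end

section \<open>Drift to infinity\<close>

lemma dyadic_between:
 fixes x y :: real
 assumes "0 \<le> x" "x < y"
 shows "\<exists>n (k::nat). x < real k / 2 ^ n \<and> real k / 2 ^ n < y"
proof -
 have "(\<lambda>n. 1 / 2 ^ n :: real) \<longlonglongrightarrow> 0" by real_asymp
 then have "eventually (\<lambda>n. 1 / 2 ^ n < y - x) sequentially"
  using order_tendstoD(2)[of _ 0 sequentially "y - x"] assms by auto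
 then obtain n where n: "1 / 2 ^ n < y - x" by (auto simp: eventually_sequentially)
 define j where "j = nat \<lfloor>x * 2 ^ n\<rfloor> + 1"
 have "real j = of_int \<lfloor>x * 2 ^ n\<rfloor> + 1" using assms by (simp add: j_def of_nat_nat)
 then have "x * 2 ^ n < real j" "real j \<le> x * 2 ^ n + 1" by linarith+
 then have "x < real j / 2 ^ n" "real j / 2 ^ n \<le> x + 1 / 2 ^ n" by (simp_all add: field_simps)
 then show ?thesis using n by (intro exI[of _ n] exI[of _ j]) linarith
qed

context levy_process begin

lemma levy_uminus: "levy_process M (\<lambda>t \<xi>. - X t \<xi>)"
proof
 have d: "distr M borel (\<lambda>\<xi>. - f \<xi>) = distr (distr M borel f) borel uminus"
  if "f \<in> borel_measurable M" for f :: "'a \<Rightarrow> real"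
  using that by (subst distr_distr) (auto simp: o_def)
 show "two_sided_levy M (\<lambda>t \<xi>. - X t \<xi>)"
  unfolding two_sided_levy_def
 proof (intro conjI allI ballI impI)
  fix s t :: real assume "s \<le> t"
  have "distr M borel (\<lambda>\<xi>. - X t \<xi> - - X s \<xi>) = distr M borel (\<lambda>\<xi>. - (X t \<xi> - X s \<xi>))"
   by (intro distr_cong) auto
  also have "\<dots> = distr M borel (\<lambda>\<xi>. - X (t - s) \<xi>)"
   using X_stationary[OF \<open>s \<le> t\<close>] by (simp only: d X_measurable borel_measurable_diff)
  finally show "distr M borel (\<lambda>\<xi>. - X t \<xi> - - X s \<xi>) = distr M borel (\<lambda>\<xi>. - X (t - s) \<xi>)" .
 next
  fix n :: nat and t :: "nat \<Rightarrow> real" assume t: "\<forall>i<n. t i \<le> t (Suc i)"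
  have "indep_vars (\<lambda>_. borel) (\<lambda>i \<xi>. - (X (t (Suc i)) \<xi> - X (t i) \<xi>)) {..<n}"
   using X_indep_increments[OF t] by (rule indep_vars_compose2) simp
  moreover have "(\<lambda>i \<xi>. - (X (t (Suc i)) \<xi> - X (t i) \<xi>)) = (\<lambda>i \<xi>. - X (t (Suc i)) \<xi> - - X (t i) \<xi>)"
   by (auto simp: fun_eq_iff)
  ultimately show "indep_vars (\<lambda>_. borel) (\<lambda>i \<xi>. - X (t (Suc i)) \<xi> - - X (t i) \<xi>) {..<n}" by (simp only:)
 qed (auto intro: cadlag_uminus X_cadlag prob_space_axioms)
qed

lemma fut_eval: "\<xi> \<in> space M \<Longrightarrow> 0 \<le> t \<Longrightarrow> fut 0 \<xi> t = X t \<xi>"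
 "0 \<le> t \<Longrightarrow> fut u \<xi> t = X (u + t) \<xi> - X u \<xi>"
 by (simp_all add: fut_def)

lemma integrable_X_nat:
 assumes "integrable M (X 1)"
 shows "integrable M (X (real k))"
proof (induction k)
 case 0
 have "integrable M (X 0) \<longleftrightarrow> integrable M (\<lambda>_. 0 :: real)" by (rule Bochner_Integration.integrable_cong) auto
 then show ?case by simp
next
 case (Suc k)
 have "integrable (distr M borel (X 1)) (\<lambda>x. x)" using assms by (subst integrable_distr_eq) auto
 then have "integrable (distr M borel (\<lambda>\<xi>. X (real (Suc k)) \<xi> - X (real k) \<xi>)) (\<lambda>x. x)"
  using X_stationary[of "real k" "real (Suc k)"] by simp
 then have "integrable M (\<lambda>\<xi>. X (real (Suc k)) \<xi> - X (real k) \<xi>)" by (subst (asm) integrable_distr_eq) auto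
 from Bochner_Integration.integrable_add[OF this Suc.IH] show ?case by simp
qed

lemma integral_fut:
 fixes F :: "(real \<Rightarrow> real) \<Rightarrow> real"
 assumes "F \<in> borel_measurable path_space"
 shows "(\<integral>\<xi>. F (fut u \<xi>) \<partial>M) = (\<integral>\<xi>. F (fut 0 \<xi>) \<partial>M)"
  "integrable M (\<lambda>\<xi>. F (fut u \<xi>)) \<longleftrightarrow> integrable M (\<lambda>\<xi>. F (fut 0 \<xi>))"
proof -
 have "(\<integral>w. F w \<partial>distr M path_space (fut u)) = (\<integral>w. F w \<partial>distr M path_space (fut 0))"
  using fut_law[of u] by simp
 then show "(\<integral>\<xi>. F (fut u \<xi>) \<partial>M) = (\<integral>\<xi>. F (fut 0 \<xi>) \<partial>M)"
  using assms by (simp add: integral_distr)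
 have "integrable (distr M path_space (fut u)) F \<longleftrightarrow> integrable (distr M path_space (fut 0)) F"
  using fut_law[of u] by simp
 then show "integrable M (\<lambda>\<xi>. F (fut u \<xi>)) \<longleftrightarrow> integrable M (\<lambda>\<xi>. F (fut 0 \<xi>))"
  using assms by (simp add: integrable_distr_eq)
qed

text \<open>Garsia: on the event that the minimum over n steps is negative, the first step is at
most the difference between that minimum and the same minimum for the walk started at time 1. The
two minima have the same expectation, so the first step has nonpositive mean on that event. If the
walk almost surely became negative, the mean of the step would be nonpositive.\<close>
lemma stays_nonneg_positive_prob:
 assumes int: "integrable M (X 1)" and mean: "0 < (\<integral>\<xi>. X 1 \<xi> \<partial>M) + c"
 shows "0 < prob {\<xi>\<in>space M. \<forall>k::nat. 0 \<le> X (real k) \<xi> + c * real k}"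
proof -
 define U where "U k \<xi> = X (real k) \<xi> + c * real k" for k :: nat and \<xi>
 define Mn where "Mn n w = Min ((\<lambda>k. w (real k) + c * real k) ` {..n})" for n :: nat and w :: "real \<Rightarrow> real"
 have Mn[measurable]: "Mn n \<in> borel_measurable path_space" for n
  unfolding Mn_def by (intro borel_measurable_Min) auto
 have U_int: "integrable M (U k)" for k
  unfolding U_def using integrable_X_nat[OF int] by simp
 have [measurable]: "U k \<in> borel_measurable M" for k unfolding U_def by simp
 define m where "m n \<xi> = Mn n (fut 0 \<xi>)" for n \<xi>
 define m' where "m' n \<xi> = Mn n (fut 1 \<xi>)" for n \<xi>
 have m: "m n \<xi> = Min ((\<lambda>k. U k \<xi>) ` {..n})" if "\<xi> \<in> space M" for n \<xi>
  using that unfolding m_def Mn_def U_def by (simp add: fut_eval)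
 have m_meas[measurable]: "m n \<in> borel_measurable M" "m' n \<in> borel_measurable M" for n
  unfolding m_def m'_def by measurable
 have m_int: "integrable M (m n)" for n
 proof (rule Bochner_Integration.integrable_bound[of M "\<lambda>\<xi>. \<Sum>k\<le>n. \<bar>U k \<xi>\<bar>"])
  show "AE \<xi> in M. norm (m n \<xi>) \<le> norm (\<Sum>k\<le>n. \<bar>U k \<xi>\<bar>)"
  proof (rule AE_I2)
   fix \<xi> assume "\<xi> \<in> space M"
   have "m n \<xi> \<in> (\<lambda>k. U k \<xi>) ` {..n}" unfolding m[OF \<open>\<xi> \<in> space M\<close>] by (intro Min_in) auto
   then obtain k where "k \<le> n" "m n \<xi> = U k \<xi>" by auto
   moreover have "\<bar>U k \<xi>\<bar> \<le> (\<Sum>k\<le>n. \<bar>U k \<xi>\<bar>)" using \<open>k \<le> n\<close> by (intro member_le_sum) auto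
   ultimately show "norm (m n \<xi>) \<le> norm (\<Sum>k\<le>n. \<bar>U k \<xi>\<bar>)" by simp
  qed
 qed (use U_int in auto)
 have m'_int: "integrable M (m' n)" and m_eq: "(\<integral>\<xi>. m' n \<xi> \<partial>M) = (\<integral>\<xi>. m n \<xi> \<partial>M)" for n
  using integral_fut[OF Mn[of n], of 1] m_int[of n] unfolding m_def m'_def by auto
 have le: "(\<integral>\<xi>. U 1 \<xi> * indicator {\<xi>. m n \<xi> < 0} \<xi> \<partial>M) \<le> 0" for n
 proof -
  have "(\<integral>\<xi>. U 1 \<xi> * indicator {\<xi>. m n \<xi> < 0} \<xi> \<partial>M) \<le> (\<integral>\<xi>. m n \<xi> - m' n \<xi> \<partial>M)"
  proof (rule integral_mono_AE)
   show "integrable M (\<lambda>\<xi>. U 1 \<xi> * indicator {\<xi>. m n \<xi> < 0} \<xi>)"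
    by (rule Bochner_Integration.integrable_bound[OF U_int[of 1]]) (auto simp: indicator_def)
   show "integrable M (\<lambda>\<xi>. m n \<xi> - m' n \<xi>)" using m_int m'_int by simp
   show "AE \<xi> in M. U 1 \<xi> * indicator {\<xi>. m n \<xi> < 0} \<xi> \<le> m n \<xi> - m' n \<xi>"
   proof (rule AE_I2)
    fix \<xi> assume w: "\<xi> \<in> space M"
    have m'_le: "m' n \<xi> \<le> fut 1 \<xi> (real k) + c * real k" if "k \<le> n" for k
     unfolding m'_def Mn_def using that by (intro Min_le) auto
    have "m n \<xi> \<in> (\<lambda>k. U k \<xi>) ` {..n}" unfolding m[OF w] by (intro Min_in) auto
    then obtain k where k: "k \<le> n" "m n \<xi> = U k \<xi>" by auto
    have "m n \<xi> \<le> U 0 \<xi>" unfolding m[OF w] by (intro Min_le) auto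
    then have m0: "m n \<xi> \<le> 0" using w by (simp add: U_def)
    have m'0: "m' n \<xi> \<le> 0" using m'_le[of 0] by (simp add: fut_eval)
    show "U 1 \<xi> * indicator {\<xi>. m n \<xi> < 0} \<xi> \<le> m n \<xi> - m' n \<xi>"
    proof (cases "m n \<xi> < 0")
     case True
     have "k \<noteq> 0"
     proof
      assume "k = 0"
      then show False using True k w by (simp add: U_def)
     qed
     then obtain j where j: "k = Suc j" by (cases k) auto
     have "U k \<xi> = U 1 \<xi> + (fut 1 \<xi> (real j) + c * real j)"
      by (simp add: j U_def fut_eval algebra_simps)
     then show ?thesis using True k m'_le[of j] j by simp
    next
     case False
     then show ?thesis using m0 m'0 by simp
    qed
   qed
  qed
  also have "\<dots> = 0" using m_int m'_int m_eq by simp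
  finally show ?thesis .
 qed
 define B where "B = {\<xi>. \<exists>k. U k \<xi> < 0}"
 have "(\<lambda>n. \<integral>\<xi>. U 1 \<xi> * indicator {\<xi>. m n \<xi> < 0} \<xi> \<partial>M) \<longlonglongrightarrow> (\<integral>\<xi>. U 1 \<xi> * indicator B \<xi> \<partial>M)"
 proof (rule integral_dominated_convergence[where w="\<lambda>\<xi>. \<bar>U 1 \<xi>\<bar>"])
  show "AE \<xi> in M. (\<lambda>n. U 1 \<xi> * indicator {\<xi>. m n \<xi> < 0} \<xi>) \<longlonglongrightarrow> U 1 \<xi> * indicator B \<xi>"
  proof (rule AE_I2)
   fix \<xi> assume w: "\<xi> \<in> space M"
   have neg: "m n \<xi> < 0 \<longleftrightarrow> (\<exists>k\<le>n. U k \<xi> < 0)" for n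
    unfolding m[OF w] by (subst Min_less_iff) auto
   have "eventually (\<lambda>n. indicator {\<xi>. m n \<xi> < 0} \<xi> = (indicator B \<xi> :: real)) sequentially"
   proof (cases "\<xi> \<in> B")
    case True
    then obtain k where "U k \<xi> < 0" by (auto simp: B_def)
    then show ?thesis using True unfolding eventually_sequentially by (auto intro!: exI[of _ k] simp: neg indicator_def)
   qed (auto simp: neg B_def)
   then show "(\<lambda>n. U 1 \<xi> * indicator {\<xi>. m n \<xi> < 0} \<xi>) \<longlonglongrightarrow> U 1 \<xi> * indicator B \<xi>"
    by (intro tendsto_eventually) (auto elim: eventually_mono)
  qed
  show "(\<lambda>\<xi>. U 1 \<xi> * indicator B \<xi>) \<in> borel_measurable M" unfolding B_def by measurable
 qed (use U_int[of 1] in \<open>auto simp: indicator_def\<close>)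
 from LIMSEQ_le_const2[OF this] le have leB: "(\<integral>\<xi>. U 1 \<xi> * indicator B \<xi> \<partial>M) \<le> 0" by blast
 show ?thesis
 proof (rule ccontr)
  assume "\<not> ?thesis"
  then have "prob {\<xi>\<in>space M. \<forall>k. 0 \<le> U k \<xi>} = 0"
   unfolding U_def by (simp add: not_less measure_le_0_iff)
  then have "AE \<xi> in M. \<not> (\<forall>k. 0 \<le> U k \<xi>)"
   by (subst (asm) prob_eq_0) auto
  then have "(\<integral>\<xi>. U 1 \<xi> * indicator B \<xi> \<partial>M) = (\<integral>\<xi>. U 1 \<xi> \<partial>M)"
   by (intro integral_cong_AE) (auto simp: B_def not_le)
  also have "\<dots> = (\<integral>\<xi>. X 1 \<xi> \<partial>M) + c"
   unfolding U_def using int by (simp add: prob_space)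
  finally show False using leB mean by simp
 qed
qed

text \<open>A zero-one law: the event does not depend on the first n steps, so it is independent of
each past and hence, by approximation, of itself. By the preceding lemma its probability is
positive.\<close>
lemma bounded_below_nat:
 assumes int: "integrable M (X 1)" and mean: "0 < (\<integral>\<xi>. X 1 \<xi> \<partial>M) + c"
 shows "prob {\<xi>\<in>space M. \<exists>K::nat. \<forall>k::nat. - real K \<le> X (real k) \<xi> + c * real k} = 1"
proof -
 define GG where "GG = {w\<in>space path_space. \<exists>K::nat. \<forall>k::nat. - real K \<le> w (real k) + c * real k}"
 define G where "G = {\<xi>\<in>space M. \<exists>K::nat. \<forall>k::nat. - real K \<le> X (real k) \<xi> + c * real k}"
 have GG: "GG \<in> sets path_space" unfolding GG_def by measurable
 have G0: "{\<xi>\<in>space M. fut 0 \<xi> \<in> GG} = G"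
  unfolding G_def GG_def by (intro Collect_cong conj_cong refl) (simp add: space_PiM fut_eval)
 have inv: "{\<xi>\<in>space M. fut (real n) \<xi> \<in> GG} = G" for n
 proof -
  have "(\<exists>K::nat. \<forall>k::nat. - real K \<le> fut (real n) \<xi> (real k) + c * real k) \<longleftrightarrow>
    (\<exists>K::nat. \<forall>k::nat. - real K \<le> X (real k) \<xi> + c * real k)" for \<xi>
  proof
   assume "\<exists>K::nat. \<forall>k::nat. - real K \<le> fut (real n) \<xi> (real k) + c * real k"
   then obtain K where K: "\<And>k. - real K \<le> fut (real n) \<xi> (real k) + c * real k" by blast
   define Y where "Y = (\<Sum>k\<le>n. \<bar>X (real k) \<xi> + c * real k\<bar>)"
   obtain L :: nat where L: "real K + Y \<le> real L" using real_arch_simple by blast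
   have Yk: "\<bar>X (real k) \<xi> + c * real k\<bar> \<le> Y" if "k \<le> n" for k
    unfolding Y_def using that by (intro member_le_sum) auto
   have "- real L \<le> X (real k) \<xi> + c * real k" for k
   proof (cases "k \<le> n")
    case True
    then show ?thesis using Yk[OF True] L by linarith
   next
    case False
    have "- real K \<le> X (real n + real (k - n)) \<xi> - X (real n) \<xi> + c * real (k - n)"
     using K[of "k - n"] by (simp add: fut_eval)
    moreover have "real n + real (k - n) = real k" "c * real (k - n) = c * real k - c * real n"
     using False by (simp_all add: of_nat_diff algebra_simps)
    ultimately show ?thesis using Yk[of n] L by simp
   qed
   then show "\<exists>K::nat. \<forall>k::nat. - real K \<le> X (real k) \<xi> + c * real k" by blast
  next
   assume "\<exists>K::nat. \<forall>k::nat. - real K \<le> X (real k) \<xi> + c * real k"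
   then obtain K where K: "\<And>k. - real K \<le> X (real k) \<xi> + c * real k" by blast
   obtain L :: nat where L: "real K + \<bar>X (real n) \<xi> + c * real n\<bar> \<le> real L" using real_arch_simple by blast
   have "- real L \<le> fut (real n) \<xi> (real k) + c * real k" for k
    using K[of "n + k"] L by (simp add: fut_eval algebra_simps)
   then show "\<exists>K::nat. \<forall>k::nat. - real K \<le> fut (real n) \<xi> (real k) + c * real k" by blast
  qed
  then show ?thesis by (auto simp: G_def GG_def space_PiM)
 qed
 let ?P = "\<Union>n. sets (past (real n))"
 have mono: "sets (past (real i)) \<subseteq> sets (past (real j))" if "i \<le> j" for i j :: nat
  using that by (intro sets_past_mono) simp
 have stable: "Int_stable ?P"
 proof (rule Int_stableI)
  fix a b assume "a \<in> ?P" "b \<in> ?P"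
  then obtain i j where "a \<in> sets (past (real i))" "b \<in> sets (past (real j))" by auto
  then have "a \<in> sets (past (real (max i j)))" "b \<in> sets (past (real (max i j)))"
   using mono[of i "max i j"] mono[of j "max i j"] by auto
  then show "a \<inter> b \<in> ?P" by (intro UN_I[of "max i j"]) auto
 qed
 have G_events: "G \<in> events" unfolding G_def by measurable
 have "indep_set ?P {G}"
 proof (rule indep_setI)
  fix a b assume "a \<in> ?P" "b \<in> {G}"
  then obtain n where "a \<in> sets (past (real n))" "b = G" by auto
  then show "prob (a \<inter> b) = prob a * prob b"
   using prob_past_fut[of "real n" a GG] GG by (simp add: inv G0)
 qed (use sets_past_subset G_events in auto)
 then have ind: "indep_set (sigma_sets (space M) ?P) (sigma_sets (space M) {G})"
  by (intro indep_set_sigma_sets stable) (auto simp: Int_stable_def)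
 have "G \<in> sigma_sets (space M) ?P"
 proof -
  let ?S = "sigma (space M) ?P"
  have P_sub: "?P \<subseteq> Pow (space M)" using sets_past_subset sets.sets_into_space by fastforce
  then have S: "sets ?S = sigma_sets (space M) ?P" "space ?S = space M" by simp_all
  have [measurable]: "X (real k) \<in> borel_measurable ?S" for k
  proof (rule measurable_mono[THEN subsetD, of borel borel "past (real k)"])
   show "sets (past (real k)) \<subseteq> sets ?S" unfolding S by (auto intro: sigma_sets.Basic)
  qed (auto simp: S intro!: X_past)
  have "{\<xi>\<in>space ?S. \<exists>K::nat. \<forall>k::nat. - real K \<le> X (real k) \<xi> + c * real k} \<in> sets ?S"
   by measurable
  then show ?thesis unfolding S G_def .
 qed
 from indep_setD[OF ind this sigma_sets.Basic[of G]] have "prob G = prob G * prob G" by simp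
 moreover have "0 < prob G"
 proof -
  have "prob {\<xi>\<in>space M. \<forall>k::nat. 0 \<le> X (real k) \<xi> + c * real k} \<le> prob G"
   by (rule finite_measure_mono[OF _ G_events]) (auto simp: G_def intro: exI[of _ 0])
  then show ?thesis using stays_nonneg_positive_prob[OF assms] by simp
 qed
 ultimately show ?thesis by (simp add: G_def)
qed

text \<open>Between integers the path is controlled by a first passage argument: a very low value at
a real time is followed by a low value at the next integer with probability at least 1/2.\<close>
lemma AE_bounded_below:
 assumes int: "integrable M (X 1)" and mean: "0 < (\<integral>\<xi>. X 1 \<xi> \<partial>M) + c"
 shows "AE \<xi> in M. \<exists>K::nat. \<forall>t\<ge>0. - real K \<le> X t \<xi> + c * t"
proof -
 define U where "U t \<xi> = X t \<xi> + c * t" for t \<xi>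
 have [measurable]: "U t \<in> borel_measurable M" for t unfolding U_def by simp
 have cad: "cadlag_on UNIV (\<lambda>t. U t \<xi>)" if "\<xi> \<in> space M" for \<xi>
  unfolding U_def using cadlag_add_linear(1)[OF X_cadlag[OF that]] .
 obtain a :: nat where a: "1 / 2 \<le> prob {\<xi>\<in>space M. \<forall>q::rat. 0 \<le> q \<and> q < 2 \<longrightarrow> U (of_rat q) \<xi> \<le> real a}"
 proof -
  let ?A = "\<lambda>i::nat. {\<xi>\<in>space M. \<forall>q::rat. 0 \<le> q \<and> q < 2 \<longrightarrow> U (of_rat q) \<xi> \<le> real i}"
  have "(\<Union>i. ?A i) = space M"
  proof (intro equalityI subsetI)
   fix \<xi> assume w: "\<xi> \<in> space M"
   obtain B where B: "\<forall>s\<in>{0..2}. \<bar>U s \<xi>\<bar> \<le> B" using cadlag_bounded[OF cad[OF w]] by blast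
   obtain i :: nat where "B \<le> real i" using real_arch_simple by blast
   moreover have "U (of_rat q) \<xi> \<le> B" if "0 \<le> q \<and> q < 2" for q :: rat
   proof -
    have "(of_rat 0::real) \<le> of_rat q" "(of_rat q::real) \<le> of_rat 2" using that by (simp_all only: of_rat_less_eq) simp
    then show ?thesis using B[rule_format, of "of_rat q"] by simp
   qed
   ultimately show "\<xi> \<in> (\<Union>i. ?A i)" using w by (auto intro!: exI[of _ i] intro: order_trans)
  qed auto
  moreover have "(\<lambda>i. prob (?A i)) \<longlonglongrightarrow> prob (\<Union>i. ?A i)"
   by (rule finite_Lim_measure_incseq) (auto simp: incseq_def intro: order_trans)
  ultimately have "(\<lambda>i. prob (?A i)) \<longlonglongrightarrow> 1" by (simp add: prob_space)
  then have "eventually (\<lambda>i. 1 / 2 < prob (?A i)) sequentially" by (rule order_tendstoD) simp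
  then obtain i where "1 / 2 < prob (?A i)" by (auto simp: eventually_sequentially)
  then show thesis by (intro that[of i]) simp
 qed
 have a_r: "1 / 2 \<le> prob {\<xi>\<in>space M. fut 0 \<xi> \<in> {w\<in>space path_space. w r + c * r \<le> real a}}"
  if r: "0 \<le> r" "r \<le> 1" for r :: real
 proof (rule order_trans[OF a], rule finite_measure_mono)
  show "{\<xi>\<in>space M. \<forall>q::rat. 0 \<le> q \<and> q < 2 \<longrightarrow> U (of_rat q) \<xi> \<le> real a}
    \<subseteq> {\<xi>\<in>space M. fut 0 \<xi> \<in> {w\<in>space path_space. w r + c * r \<le> real a}}"
  proof safe
   fix \<xi> assume w: "\<xi> \<in> space M" and q: "\<forall>q::rat. 0 \<le> q \<and> q < 2 \<longrightarrow> U (of_rat q) \<xi> \<le> real a"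
   have "U r \<xi> \<le> real a"
   proof (rule field_le_epsilon)
    fix e :: real assume "0 < e"
    obtain q' :: rat where q': "r < of_rat q'" "of_rat q' < (2::real)" "\<bar>U (of_rat q') \<xi> - U r \<xi>\<bar> < e"
     using cadlag_rat_right[OF cad[OF w] \<open>0 < e\<close>, of r 2] r by auto
    have "0 < (of_rat q'::real)" "(of_rat q'::real) < of_rat 2" using q' r by (linarith, simp)
    then have "0 \<le> q' \<and> q' < 2" by (simp only: of_rat_less zero_less_of_rat_iff) simp
    then show "U r \<xi> \<le> real a + e" using q q'(3) by force
   qed
   then show "fut 0 \<xi> r + c * r \<le> real a" using w r by (simp add: fut_eval U_def)
  qed (simp add: space_PiM)
 qed measurable
 define E where "E x n = {\<xi>\<in>space M. \<exists>k::nat. U (real k / 2 ^ n) \<xi> < - real x - real a}" for x n :: nat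
 have [measurable]: "E x n \<in> events" for x n unfolding E_def by measurable
 have E_le: "prob (E x n) \<le> 2 * prob {\<xi>\<in>space M. \<exists>k::nat. U (real k) \<xi> < - real x}" for x n
 proof -
  let ?h = "1 / 2 ^ n :: real"
  let ?A = "\<lambda>k. {\<xi>\<in>space M. U (real k * ?h) \<xi> < - real x - real a}"
  let ?r = "\<lambda>k. of_int \<lceil>real k * ?h\<rceil> - real k * ?h"
  let ?C = "\<lambda>k. {w\<in>space path_space. w (?r k) + c * ?r k \<le> real a}"
  have "1 / 2 * prob (\<Union>k. ?A k) \<le> prob (\<Union>k. ?A k \<inter> {\<xi>\<in>space M. fut (real k * ?h) \<xi> \<in> ?C k})"
  proof (rule first_passage_lower)
   fix k
   have [measurable]: "X (real k * ?h) \<in> borel_measurable (past (real k * ?h))" by (rule X_past) simp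
   have "{\<xi>\<in>space (past (real k * ?h)). U (real k * ?h) \<xi> < - real x - real a} \<in> sets (past (real k * ?h))"
    unfolding U_def by measurable
   then show "?A k \<in> sets (past (real k * ?h))" by simp
   show "1 / 2 \<le> prob {\<xi>\<in>space M. fut 0 \<xi> \<in> ?C k}"
    by (rule a_r) linarith+
  qed (simp, measurable)
  also have "\<dots> \<le> prob {\<xi>\<in>space M. \<exists>k::nat. U (real k) \<xi> < - real x}"
  proof (rule finite_measure_mono)
   show "(\<Union>k. ?A k \<inter> {\<xi>\<in>space M. fut (real k * ?h) \<xi> \<in> ?C k}) \<subseteq> {\<xi>\<in>space M. \<exists>k::nat. U (real k) \<xi> < - real x}"
   proof safe
    fix k \<xi> assume 1: "U (real k * ?h) \<xi> < - real x - real a" and 2: "fut (real k * ?h) \<xi> (?r k) + c * ?r k \<le> real a"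
    have "0 \<le> ?r k" by linarith
    then have "U (real k * ?h + ?r k) \<xi> < - real x"
     using 1 2 by (simp add: fut_eval U_def algebra_simps)
    moreover have "real k * ?h + ?r k = real (nat \<lceil>real k * ?h\<rceil>)" by (simp add: of_nat_nat)
    ultimately show "\<exists>k::nat. U (real k) \<xi> < - real x" by metis
   qed
  qed measurable
  also have "(\<Union>k. ?A k) = E x n" by (auto simp: E_def)
  finally show ?thesis by simp
 qed
 define F where "F x = (\<Union>n. E x n)" for x
 have F_le: "prob (F x) \<le> 2 * prob {\<xi>\<in>space M. \<exists>k::nat. U (real k) \<xi> < - real x}" for x
 proof -
  have "E x n \<subseteq> E x (Suc n)" for n
  proof
   fix \<xi> assume "\<xi> \<in> E x n"
   then obtain k where "\<xi> \<in> space M" "U (real k / 2 ^ n) \<xi> < - real x - real a" by (auto simp: E_def)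
   moreover have "real (2 * k) / 2 ^ Suc n = real k / 2 ^ n" by simp
   ultimately show "\<xi> \<in> E x (Suc n)" unfolding E_def by (intro CollectI conjI exI[of _ "2 * k"]) (simp_all only:)
  qed
  then have "(\<lambda>n. prob (E x n)) \<longlonglongrightarrow> prob (F x)"
   unfolding F_def by (intro finite_Lim_measure_incseq) (auto intro: incseq_SucI)
  then show ?thesis by (rule LIMSEQ_le_const2) (use E_le in blast)
 qed
 have "(\<lambda>x. prob {\<xi>\<in>space M. \<exists>k::nat. U (real k) \<xi> < - real x}) \<longlonglongrightarrow> 0"
 proof -
  let ?N = "\<lambda>x::nat. {\<xi>\<in>space M. \<exists>k::nat. U (real k) \<xi> < - real x}"
  have "(\<lambda>x. prob (?N x)) \<longlonglongrightarrow> prob (\<Inter>x. ?N x)"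
  proof (rule finite_Lim_measure_decseq)
   show "range ?N \<subseteq> events" by auto
   show "decseq ?N"
   proof (rule decseq_SucI, safe)
    fix x \<xi> k assume "U (real k) \<xi> < - real (Suc x)"
    then show "\<exists>k::nat. U (real k) \<xi> < - real x" by (intro exI[of _ k]) simp
   qed
  qed
  moreover have "prob (\<Inter>x. ?N x) = 0"
  proof -
   have "(\<Inter>x. ?N x) = space M - {\<xi>\<in>space M. \<exists>K::nat. \<forall>k::nat. - real K \<le> U (real k) \<xi>}"
    by (auto simp flip: not_le)
   moreover have "{\<xi>\<in>space M. \<exists>K::nat. \<forall>k::nat. - real K \<le> U (real k) \<xi>} \<in> events" by measurable
   ultimately show ?thesis using bounded_below_nat[OF assms] by (simp add: prob_compl U_def)
  qed
  ultimately show ?thesis by simp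
 qed
 then have lim: "(\<lambda>x. 2 * prob {\<xi>\<in>space M. \<exists>k::nat. U (real k) \<xi> < - real x}) \<longlonglongrightarrow> 0"
  using tendsto_mult_right_zero by blast
 have "prob (\<Inter>x. F x) \<le> prob (F x)" for x
  unfolding F_def by (intro finite_measure_mono) auto
 then have "prob (\<Inter>x. F x) \<le> 2 * prob {\<xi>\<in>space M. \<exists>k::nat. U (real k) \<xi> < - real x}" for x
  using F_le[of x] order_trans by blast
 then have "prob (\<Inter>x. F x) \<le> 0" by (intro LIMSEQ_le_const[OF lim]) blast
 then have "prob (\<Inter>x. F x) = 0" by (simp add: measure_le_0_iff)
 then have "AE \<xi> in M. \<xi> \<notin> (\<Inter>x. F x)"
  by (subst (asm) prob_eq_0) (auto simp: F_def)
 then show ?thesis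
 proof (rule AE_mp, intro AE_I2 impI)
  fix \<xi> assume w: "\<xi> \<in> space M" and "\<xi> \<notin> (\<Inter>x. F x)"
  then obtain x where x: "\<And>n k. - real x - real a \<le> U (real k / 2 ^ n) \<xi>"
   by (auto simp: F_def E_def not_less)
  have "- real (x + a) \<le> U t \<xi>" if t0: "0 \<le> t" for t
  proof (rule field_le_epsilon)
   fix e :: real assume "0 < e"
   obtain d where d: "0 < d" "\<And>s. t \<le> s \<Longrightarrow> s < t + d \<Longrightarrow> \<bar>U s \<xi> - U t \<xi>\<bar> < e"
    using cadlag_right_eps[OF cad[OF w] \<open>0 < e\<close>, of t] by metis
   obtain n k where "t < real k / 2 ^ n" "real k / 2 ^ n < t + d" using dyadic_between[OF t0, of "t + d"] d by auto
   then show "- real (x + a) \<le> U t \<xi> + e" using d(2)[of "real k / 2 ^ n"] x[of k n] by (simp add: abs_less_iff)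
  qed
  then show "\<exists>K::nat. \<forall>t\<ge>0. - real K \<le> X t \<xi> + c * t" unfolding U_def by blast
 qed
qed

text \<open>Lower the drift by a little: the lowered path is still bounded below.\<close>
lemma AE_tends_to_infinity:
 assumes int: "integrable M (X 1)" and mean: "0 < (\<integral>\<xi>. X 1 \<xi> \<partial>M) + c"
 shows "AE \<xi> in M. filterlim (\<lambda>t. X t \<xi> + c * t) at_top at_top"
proof -
 define e where "e = ((\<integral>\<xi>. X 1 \<xi> \<partial>M) + c) / 2"
 have e: "0 < e" "0 < (\<integral>\<xi>. X 1 \<xi> \<partial>M) + (c - e)" using mean by (simp_all add: e_def field_simps)
 from AE_bounded_below[OF int e(2)] show ?thesis
 proof (rule AE_mp, intro AE_I2 impI)
  fix \<xi> assume "\<exists>K::nat. \<forall>t\<ge>0. - real K \<le> X t \<xi> + (c - e) * t"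
  then obtain K :: nat where K: "\<And>t. 0 \<le> t \<Longrightarrow> - real K \<le> X t \<xi> + (c - e) * t" by blast
  have "filterlim (\<lambda>t. - real K + e * t) at_top at_top" using e(1) by real_asymp
  moreover have "eventually (\<lambda>t. - real K + e * t \<le> X t \<xi> + c * t) at_top"
   using eventually_ge_at_top[of 0] by eventually_elim (use K in \<open>force simp: algebra_simps\<close>)
  ultimately show "filterlim (\<lambda>t. X t \<xi> + c * t) at_top at_top" by (rule filterlim_at_top_mono)
 qed
qed

end

section \<open>Consequences of regularity\<close>

text \<open>Translation is continuous in measure.\<close>
lemma translation_overlap_tendsto:
 fixes B :: "real set"
 assumes B: "B \<in> sets borel" "B \<subseteq> {0..K}" and u: "u \<longlonglongrightarrow> 0"
 shows "(\<lambda>n. measure lebesgue (B \<inter> {s. s + u n \<in> B})) \<longlonglongrightarrow> measure lebesgue B"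
proof (rule tendstoI)
 fix e' :: real assume "0 < e'"
 define e where "e = e' / 3"
 have e: "0 < e" using \<open>0 < e'\<close> by (simp add: e_def)
 have Bleb: "B \<in> sets lebesgue" using B by (simp add: sets_completionI_sets)
 have Bm: "B \<in> lmeasurable"
  by (rule fmeasurableI2[of "{0..K}"]) (use B Bleb in auto)
 obtain F where F: "closed F" "F \<subseteq> B" "B - F \<in> lmeasurable" "emeasure lebesgue (B - F) < ennreal e"
  using sets_lebesgue_inner_closed[OF Bleb e] by blast
 have "compact F" using F(1) B(2) F(2)
  by (auto simp: compact_eq_bounded_closed intro: bounded_subset[OF bounded_closed_interval])
 then have Fm: "F \<in> lmeasurable" by (rule lmeasurable_compact)
 obtain T where T: "open T" "F \<subseteq> T" "T - F \<in> lmeasurable" "emeasure lebesgue (T - F) < ennreal e"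
  using sets_lebesgue_outer_open[of F e] e Fm by (auto simp: fmeasurableD)
 have mT: "T \<in> lmeasurable" "measure lebesgue T \<le> measure lebesgue F + e"
 proof -
  have eq: "T = F \<union> (T - F)" using T(2) by auto
  show "T \<in> lmeasurable" by (subst eq) (intro fmeasurable.Un Fm T(3))
  have "measure lebesgue T \<le> measure lebesgue F + measure lebesgue (T - F)"
   by (subst eq) (intro measure_Un_le fmeasurableD Fm T(3))
  moreover have "measure lebesgue (T - F) < e"
   using T(3,4) e by (simp add: emeasure_eq_measure2 ennreal_less_iff)
  ultimately show "measure lebesgue T \<le> measure lebesgue F + e" by simp
 qed
 have mB: "measure lebesgue B \<le> measure lebesgue F + e"
 proof -
  have eq: "B = F \<union> (B - F)" using F(2) by auto
  have "measure lebesgue B \<le> measure lebesgue F + measure lebesgue (B - F)"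
   by (subst eq) (intro measure_Un_le fmeasurableD Fm F(3))
  moreover have "measure lebesgue (B - F) < e"
   using F(3,4) e by (simp add: emeasure_eq_measure2 ennreal_less_iff)
  ultimately show ?thesis by simp
 qed
 obtain d where d: "0 < d" "(\<Union>x\<in>F. ball x d) \<subseteq> T"
  using compact_subset_open_imp_ball_epsilon_subset[OF \<open>compact F\<close> T(1,2)] by metis
 have "eventually (\<lambda>n. dist (u n) 0 < d) sequentially" using tendstoD[OF u d(1)] .
 then show "eventually (\<lambda>n. dist (measure lebesgue (B \<inter> {s. s + u n \<in> B})) (measure lebesgue B) < e') sequentially"
 proof eventually_elim
  case (elim n)
  let ?G = "(+) (- u n) ` F"
  have Gm: "?G \<in> lmeasurable" by (rule measurable_translation[OF Fm])
  have GT: "?G \<subseteq> T"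
  proof
   fix x assume "x \<in> ?G"
   then obtain y where "y \<in> F" "x = - u n + y" by auto
   then have "x \<in> ball y d" using elim by (simp add: dist_real_def)
   then show "x \<in> T" using d(2) \<open>y \<in> F\<close> by blast
  qed
  have "measure lebesgue (F \<union> ?G) = measure lebesgue F + measure lebesgue ?G - measure lebesgue (F \<inter> ?G)"
   by (rule measure_Un3[OF Fm Gm])
  moreover have "measure lebesgue (F \<union> ?G) \<le> measure lebesgue T"
   using GT T(2) Fm Gm mT by (intro measure_mono_fmeasurable) auto
  moreover have "measure lebesgue ?G = measure lebesgue F" by (rule measure_translation)
  ultimately have 1: "measure lebesgue F - e \<le> measure lebesgue (F \<inter> ?G)" using mT(2) by linarith
  have "{s. s + u n \<in> B} = (+) (- u n) ` B" by (auto intro!: image_eqI[of _ _ "_ + u n"])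
  then have Gm': "{s. s + u n \<in> B} \<in> lmeasurable" using measurable_translation[OF Bm, of "- u n"] by (simp only:)
  have 2: "measure lebesgue (F \<inter> ?G) \<le> measure lebesgue (B \<inter> {s. s + u n \<in> B})"
   using F(2) Fm Gm Bm Gm' by (intro measure_mono_fmeasurable) auto
  have 3: "measure lebesgue (B \<inter> {s. s + u n \<in> B}) \<le> measure lebesgue B"
   using Bm Gm' by (intro measure_mono_fmeasurable) auto
  show ?case using 1 2 3 mB e by (simp add: dist_real_def e_def)
 qed
qed

lemma cadlag_on_restrict:
 assumes "cadlag_on UNIV f"
 shows "cadlag_on {0..} (\<lambda>t\<in>{0..}. f t)"
 unfolding cadlag_on_def
proof (intro ballI conjI)
 fix t :: real assume t: "t \<in> {0..}"
 let ?g = "\<lambda>t\<in>{0..}. f t"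
 have eq: "((\<lambda>t\<in>{0..}. f t) \<longlongrightarrow> l) (at t within {0..} \<inter> A) \<longleftrightarrow> (f \<longlongrightarrow> l) (at t within {0..} \<inter> A)" for l A
  by (rule tendsto_cong) (auto simp: eventually_at_filter)
 have R: "(f \<longlongrightarrow> f t) (at t within {0..} \<inter> {t<..})"
  by (rule tendsto_mono[OF at_le cadlag_tendsto_right[OF assms]]) auto
 then show "(?g \<longlongrightarrow> ?g t) (at t within {0..} \<inter> {t<..})" using t eq by simp
 have "(f \<longlongrightarrow> left_limit f t) (at t within {0..} \<inter> {..<t})"
  by (rule tendsto_mono[OF at_le cadlag_tendsto_left[OF assms]]) auto
 then show "\<exists>l. (?g \<longlongrightarrow> l) (at t within {0..} \<inter> {..<t})" using eq by blast
qed

locale regular_levy = levy_process M X for M :: "'a measure" and X :: "real \<Rightarrow> 'a \<Rightarrow> real" +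
 fixes \<alpha> :: real
 assumes alpha: "0 < \<alpha>" and X1: "integrable M (X 1)" and mean: "\<bar>\<integral>\<xi>. X 1 \<xi> \<partial>M\<bar> < \<alpha>"
  and regular: "regular_for_positive (drift_law M X \<alpha> 0)"
begin

abbreviation (input) W :: "real \<Rightarrow> 'a \<Rightarrow> real" where "W t \<xi> \<equiv> X t \<xi> + \<alpha> * t"
abbreviation (input) V :: "real \<Rightarrow> 'a \<Rightarrow> real" where "V t \<xi> \<equiv> X t \<xi> - \<alpha> * t"

lemma W_cadlag: "\<xi> \<in> space M \<Longrightarrow> cadlag_on UNIV (\<lambda>t. W t \<xi>)"
 using cadlag_add_linear(1)[OF X_cadlag] .

lemma drift_path_measurable[measurable]:
 "(\<lambda>\<xi>. \<lambda>t\<in>{0..}. x + X t \<xi> + \<alpha> * t) \<in> measurable M cadlag_space"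
 unfolding cadlag_space_def
proof (rule measurable_restrict_space2)
 show "(\<lambda>\<xi>. \<lambda>t\<in>{0..}. x + X t \<xi> + \<alpha> * t) \<in> space M \<rightarrow> {w. cadlag_on {0..} w}"
 proof safe
  fix \<xi> assume "\<xi> \<in> space M"
  have "cadlag_on UNIV (\<lambda>t. X t \<xi> + \<alpha> * t + x)"
   using W_cadlag[OF \<open>\<xi> \<in> space M\<close>] tendsto_add[OF _ tendsto_const[of x]] unfolding cadlag_on_def by blast
  from cadlag_on_restrict[OF this] show "cadlag_on {0..} (\<lambda>t\<in>{0..}. x + X t \<xi> + \<alpha> * t)"
   by (simp add: algebra_simps)
 qed
qed (intro measurable_restrict, measurable)

lemma AE_regular: "AE \<xi> in M. \<forall>\<eta>>0. \<exists>u::rat. 0 < u \<and> of_rat u < (\<eta>::real) \<and> 0 < W (of_rat u) \<xi>"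
proof -
 have "AE \<xi> in M. Inf {ereal t |t. 0 < t \<and> 0 < (\<lambda>t\<in>{0..}. 0 + X t \<xi> + \<alpha> * t) t} = 0"
  using regular unfolding regular_for_positive_def drift_law_def
  by (rule AE_distrD[rotated]) measurable
 then show ?thesis
 proof (rule AE_mp, intro AE_I2 impI allI)
  fix \<xi> and \<eta> :: real assume w: "\<xi> \<in> space M" and inf: "Inf {ereal t |t. 0 < t \<and> 0 < (\<lambda>t\<in>{0..}. 0 + X t \<xi> + \<alpha> * t) t} = 0"
   and "0 < \<eta>"
  then have "Inf {ereal t |t. 0 < t \<and> 0 < (\<lambda>t\<in>{0..}. 0 + X t \<xi> + \<alpha> * t) t} < ereal \<eta>" by simp
  then obtain t where t: "0 < t" "t < \<eta>" "0 < W t \<xi>"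
   unfolding Inf_less_iff by auto
  obtain u :: rat where u: "t < of_rat u" "of_rat u < \<eta>" "\<bar>W (of_rat u) \<xi> - W t \<xi>\<bar> < W t \<xi>"
   using cadlag_rat_right[OF W_cadlag[OF w] t(3) t(2)] by blast
  then have "0 < (of_rat u::real)" "0 < W (of_rat u) \<xi>" using t by linarith+
  then show "\<exists>u::rat. 0 < u \<and> of_rat u < \<eta> \<and> 0 < W (of_rat u) \<xi>" using u by (intro exI[of _ u]) simp
 qed
qed

text \<open>The increment path stays below e on \<open>(0, \<eta>)\<close>. Regularity says that
this has probability 0 for e = 0; as e decreases to 0 the probability tends to 0.\<close>
definition stays_below :: "real \<Rightarrow> real \<Rightarrow> (real \<Rightarrow> real) set" where
 "stays_below \<eta> e = {w\<in>space path_space. \<forall>u::rat. 0 < u \<longrightarrow> of_rat u < \<eta> \<longrightarrow> w (of_rat u) + \<alpha> * of_rat u \<le> e}"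

lemma stays_below_sets[measurable]: "stays_below \<eta> e \<in> sets path_space"
 unfolding stays_below_def by measurable

lemma prob_stays_below_0: "0 < \<eta> \<Longrightarrow> emeasure M {\<xi>\<in>space M. fut 0 \<xi> \<in> stays_below \<eta> 0} = 0"
proof -
 assume "0 < \<eta>"
 have "AE \<xi> in M. \<not> (fut 0 \<xi> \<in> stays_below \<eta> 0)"
  using AE_regular
 proof (rule AE_mp, intro AE_I2 impI notI)
  fix \<xi> assume w: "\<xi> \<in> space M" and ex: "\<forall>\<eta>>0. \<exists>u::rat. 0 < u \<and> of_rat u < (\<eta>::real) \<and> 0 < W (of_rat u) \<xi>"
   and st: "fut 0 \<xi> \<in> stays_below \<eta> 0"
  obtain u :: rat where u: "0 < u" "of_rat u < \<eta>" "0 < W (of_rat u) \<xi>" using ex \<open>0 < \<eta>\<close> by blast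
  then show False using st w fut_eval(1)[OF w, of "of_rat u"] by (auto simp: stays_below_def dest!: spec[of _ u])
 qed
 then show ?thesis by (subst (asm) AE_iff_measurable[OF _ refl]) auto
qed

text \<open>Regularity of 0 for the time-reversed process, which has the same law.\<close>
lemma AE_dips_left: "AE \<xi> in M. \<forall>r<q. \<exists>s. r < s \<and> s < q \<and> W s \<xi> < W q \<xi>"
proof -
 have "AE \<xi> in M. \<forall>n::nat. \<not> (backward q \<xi> \<in> stays_below (1 / Suc n) 0)"
 proof (subst AE_all_countable, rule allI)
  fix n :: nat
  have "emeasure M {\<xi>\<in>space M. backward q \<xi> \<in> stays_below (1 / Suc n) 0} = 0"
   using emeasure_backward[OF stays_below_sets] prob_stays_below_0 by simp
  then show "AE \<xi> in M. \<not> (backward q \<xi> \<in> stays_below (1 / Suc n) 0)"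
   by (subst AE_iff_measurable[OF _ refl]) auto
 qed
 then show ?thesis
 proof (rule AE_mp, intro AE_I2 impI allI)
  fix \<xi> r assume w: "\<xi> \<in> space M" and n: "\<forall>n::nat. \<not> (backward q \<xi> \<in> stays_below (1 / Suc n) 0)" and "r < q"
  obtain n where "1 / Suc n < q - r" using nat_approx_posE[of "q - r"] \<open>r < q\<close> by auto
  from n obtain u :: rat where u: "0 < u" "of_rat u < 1 / real (Suc n)" "0 < backward q \<xi> (of_rat u) + \<alpha> * of_rat u"
   by (auto simp: stays_below_def space_PiM not_le)
  then show "\<exists>s. r < s \<and> s < q \<and> W s \<xi> < W q \<xi>"
   using \<open>1 / Suc n < q - r\<close>
   by (intro exI[of _ "q - of_rat u"]) (auto simp: backward_def algebra_simps)
 qed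
qed

lemma X_joint[measurable]: "(\<lambda>p. X (fst p) (snd p)) \<in> borel_measurable (borel \<Otimes>\<^sub>M M)"
proof (rule borel_measurable_LIMSEQ_real[where u="\<lambda>n p. X ((of_int \<lfloor>fst p * real (Suc n)\<rfloor> + 1) / real (Suc n)) (snd p)"])
 fix p :: "real \<times> 'a" assume "p \<in> space (borel \<Otimes>\<^sub>M M)"
 then have w: "snd p \<in> space M" by (auto simp: space_pair_measure)
 let ?t = "\<lambda>n. (of_int \<lfloor>fst p * real (Suc n)\<rfloor> + 1) / real (Suc n)"
 have gt: "fst p < ?t n" and le: "?t n \<le> fst p + 1 / real (Suc n)" for n
 proof -
  have "fst p * real (Suc n) < of_int \<lfloor>fst p * real (Suc n)\<rfloor> + 1" "of_int \<lfloor>fst p * real (Suc n)\<rfloor> + 1 \<le> fst p * real (Suc n) + 1" by linarith+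
  then show "fst p < ?t n" by (simp add: field_simps)
  have "?t n \<le> (fst p * real (Suc n) + 1) / real (Suc n)"
   by (rule divide_right_mono) linarith+
  also have "\<dots> = fst p + 1 / real (Suc n)" by (simp add: add_divide_distrib)
  finally show "?t n \<le> fst p + 1 / real (Suc n)" .
 qed
 have lim: "(\<lambda>n. fst p + 1 / real (Suc n)) \<longlonglongrightarrow> fst p" by real_asymp
 have "?t \<longlonglongrightarrow> fst p"
  by (rule tendsto_sandwich[OF _ _ tendsto_const lim]) (intro always_eventually allI less_imp_le gt le)+
 moreover have "?t n \<in> {fst p<..} \<and> ?t n \<noteq> fst p" for n using gt[of n] by (metis greaterThan_iff less_irrefl)
 ultimately have "filterlim ?t (at_right (fst p)) sequentially"
  unfolding filterlim_at using always_eventually[of "\<lambda>n. ?t n \<in> {fst p<..} \<and> ?t n \<noteq> fst p"] by blast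
 from filterlim_compose[OF cadlag_tendsto_right[OF X_cadlag[OF w]] this]
 show "(\<lambda>n. X (?t n) (snd p)) \<longlonglongrightarrow> X (fst p) (snd p)" .
next
 fix n
 show "(\<lambda>p. X ((of_int \<lfloor>fst p * real (Suc n)\<rfloor> + 1) / real (Suc n)) (snd p)) \<in> borel_measurable (borel \<Otimes>\<^sub>M M)"
  by (rule measurable_compose_countable[where f="\<lambda>i p. X ((of_int i + 1) / real (Suc n)) (snd p)"]) measurable
qed

lemma X_joint'[measurable (raw)]:
 assumes [measurable]: "f \<in> borel_measurable N" "g \<in> measurable N M"
 shows "(\<lambda>x. X (f x) (g x)) \<in> borel_measurable N"
 using measurable_compose[OF measurable_Pair[OF assms] X_joint] by simp

text \<open>If returns to 0 were this likely at all small times, the first passage inequality would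
make \<open>W\<close> vanish on a whole interval with probability at least 8/9, which regularity
forbids.\<close>
lemma return_prob_not_near_1:
 assumes "0 < \<tau>"
 shows "\<exists>v. 0 \<le> v \<and> v \<le> \<tau> \<and> prob {\<xi>\<in>space M. W v \<xi> = 0} < 9 / 10"
proof (rule ccontr)
 assume "\<not> ?thesis"
 then have g: "9 / 10 \<le> prob {\<xi>\<in>space M. W v \<xi> = 0}" if "0 \<le> v" "v \<le> \<tau>" for v using that by force
 define Z where "Z n = {\<xi>\<in>space M. \<forall>k\<le>2 ^ n. W (real k * (\<tau> / 2 ^ n)) \<xi> = 0}" for n :: nat
 have Z_meas[measurable]: "Z n \<in> events" for n unfolding Z_def by measurable
 (* The first passage inequality bounds 9/10 times the probability of leaving 0 by 1/10. *)
 have Z: "8 / 9 \<le> prob (Z n)" for n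
 proof -
  let ?h = "\<tau> / 2 ^ n"
  let ?A = "\<lambda>k. {\<xi>\<in>space M. k \<le> 2 ^ n \<and> W (real k * ?h) \<xi> \<noteq> 0}"
  let ?C = "\<lambda>k. {w\<in>space path_space. k \<le> 2 ^ n \<longrightarrow> w (\<tau> - real k * ?h) + \<alpha> * (\<tau> - real k * ?h) = 0}"
  have kh: "real k * ?h \<le> \<tau>" if "k \<le> 2 ^ n" for k
  proof -
   have "real k \<le> 2 ^ n" using that by (metis of_nat_le_iff of_nat_numeral of_nat_power)
   then show ?thesis using assms by (simp add: field_simps)
  qed
  have "9 / 10 * prob (\<Union>k. ?A k) \<le> prob (\<Union>k. ?A k \<inter> {\<xi>\<in>space M. fut (real k * ?h) \<xi> \<in> ?C k})"
  proof (rule first_passage_lower)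
   fix k :: nat
   have [measurable]: "X (real k * ?h) \<in> borel_measurable (past (real k * ?h))" by (rule X_past) simp
   have "{\<xi>\<in>space (past (real k * ?h)). k \<le> 2 ^ n \<and> W (real k * ?h) \<xi> \<noteq> 0} \<in> sets (past (real k * ?h))"
    by measurable
   then show "?A k \<in> sets (past (real k * ?h))" unfolding space_past .
   show "9 / 10 \<le> prob {\<xi>\<in>space M. fut 0 \<xi> \<in> ?C k}"
   proof (cases "k \<le> 2 ^ n")
    case True
    then have "0 \<le> \<tau> - real k * ?h" using kh by simp
    then have "{\<xi>\<in>space M. fut 0 \<xi> \<in> ?C k} = {\<xi>\<in>space M. W (\<tau> - real k * ?h) \<xi> = 0}"
     using True by (auto simp: space_PiM fut_eval)
    then show ?thesis using g[of "\<tau> - real k * ?h"] kh[OF True] assms by simp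
   next
    case False
    then have "{\<xi>\<in>space M. fut 0 \<xi> \<in> ?C k} = space M" by (auto simp: space_PiM)
    then show ?thesis by (simp add: prob_space)
   qed
  qed (use assms in simp, measurable)
  also have "\<dots> \<le> prob {\<xi>\<in>space M. W \<tau> \<xi> \<noteq> 0}"
  proof (rule finite_measure_mono)
   show "(\<Union>k. ?A k \<inter> {\<xi>\<in>space M. fut (real k * ?h) \<xi> \<in> ?C k}) \<subseteq> {\<xi>\<in>space M. W \<tau> \<xi> \<noteq> 0}"
   proof (rule subsetI, rule ccontr)
    fix \<xi> assume "\<xi> \<in> (\<Union>k. ?A k \<inter> {\<xi>\<in>space M. fut (real k * ?h) \<xi> \<in> ?C k})"
     and not: "\<xi> \<notin> {\<xi>\<in>space M. W \<tau> \<xi> \<noteq> 0}"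
    then obtain k where w: "\<xi> \<in> space M" and k: "k \<le> 2 ^ n" and 1: "W (real k * ?h) \<xi> \<noteq> 0"
     and 3: "k \<le> 2 ^ n \<longrightarrow> fut (real k * ?h) \<xi> (\<tau> - real k * ?h) + \<alpha> * (\<tau> - real k * ?h) = 0"
     by blast
    then have 2: "W \<tau> \<xi> = 0" using not by blast
    have "fut (real k * ?h) \<xi> (\<tau> - real k * ?h) = X \<tau> \<xi> - X (real k * ?h) \<xi>"
     using kh[OF k] by (simp add: fut_def)
    then have "W (real k * ?h) \<xi> = W \<tau> \<xi>" using 3 k by (simp add: algebra_simps)
    then show False using 1 2 by simp
   qed
  qed measurable
  also have "\<dots> = 1 - prob {\<xi>\<in>space M. W \<tau> \<xi> = 0}"
  proof -
   have "{\<xi>\<in>space M. W \<tau> \<xi> \<noteq> 0} = space M - {\<xi>\<in>space M. W \<tau> \<xi> = 0}" by auto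
   then show ?thesis by (simp add: prob_compl)
  qed
  also have "\<dots> \<le> 1 / 10" using g[of \<tau>] assms by simp
  finally have "prob (\<Union>k. ?A k) \<le> 1 / 9" by simp
  moreover have "(\<Union>k. ?A k) = space M - Z n" by (auto simp: Z_def)
  ultimately show ?thesis by (simp add: prob_compl)
 qed
 have dec: "Z (Suc n) \<subseteq> Z n" for n
 proof safe
  fix \<xi> assume "\<xi> \<in> Z (Suc n)"
  then have w: "\<xi> \<in> space M" and 0: "\<And>k. k \<le> 2 ^ Suc n \<Longrightarrow> W (real k * (\<tau> / 2 ^ Suc n)) \<xi> = 0" by (auto simp: Z_def)
  have "W (real k * (\<tau> / 2 ^ n)) \<xi> = 0" if "k \<le> 2 ^ n" for k
   using 0[of "2 * k"] that by simp
  then show "\<xi> \<in> Z n" using w by (simp add: Z_def)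
 qed
 have "(\<lambda>n. prob (Z n)) \<longlonglongrightarrow> prob (\<Inter>n. Z n)"
  by (rule finite_Lim_measure_decseq[OF _ decseq_SucI[of Z, OF dec]]) auto
 from LIMSEQ_le_const[OF this] Z have "8 / 9 \<le> prob (\<Inter>n. Z n)" by blast
 moreover have "AE \<xi> in M. \<xi> \<notin> (\<Inter>n. Z n)"
  using AE_regular
 proof (rule AE_mp, intro AE_I2 impI notI)
  fix \<xi> assume w: "\<xi> \<in> space M" and ex: "\<forall>\<eta>>0. \<exists>u::rat. 0 < u \<and> of_rat u < (\<eta>::real) \<and> 0 < W (of_rat u) \<xi>"
   and Zw: "\<xi> \<in> (\<Inter>n. Z n)"
  obtain u :: rat where u: "0 < u" "of_rat u < \<tau>" "0 < W (of_rat u) \<xi>" using ex assms by blast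
  define t where "t = (of_rat u :: real)"
  obtain d where d: "0 < d" "\<And>s. t \<le> s \<Longrightarrow> s < t + d \<Longrightarrow> \<bar>W s \<xi> - W t \<xi>\<bar> < W t \<xi>"
   using cadlag_right_eps[OF W_cadlag[OF w], of "W t \<xi>" t] u(3) unfolding t_def by metis
  have t: "0 \<le> t" "t < \<tau>" using u by (auto simp: t_def)
  obtain n k where nk: "t / \<tau> < real k / 2 ^ n" "real k / 2 ^ n < min (\<tau>/\<tau>) ((t + d) / \<tau>)"
   using dyadic_between[of "t / \<tau>" "min (\<tau>/\<tau>) ((t + d) / \<tau>)"] t d assms by (auto simp: divide_strict_right_mono)
  then have "real k < 2 ^ n" using assms by (auto simp: field_simps)
  then have "k \<le> 2 ^ n" by (metis less_imp_le of_nat_less_iff of_nat_numeral of_nat_power)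
  then have "W (real k * (\<tau> / 2 ^ n)) \<xi> = 0" using Zw by (auto simp: Z_def)
  moreover have "t < real k * (\<tau> / 2 ^ n)" "real k * (\<tau> / 2 ^ n) < t + d" using nk assms by (simp_all add: field_simps)
  ultimately show False using d(2)[of "real k * (\<tau> / 2 ^ n)"] by simp
 qed
 then have "prob (\<Inter>n. Z n) = 0" by (subst prob_eq_0) auto
 ultimately show False by simp
qed

text \<open>By independence of increments, the expected overlap of the random set of times at which
\<open>W\<close> is at a with its translate by u is the expected measure of that set times the
probability of \<open>W\<^sub>u = 0\<close>. If the expected measure were positive, continuity of
translations would make this probability tend to 1 as u tends to 0.\<close>
lemma AE_no_atom: "AE s in lborel. 0 \<le> s \<longrightarrow> emeasure M {\<xi>\<in>space M. W s \<xi> = a} = 0"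
proof -
 have meas[measurable]: "(\<lambda>s. emeasure M {\<xi>\<in>space M. W s \<xi> = a}) \<in> borel_measurable borel"
 proof -
  have "(\<lambda>s. \<integral>\<^sup>+\<xi>. indicator {\<xi>\<in>space M. W s \<xi> = a} \<xi> \<partial>M) \<in> borel_measurable borel"
  proof (rule borel_measurable_nn_integral)
   have "(\<lambda>p. if X (fst p) (snd p) + \<alpha> * fst p = a then 1 else 0 :: ennreal) \<in> borel_measurable (borel \<Otimes>\<^sub>M M)"
    by measurable
   moreover have "(\<lambda>p. if X (fst p) (snd p) + \<alpha> * fst p = a then 1 else 0 :: ennreal) p
     = (case p of (s, \<xi>) \<Rightarrow> indicator {\<xi>\<in>space M. W s \<xi> = a} \<xi>)" if "p \<in> space (borel \<Otimes>\<^sub>M M)" for p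
    using that by (auto simp: space_pair_measure split: prod.split)
   ultimately show "(\<lambda>(s, \<xi>). indicator {\<xi>\<in>space M. W s \<xi> = a} \<xi> :: ennreal) \<in> borel_measurable (borel \<Otimes>\<^sub>M M)"
    by (subst measurable_cong[symmetric]) auto
  qed
  then show ?thesis by simp
 qed
 interpret L: pair_sigma_finite lborel M ..
 have zero: "(\<integral>\<^sup>+s. indicator {0..real K} s * emeasure M {\<xi>\<in>space M. W s \<xi> = a} \<partial>lborel) = 0" (is "?c = 0") for K :: nat
 proof (rule ccontr)
  assume c: "?c \<noteq> 0"
  have "?c \<le> (\<integral>\<^sup>+s. indicator {0..real K} s \<partial>lborel)"
   by (intro nn_integral_mono) (auto simp: indicator_def emeasure_eq_measure)
  also have "\<dots> = ennreal (real K)" by simp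
  finally have c_fin: "?c < \<top>" by (rule le_less_trans) simp
  let ?g = "\<lambda>u. emeasure M {\<xi>\<in>space M. W u \<xi> = 0}"
  define B where "B \<xi> = {s\<in>{0..real K + 1}. W s \<xi> = a}" for \<xi>
  have B: "B \<xi> \<in> sets borel" if w: "\<xi> \<in> space M" for \<xi>
  proof -
   have [measurable]: "(\<lambda>s. X s \<xi>) \<in> borel_measurable borel"
    using X_joint'[of "\<lambda>s. s" borel "\<lambda>s. \<xi>"] w by simp
   show ?thesis unfolding B_def by measurable
  qed
  define D :: "real \<Rightarrow> 'a \<Rightarrow> ennreal" where "D u \<xi> =
   (\<integral>\<^sup>+s. (if 0 \<le> s \<and> s \<le> real K \<and> X s \<xi> + \<alpha> * s = a \<and> X (s + u) \<xi> + \<alpha> * (s + u) = a then 1 else 0) \<partial>lborel)" for u \<xi>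
  have D_meas[measurable]: "D u \<in> borel_measurable M" for u
   unfolding D_def by (rule lborel.borel_measurable_nn_integral) (simp add: split_beta', measurable)
  have D_emeasure: "D u \<xi> = emeasure lborel ({0..real K} \<inter> (B \<xi> \<inter> {s. s + u \<in> B \<xi>}))"
   if u: "0 \<le> u" "u \<le> 1" and w: "\<xi> \<in> space M" for u \<xi>
  proof -
   have [measurable]: "B \<xi> \<in> sets borel" by (rule B[OF w])
   have "{0..real K} \<inter> (B \<xi> \<inter> {s. s + u \<in> B \<xi>}) \<in> sets borel" by measurable
   then have "emeasure lborel ({0..real K} \<inter> (B \<xi> \<inter> {s. s + u \<in> B \<xi>}))
     = (\<integral>\<^sup>+s. indicator ({0..real K} \<inter> (B \<xi> \<inter> {s. s + u \<in> B \<xi>})) s \<partial>lborel)"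
    by simp
   also have "\<dots> = D u \<xi>"
    unfolding D_def using u by (intro nn_integral_cong) (auto simp: B_def indicator_def)
   finally show ?thesis by simp
  qed
  have D_eq: "(\<integral>\<^sup>+\<xi>. D u \<xi> \<partial>M) = ?c * ?g u" if u: "0 \<le> u" for u
  proof -
   have "(\<integral>\<^sup>+\<xi>. D u \<xi> \<partial>M) = (\<integral>\<^sup>+\<xi>. \<integral>\<^sup>+s. (if 0 \<le> s \<and> s \<le> real K \<and> X s \<xi> + \<alpha> * s = a \<and> X (s + u) \<xi> + \<alpha> * (s + u) = a then 1 else 0) \<partial>lborel \<partial>M)"
    by (simp only: D_def)
   also have "\<dots> = (\<integral>\<^sup>+s. \<integral>\<^sup>+\<xi>. (if 0 \<le> s \<and> s \<le> real K \<and> X s \<xi> + \<alpha> * s = a \<and> X (s + u) \<xi> + \<alpha> * (s + u) = a then 1 else 0) \<partial>M \<partial>lborel)"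
    by (rule L.Fubini') (simp add: split_beta', measurable)
   also have "\<dots> = (\<integral>\<^sup>+s. indicator {0..real K} s * emeasure M {\<xi>\<in>space M. W s \<xi> = a} * ?g u \<partial>lborel)"
   proof (rule nn_integral_cong)
    fix s :: real
    show "(\<integral>\<^sup>+\<xi>. (if 0 \<le> s \<and> s \<le> real K \<and> X s \<xi> + \<alpha> * s = a \<and> X (s + u) \<xi> + \<alpha> * (s + u) = a then 1 else 0) \<partial>M)
      = indicator {0..real K} s * emeasure M {\<xi>\<in>space M. W s \<xi> = a} * ?g u"
    proof (cases "0 \<le> s \<and> s \<le> real K")
     case True
     let ?C = "{w\<in>space path_space. w u + \<alpha> * u = 0}"
     have [measurable]: "X s \<in> borel_measurable (past s)" by (rule X_past) simp
     have "{\<xi>\<in>space (past s). W s \<xi> = a} \<in> sets (past s)" by measurable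
     then have A: "{\<xi>\<in>space M. W s \<xi> = a} \<in> sets (past s)" unfolding space_past .
     have "(\<integral>\<^sup>+\<xi>. (if 0 \<le> s \<and> s \<le> real K \<and> X s \<xi> + \<alpha> * s = a \<and> X (s + u) \<xi> + \<alpha> * (s + u) = a then 1 else 0) \<partial>M)
       = (\<integral>\<^sup>+\<xi>. indicator ({\<xi>\<in>space M. W s \<xi> = a} \<inter> {\<xi>\<in>space M. fut s \<xi> \<in> ?C}) \<xi> \<partial>M)"
      using True u by (intro nn_integral_cong) (auto simp: indicator_def fut_eval space_PiM algebra_simps)
     also have "\<dots> = emeasure M ({\<xi>\<in>space M. W s \<xi> = a} \<inter> {\<xi>\<in>space M. fut s \<xi> \<in> ?C})" by simp
     also have "\<dots> = emeasure M {\<xi>\<in>space M. W s \<xi> = a} * emeasure M {\<xi>\<in>space M. fut 0 \<xi> \<in> ?C}"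
     proof -
      have "?C \<in> sets path_space" by measurable
      from prob_past_fut[OF _ A this] True show ?thesis
       by (simp add: emeasure_eq_measure ennreal_mult)
     qed
     also have "{\<xi>\<in>space M. fut 0 \<xi> \<in> ?C} = {\<xi>\<in>space M. W u \<xi> = 0}"
      using u by (auto simp: fut_eval space_PiM)
     finally show ?thesis using True by simp
    next
     case False
     then show ?thesis by (auto simp: indicator_def)
    qed
   qed
   also have "\<dots> = ?c * ?g u" by (rule nn_integral_multc) measurable
   finally show ?thesis .
  qed
  have D_lim: "(\<lambda>n. D (u n) \<xi>) \<longlonglongrightarrow> D 0 \<xi>"
   if u: "u \<longlonglongrightarrow> 0" "\<And>n. 0 \<le> u n" "\<And>n. u n \<le> 1" and w: "\<xi> \<in> space M" for u \<xi>
  proof -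
   have Bb[measurable]: "B \<xi> \<in> sets borel" by (rule B[OF w])
   have B_sub: "B \<xi> \<subseteq> {0..real K + 1}" by (auto simp: B_def)
   have fin: "emeasure lborel S = ennreal (measure lebesgue S)" if "S \<in> sets borel" "S \<subseteq> {0..real K + 1}" for S
   proof -
    have "emeasure lborel S \<le> emeasure lborel {0..real K + 1}" using that by (intro emeasure_mono) auto
    then have "emeasure lborel S \<noteq> \<infinity>" by (auto simp: top_unique)
    then show ?thesis using that by (simp add: emeasure_eq_ennreal_measure measure_completion)
   qed
   have fm: "S \<in> lmeasurable" if "S \<in> sets borel" "S \<subseteq> {0..real K + 1}" for S
    by (rule fmeasurableI2[of "{0..real K + 1}"]) (use that in auto)
   define S where "S n = B \<xi> \<inter> {s. s + u n \<in> B \<xi>}" for n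
   define R where "R = {0..real K} \<inter> B \<xi>"
   have Sb: "S n \<in> sets borel" for n unfolding S_def by measurable
   have Rb: "R \<in> sets borel" unfolding R_def by measurable
   have S: "S n \<in> lmeasurable" "{0..real K} \<inter> S n \<in> lmeasurable" for n
    using Sb B_sub by (auto intro!: fm simp: S_def)
   have R: "R \<in> lmeasurable" "B \<xi> \<in> lmeasurable" using Rb Bb B_sub by (auto intro!: fm simp: R_def)
   have lim: "(\<lambda>n. measure lebesgue (S n)) \<longlonglongrightarrow> measure lebesgue (B \<xi>)"
    unfolding S_def by (rule translation_overlap_tendsto[OF Bb B_sub u(1)])
   have "(\<lambda>n. measure lebesgue ({0..real K} \<inter> S n)) \<longlonglongrightarrow> measure lebesgue R"
   proof (rule tendsto_sandwich[OF _ _ _ tendsto_const])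
    have "measure lebesgue ({0..real K} \<inter> S n) \<le> measure lebesgue R" for n
     by (intro measure_mono_fmeasurable fmeasurableD S R) (auto simp: S_def R_def)
    then show "eventually (\<lambda>n. measure lebesgue ({0..real K} \<inter> S n) \<le> measure lebesgue R) sequentially" by simp
    show "(\<lambda>n. measure lebesgue R - (measure lebesgue (B \<xi>) - measure lebesgue (S n))) \<longlonglongrightarrow> measure lebesgue R"
     using tendsto_diff[OF tendsto_const tendsto_diff[OF tendsto_const lim], of "measure lebesgue R" "measure lebesgue (B \<xi>)"] by simp
    have "measure lebesgue R - (measure lebesgue (B \<xi>) - measure lebesgue (S n)) \<le> measure lebesgue ({0..real K} \<inter> S n)" for n
    proof -
     have "R \<subseteq> ({0..real K} \<inter> S n) \<union> (B \<xi> - S n)" by (auto simp: R_def)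
     then have "measure lebesgue R \<le> measure lebesgue (({0..real K} \<inter> S n) \<union> (B \<xi> - S n))"
      by (intro measure_mono_fmeasurable fmeasurable.Un fmeasurable.Diff fmeasurableD S R)
     also have "\<dots> \<le> measure lebesgue ({0..real K} \<inter> S n) + measure lebesgue (B \<xi> - S n)"
      by (intro measure_Un_le fmeasurableD fmeasurable.Diff S R)
     also have "measure lebesgue (B \<xi> - S n) = measure lebesgue (B \<xi>) - measure lebesgue (S n)"
      by (rule measurable_measure_Diff) (auto intro: S R fmeasurableD simp: S_def)
     finally show ?thesis by simp
    qed
    then show "eventually (\<lambda>n. measure lebesgue R - (measure lebesgue (B \<xi>) - measure lebesgue (S n)) \<le> measure lebesgue ({0..real K} \<inter> S n)) sequentially" by simp
   qed
   then have "(\<lambda>n. ennreal (measure lebesgue ({0..real K} \<inter> S n))) \<longlonglongrightarrow> ennreal (measure lebesgue R)" by (rule tendsto_ennrealI)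
   moreover have "D (u n) \<xi> = ennreal (measure lebesgue ({0..real K} \<inter> S n))" for n
    unfolding D_emeasure[OF u(2,3) w] using Sb B_sub by (subst fin) (auto simp: S_def)
   moreover have "D 0 \<xi> = ennreal (measure lebesgue R)"
    using D_emeasure[of 0 \<xi>] w fin[of R] Rb B_sub by (auto simp: R_def)
   ultimately show ?thesis by simp
  qed
  have "\<exists>v. 0 \<le> v \<and> v \<le> 1 / Suc n \<and> prob {\<xi>\<in>space M. W v \<xi> = 0} < 9 / 10" for n
   by (rule return_prob_not_near_1) simp
  then have "\<exists>u. \<forall>n. 0 \<le> u n \<and> u n \<le> 1 / real (Suc n) \<and> prob {\<xi>\<in>space M. W (u n) \<xi> = 0} < 9 / 10"
   by (intro choice allI)
  then obtain u where u_all: "\<forall>n. 0 \<le> u n \<and> u n \<le> 1 / real (Suc n) \<and> prob {\<xi>\<in>space M. W (u n) \<xi> = 0} < 9 / 10"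
   by (elim exE)
  have u: "0 \<le> u n" "u n \<le> 1 / real (Suc n)" "prob {\<xi>\<in>space M. W (u n) \<xi> = 0} < 9 / 10" for n
   using u_all by blast+
  have u0: "u \<longlonglongrightarrow> 0"
  proof (rule tendsto_sandwich[OF _ _ tendsto_const])
   show "(\<lambda>n. 1 / real (Suc n)) \<longlonglongrightarrow> 0" by real_asymp
  qed (use u in auto)
  have u1: "u n \<le> 1" for n using u(2)[of n] by (rule order_trans) simp
  have "(\<lambda>n. \<integral>\<^sup>+\<xi>. D (u n) \<xi> \<partial>M) \<longlonglongrightarrow> (\<integral>\<^sup>+\<xi>. D 0 \<xi> \<partial>M)"
  proof (rule nn_integral_dominated_convergence[where w="\<lambda>_. ennreal (real K)"])
   show "AE \<xi> in M. D (u n) \<xi> \<le> ennreal (real K)" for n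
   proof (rule AE_I2)
    fix \<xi>
    have "D (u n) \<xi> \<le> (\<integral>\<^sup>+s. indicator {0..real K} s \<partial>lborel)"
     unfolding D_def by (intro nn_integral_mono) (auto simp: indicator_def)
    then show "D (u n) \<xi> \<le> ennreal (real K)" by simp
   qed
   show "AE \<xi> in M. (\<lambda>n. D (u n) \<xi>) \<longlonglongrightarrow> D 0 \<xi>"
    by (rule AE_I2) (rule D_lim[OF u0 u(1) u1])
  qed (simp_all add: emeasure_eq_measure ennreal_mult_less_top)
  moreover have "(\<integral>\<^sup>+\<xi>. D (u n) \<xi> \<partial>M) \<le> ?c * ennreal (9 / 10)" for n
   unfolding D_eq[OF u(1)] using u(3)[of n]
   by (intro mult_left_mono) (auto simp: emeasure_eq_measure intro!: ennreal_leI)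
  ultimately have "(\<integral>\<^sup>+\<xi>. D 0 \<xi> \<partial>M) \<le> ?c * ennreal (9 / 10)"
   by (intro LIMSEQ_le_const2) auto
  moreover have "?g 0 = 1"
  proof -
   have "{\<xi>\<in>space M. W 0 \<xi> = 0} = space M" by auto
   then show ?thesis by (simp only: emeasure_space_1)
  qed
  then have "(\<integral>\<^sup>+\<xi>. D 0 \<xi> \<partial>M) = ?c" using D_eq[of 0] by (simp only: order_refl mult_1_right)
  ultimately have le: "?c \<le> ?c * ennreal (9 / 10)" by (simp only:)
  obtain r where r: "?c = ennreal r" "0 \<le> r" using c_fin by (cases "?c") auto
  have "r \<le> r * (9 / 10)" using le r unfolding r(1) by (simp add: ennreal_mult[symmetric] del: ennreal_mult)
  then have "r = 0" using r(2) by simp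
  then show False using c r(1) by simp
 qed
 have "AE s in lborel. \<forall>K::nat. indicator {0..real K} s * emeasure M {\<xi>\<in>space M. W s \<xi> = a} = 0"
  by (subst AE_all_countable, rule allI, subst nn_integral_0_iff_AE[symmetric]) (measurable, rule zero)
 then show ?thesis
 proof (rule AE_mp, intro AE_I2 impI)
  fix s :: real assume *: "\<forall>K::nat. indicator {0..real K} s * emeasure M {\<xi>\<in>space M. W s \<xi> = a} = 0" and "0 \<le> s"
  obtain K :: nat where "s \<le> real K" using real_arch_simple by blast
  then show "emeasure M {\<xi>\<in>space M. W s \<xi> = a} = 0" using *[rule_format, of K] \<open>0 \<le> s\<close> by (simp add: indicator_def)
 qed
qed

end

section \<open>Infima of the future\<close>

lemma AE_lborel_ex_between:
 fixes a b :: real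
 assumes "AE q in lborel. P q" "a < b"
 shows "\<exists>q. a < q \<and> q < b \<and> P q"
proof (rule ccontr)
 assume n: "\<not> ?thesis"
 have "AE q in lborel. q \<notin> {a<..<b}"
  using assms(1) by eventually_elim (use n in auto)
 then have "emeasure lborel {a<..<b} = 0"
 proof (rule AE_iff_measurable[THEN iffD1, rotated 2])
  show "{x \<in> space lborel. \<not> x \<notin> {a<..<b}} = {a<..<b}" by auto
 qed simp
 then show False using \<open>a < b\<close> by simp
qed

lemma (in prob_space) prob_liminf_le:
 assumes [measurable]: "\<And>n. U n \<in> events" and le: "\<And>n. n0 \<le> n \<Longrightarrow> prob (U n) \<le> b"
 shows "prob (\<Union>N::nat. \<Inter>n\<in>{N..}. U n) \<le> b"
proof -
 have lim: "(\<lambda>N. prob (\<Inter>n\<in>{N..}. U n)) \<longlonglongrightarrow> prob (\<Union>N. \<Inter>n\<in>{N..}. U n)"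
 proof (rule finite_Lim_measure_incseq)
  show "incseq (\<lambda>N. \<Inter>n\<in>{N..}. U n)" by (rule incseq_SucI) auto
 qed auto
 have "prob (\<Inter>n\<in>{N..}. U n) \<le> b" if "n0 \<le> N" for N
 proof -
  have "prob (\<Inter>n\<in>{N..}. U n) \<le> prob (U N)" by (intro finite_measure_mono) auto
  then show ?thesis using le[OF that] by simp
 qed
 then show ?thesis by (intro LIMSEQ_le_const2[OF lim]) blast
qed

context regular_levy begin

text \<open>The infimum over all times, but as a function on path space that depends on countably
many coordinates.\<close>
definition future_inf :: "(real \<Rightarrow> real) \<Rightarrow> ereal" where
 "future_inf w = (INF q\<in>{q::rat. 0 \<le> q}. ereal (w (of_rat q) + \<alpha> * of_rat q))"

lemma future_inf_measurable[measurable]: "future_inf \<in> borel_measurable path_space"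
 unfolding future_inf_def[abs_def] by measurable

lemma W_rat_right:
 assumes w: "\<xi> \<in> space M" and "0 < e" "0 \<le> t"
 obtains q :: rat where "0 \<le> q" "t < of_rat q" "\<bar>W (u + of_rat q) \<xi> - W (u + t) \<xi>\<bar> < e"
proof -
 obtain d where d: "0 < d" "\<And>s. u + t \<le> s \<Longrightarrow> s < (u + t) + d \<Longrightarrow> \<bar>W s \<xi> - W (u + t) \<xi>\<bar> < e"
  using cadlag_right_eps[OF W_cadlag[OF w] \<open>0 < e\<close>, of "u + t"] by metis
 obtain q :: rat where q: "t < of_rat q" "of_rat q < t + d" using of_rat_dense[of t "t + d"] d by auto
 have "0 < (of_rat q::real)" using q assms by linarith
 then show thesis using d(2)[of "u + of_rat q"] q by (intro that[of q]) auto
qed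

lemma future_inf_eqI:
 assumes w: "\<xi> \<in> space M"
  and lower: "\<And>t. 0 \<le> t \<Longrightarrow> y \<le> W (u + t) \<xi> - W u \<xi>"
  and near: "\<And>e. 0 < e \<Longrightarrow> \<exists>t\<ge>0. W (u + t) \<xi> - W u \<xi> < y + e"
 shows "future_inf (fut u \<xi>) = ereal y"
 unfolding future_inf_def
proof (rule INF_eqI)
 fix q :: rat assume "q \<in> {q. 0 \<le> q}"
 then have "0 \<le> (of_rat q :: real)" by simp
 then show "ereal y \<le> ereal (fut u \<xi> (of_rat q) + \<alpha> * of_rat q)"
  using lower[of "of_rat q"] by (simp add: fut_eval algebra_simps)
next
 fix z assume z: "\<And>q. q \<in> {q::rat. 0 \<le> q} \<Longrightarrow> z \<le> ereal (fut u \<xi> (of_rat q) + \<alpha> * of_rat q)"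
 show "z \<le> ereal y"
 proof (rule ereal_le_epsilon2)
  fix e :: real assume "0 < e"
  then obtain t where t: "0 \<le> t" "W (u + t) \<xi> - W u \<xi> < y + e / 2" using near[of "e/2"] by auto
  obtain q :: rat where q: "0 \<le> q" "t < of_rat q" "\<bar>W (u + of_rat q) \<xi> - W (u + t) \<xi>\<bar> < e / 2"
   using W_rat_right[OF w, of "e/2" t u] \<open>0 < e\<close> t(1) by auto
  have "z \<le> ereal (fut u \<xi> (of_rat q) + \<alpha> * of_rat q)" using z q by simp
  also have "fut u \<xi> (of_rat q) + \<alpha> * of_rat q \<le> y + e"
  proof -
   have "fut u \<xi> (of_rat q) + \<alpha> * of_rat q = W (u + of_rat q) \<xi> - W u \<xi>"
    using q by (simp add: fut_eval algebra_simps)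
   then show ?thesis using q(3) t(2) by linarith
  qed
  finally show "z \<le> ereal y + ereal e" by simp
 qed
qed

lemma future_inf_lower:
 assumes w: "\<xi> \<in> space M" and eq: "future_inf (fut u \<xi>) = ereal y" and "0 \<le> t"
 shows "y \<le> W (u + t) \<xi> - W u \<xi>"
proof (rule field_le_epsilon)
 fix e :: real assume "0 < e"
 obtain q :: rat where q: "0 \<le> q" "t < of_rat q" "\<bar>W (u + of_rat q) \<xi> - W (u + t) \<xi>\<bar> < e"
  using W_rat_right[OF w \<open>0 < e\<close> \<open>0 \<le> t\<close>] by blast
 have "future_inf (fut u \<xi>) \<le> ereal (fut u \<xi> (of_rat q) + \<alpha> * of_rat q)"
  unfolding future_inf_def using q by (intro INF_lower) auto
 then have "y \<le> fut u \<xi> (of_rat q) + \<alpha> * of_rat q" using eq by simp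
 moreover have "fut u \<xi> (of_rat q) + \<alpha> * of_rat q = W (u + of_rat q) \<xi> - W u \<xi>"
  using q by (simp add: fut_eval algebra_simps)
 ultimately show "y \<le> W (u + t) \<xi> - W u \<xi> + e" using q(3) by linarith
qed

lemma future_inf_near:
 assumes eq: "future_inf (fut u \<xi>) = ereal y" and "0 < e"
 shows "\<exists>t\<ge>0. W (u + t) \<xi> - W u \<xi> < y + e"
proof -
 have "future_inf (fut u \<xi>) < ereal (y + e)" using eq \<open>0 < e\<close> by simp
 then obtain q :: rat where q: "0 \<le> q" "ereal (fut u \<xi> (of_rat q) + \<alpha> * of_rat q) < ereal (y + e)"
  unfolding future_inf_def INF_less_iff by blast
 have "fut u \<xi> (of_rat q) + \<alpha> * of_rat q = W (u + of_rat q) \<xi> - W u \<xi>"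
  using q by (simp add: fut_eval algebra_simps)
 then show ?thesis using q by (intro exI[of _ "of_rat q"]) simp
qed

text \<open>As \<open>-x\<close> is negative, the infimum over \<open>[0, \<infinity>)\<close> is
\<open>W\<^sub>q\<close> plus the infimum of the increments after q, for every small q. These two
are independent and \<open>W\<^sub>q\<close> has no atom for almost every q.\<close>
lemma AE_future_inf_no_atom:
 assumes "0 < x"
 shows "AE \<xi> in M. future_inf (fut 0 \<xi>) \<noteq> ereal (- x)"
proof -
 interpret L: pair_sigma_finite lborel M ..
 interpret P: pair_sigma_finite M M ..
 define G :: "real \<Rightarrow> 'a \<Rightarrow> 'a \<Rightarrow> ennreal" where
  "G q \<xi> \<xi>' = (if 0 \<le> q \<and> ereal (X q \<xi> + \<alpha> * q) + future_inf (fut 0 \<xi>') = ereal (- x) then 1 else 0)" for q \<xi> \<xi>'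
 have G_meas: "(\<lambda>p. G (fst p) (fst (snd p)) (snd (snd p))) \<in> borel_measurable (lborel \<Otimes>\<^sub>M (M \<Otimes>\<^sub>M M))"
  unfolding G_def by measurable
 have "(\<integral>\<^sup>+q. \<integral>\<^sup>+\<xi>'. \<integral>\<^sup>+\<xi>. G q \<xi> \<xi>' \<partial>M \<partial>M \<partial>lborel) = (\<integral>\<^sup>+\<xi>'. \<integral>\<^sup>+q. \<integral>\<^sup>+\<xi>. G q \<xi> \<xi>' \<partial>M \<partial>lborel \<partial>M)"
  by (rule L.Fubini'[symmetric]) (unfold G_def split_beta', measurable)
 also have "\<dots> = (\<integral>\<^sup>+\<xi>'. 0 \<partial>M)"
 proof (rule nn_integral_cong)
  fix \<xi>' assume "\<xi>' \<in> space M"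
  have "AE q in lborel. (\<integral>\<^sup>+\<xi>. G q \<xi> \<xi>' \<partial>M) = 0"
  proof (cases "future_inf (fut 0 \<xi>')")
   case (real i)
   show ?thesis using AE_no_atom[of "- x - i"]
   proof eventually_elim
    case (elim q)
    have "(\<integral>\<^sup>+\<xi>. G q \<xi> \<xi>' \<partial>M) = (\<integral>\<^sup>+\<xi>. indicator {\<xi>\<in>space M. 0 \<le> q \<and> W q \<xi> = - x - i} \<xi> \<partial>M)"
     unfolding G_def real by (intro nn_integral_cong) (auto simp: indicator_def)
    also have "\<dots> = emeasure M {\<xi>\<in>space M. 0 \<le> q \<and> W q \<xi> = - x - i}" by simp
    also have "\<dots> = 0" using elim by (cases "0 \<le> q") auto
    finally show ?case .
   qed
  qed (simp_all add: G_def)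
  then show "(\<integral>\<^sup>+q. \<integral>\<^sup>+\<xi>. G q \<xi> \<xi>' \<partial>M \<partial>lborel) = 0"
   by (subst nn_integral_cong_AE[of _ "\<lambda>_. 0"]) auto
 qed
 finally have "(\<integral>\<^sup>+q. \<integral>\<^sup>+\<xi>'. \<integral>\<^sup>+\<xi>. G q \<xi> \<xi>' \<partial>M \<partial>M \<partial>lborel) = 0" by simp
 then have AEq: "AE q in lborel. (\<integral>\<^sup>+\<xi>'. \<integral>\<^sup>+\<xi>. G q \<xi> \<xi>' \<partial>M \<partial>M) = 0"
  by (subst (asm) nn_integral_0_iff_AE) (unfold G_def, measurable)
 have AEn: "AE \<xi> in M. ereal (W q \<xi>) + future_inf (fut q \<xi>) \<noteq> ereal (- x)"
  if q: "0 \<le> q" and zero: "(\<integral>\<^sup>+\<xi>'. \<integral>\<^sup>+\<xi>. G q \<xi> \<xi>' \<partial>M \<partial>M) = 0" for q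
 proof -
  have [measurable]: "X q \<in> borel_measurable (past q)" by (rule X_past) simp
  let ?F = "\<lambda>\<xi> w. if ereal (X q \<xi> + \<alpha> * q) + future_inf w = ereal (- x) then 1 else 0 :: ennreal"
  have "(\<integral>\<^sup>+\<xi>. ?F \<xi> (fut q \<xi>) \<partial>M) = (\<integral>\<^sup>+\<xi>. (\<integral>\<^sup>+\<xi>'. ?F \<xi> (fut 0 \<xi>') \<partial>M) \<partial>M)"
   by (rule nn_integral_fut_past[OF q]) measurable
  also have "\<dots> = (\<integral>\<^sup>+\<xi>'. (\<integral>\<^sup>+\<xi>. ?F \<xi> (fut 0 \<xi>') \<partial>M) \<partial>M)"
   by (rule P.Fubini') (unfold split_beta', measurable)
  also have "\<dots> = 0" using zero q by (simp add: G_def)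
  finally show ?thesis
   by (subst (asm) nn_integral_0_iff_AE) (measurable, auto split: if_splits)
 qed
 have "\<exists>q. 0 < q \<and> q < 1 / real (Suc n) \<and> (\<integral>\<^sup>+\<xi>'. \<integral>\<^sup>+\<xi>. G q \<xi> \<xi>' \<partial>M \<partial>M) = 0" for n
  by (rule AE_lborel_ex_between[OF AEq]) simp
 then have "\<exists>q. \<forall>n. 0 < q n \<and> q n < 1 / real (Suc n) \<and> (\<integral>\<^sup>+\<xi>'. \<integral>\<^sup>+\<xi>. G (q n) \<xi> \<xi>' \<partial>M \<partial>M) = 0"
  by (intro choice allI)
 then obtain q where q: "\<forall>n. 0 < q n \<and> q n < 1 / real (Suc n) \<and> (\<integral>\<^sup>+\<xi>'. \<integral>\<^sup>+\<xi>. G (q n) \<xi> \<xi>' \<partial>M \<partial>M) = 0"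
  by (elim exE)
 have "AE \<xi> in M. \<forall>n. ereal (W (q n) \<xi>) + future_inf (fut (q n) \<xi>) \<noteq> ereal (- x)"
  by (subst AE_all_countable, intro allI AEn) (use q in \<open>auto simp: less_imp_le\<close>)
 then show ?thesis
 proof (rule AE_mp, intro AE_I2 impI notI)
  fix \<xi> assume w: "\<xi> \<in> space M" and n: "\<forall>n. ereal (W (q n) \<xi>) + future_inf (fut (q n) \<xi>) \<noteq> ereal (- x)"
   and eq: "future_inf (fut 0 \<xi>) = ereal (- x)"
  obtain d where d: "0 < d" "\<And>s. 0 \<le> s \<Longrightarrow> s < 0 + d \<Longrightarrow> \<bar>W s \<xi> - W 0 \<xi>\<bar> < x / 2"
   using cadlag_right_eps[OF W_cadlag[OF w], of "x/2" 0] \<open>0 < x\<close> by (metis half_gt_zero)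
  obtain k where k: "1 / real (Suc k) < d" using nat_approx_posE[OF d(1)] by auto
  define u where "u = q k"
  have u: "0 < u" "u < d" using q k unfolding u_def by (auto intro: less_trans)
  have "future_inf (fut u \<xi>) = ereal (- x - W u \<xi>)"
  proof (rule future_inf_eqI[OF w])
   fix t :: real assume "0 \<le> t"
   then show "- x - W u \<xi> \<le> W (u + t) \<xi> - W u \<xi>"
    using future_inf_lower[OF w eq, of "u + t"] u w by simp
  next
   fix e :: real assume "0 < e"
   obtain t where t: "0 \<le> t" "W t \<xi> < - x + min e (x/2)"
    using future_inf_near[OF eq, of "min e (x/2)"] \<open>0 < e\<close> \<open>0 < x\<close> w by auto
   have "d \<le> t"
   proof (rule ccontr)
    assume "\<not> d \<le> t"
    then have "\<bar>W t \<xi>\<bar> < x / 2" using d(2)[of t] t w by simp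
    then show False using t by linarith
   qed
   then show "\<exists>t\<ge>0. W (u + t) \<xi> - W u \<xi> < - x - W u \<xi> + e"
    using t u by (intro exI[of _ "t - u"]) auto
  qed
  then show False using n[rule_format, of k] unfolding u_def by simp
 qed
qed

lemma hit_past[measurable]: "Measurable.pred (past u) (\<lambda>\<xi>. hit \<alpha> (\<lambda>t. X t \<xi>) u)" if u: "0 \<le> u"
proof -
 have *: "Measurable.pred (past u) (\<lambda>\<xi>. of_rat s \<le> u \<and> (\<forall>r::rat. r \<le> 0 \<longrightarrow>
   X (of_rat s) \<xi> - \<alpha> * of_rat s \<le> X (of_rat r) \<xi> - \<alpha> * of_rat r + 1 / Suc m))" for s :: rat and m
 proof (cases "of_rat s \<le> u")
  case True
  have [measurable]: "X (of_rat s) \<in> borel_measurable (past u)" by (rule X_past[OF True])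
  have "Measurable.pred (past u) (\<lambda>\<xi>. r \<le> 0 \<longrightarrow>
   X (of_rat s) \<xi> - \<alpha> * of_rat s \<le> X (of_rat r) \<xi> - \<alpha> * of_rat r + 1 / Suc m)" for r :: rat
  proof (cases "r \<le> 0")
   case True
   then have "(of_rat r::real) \<le> 0" by simp
   then have "(of_rat r::real) \<le> u" using u by linarith
   then have [measurable]: "X (of_rat r) \<in> borel_measurable (past u)" by (rule X_past)
   show ?thesis by measurable
  qed simp
  from pred_intros_countable(1)[OF this] show ?thesis by (simp only: True simp_thms)
 qed simp
 have const: "Measurable.pred (past u) (\<lambda>\<xi>. P \<and> Q \<xi>)" if "Measurable.pred (past u) Q" for P Q
  using that by (cases P) simp_all
 show ?thesis
  unfolding hit_def by (intro pred_intros_countable const *)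
qed

lemma hit_mono: "hit \<alpha> f u \<Longrightarrow> u \<le> v \<Longrightarrow> hit \<alpha> f v"
 unfolding hit_def by (meson less_le_trans order_trans)

text \<open>The infimum before q belongs to the past of q, and the infimum after q is
\<open>W\<^sub>q\<close> plus an independent infimum without atoms on the negative half-line. The
common value would be strictly below \<open>W\<^sub>q\<close> because of the dips of
\<open>W\<close> to the left of q.\<close>
lemma AE_no_tie:
 "AE \<xi> in M. \<forall>q::rat. \<forall>m. \<not> ((\<forall>s::rat. 0 < s \<longrightarrow> s < q \<longrightarrow> hit \<alpha> (\<lambda>t. X t \<xi>) (of_rat s) \<longrightarrow> m \<le> W (of_rat s) \<xi>) \<and>
  (\<forall>e>0. \<exists>s::rat. 0 < s \<and> s < q \<and> hit \<alpha> (\<lambda>t. X t \<xi>) (of_rat s) \<and> W (of_rat s) \<xi> < m + e) \<and>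
  (\<forall>s::rat. q \<le> s \<longrightarrow> m \<le> W (of_rat s) \<xi>) \<and>
  (\<forall>e>0. \<exists>s::rat. q \<le> s \<and> W (of_rat s) \<xi> < m + e))"
proof (subst AE_all_countable, rule allI)
 fix q :: rat
 let ?h = "\<lambda>\<xi> s. hit \<alpha> (\<lambda>t. X t \<xi>) (of_rat s)"
 define A where "A \<xi> = (INF s\<in>{s::rat. 0 < s \<and> s < q}. if ?h \<xi> s then ereal (W (of_rat s) \<xi>) else \<infinity>)" for \<xi>
 define b where "b = (of_rat q :: real)"
 show "AE \<xi> in M. \<forall>m. \<not> ((\<forall>s::rat. 0 < s \<longrightarrow> s < q \<longrightarrow> ?h \<xi> s \<longrightarrow> m \<le> W (of_rat s) \<xi>) \<and>
  (\<forall>e>0. \<exists>s::rat. 0 < s \<and> s < q \<and> ?h \<xi> s \<and> W (of_rat s) \<xi> < m + e) \<and>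
  (\<forall>s::rat. q \<le> s \<longrightarrow> m \<le> W (of_rat s) \<xi>) \<and>
  (\<forall>e>0. \<exists>s::rat. q \<le> s \<and> W (of_rat s) \<xi> < m + e))"
 proof (cases "0 < q")
  case False
  then have "\<not> (\<exists>s::rat. 0 < s \<and> s < q)" by auto
  then show ?thesis by (intro AE_I2) (metis zero_less_one)
 next
  case True
  then have b: "0 < b" by (simp add: b_def)
  have [measurable]: "X b \<in> borel_measurable (past b)" by (rule X_past) simp
  have A_meas[measurable]: "A \<in> borel_measurable (past b)"
   unfolding A_def[abs_def]
  proof (rule borel_measurable_INF)
   fix s :: rat assume s: "s \<in> {s. 0 < s \<and> s < q}"
   then have sb: "0 \<le> (of_rat s :: real)" "(of_rat s :: real) \<le> b" by (simp_all add: b_def of_rat_less_eq)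
   have [measurable]: "X (of_rat s) \<in> borel_measurable (past b)" by (rule X_past[OF sb(2)])
   have [measurable]: "Measurable.pred (past b) (\<lambda>\<xi>. ?h \<xi> s)"
    by (rule measurable_past_mono[OF hit_past sb(2)]) (rule sb)
   show "(\<lambda>\<xi>. if ?h \<xi> s then ereal (W (of_rat s) \<xi>) else \<infinity>) \<in> borel_measurable (past b)" by measurable
  qed simp
  have [measurable]: "A \<in> borel_measurable M" by (rule measurable_past_M[OF A_meas])
  let ?F = "\<lambda>\<xi> w. if \<bar>A \<xi>\<bar> \<noteq> \<infinity> \<and> A \<xi> < ereal (X b \<xi> + \<alpha> * b) \<and> A \<xi> = ereal (X b \<xi> + \<alpha> * b) + future_inf w then 1 else 0 :: ennreal"
  have "(\<integral>\<^sup>+\<xi>. ?F \<xi> (fut b \<xi>) \<partial>M) = (\<integral>\<^sup>+\<xi>. (\<integral>\<^sup>+\<xi>'. ?F \<xi> (fut 0 \<xi>') \<partial>M) \<partial>M)"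
   by (rule nn_integral_fut_past) (use b in simp, measurable)
  also have "\<dots> = (\<integral>\<^sup>+\<xi>. 0 \<partial>M)"
  proof (rule nn_integral_cong)
   fix \<xi>
   have "AE \<xi>' in M. ?F \<xi> (fut 0 \<xi>') = 0"
   proof (cases "A \<xi>")
    case (real a)
    show ?thesis
    proof (cases "a < W b \<xi>")
     case True
     have "AE \<xi>' in M. future_inf (fut 0 \<xi>') \<noteq> ereal (- (W b \<xi> - a))"
      using True by (intro AE_future_inf_no_atom) simp
     then show ?thesis
     proof (rule AE_mp, intro AE_I2 impI)
      fix \<xi>' assume n: "future_inf (fut 0 \<xi>') \<noteq> ereal (- (W b \<xi> - a))"
      show "?F \<xi> (fut 0 \<xi>') = 0" using n real by (cases "future_inf (fut 0 \<xi>')") auto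
     qed
    qed (use real in simp)
   qed simp_all
   then show "(\<integral>\<^sup>+\<xi>'. ?F \<xi> (fut 0 \<xi>') \<partial>M) = 0"
    by (subst nn_integral_cong_AE[of _ "\<lambda>_. 0"]) auto
  qed
  finally have "(\<integral>\<^sup>+\<xi>. ?F \<xi> (fut b \<xi>) \<partial>M) = 0" by simp
  then have "AE \<xi> in M. ?F \<xi> (fut b \<xi>) = 0" by (subst (asm) nn_integral_0_iff_AE) measurable
  with AE_dips_left[of b] show ?thesis
  proof (rule AE_mp[OF _ AE_mp], intro AE_I2 impI allI notI, elim conjE)
   fix \<xi> m
   assume w: "\<xi> \<in> space M" and dips: "\<forall>r<b. \<exists>s. r < s \<and> s < b \<and> W s \<xi> < W b \<xi>" and F: "?F \<xi> (fut b \<xi>) = 0"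
    and 1: "\<forall>s::rat. 0 < s \<longrightarrow> s < q \<longrightarrow> ?h \<xi> s \<longrightarrow> m \<le> W (of_rat s) \<xi>"
    and 2: "\<forall>e>0. \<exists>s::rat. 0 < s \<and> s < q \<and> ?h \<xi> s \<and> W (of_rat s) \<xi> < m + e"
    and 3: "\<forall>s::rat. q \<le> s \<longrightarrow> m \<le> W (of_rat s) \<xi>"
    and 4: "\<forall>e>0. \<exists>s::rat. q \<le> s \<and> W (of_rat s) \<xi> < m + e"
   have Am: "A \<xi> = ereal m"
    unfolding A_def
   proof (rule INF_eqI)
    fix s assume "s \<in> {s. 0 < s \<and> s < q}"
    then show "ereal m \<le> (if ?h \<xi> s then ereal (W (of_rat s) \<xi>) else \<infinity>)" using 1 by auto
   next
    fix z assume z: "\<And>s. s \<in> {s. 0 < s \<and> s < q} \<Longrightarrow> z \<le> (if ?h \<xi> s then ereal (W (of_rat s) \<xi>) else \<infinity>)"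
    show "z \<le> ereal m"
    proof (rule ereal_le_epsilon2)
     fix e :: real assume "0 < e"
     then obtain s where s: "0 < s \<and> s < q \<and> ?h \<xi> s \<and> W (of_rat s) \<xi> < m + e" using 2 by blast
     then have "z \<le> ereal (W (of_rat s) \<xi>)" using z[of s] by simp
     also have "\<dots> \<le> ereal m + ereal e" using s by simp
     finally show "z \<le> ereal m + ereal e" .
    qed
   qed
   have fm: "future_inf (fut b \<xi>) = ereal (m - W b \<xi>)"
   proof (rule future_inf_eqI[OF w])
    fix t :: real assume "0 \<le> t"
    have "m \<le> W (b + t) \<xi>"
    proof (rule field_le_epsilon)
     fix e :: real assume "0 < e"
     obtain p :: rat where p: "b + t < of_rat p" "\<bar>W (of_rat p) \<xi> - W (b + t) \<xi>\<bar> < e"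
      using cadlag_rat_right[OF W_cadlag[OF w] \<open>0 < e\<close>, of "b + t" "b + t + 1"] by auto
     have "(of_rat q::real) \<le> of_rat p" using p \<open>0 \<le> t\<close> unfolding b_def by linarith
     then have "q \<le> p" by (simp add: of_rat_less_eq)
     then show "m \<le> W (b + t) \<xi> + e" using 3 p(2) by force
    qed
    then show "m - W b \<xi> \<le> W (b + t) \<xi> - W b \<xi>" by simp
   next
    fix e :: real assume "0 < e"
    then obtain s :: rat where s: "q \<le> s" "W (of_rat s) \<xi> < m + e" using 4 by blast
    then have "b \<le> of_rat s" unfolding b_def by (simp add: of_rat_less_eq)
    then show "\<exists>t\<ge>0. W (b + t) \<xi> - W b \<xi> < m - W b \<xi> + e"
     using s by (intro exI[of _ "of_rat s - b"]) auto
   qed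
   have "m \<le> W b \<xi>" using 3 unfolding b_def by blast
   moreover have "\<not> m < W b \<xi>"
    using F Am fm by (auto split: if_splits)
   ultimately have mb: "m = W b \<xi>" by simp
   obtain s0 :: rat where s0: "0 < s0" "s0 < q" "?h \<xi> s0" using 2 by (metis zero_less_one)
   have "(of_rat s0 :: real) < b" using s0 by (simp add: b_def of_rat_less)
   then obtain s where s: "of_rat s0 < s" "s < b" "W s \<xi> < m" using dips mb by blast
   obtain p :: rat where p: "s < of_rat p" "of_rat p < b" "\<bar>W (of_rat p) \<xi> - W s \<xi>\<bar> < m - W s \<xi>"
    using cadlag_rat_right[OF W_cadlag[OF w], of "m - W s \<xi>" s b] s by auto
   have "(of_rat s0::real) < of_rat p" "(of_rat p::real) < of_rat q" using p s unfolding b_def by linarith+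
   then have "s0 < p" "p < q" by (simp_all add: of_rat_less)
   moreover have "?h \<xi> p" using hit_mono[OF s0(3)] \<open>(of_rat s0::real) < of_rat p\<close> by simp
   ultimately have "m \<le> W (of_rat p) \<xi>" using 1 s0(1) by (meson less_trans)
   then show False using p(3) by linarith
  qed
 qed
qed

end

section \<open>Jumps, and almost all paths are good\<close>

lemma cadlag_left_ex:
 assumes "cadlag_on UNIV f" "0 < e"
 shows "\<exists>d>0. \<forall>s. t - d < s \<longrightarrow> s < t \<longrightarrow> \<bar>f s - left_limit f t\<bar> < e"
 using cadlag_left_eps[OF assms] by metis

lemma pred_const_conj: "Measurable.pred N Q \<Longrightarrow> Measurable.pred N (\<lambda>\<xi>. P \<and> Q \<xi>)"
 by (cases P) simp_all

context levy_process begin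

lemma prob_increment:
 assumes "s \<le> t" "B \<in> sets borel"
 shows "prob {\<xi>\<in>space M. X t \<xi> - X s \<xi> \<in> B} = prob {\<xi>\<in>space M. X (t - s) \<xi> \<in> B}"
proof -
 have "measure (distr M borel (\<lambda>\<xi>. X t \<xi> - X s \<xi>)) B = measure (distr M borel (X (t - s))) B"
  using X_stationary[OF assms(1)] by (rule arg_cong)
 moreover have "(\<lambda>\<xi>. X t \<xi> - X s \<xi>) -` B \<inter> space M = {\<xi>\<in>space M. X t \<xi> - X s \<xi> \<in> B}"
  "X (t - s) -` B \<inter> space M = {\<xi>\<in>space M. X (t - s) \<xi> \<in> B}" by auto
 ultimately show ?thesis using assms(2) by (simp add: measure_distr)
qed

text \<open>By right continuity at 0, with probability more than 1/2 none of the independent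
increments over the cells of a fixed initial interval exceeds \<open>\<delta>\<close>. There are of
order \<open>2\<^sup>n\<close> such cells.\<close>
lemma jump_rate:
 assumes \<delta>: "0 < \<delta>"
 shows "\<exists>C\<ge>0. \<forall>n. prob {\<xi>\<in>space M. \<delta> < X (1 / 2 ^ n) \<xi>} \<le> C / 2 ^ n"
proof -
 define G where "G i = {\<xi>\<in>space M. \<forall>n j::nat. real j / 2 ^ n \<le> 1 / 2 ^ i \<longrightarrow> \<bar>X (real j / 2 ^ n) \<xi>\<bar> \<le> \<delta> / 2}" for i :: nat
 have G_meas[measurable]: "G i \<in> events" for i unfolding G_def by measurable
 have "(\<Union>i. G i) = space M"
 proof (intro equalityI subsetI)
  fix \<xi> assume w: "\<xi> \<in> space M"
  obtain d where d: "0 < d" "\<And>s. 0 \<le> s \<Longrightarrow> s < 0 + d \<Longrightarrow> \<bar>X s \<xi> - X 0 \<xi>\<bar> < \<delta> / 2"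
   using cadlag_right_eps[OF X_cadlag[OF w], of "\<delta>/2" 0] \<delta> by (metis half_gt_zero)
  have "(\<lambda>n. 1 / 2 ^ n :: real) \<longlonglongrightarrow> 0" by real_asymp
  then have "eventually (\<lambda>n. 1 / 2 ^ n < d) sequentially" using order_tendstoD(2)[of _ 0 sequentially d] d by auto
  then obtain i where i: "1 / 2 ^ i < d" by (auto simp: eventually_sequentially)
  have "\<bar>X (real j / 2 ^ n) \<xi>\<bar> \<le> \<delta> / 2" if "real j / 2 ^ n \<le> 1 / 2 ^ i" for n j
   using d(2)[of "real j / 2 ^ n"] that i w by simp
  then show "\<xi> \<in> (\<Union>i. G i)" using w by (auto simp: G_def)
 qed (auto simp: G_def)
 moreover have "(\<lambda>i. prob (G i)) \<longlonglongrightarrow> prob (\<Union>i. G i)"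
 proof (rule finite_Lim_measure_incseq)
  show "incseq G"
  proof (rule incseq_SucI, rule subsetI)
   fix i \<xi> assume "\<xi> \<in> G i"
   moreover have "x \<le> 1 / 2 ^ i" if "x \<le> 1 / 2 ^ Suc i" for x :: real
    by (rule order_trans[OF that]) (simp add: field_simps)
   ultimately show "\<xi> \<in> G (Suc i)" unfolding G_def by blast
  qed
 qed auto
 ultimately have "(\<lambda>i. prob (G i)) \<longlonglongrightarrow> 1" by (simp add: prob_space)
 then have "eventually (\<lambda>i. 1 / 2 < prob (G i)) sequentially" by (rule order_tendstoD) simp
 then obtain i where i: "1 / 2 < prob (G i)" by (auto simp: eventually_sequentially)
 have "prob {\<xi>\<in>space M. \<delta> < X (1 / 2 ^ n) \<xi>} \<le> 2 ^ i / 2 ^ n" for n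
 proof (cases "i \<le> n")
  case False
  then have "(2::real) ^ n \<le> 2 ^ i" by (intro power_increasing) auto
  then have "1 \<le> (2::real) ^ i / 2 ^ n" by simp
  then show ?thesis using prob_le_1 order_trans by blast
 next
  case True
  let ?h = "1 / 2 ^ n :: real"
  define m :: nat where "m = 2 ^ (n - i)"
  define p where "p = prob {\<xi>\<in>space M. \<delta> < X ?h \<xi>}"
  have pow: "(2::real) ^ n = 2 ^ i * 2 ^ (n - i)" using True by (simp flip: power_add)
  have m: "0 < m" "real m * ?h = 1 / 2 ^ i"
   by (simp_all add: m_def pow)
  let ?I = "\<lambda>j \<xi>. X (real (Suc j) * ?h) \<xi> - X (real j * ?h) \<xi>"
  have ind: "indep_vars (\<lambda>_. borel) ?I {..<m}"
   by (rule X_indep_increments) (simp add: divide_right_mono)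
  have "prob (\<Inter>j\<in>{..<m}. ?I j -` {..\<delta>} \<inter> space M) = (\<Prod>j\<in>{..<m}. prob (?I j -` {..\<delta>} \<inter> space M))"
   by (rule indep_varsD_finite[OF ind]) (use m in auto)
  also have "\<dots> = (\<Prod>j\<in>{..<m}. 1 - p)"
  proof (rule prod.cong[OF refl])
   fix j
   have "?I j -` {..\<delta>} \<inter> space M = {\<xi>\<in>space M. ?I j \<xi> \<in> {..\<delta>}}" by auto
   also have "prob \<dots> = prob {\<xi>\<in>space M. X (real (Suc j) * ?h - real j * ?h) \<xi> \<in> {..\<delta>}}"
    by (rule prob_increment) (simp_all add: divide_right_mono)
   also have "real (Suc j) * ?h - real j * ?h = ?h" by (simp add: field_simps)
   also have "{\<xi>\<in>space M. X ?h \<xi> \<in> {..\<delta>}} = space M - {\<xi>\<in>space M. \<delta> < X ?h \<xi>}" by auto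
   also have "prob \<dots> = 1 - p" unfolding p_def by (rule prob_compl) measurable
   finally show "prob (?I j -` {..\<delta>} \<inter> space M) = 1 - p" .
  qed
  also have "\<dots> = (1 - p) ^ m" by simp
  finally have eq: "prob (\<Inter>j\<in>{..<m}. ?I j -` {..\<delta>} \<inter> space M) = (1 - p) ^ m" .
  have "prob (G i) \<le> prob (\<Inter>j\<in>{..<m}. ?I j -` {..\<delta>} \<inter> space M)"
  proof (rule finite_measure_mono)
   show "G i \<subseteq> (\<Inter>j\<in>{..<m}. ?I j -` {..\<delta>} \<inter> space M)"
   proof
    fix \<xi> assume w: "\<xi> \<in> G i"
    have "?I j \<xi> \<le> \<delta>" if j: "j < m" for j
    proof -
    have "real (Suc j) * ?h \<le> real m * ?h" using j by (intro mult_right_mono) auto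
    then have 1: "real (Suc j) / 2 ^ n \<le> 1 / 2 ^ i" using m(2) by simp
    have "real j / 2 ^ n \<le> real (Suc j) / 2 ^ n" by (simp add: divide_right_mono)
    then have 2: "real j / 2 ^ n \<le> 1 / 2 ^ i" using 1 by linarith
    have "\<bar>X (real (Suc j) / 2 ^ n) \<xi>\<bar> \<le> \<delta> / 2" "\<bar>X (real j / 2 ^ n) \<xi>\<bar> \<le> \<delta> / 2"
     using w 1 2 unfolding G_def by blast+
    then show ?thesis by simp
    qed
    then show "\<xi> \<in> (\<Inter>j\<in>{..<m}. ?I j -` {..\<delta>} \<inter> space M)" using w by (auto simp: G_def)
   qed
   show "(\<Inter>j\<in>{..<m}. ?I j -` {..\<delta>} \<inter> space M) \<in> events"
    using m(1) by (intro sets.finite_INT) auto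
  qed
  with i eq have half: "1 / 2 \<le> (1 - p) ^ m" by linarith
  have p01: "0 \<le> p" "p \<le> 1" by (simp_all add: p_def)
  have "(1 - p) ^ m \<le> exp (- p) ^ m"
   using p01 exp_ge_add_one_self[of "- p"] by (intro power_mono) auto
  also have "\<dots> = exp (- (p * m))" by (simp add: exp_of_nat_mult[symmetric] mult.commute)
  finally have "1 / 2 \<le> exp (- (p * m))" using half by linarith
  then have "exp (p * m) \<le> 2" by (simp add: exp_minus field_simps)
  then have "1 + p * m \<le> 2" using exp_ge_add_one_self[of "p * m"] by linarith
  then have "p * real m \<le> 1" by simp
  moreover have "real m = 2 ^ n / 2 ^ i" by (simp add: m_def pow)
  ultimately show ?thesis unfolding p_def[symmetric] by (simp add: field_simps)
 qed
 then show ?thesis by (intro exI[of _ "2 ^ i"]) auto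
qed

lemma backward_past[measurable]: "backward u \<in> measurable (past u) path_space"
 using process_measurable_path_space[of "\<lambda>t \<xi>. X u \<xi> - X (u - max 0 t) \<xi>" "past u"]
 by (simp add: backward_def[abs_def] X_past)

text \<open>The increments just before q have the law of those just after 0, which tend to
0.\<close>
lemma AE_no_fixed_jump: "AE \<xi> in M. left_limit (\<lambda>t. X t \<xi>) q = X q \<xi>"
proof -
 define C where "C = {w\<in>space path_space. \<forall>m::nat. \<exists>i::nat. \<forall>u::rat. 0 < u \<longrightarrow> of_rat u < 1 / real (Suc i) \<longrightarrow> \<bar>w (of_rat u)\<bar> \<le> 1 / real (Suc m)}"
 have C: "C \<in> sets path_space" unfolding C_def by measurable
 have "{\<xi>\<in>space M. fut 0 \<xi> \<in> C} = space M"
 proof (intro equalityI subsetI CollectI conjI)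
  fix \<xi> assume w: "\<xi> \<in> space M"
  have "\<exists>i::nat. \<forall>u::rat. 0 < u \<longrightarrow> of_rat u < 1 / real (Suc i) \<longrightarrow> \<bar>fut 0 \<xi> (of_rat u)\<bar> \<le> 1 / real (Suc m)" for m :: nat
  proof -
   obtain d where d: "0 < d" "\<And>s. 0 \<le> s \<Longrightarrow> s < 0 + d \<Longrightarrow> \<bar>X s \<xi> - X 0 \<xi>\<bar> < 1 / real (Suc m)"
    using cadlag_right_eps[OF X_cadlag[OF w], of "1 / real (Suc m)" 0] by (metis of_nat_0_less_iff zero_less_Suc zero_less_divide_1_iff)
   obtain i where i: "1 / real (Suc i) < d" using nat_approx_posE[OF d(1)] by auto
   have "\<bar>fut 0 \<xi> (of_rat u)\<bar> \<le> 1 / real (Suc m)" if "0 < u" "of_rat u < 1 / real (Suc i)" for u :: rat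
    using d(2)[of "of_rat u"] that i w by (simp add: fut_eval del: of_nat_Suc)
   then show ?thesis by blast
  qed
  then show "fut 0 \<xi> \<in> C" unfolding C_def by (simp add: space_PiM)
 qed auto
 then have "prob {\<xi>\<in>space M. backward q \<xi> \<in> C} = 1"
  using emeasure_backward[OF C, of q] by (simp add: emeasure_eq_measure prob_space)
 then have "AE \<xi> in M. backward q \<xi> \<in> C"
  using C by (subst (asm) prob_eq_1) (auto intro: measurable_sets)
 then show ?thesis
 proof (rule AE_mp, intro AE_I2 impI)
  fix \<xi> assume w: "\<xi> \<in> space M" and "backward q \<xi> \<in> C"
  then have C: "\<And>m::nat. \<exists>i::nat. \<forall>u::rat. 0 < u \<longrightarrow> of_rat u < 1 / real (Suc i) \<longrightarrow> \<bar>backward q \<xi> (of_rat u)\<bar> \<le> 1 / real (Suc m)"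
   by (auto simp: C_def)
  have le: "\<bar>X q \<xi> - left_limit (\<lambda>t. X t \<xi>) q\<bar> \<le> 0 + e" if e: "0 < e" for e
  proof -
   obtain m where m: "1 / real (Suc m) < e / 2" using nat_approx_posE[of "e/2"] e by auto
   obtain i where i: "\<And>u::rat. 0 < u \<Longrightarrow> of_rat u < 1 / real (Suc i) \<Longrightarrow> \<bar>backward q \<xi> (of_rat u)\<bar> \<le> 1 / real (Suc m)"
    using C[of m] by blast
   obtain d where d: "0 < d" "\<And>s. q - d < s \<Longrightarrow> s < q \<Longrightarrow> \<bar>X s \<xi> - left_limit (\<lambda>t. X t \<xi>) q\<bar> < e / 2"
    using cadlag_left_eps[OF X_cadlag[OF w], of "e/2" q] e by (metis half_gt_zero)
   obtain u :: rat where u: "0 < (of_rat u::real)" "of_rat u < min d (1 / real (Suc i))"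
    using of_rat_dense[of 0 "min d (1 / real (Suc i))"] d(1) by auto
   have "\<bar>X q \<xi> - X (q - of_rat u) \<xi>\<bar> \<le> 1 / real (Suc m)"
    using i[of u] u by (simp add: backward_def del: of_nat_Suc)
   moreover have "\<bar>X (q - of_rat u) \<xi> - left_limit (\<lambda>t. X t \<xi>) q\<bar> < e / 2" using d(2)[of "q - of_rat u"] u by simp
   ultimately show ?thesis using m by linarith
  qed
  have "\<bar>X q \<xi> - left_limit (\<lambda>t. X t \<xi>) q\<bar> \<le> 0" by (rule field_le_epsilon) (rule le)
  then show "left_limit (\<lambda>t. X t \<xi>) q = X q \<xi>" by simp
 qed
qed

end

lemma lattice_before:
 fixes t :: real
 assumes "0 < t"
 obtains k :: nat where "real k / 2 ^ n < t" "t \<le> real (Suc k) / 2 ^ n" "t - 1 / 2 ^ n \<le> real k / 2 ^ n" "real (Suc k) / 2 ^ n < t + 1 / 2 ^ n"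
proof -
 define k where "k = nat (\<lceil>t * 2 ^ n\<rceil> - 1)"
 have "0 < t * 2 ^ n" using assms by simp
 then have "real k = of_int \<lceil>t * 2 ^ n\<rceil> - 1" unfolding k_def by (subst of_nat_nat) linarith+
 then have "real k < t * 2 ^ n" "t * 2 ^ n \<le> real k + 1" by linarith+
 then have "real k / 2 ^ n < t" "t \<le> real (Suc k) / 2 ^ n" by (simp_all add: field_simps)
 moreover have "real (Suc k) / 2 ^ n = real k / 2 ^ n + 1 / 2 ^ n" by (simp add: add_divide_distrib)
 ultimately show thesis by (intro that[of k]) linarith+
qed

lemma power_half_less:
 fixes d :: real assumes "0 < d"
 shows "\<exists>N. \<forall>n\<ge>N. 1 / 2 ^ n < d"
proof -
 have "(\<lambda>n. 1 / 2 ^ n :: real) \<longlonglongrightarrow> 0" by real_asymp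
 then have "eventually (\<lambda>n. 1 / 2 ^ n < d) sequentially" using order_tendstoD(2)[of _ 0 sequentially d] assms by auto
 then show ?thesis by (simp add: eventually_sequentially)
qed

context regular_levy begin

lemma stays_below_tendsto:
 assumes "0 < \<eta>"
 shows "(\<lambda>m. prob {\<xi>\<in>space M. fut 0 \<xi> \<in> stays_below \<eta> (1 / real (Suc m))}) \<longlonglongrightarrow> 0"
proof -
 let ?A = "\<lambda>m. {\<xi>\<in>space M. fut 0 \<xi> \<in> stays_below \<eta> (1 / real (Suc m))}"
 have "(\<lambda>m. prob (?A m)) \<longlonglongrightarrow> prob (\<Inter>m. ?A m)"
 proof (rule finite_Lim_measure_decseq)
  show "decseq ?A"
  proof (rule decseq_SucI, rule subsetI)
   fix m \<xi> assume "\<xi> \<in> ?A (Suc m)"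
   moreover have "x \<le> 1 / real (Suc m)" if "x \<le> 1 / real (Suc (Suc m))" for x
    by (rule order_trans[OF that]) (simp add: frac_le)
   ultimately show "\<xi> \<in> ?A m" unfolding stays_below_def by blast
  qed
 qed auto
 moreover have "(\<Inter>m. ?A m) = {\<xi>\<in>space M. fut 0 \<xi> \<in> stays_below \<eta> 0}"
 proof (intro equalityI subsetI)
  fix \<xi> assume w: "\<xi> \<in> (\<Inter>m. ?A m)"
  have "x \<le> 0" if "\<And>m::nat. x \<le> 1 / real (Suc m)" for x :: real
  proof (rule ccontr)
   assume "\<not> x \<le> 0"
   then obtain m where "1 / real (Suc m) < x" using nat_approx_posE[of x] by auto
   then show False using that[of m] by simp
  qed
  then show "\<xi> \<in> {\<xi>\<in>space M. fut 0 \<xi> \<in> stays_below \<eta> 0}"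
   using w unfolding stays_below_def by blast
 next
  fix \<xi> assume w: "\<xi> \<in> {\<xi>\<in>space M. fut 0 \<xi> \<in> stays_below \<eta> 0}"
  have "x \<le> 1 / real (Suc m)" if "x \<le> 0" for x :: real and m by (rule order_trans[OF that]) simp
  then show "\<xi> \<in> (\<Inter>m. ?A m)" using w unfolding stays_below_def by blast
 qed
 ultimately show ?thesis using prob_stays_below_0[OF assms] by (simp add: emeasure_eq_measure)
qed

lemma AE_jump_dip_aux:
 fixes K :: nat
 assumes \<delta>: "0 < \<delta>" and \<eta>: "0 < \<eta>"
 shows "AE \<xi> in M. \<not> (\<exists>t>0. t \<le> real K \<and> left_limit (\<lambda>t. X t \<xi>) t + \<delta> < X t \<xi> \<and>
  (\<forall>s. t - 2 * \<eta> < s \<longrightarrow> s < t \<longrightarrow> left_limit (\<lambda>t. X t \<xi>) t + \<alpha> * t \<le> W s \<xi>))"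
proof -
 obtain C where C: "0 \<le> C" "\<And>n. prob {\<xi>\<in>space M. \<delta> < X (1 / 2 ^ n) \<xi>} \<le> C / 2 ^ n"
  using jump_rate[OF \<delta>] by blast
 define \<rho> where "\<rho> m = prob {\<xi>\<in>space M. fut 0 \<xi> \<in> stays_below \<eta> (1 / real (Suc m))}" for m
 define E where "E n m k = {\<xi>\<in>space M. backward (real k / 2 ^ n) \<xi> \<in> stays_below \<eta> (1 / real (Suc m))}" for n m k :: nat
 define J where "J n k = {\<xi>\<in>space M. fut (real k / 2 ^ n) \<xi> \<in> {w\<in>space path_space. \<delta> < w (1 / 2 ^ n)}}" for n k :: nat
 define U where "U n m = (\<Union>k<K * 2 ^ n. E n m k \<inter> J n k)" for n m
 have [measurable]: "E n m k \<in> events" "J n k \<in> events" for n m k unfolding E_def J_def by measurable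
 have [measurable]: "U n m \<in> events" for n m unfolding U_def by measurable
 have pE: "prob (E n m k \<inter> J n k) \<le> \<rho> m * (C / 2 ^ n)" for n m k
 proof -
  have "{\<xi>\<in>space (past (real k / 2 ^ n)). backward (real k / 2 ^ n) \<xi> \<in> stays_below \<eta> (1 / real (Suc m))} \<in> sets (past (real k / 2 ^ n))"
   by measurable
  then have E_past: "E n m k \<in> sets (past (real k / 2 ^ n))" unfolding E_def space_past .
  have Jm: "{w\<in>space path_space. \<delta> < w (1 / 2 ^ n)} \<in> sets path_space" by measurable
  have "prob (E n m k \<inter> J n k) = prob (E n m k) * prob {\<xi>\<in>space M. fut 0 \<xi> \<in> {w\<in>space path_space. \<delta> < w (1 / 2 ^ n)}}"
   unfolding J_def by (rule prob_past_fut[OF _ E_past Jm]) simp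
  also have "prob (E n m k) = \<rho> m"
   unfolding E_def \<rho>_def using emeasure_backward[OF stays_below_sets] by (simp add: measure_def)
  also have "{\<xi>\<in>space M. fut 0 \<xi> \<in> {w\<in>space path_space. \<delta> < w (1 / 2 ^ n)}} = {\<xi>\<in>space M. \<delta> < X (1 / 2 ^ n) \<xi>}"
   by (auto simp: space_PiM fut_eval)
  also have "\<rho> m * prob \<dots> \<le> \<rho> m * (C / 2 ^ n)"
   by (intro mult_left_mono C) (simp add: \<rho>_def)
  finally show ?thesis .
 qed
 have pU: "prob (U n m) \<le> real K * C * \<rho> m" for n m
 proof -
  have "prob (U n m) \<le> (\<Sum>k<K * 2 ^ n. prob (E n m k \<inter> J n k))"
   unfolding U_def by (rule finite_measure_subadditive_finite) auto
  also have "\<dots> \<le> (\<Sum>k<K * 2 ^ n. \<rho> m * (C / 2 ^ n))" by (intro sum_mono pE)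
  also have "\<dots> = real K * C * \<rho> m" by (simp add: field_simps)
  finally show ?thesis .
 qed
 define Bad where "Bad m = (\<Union>N. \<Inter>n\<in>{N..}. U n m)" for m
 have Bad_meas[measurable]: "Bad m \<in> events" for m unfolding Bad_def by measurable
 have "prob (\<Inter>m. Bad m) \<le> real K * C * \<rho> m" for m
 proof -
  have "prob (\<Inter>m. Bad m) \<le> prob (Bad m)" by (intro finite_measure_mono) auto
  also have "\<dots> \<le> real K * C * \<rho> m" unfolding Bad_def by (rule prob_liminf_le[of _ 0]) (use pU in auto)
  finally show ?thesis .
 qed
 moreover have "(\<lambda>m. real K * C * \<rho> m) \<longlonglongrightarrow> 0"
  using tendsto_mult_right_zero[OF stays_below_tendsto[OF \<eta>]] unfolding \<rho>_def by blast
 ultimately have "prob (\<Inter>m. Bad m) \<le> 0" by (intro LIMSEQ_le_const[where X="\<lambda>m. real K * C * \<rho> m"]) auto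
 then have "prob (\<Inter>m. Bad m) = 0" by (simp add: measure_le_0_iff)
 then have "AE \<xi> in M. \<xi> \<notin> (\<Inter>m. Bad m)" by (subst (asm) prob_eq_0) auto
 then show ?thesis
 proof (rule AE_mp, intro AE_I2 impI notI)
  fix \<xi> assume w: "\<xi> \<in> space M" and nbad: "\<xi> \<notin> (\<Inter>m. Bad m)"
   and "\<exists>t>0. t \<le> real K \<and> left_limit (\<lambda>t. X t \<xi>) t + \<delta> < X t \<xi> \<and>
    (\<forall>s. t - 2 * \<eta> < s \<longrightarrow> s < t \<longrightarrow> left_limit (\<lambda>t. X t \<xi>) t + \<alpha> * t \<le> W s \<xi>)"
  then obtain t where t: "0 < t" "t \<le> real K" and jump: "left_limit (\<lambda>t. X t \<xi>) t + \<delta> < X t \<xi>"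
   and above: "\<And>s. t - 2 * \<eta> < s \<Longrightarrow> s < t \<Longrightarrow> left_limit (\<lambda>t. X t \<xi>) t + \<alpha> * t \<le> W s \<xi>" by blast
  let ?l = "left_limit (\<lambda>t. X t \<xi>) t"
  have "\<xi> \<in> Bad m" for m
  proof -
   define e where "e = min ((X t \<xi> - ?l - \<delta>) / 2) (1 / real (Suc m))"
   have e: "0 < e" using jump by (simp add: e_def)
   obtain d1 where d1: "0 < d1" "\<And>s. t \<le> s \<Longrightarrow> s < t + d1 \<Longrightarrow> \<bar>X s \<xi> - X t \<xi>\<bar> < e"
    using cadlag_right_eps[OF X_cadlag[OF w] e, of t] by metis
   obtain d2 where d2: "0 < d2" "\<And>s. t - d2 < s \<Longrightarrow> s < t \<Longrightarrow> \<bar>X s \<xi> - ?l\<bar> < e"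
    using cadlag_left_eps[OF X_cadlag[OF w] e, of t] by metis
   have "0 < min (min d1 d2) \<eta>" using d1(1) d2(1) \<eta> by simp
   from power_half_less[OF this]
   obtain N where N_all: "\<forall>n\<ge>N. 1 / 2 ^ n < min (min d1 d2) \<eta>" by (elim exE)
   have N: "1 / 2 ^ n < min (min d1 d2) \<eta>" if "N \<le> n" for n using N_all that by blast
   have "\<xi> \<in> U n m" if "N \<le> n" for n
   proof -
    have h: "1 / 2 ^ n < d1" "1 / 2 ^ n < d2" "1 / 2 ^ n < \<eta>" using N[OF that] by auto
    obtain k :: nat where k: "real k / 2 ^ n < t" "t \<le> real (Suc k) / 2 ^ n" "t - 1 / 2 ^ n \<le> real k / 2 ^ n" "real (Suc k) / 2 ^ n < t + 1 / 2 ^ n"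
     using lattice_before[OF t(1), of n] by blast
    let ?x = "real k / 2 ^ n"
    have Xk: "\<bar>X ?x \<xi> - ?l\<bar> < e" using d2(2)[of ?x] k h by linarith
    have Xk1: "\<bar>X (real (Suc k) / 2 ^ n) \<xi> - X t \<xi>\<bar> < e" using d1(2)[of "real (Suc k) / 2 ^ n"] k h by linarith
    have "?x < real K" using k(1) t(2) by (rule less_le_trans)
    then have "real k < real (K * 2 ^ n)" by (simp add: divide_less_eq)
    then have kK: "k < K * 2 ^ n" by (simp only: of_nat_less_iff)
    have "backward ?x \<xi> (of_rat u) + \<alpha> * of_rat u \<le> 1 / real (Suc m)" if u: "0 < u" "of_rat u < \<eta>" for u :: rat
    proof -
     have u0: "0 < (of_rat u::real)" using u by simp
     have "?l + \<alpha> * t \<le> W (?x - of_rat u) \<xi>" using above[of "?x - of_rat u"] k h u u0 by linarith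
     moreover have "W ?x \<xi> \<le> ?l + e + \<alpha> * t"
     proof -
      have "\<alpha> * ?x \<le> \<alpha> * t" using alpha k(1) by (intro mult_left_mono) auto
      then show ?thesis using Xk by linarith
     qed
     moreover have "e \<le> 1 / real (Suc m)" unfolding e_def by (rule min.cobounded2)
     moreover have "backward ?x \<xi> (of_rat u) + \<alpha> * of_rat u = W ?x \<xi> - W (?x - of_rat u) \<xi>"
      using u0 by (simp add: backward_def algebra_simps)
     ultimately show ?thesis by linarith
    qed
    then have "\<xi> \<in> E n m k" using w by (simp add: E_def stays_below_def space_PiM)
    moreover have "\<xi> \<in> J n k"
    proof -
     have "?x + 1 / 2 ^ n = real (Suc k) / 2 ^ n" by (simp add: field_simps)
     then have "fut ?x \<xi> (1 / 2 ^ n) = X (real (Suc k) / 2 ^ n) \<xi> - X ?x \<xi>" by (simp add: fut_eval)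
     moreover have "2 * e \<le> X t \<xi> - ?l - \<delta>"
     proof -
      have "e \<le> (X t \<xi> - ?l - \<delta>) / 2" unfolding e_def by (rule min.cobounded1)
      from mult_left_mono[OF this, of 2] show ?thesis by simp
     qed
     ultimately have "\<delta> < fut ?x \<xi> (1 / 2 ^ n)" using Xk Xk1 by linarith
     then show ?thesis using w by (simp add: J_def space_PiM)
    qed
    ultimately show ?thesis using kK unfolding U_def by blast
   qed
   then show ?thesis unfolding Bad_def by blast
  qed
  then show False using nbad by blast
 qed
qed

text \<open>There are about \<open>2\<^sup>n\<close> lattice cells, each of which contains a large
jump with probability of order \<open>1/2\<^sup>n\<close>, independently of the time-reversed path
before it. By regularity the latter stays above its end value, up to a small error, on an interval
of fixed length with a probability that tends to 0 with the error.\<close>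
lemma AE_jump_dip:
 "AE \<xi> in M. \<forall>t r. 0 < t \<longrightarrow> left_limit (\<lambda>t. X t \<xi>) t < X t \<xi> \<longrightarrow> r < t \<longrightarrow>
  (\<exists>s. r < s \<and> s < t \<and> W s \<xi> < left_limit (\<lambda>t. X t \<xi>) t + \<alpha> * t)"
proof -
 have "AE \<xi> in M. \<forall>K d e::nat. \<not> (\<exists>t>0. t \<le> real K \<and> left_limit (\<lambda>t. X t \<xi>) t + 1 / real (Suc d) < X t \<xi> \<and>
  (\<forall>s. t - 2 * (1 / real (Suc e)) < s \<longrightarrow> s < t \<longrightarrow> left_limit (\<lambda>t. X t \<xi>) t + \<alpha> * t \<le> W s \<xi>))"
  by (intro AE_all_countable[THEN iffD2] allI AE_jump_dip_aux) simp_all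
 then show ?thesis
 proof (rule AE_mp, intro AE_I2 impI allI)
  fix \<xi> t r
  assume no: "\<forall>K d e::nat. \<not> (\<exists>t>0. t \<le> real K \<and> left_limit (\<lambda>t. X t \<xi>) t + 1 / real (Suc d) < X t \<xi> \<and>
   (\<forall>s. t - 2 * (1 / real (Suc e)) < s \<longrightarrow> s < t \<longrightarrow> left_limit (\<lambda>t. X t \<xi>) t + \<alpha> * t \<le> W s \<xi>))"
   and t: "0 < t" "left_limit (\<lambda>t. X t \<xi>) t < X t \<xi>" "r < t"
  obtain K :: nat where K: "t \<le> real K" using real_arch_simple by blast
  obtain d where d: "1 / real (Suc d) < X t \<xi> - left_limit (\<lambda>t. X t \<xi>) t" using nat_approx_posE[of "X t \<xi> - left_limit (\<lambda>t. X t \<xi>) t"] t by auto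
  obtain e where e: "1 / real (Suc e) < (t - r) / 2" using nat_approx_posE[of "(t - r) / 2"] t by auto
  have "left_limit (\<lambda>t. X t \<xi>) t + 1 / real (Suc d) < X t \<xi>" using d by linarith
  then obtain s where s: "t - 2 * (1 / real (Suc e)) < s" "s < t" "\<not> left_limit (\<lambda>t. X t \<xi>) t + \<alpha> * t \<le> W s \<xi>"
   using no[rule_format, of K d e] K t(1) by blast
  then show "\<exists>s. r < s \<and> s < t \<and> W s \<xi> < left_limit (\<lambda>t. X t \<xi>) t + \<alpha> * t"
   using e by (intro exI[of _ s]) auto
 qed
qed

text \<open>Just before such a jump \<open>V\<close> comes close, for the first time, to a level
that is determined by the path until 0. The first lattice time at which it is close to that level
depends on the past only, and a jump larger than \<open>\<delta>\<close> is unlikely in a short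
interval after it.\<close>
lemma AE_no_jump_hit_aux:
 assumes \<delta>: "0 < \<delta>" and a: "0 < a"
 shows "AE \<xi> in M. \<not> (\<exists>t>a. left_limit (\<lambda>t. X t \<xi>) t + \<delta> < X t \<xi> \<and>
  (\<forall>r\<le>0. left_limit (\<lambda>t. X t \<xi>) t - \<alpha> * t \<le> V r \<xi>) \<and>
  (\<forall>s. 0 < s \<longrightarrow> s < t \<longrightarrow> (\<exists>r\<le>0. V r \<xi> < min (X s \<xi>) (left_limit (\<lambda>t. X t \<xi>) s) - \<alpha> * s)))"
proof -
 obtain C where C: "0 \<le> C" "\<And>n. prob {\<xi>\<in>space M. \<delta> < X (1 / 2 ^ n) \<xi>} \<le> C / 2 ^ n"
  using jump_rate[OF \<delta>] by blast
 define A where "A n m k = {\<xi>\<in>space M. a \<le> real k * (1 / 2 ^ n) \<and>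
   (\<forall>r::rat. r \<le> 0 \<longrightarrow> V (real k * (1 / 2 ^ n)) \<xi> \<le> V (of_rat r) \<xi> + 1 / real (Suc m))}" for n m k :: nat
 define B where "B n i = {w\<in>space path_space. \<exists>j\<le>2 ^ (n - i). \<delta> < w (real (Suc j) / 2 ^ n) - w (real j / 2 ^ n)}" for n i :: nat
 define U where "U n m i = (\<Union>k. disjointed (A n m) k \<inter> {\<xi>\<in>space M. fut (real k * (1 / 2 ^ n)) \<xi> \<in> B n i})" for n m i
 have B_meas[measurable]: "B n i \<in> sets path_space" for n i unfolding B_def by measurable
 have A_past: "A n m k \<in> sets (past (real k * (1 / 2 ^ n)))" for n m k
 proof -
  have "{\<xi>\<in>space (past u). P \<and> (\<forall>r::rat. r \<le> 0 \<longrightarrow> V u \<xi> \<le> V (of_rat r) \<xi> + c)} \<in> sets (past u)"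
   if u: "0 \<le> u" for u c P
  proof -
   have [measurable]: "X u \<in> borel_measurable (past u)" by (rule X_past) simp
   have pr: "Measurable.pred (past u) (\<lambda>\<xi>. r \<le> 0 \<longrightarrow> V u \<xi> \<le> V (of_rat r) \<xi> + c)" for r :: rat
   proof (cases "r \<le> 0")
    case True
    then have "(of_rat r::real) \<le> 0" by simp
    then have "(of_rat r::real) \<le> u" using u by linarith
    then have [measurable]: "X (of_rat r) \<in> borel_measurable (past u)" by (rule X_past)
    show ?thesis by measurable
   qed simp
   have "Measurable.pred (past u) (\<lambda>\<xi>. P \<and> (\<forall>r::rat. r \<le> 0 \<longrightarrow> V u \<xi> \<le> V (of_rat r) \<xi> + c))"
    by (intro pred_const_conj pred_intros_countable pr)
   then show ?thesis unfolding pred_def .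
  qed
  note gen = this
  have u0: "0 \<le> real k * (1 / 2 ^ n)" by simp
  show ?thesis
   unfolding A_def using gen[OF u0, of "a \<le> real k * (1 / 2 ^ n)" "1 / real (Suc m)"] unfolding space_past .
 qed
 have A_ev: "A n m k \<in> events" for n m k using A_past sets_past_subset by blast
 have U_meas[measurable]: "U n m i \<in> events" for n m i
 proof -
  have "disjointed (A n m) k \<in> events" for k
   using sets.range_disjointed_sets[of "A n m" M] A_ev by auto
  then show ?thesis unfolding U_def by measurable
 qed
 have pB: "prob {\<xi>\<in>space M. fut 0 \<xi> \<in> B n i} \<le> 2 * C / 2 ^ i" if "i \<le> n" for n i
 proof -
  let ?J = "\<lambda>j. {\<xi>\<in>space M. X (real (Suc j) / 2 ^ n) \<xi> - X (real j / 2 ^ n) \<xi> \<in> {\<delta><..}}"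
  have f: "fut 0 \<xi> (real j / 2 ^ n) = X (real j / 2 ^ n) \<xi>" if "\<xi> \<in> space M" for \<xi> j
   by (rule fut_eval(1)[OF that]) simp
  have "{\<xi>\<in>space M. fut 0 \<xi> \<in> B n i} = (\<Union>j\<in>{..2 ^ (n - i)}. ?J j)"
   unfolding B_def using f by (auto simp: space_PiM simp del: of_nat_Suc)
  moreover have "prob (\<Union>j\<in>{..2 ^ (n - i)}. ?J j) \<le> (\<Sum>j\<in>{..2 ^ (n - i)}. prob (?J j))"
   by (rule finite_measure_subadditive_finite) (simp, intro image_subsetI, measurable)
  ultimately have "prob {\<xi>\<in>space M. fut 0 \<xi> \<in> B n i} \<le> (\<Sum>j\<in>{..2 ^ (n - i)}. prob (?J j))"
   by (simp only:)
  also have "\<dots> \<le> (\<Sum>j\<in>{..(2::nat) ^ (n - i)}. C / 2 ^ n)"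
  proof (rule sum_mono)
   fix j
   have "prob (?J j) = prob {\<xi>\<in>space M. X (real (Suc j) / 2 ^ n - real j / 2 ^ n) \<xi> \<in> {\<delta><..}}"
    by (rule prob_increment) (simp_all add: divide_right_mono)
   also have "real (Suc j) / 2 ^ n - real j / 2 ^ n = 1 / 2 ^ n" by (simp add: diff_divide_distrib[symmetric])
   also have "prob {\<xi>\<in>space M. X (1 / 2 ^ n) \<xi> \<in> {\<delta><..}} \<le> C / 2 ^ n" using C(2)[of n] by simp
   finally show "prob (?J j) \<le> C / 2 ^ n" .
  qed
  also have "\<dots> = (2 ^ (n - i) + 1) * (C / 2 ^ n)" by (simp add: algebra_simps)
  also have "\<dots> \<le> (2 * 2 ^ (n - i)) * (C / 2 ^ n)"
   using C(1) by (intro mult_right_mono) auto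
  also have "\<dots> = 2 * C / 2 ^ i"
  proof -
   have "(2::real) ^ n = 2 ^ i * 2 ^ (n - i)" using that by (simp flip: power_add)
   then show ?thesis by simp
  qed
  finally show ?thesis .
 qed
 have pU: "prob (U n m i) \<le> 2 * C / 2 ^ i" if "i \<le> n" for n m i
 proof -
  have "prob (U n m i) \<le> 2 * C / 2 ^ i * prob (\<Union>k. A n m k)"
   unfolding U_def by (rule first_passage_upper[OF _ A_past]) (use pB[OF that] in simp_all)
  also have "\<dots> \<le> 2 * C / 2 ^ i * 1" using C(1) by (intro mult_left_mono prob_le_1) auto
  finally show ?thesis by simp
 qed
 define Bad where "Bad i = (\<Union>m0. \<Inter>m\<in>{m0..}. \<Union>N. \<Inter>n\<in>{N..}. U n m i)" for i
 have Bad_meas[measurable]: "Bad i \<in> events" for i unfolding Bad_def by measurable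
 have pBad: "prob (Bad i) \<le> 2 * C / 2 ^ i" for i
  unfolding Bad_def
 proof (rule prob_liminf_le[of _ 0])
  fix m
  show "prob (\<Union>N. \<Inter>n\<in>{N..}. U n m i) \<le> 2 * C / 2 ^ i"
   by (rule prob_liminf_le[of _ i]) (use pU in auto)
 qed measurable
 have "prob (\<Inter>i. Bad i) \<le> 2 * C / 2 ^ i" for i
 proof -
  have "prob (\<Inter>i. Bad i) \<le> prob (Bad i)" by (intro finite_measure_mono) auto
  then show ?thesis using pBad[of i] by linarith
 qed
 moreover have "(\<lambda>i. 2 * C / 2 ^ i) \<longlonglongrightarrow> 0" by real_asymp
 ultimately have "prob (\<Inter>i. Bad i) \<le> 0" by (intro LIMSEQ_le_const[where X="\<lambda>i. 2 * C / 2 ^ i"]) auto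
 then have "prob (\<Inter>i. Bad i) = 0" by (simp add: measure_le_0_iff)
 then have "AE \<xi> in M. \<xi> \<notin> (\<Inter>i. Bad i)" by (subst (asm) prob_eq_0) auto
 then show ?thesis
 proof (rule AE_mp, intro AE_I2 impI notI, elim exE conjE)
  fix \<xi> t assume w: "\<xi> \<in> space M" and nbad: "\<xi> \<notin> (\<Inter>i. Bad i)" and ta: "a < t"
   and jump: "left_limit (\<lambda>t. X t \<xi>) t + \<delta> < X t \<xi>"
   and le: "\<forall>r\<le>0. left_limit (\<lambda>t. X t \<xi>) t - \<alpha> * t \<le> V r \<xi>"
   and before: "\<forall>s. 0 < s \<longrightarrow> s < t \<longrightarrow> (\<exists>r\<le>0. V r \<xi> < min (X s \<xi>) (left_limit (\<lambda>t. X t \<xi>) s) - \<alpha> * s)"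
  let ?l = "left_limit (\<lambda>t. X t \<xi>) t"
  have Vc: "cadlag_on UNIV (\<lambda>t. V t \<xi>)" "\<And>t. left_limit (\<lambda>t. V t \<xi>) t = left_limit (\<lambda>t. X t \<xi>) t - \<alpha> * t"
   using cadlag_diff_linear[OF X_cadlag[OF w], of \<alpha>] by simp_all
  have "\<xi> \<in> Bad i" for i
  proof -
   define b where "b = t - 1 / 2 ^ Suc i"
   have "\<exists>r0::rat. \<exists>e0>0. r0 \<le> 0 \<and> (\<forall>s\<in>{a..b}. V (of_rat r0) \<xi> + e0 < V s \<xi>)"
   proof (cases "a \<le> b")
    case True
    obtain u where u: "a \<le> u" "u \<le> b" and
     inf: "(\<forall>s\<in>{a..b}. V u \<xi> \<le> V s \<xi>) \<or> (a < u \<and> (\<forall>s\<in>{a..b}. left_limit (\<lambda>t. V t \<xi>) u \<le> V s \<xi>))"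
     using cadlag_attains_inf[OF Vc(1) True] by blast
    define v where "v = min (V u \<xi>) (left_limit (\<lambda>t. V t \<xi>) u)"
    have v: "\<forall>s\<in>{a..b}. v \<le> V s \<xi>" using inf by (auto simp: v_def min_le_iff_disj)
    have v_eq: "v = min (X u \<xi>) (left_limit (\<lambda>t. X t \<xi>) u) - \<alpha> * u"
     unfolding v_def Vc(2) by (simp add: min_def)
    have "0 < u" "u < t" using a u unfolding b_def by (auto intro: less_le_trans le_less_trans)
    then obtain r where r: "r \<le> 0" "V r \<xi> < v" using before unfolding v_eq by blast
    obtain r0 :: rat where r0: "r0 \<le> 0" "V (of_rat r0) \<xi> < v"
    proof (cases "r = 0")
     case True then show thesis using r by (intro that[of 0]) auto
    next
     case False
     obtain q :: rat where q: "r < of_rat q" "of_rat q < (0::real)" "\<bar>V (of_rat q) \<xi> - V r \<xi>\<bar> < v - V r \<xi>"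
      using cadlag_rat_right[OF Vc(1), of "v - V r \<xi>" r 0] False r by auto
     then show thesis by (intro that[of q]) (auto simp: less_imp_le)
    qed
    show ?thesis
     by (rule exI[of _ r0], rule exI[of _ "(v - V (of_rat r0) \<xi>) / 2"])
      (use r0 v in \<open>auto simp: field_simps intro: less_le_trans\<close>)
   qed (auto intro: exI[of _ 0] exI[of _ 1])
   then obtain r0 :: rat and e0 :: real where r0': "0 < e0" "r0 \<le> 0" "\<forall>s\<in>{a..b}. V (of_rat r0) \<xi> + e0 < V s \<xi>"
    by (elim exE conjE)
   have r0: "0 < e0" "r0 \<le> 0" "V (of_rat r0) \<xi> + e0 < V s \<xi>" if "s \<in> {a..b}" for s
    using r0' that by blast+
   have e0: "0 < e0" "r0 \<le> 0" using r0' by blast+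
   obtain m0 where m0: "1 / real (Suc m0) < e0" using nat_approx_posE[OF e0(1)] by auto
   have "\<xi> \<in> (\<Union>N. \<Inter>n\<in>{N..}. U n m i)" if m: "m0 \<le> m" for m
   proof -
    have me: "1 / real (Suc m) < e0"
    proof -
     have "1 / real (Suc m) \<le> 1 / real (Suc m0)" using m by (simp add: frac_le)
     then show ?thesis using m0 by linarith
    qed
    define e where "e = min ((X t \<xi> - ?l - \<delta>) / 2) (1 / real (Suc m))"
    have e: "0 < e" "e \<le> 1 / real (Suc m)" "e \<le> (X t \<xi> - ?l - \<delta>) / 2"
     using jump unfolding e_def by (simp, intro min.cobounded2, intro min.cobounded1)
    obtain d1 where d1: "0 < d1" "\<And>s. t \<le> s \<Longrightarrow> s < t + d1 \<Longrightarrow> \<bar>X s \<xi> - X t \<xi>\<bar> < e"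
     using cadlag_right_eps[OF X_cadlag[OF w] e(1), of t] by metis
    obtain d2 where d2: "0 < d2" "\<And>s. t - d2 < s \<Longrightarrow> s < t \<Longrightarrow> \<bar>X s \<xi> - ?l\<bar> < e"
     using cadlag_left_eps[OF X_cadlag[OF w] e(1), of t] by metis
    obtain d3 where d3: "0 < d3" and d3_all: "\<forall>s. t - d3 < s \<longrightarrow> s < t \<longrightarrow> \<bar>V s \<xi> - left_limit (\<lambda>t. V t \<xi>) t\<bar> < e"
     using cadlag_left_ex[OF Vc(1) e(1), of t] by blast
    have "0 < min (min d1 d2) (min d3 (t - a))" using d1(1) d2(1) d3 ta by simp
    from power_half_less[OF this]
    obtain N where N_all: "\<forall>n\<ge>N. 1 / 2 ^ n < min (min d1 d2) (min d3 (t - a))" by (elim exE)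
    have N: "1 / 2 ^ n < min (min d1 d2) (min d3 (t - a))" if "N \<le> n" for n using N_all that by blast
    have "\<xi> \<in> U n m i" if n: "max N i \<le> n" for n
    proof -
     have h: "1 / 2 ^ n < d1" "1 / 2 ^ n < d2" "1 / 2 ^ n < d3" "1 / 2 ^ n < t - a" using N[of n] n by auto
     have "0 < t" using a ta by simp
     then obtain k1 :: nat where k1: "real k1 / 2 ^ n < t" "t \<le> real (Suc k1) / 2 ^ n" "t - 1 / 2 ^ n \<le> real k1 / 2 ^ n" "real (Suc k1) / 2 ^ n < t + 1 / 2 ^ n"
      using lattice_before[of t n] by blast
     have Xk: "\<bar>X (real k1 / 2 ^ n) \<xi> - ?l\<bar> < e" using d2(2)[of "real k1 / 2 ^ n"] k1 h by linarith
     have Xk1: "\<bar>X (real (Suc k1) / 2 ^ n) \<xi> - X t \<xi>\<bar> < e" using d1(2)[of "real (Suc k1) / 2 ^ n"] k1 h by linarith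
     have Vk: "V (real k1 / 2 ^ n) \<xi> < ?l - \<alpha> * t + e"
      using d3_all[rule_format, of "real k1 / 2 ^ n"] k1 h Vc(2)[of t] by linarith
     have Ak1: "\<xi> \<in> A n m k1"
     proof -
      have "V (real k1 / 2 ^ n) \<xi> \<le> V (of_rat r) \<xi> + 1 / real (Suc m)" if "r \<le> 0" for r :: rat
      proof -
       have "(of_rat r :: real) \<le> 0" using that by simp
       then have "?l - \<alpha> * t \<le> V (of_rat r) \<xi>" using le by blast
       then show ?thesis using Vk e(2) by linarith
      qed
      moreover have "a \<le> real k1 / 2 ^ n" using k1 h by linarith
      ultimately show ?thesis using w by (simp add: A_def)
     qed
     define k0 where "k0 = (LEAST k. \<xi> \<in> A n m k)"
     have Ak0: "\<xi> \<in> A n m k0" unfolding k0_def using Ak1 by (rule LeastI)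
     have k01: "k0 \<le> k1" unfolding k0_def using Ak1 by (rule Least_le)
     have "\<xi> \<notin> A n m k" if "k < k0" for k using not_less_Least[of k "\<lambda>k. \<xi> \<in> A n m k"] that by (simp add: k0_def)
     then have dis: "\<xi> \<in> disjointed (A n m) k0" using Ak0 by (auto simp: disjointed_def)
     let ?x = "real k0 * (1 / 2 ^ n)"
     have A0: "a \<le> ?x" "V ?x \<xi> \<le> V (of_rat r0) \<xi> + 1 / real (Suc m)" using Ak0 e0(2) by (auto simp: A_def)
     have xb: "b < ?x"
     proof (rule ccontr)
      assume "\<not> b < ?x"
      then have "V (of_rat r0) \<xi> + e0 < V ?x \<xi>" using r0(3)[of ?x] A0 by simp
      then show False using A0(2) me by linarith
     qed
     define j where "j = k1 - k0"
     have j: "real j / 2 ^ n = real k1 / 2 ^ n - ?x" using k01 by (simp add: j_def of_nat_diff diff_divide_distrib)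
     have j': "real (Suc j) / 2 ^ n = real (Suc k1) / 2 ^ n - ?x"
      using j by (simp add: add_divide_distrib)
     have "real j / 2 ^ n < 1 / 2 ^ Suc i" using j xb k1 unfolding b_def by linarith
     then have "real j * 2 ^ Suc i < 2 ^ n" by (simp add: field_simps)
     also have "(2::real) ^ n = 2 ^ (n - i) * 2 ^ i" using n by (simp flip: power_add)
     finally have "(real j * 2) * 2 ^ i < 2 ^ (n - i) * 2 ^ i" by (simp add: mult.assoc)
     then have "real j * 2 < 2 ^ (n - i)" by (simp only: mult_less_cancel_right_pos zero_less_power zero_less_numeral)
     then have "real j \<le> 2 ^ (n - i)" by linarith
     then have "real j \<le> real (2 ^ (n - i))" by (simp only: of_nat_power of_nat_numeral)
     then have jle: "j \<le> 2 ^ (n - i)" by (simp only: of_nat_le_iff)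
     have "fut ?x \<xi> (real (Suc j) / 2 ^ n) - fut ?x \<xi> (real j / 2 ^ n)
       = X (real (Suc k1) / 2 ^ n) \<xi> - X (real k1 / 2 ^ n) \<xi>"
     proof -
      have "fut ?x \<xi> (real (Suc j) / 2 ^ n) = X (?x + real (Suc j) / 2 ^ n) \<xi> - X ?x \<xi>"
       "fut ?x \<xi> (real j / 2 ^ n) = X (?x + real j / 2 ^ n) \<xi> - X ?x \<xi>"
       by (rule fut_eval; simp)+
      moreover have "?x + real (Suc j) / 2 ^ n = real (Suc k1) / 2 ^ n" "?x + real j / 2 ^ n = real k1 / 2 ^ n"
       unfolding j j' by simp_all
      ultimately show ?thesis by simp
     qed
     moreover have "\<delta> < X (real (Suc k1) / 2 ^ n) \<xi> - X (real k1 / 2 ^ n) \<xi>"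
     proof -
      have "2 * e \<le> X t \<xi> - ?l - \<delta>" using mult_left_mono[OF e(3), of 2] by simp
      then show ?thesis using Xk Xk1 by linarith
     qed
     ultimately have "fut ?x \<xi> \<in> B n i" using jle unfolding B_def by (auto simp: space_PiM)
     then show ?thesis using dis w unfolding U_def by blast
    qed
    then show ?thesis by blast
   qed
   then show ?thesis unfolding Bad_def by blast
  qed
  then show False using nbad by blast
 qed
qed

lemma AE_no_jump_hit:
 "AE \<xi> in M. \<forall>t>0. (\<forall>r\<le>0. left_limit (\<lambda>t. X t \<xi>) t - \<alpha> * t \<le> V r \<xi>) \<longrightarrow>
  (\<forall>s. 0 < s \<longrightarrow> s < t \<longrightarrow> (\<exists>r\<le>0. V r \<xi> < min (X s \<xi>) (left_limit (\<lambda>t. X t \<xi>) s) - \<alpha> * s)) \<longrightarrow>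
  X t \<xi> \<le> left_limit (\<lambda>t. X t \<xi>) t"
proof -
 have "AE \<xi> in M. \<forall>d b::nat. \<not> (\<exists>t>1 / real (Suc b). left_limit (\<lambda>t. X t \<xi>) t + 1 / real (Suc d) < X t \<xi> \<and>
  (\<forall>r\<le>0. left_limit (\<lambda>t. X t \<xi>) t - \<alpha> * t \<le> V r \<xi>) \<and>
  (\<forall>s. 0 < s \<longrightarrow> s < t \<longrightarrow> (\<exists>r\<le>0. V r \<xi> < min (X s \<xi>) (left_limit (\<lambda>t. X t \<xi>) s) - \<alpha> * s)))"
  by (intro AE_all_countable[THEN iffD2] allI AE_no_jump_hit_aux) simp_all
 then show ?thesis
 proof (rule AE_mp, intro AE_I2 impI allI)
  fix \<xi> t
  assume no: "\<forall>d b::nat. \<not> (\<exists>t>1 / real (Suc b). left_limit (\<lambda>t. X t \<xi>) t + 1 / real (Suc d) < X t \<xi> \<and>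
   (\<forall>r\<le>0. left_limit (\<lambda>t. X t \<xi>) t - \<alpha> * t \<le> V r \<xi>) \<and>
   (\<forall>s. 0 < s \<longrightarrow> s < t \<longrightarrow> (\<exists>r\<le>0. V r \<xi> < min (X s \<xi>) (left_limit (\<lambda>t. X t \<xi>) s) - \<alpha> * s)))"
   and t: "0 < t" and le: "\<forall>r\<le>0. left_limit (\<lambda>t. X t \<xi>) t - \<alpha> * t \<le> V r \<xi>"
   and before: "\<forall>s. 0 < s \<longrightarrow> s < t \<longrightarrow> (\<exists>r\<le>0. V r \<xi> < min (X s \<xi>) (left_limit (\<lambda>t. X t \<xi>) s) - \<alpha> * s)"
  show "X t \<xi> \<le> left_limit (\<lambda>t. X t \<xi>) t"
  proof (rule ccontr)
   assume "\<not> ?thesis"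
   then obtain d where d: "1 / real (Suc d) < X t \<xi> - left_limit (\<lambda>t. X t \<xi>) t" using nat_approx_posE[of "X t \<xi> - left_limit (\<lambda>t. X t \<xi>) t"] by auto
   obtain b where b: "1 / real (Suc b) < t" using nat_approx_posE[OF t] by auto
   have "left_limit (\<lambda>t. X t \<xi>) t + 1 / real (Suc d) < X t \<xi>" using d by linarith
   then show False using no[rule_format, of b d] b le before by blast
  qed
 qed
qed

lemma AE_left_bounded: "AE \<xi> in M. \<exists>B. \<forall>r\<le>0. B \<le> V r \<xi>"
proof -
 interpret N: levy_process M "\<lambda>t \<xi>. - X t \<xi>" by (rule levy_uminus)
 define C where "C = {w\<in>space path_space. \<exists>K::nat. \<forall>q::rat. 0 \<le> q \<longrightarrow> - real K \<le> - w (of_rat q) + \<alpha> * of_rat q}"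
 have C: "C \<in> sets path_space" unfolding C_def by measurable
 have "AE \<xi> in M. \<exists>K::nat. \<forall>t\<ge>0. - real K \<le> - X t \<xi> + \<alpha> * t"
  by (rule N.AE_bounded_below) (use X1 mean in auto)
 then have "AE \<xi> in M. fut 0 \<xi> \<in> C"
 proof (rule AE_mp, intro AE_I2 impI)
  fix \<xi> assume w: "\<xi> \<in> space M" and "\<exists>K::nat. \<forall>t\<ge>0. - real K \<le> - X t \<xi> + \<alpha> * t"
  then obtain K :: nat where K: "\<And>t. 0 \<le> t \<Longrightarrow> - real K \<le> - X t \<xi> + \<alpha> * t" by blast
  have "- real K \<le> - fut 0 \<xi> (of_rat q) + \<alpha> * of_rat q" if "0 \<le> q" for q :: rat
   using K[of "of_rat q"] that w by (simp add: fut_eval)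
  then show "fut 0 \<xi> \<in> C" unfolding C_def by (auto simp: space_PiM)
 qed
 then have "prob {\<xi>\<in>space M. fut 0 \<xi> \<in> C} = 1" using C by (subst prob_Collect_eq_1) auto
 then have "prob {\<xi>\<in>space M. backward 0 \<xi> \<in> C} = 1"
  using emeasure_backward[OF C, of 0] by (simp add: emeasure_eq_measure)
 then have "AE \<xi> in M. backward 0 \<xi> \<in> C" using C by (subst (asm) prob_Collect_eq_1) auto
 then show ?thesis
 proof (rule AE_mp, intro AE_I2 impI)
  fix \<xi> assume w: "\<xi> \<in> space M" and "backward 0 \<xi> \<in> C"
  then obtain K :: nat where K: "\<And>q::rat. 0 \<le> q \<Longrightarrow> - real K \<le> - backward 0 \<xi> (of_rat q) + \<alpha> * of_rat q"
   by (auto simp: C_def)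
  have K': "- real K \<le> V (of_rat r) \<xi>" if "r \<le> 0" for r :: rat
   using K[of "- r"] that w by (simp add: backward_def of_rat_minus)
  have "- real K \<le> V r \<xi>" if r: "r \<le> 0" for r
  proof (cases "r = 0")
   case True then show ?thesis using K'[of 0] by simp
  next
   case False
   show ?thesis
   proof (rule field_le_epsilon)
    fix e :: real assume "0 < e"
    obtain q :: rat where "r < of_rat q" "of_rat q < (0::real)" "\<bar>V (of_rat q) \<xi> - V r \<xi>\<bar> < e"
     using cadlag_rat_right[OF cadlag_diff_linear(1)[OF X_cadlag[OF w], of \<alpha>] \<open>0 < e\<close>, of r 0] False r by auto
    then show "- real K \<le> V r \<xi> + e" using K'[of q] by simp
   qed
  qed
  then show "\<exists>B. \<forall>r\<le>0. B \<le> V r \<xi>" by blast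
 qed
qed

theorem AE_good_path: "AE \<xi> in M. good_path \<alpha> (\<lambda>t. X t \<xi>)"
proof -
 interpret N: levy_process M "\<lambda>t \<xi>. - X t \<xi>" by (rule levy_uminus)
 have up: "AE \<xi> in M. filterlim (\<lambda>t. X t \<xi> + \<alpha> * t) at_top at_top"
  by (rule AE_tends_to_infinity) (use X1 mean in auto)
 have down: "AE \<xi> in M. filterlim (\<lambda>t. - X t \<xi> + \<alpha> * t) at_top at_top"
  by (rule N.AE_tends_to_infinity) (use X1 mean in auto)
 show ?thesis
  using up down AE_left_bounded AE_no_tie AE_jump_dip AE_no_jump_hit AE_no_fixed_jump[of 0] AE_space
 proof eventually_elim
  case (elim \<xi>)
  note w = elim(8)
  show ?case
  proof (rule good_path.intro)
   show "cadlag_on UNIV (\<lambda>t. X t \<xi>)" by (rule X_cadlag[OF w])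
   show "\<exists>t>0. X t \<xi> - \<alpha> * t < B" for B
   proof -
    have "eventually (\<lambda>t. - B + 1 \<le> - X t \<xi> + \<alpha> * t) at_top" using elim(2) by (simp add: filterlim_at_top)
    then obtain t0 where "\<And>t. t0 \<le> t \<Longrightarrow> - B + 1 \<le> - X t \<xi> + \<alpha> * t" by (auto simp: eventually_at_top_linorder)
    from this[of "max t0 1"] show ?thesis by (intro exI[of _ "max t0 1"]) auto
   qed
   show False if "\<And>s::rat. 0 < s \<Longrightarrow> s < q \<Longrightarrow> hit \<alpha> (\<lambda>t. X t \<xi>) (of_rat s) \<Longrightarrow> m \<le> X (of_rat s) \<xi> + \<alpha> * of_rat s"
    "\<And>e. 0 < e \<Longrightarrow> \<exists>s::rat. 0 < s \<and> s < q \<and> hit \<alpha> (\<lambda>t. X t \<xi>) (of_rat s) \<and> X (of_rat s) \<xi> + \<alpha> * of_rat s < m + e"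
    "\<And>s::rat. q \<le> s \<Longrightarrow> m \<le> X (of_rat s) \<xi> + \<alpha> * of_rat s"
    "\<And>e. 0 < e \<Longrightarrow> \<exists>s::rat. q \<le> s \<and> X (of_rat s) \<xi> + \<alpha> * of_rat s < m + e" for q :: rat and m
    using elim(4)[rule_format, of q m] that by blast
   show "0 < \<alpha>" by (rule alpha)
   show "X 0 \<xi> = 0" by (rule X_0[OF w])
   show "left_limit (\<lambda>t. X t \<xi>) 0 = X 0 \<xi>" by (rule elim(7))
   show "filterlim (\<lambda>t. X t \<xi> + \<alpha> * t) at_top at_top" by (rule elim(1))
   show "\<exists>B. \<forall>r\<le>0. B \<le> X r \<xi> - \<alpha> * r" by (rule elim(3))
   show "\<exists>s. r < s \<and> s < t \<and> X s \<xi> + \<alpha> * s < left_limit (\<lambda>t. X t \<xi>) t + \<alpha> * t"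
    if "0 < t" "left_limit (\<lambda>t. X t \<xi>) t < X t \<xi>" "r < t" for t r
    using elim(5)[rule_format, OF that] .
   show "X t \<xi> \<le> left_limit (\<lambda>t. X t \<xi>) t"
    if "0 < t" "\<And>r. r \<le> 0 \<Longrightarrow> left_limit (\<lambda>t. X t \<xi>) t - \<alpha> * t \<le> X r \<xi> - \<alpha> * r"
     "\<And>s. 0 < s \<Longrightarrow> s < t \<Longrightarrow> \<exists>r\<le>0. X r \<xi> - \<alpha> * r < min (X s \<xi>) (left_limit (\<lambda>t. X t \<xi>) s) - \<alpha> * s" for t
    using elim(6)[rule_format, OF that(1)] that(2,3) by simp
  qed
 qed
qed

end

section \<open>Decomposition at a lattice time\<close>

text \<open>By compactness, approximate contacts at rational times have a limit point, which is a
contact. This is what makes the contact time measurable.\<close>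
lemma contact_between_iff:
 assumes f: "cadlag_on UNIV f" and \<alpha>: "0 \<le> \<alpha>"
 shows "(\<exists>t\<in>{a..b}. t \<in> contact_set \<alpha> f) \<longleftrightarrow>
  (\<forall>n::nat. \<exists>q::rat. a - 1 / real (Suc n) < of_rat q \<and> of_rat q < b + 1 / real (Suc n) \<and>
   (\<forall>s::rat. f (of_rat q) \<le> f (of_rat s) + \<alpha> * \<bar>of_rat q - of_rat s\<bar> + 1 / real (Suc n)))"
  (is "?L \<longleftrightarrow> ?R")
proof
 assume ?L
 then obtain t where t: "a \<le> t" "t \<le> b" and le: "\<And>s. min (f t) (left_limit f t) \<le> f s + \<alpha> * \<bar>t - s\<bar>"
  unfolding contact_set_iff[OF f \<alpha>] by auto
 show ?R
 proof
  fix n :: nat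
  define e where "e = 1 / real (Suc n)"
  have e: "0 < e" by (simp add: e_def)
  define d where "d = min e (e / (2 * (\<alpha> + 1)))"
  have d: "0 < d" "d \<le> e" using e \<alpha> by (auto simp: d_def)
  have "\<alpha> * d \<le> \<alpha> * (e / (2 * (\<alpha> + 1)))" using \<alpha> by (intro mult_left_mono) (simp_all add: d_def)
  also have "\<dots> \<le> e / 2" using \<alpha> e by (simp add: field_simps)
  finally have ad: "\<alpha> * d \<le> e / 2" .
  have "\<exists>q::rat. \<bar>of_rat q - t\<bar> < d \<and> f (of_rat q) < min (f t) (left_limit f t) + e / 2"
  proof (cases "f t \<le> left_limit f t")
   case True
   obtain q :: rat where "t < of_rat q" "of_rat q < t + d" "\<bar>f (of_rat q) - f t\<bar> < e / 2"
    using cadlag_rat_right[OF f, of "e/2" t "t + d"] e d by auto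
   then have "\<bar>of_rat q - t\<bar> < d \<and> f (of_rat q) < f t + e / 2" by (intro conjI; linarith)
   then show ?thesis using True by (intro exI[of _ q]) (simp add: min_absorb1)
  next
   case False
   obtain q :: rat where "t - d < of_rat q" "of_rat q < t" "\<bar>f (of_rat q) - left_limit f t\<bar> < e / 2"
    using cadlag_rat_left[OF f, of "e/2" "t - d" t] e d by auto
   then have "\<bar>of_rat q - t\<bar> < d \<and> f (of_rat q) < left_limit f t + e / 2" by (intro conjI; linarith)
   then show ?thesis using False by (intro exI[of _ q]) (simp add: min_absorb2)
  qed
  then obtain q :: rat where q: "\<bar>of_rat q - t\<bar> < d" "f (of_rat q) < min (f t) (left_limit f t) + e / 2" by blast
  have "f (of_rat q) \<le> f (of_rat s) + \<alpha> * \<bar>of_rat q - of_rat s\<bar> + e" for s :: rat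
  proof -
   have "\<alpha> * \<bar>t - of_rat s\<bar> \<le> \<alpha> * (\<bar>of_rat q - of_rat s\<bar> + d)"
    using q(1) \<alpha> by (intro mult_left_mono) linarith+
   then show ?thesis using le[of "of_rat s"] q(2) ad unfolding distrib_left by linarith
  qed
  moreover have "a - e < of_rat q" "of_rat q < b + e" using q(1) t d(2) by linarith+
  ultimately show "\<exists>q::rat. a - 1 / real (Suc n) < of_rat q \<and> of_rat q < b + 1 / real (Suc n) \<and>
   (\<forall>s::rat. f (of_rat q) \<le> f (of_rat s) + \<alpha> * \<bar>of_rat q - of_rat s\<bar> + 1 / real (Suc n))"
   unfolding e_def by blast
 qed
next
 assume R: ?R
 from choice[OF R] obtain q :: "nat \<Rightarrow> rat" where q: "\<forall>n. a - 1 / real (Suc n) < of_rat (q n) \<and> of_rat (q n) < b + 1 / real (Suc n) \<and>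
   (\<forall>s::rat. f (of_rat (q n)) \<le> f (of_rat s) + \<alpha> * \<bar>of_rat (q n) - of_rat s\<bar> + 1 / real (Suc n))"
  by (elim exE)
 define x where "x n = (of_rat (q n) :: real)" for n
 have xa: "a - 1 / real (Suc n) < x n" and xb: "x n < b + 1 / real (Suc n)"
  and xs: "f (x n) \<le> f (of_rat s) + \<alpha> * \<bar>x n - of_rat s\<bar> + 1 / real (Suc n)" for n and s :: rat
  using q unfolding x_def by blast+
 have one: "1 / real (Suc n) \<le> 1" for n by simp
 have "bounded (range x)"
  unfolding bounded_iff
 proof (intro exI ballI)
  fix y assume "y \<in> range x"
  then obtain n where n: "y = x n" by auto
  show "norm y \<le> \<bar>a\<bar> + \<bar>b\<bar> + 1" using xa[of n] xb[of n] one[of n] unfolding real_norm_def n by linarith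
 qed
 then obtain l r where r: "strict_mono (r :: nat \<Rightarrow> nat)" and lim: "(x \<circ> r) \<longlonglongrightarrow> l"
  using bounded_imp_convergent_subsequence by blast
 have h0: "(\<lambda>n. 1 / real (Suc n)) \<longlonglongrightarrow> 0" by real_asymp
 from LIMSEQ_subseq_LIMSEQ[OF h0 r] have h: "(\<lambda>n. 1 / real (Suc (r n))) \<longlonglongrightarrow> 0" by (simp add: o_def)
 have "a - 0 \<le> l"
  by (rule LIMSEQ_le[OF tendsto_diff[OF tendsto_const h] lim]) (use xa in \<open>auto intro: less_imp_le\<close>)
 moreover have "l \<le> b + 0"
  by (rule LIMSEQ_le[OF lim tendsto_add[OF tendsto_const h]]) (use xb in \<open>auto intro: less_imp_le\<close>)
 moreover have "min (f l) (left_limit f l) \<le> f s + \<alpha> * \<bar>l - s\<bar>" for s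
 proof -
  have rat: "min (f l) (left_limit f l) \<le> f (of_rat s) + \<alpha> * \<bar>l - of_rat s\<bar>" for s :: rat
  proof (rule field_le_epsilon)
   fix e :: real assume "0 < e"
   obtain d where d: "0 < d" "\<And>s. \<bar>s - l\<bar> < d \<Longrightarrow> min (f l) (left_limit f l) - e < f s"
    using cadlag_lower_eps[OF f \<open>0 < e\<close>, of l] by metis
   have ev: "eventually (\<lambda>n. dist ((x \<circ> r) n) l < d) sequentially" by (rule tendstoD[OF lim d(1)])
   have "(\<lambda>n. f (of_rat s) + \<alpha> * \<bar>(x \<circ> r) n - of_rat s\<bar> + 1 / real (Suc (r n))) \<longlonglongrightarrow> f (of_rat s) + \<alpha> * \<bar>l - of_rat s\<bar> + 0"
    by (intro tendsto_intros lim h)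
   then have "min (f l) (left_limit f l) - e \<le> f (of_rat s) + \<alpha> * \<bar>l - of_rat s\<bar> + 0"
   proof (rule tendsto_lowerbound)
    show "\<forall>\<^sub>F n in sequentially. min (f l) (left_limit f l) - e \<le> f (of_rat s) + \<alpha> * \<bar>(x \<circ> r) n - of_rat s\<bar> + 1 / real (Suc (r n))"
     using ev
    proof eventually_elim
     case (elim n)
     then show ?case using d(2)[of "x (r n)"] xs[of "r n" s] by (simp add: dist_real_def del: of_nat_Suc)
    qed
   qed simp
   then show "min (f l) (left_limit f l) \<le> f (of_rat s) + \<alpha> * \<bar>l - of_rat s\<bar> + e" by simp
  qed
  show ?thesis
  proof (rule field_le_epsilon)
   fix e :: real assume "0 < e"
   define d where "d = e / (2 * (\<alpha> + 1))"
   have d: "0 < d" using \<open>0 < e\<close> \<alpha> by (simp add: d_def)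
   have ad: "\<alpha> * d \<le> e / 2" using \<alpha> \<open>0 < e\<close> by (simp add: d_def field_simps)
   obtain p :: rat where p: "s < of_rat p" "of_rat p < s + d" "\<bar>f (of_rat p) - f s\<bar> < e / 2"
    using cadlag_rat_right[OF f, of "e/2" s "s + d"] d \<open>0 < e\<close> by auto
   have "\<alpha> * \<bar>l - of_rat p\<bar> \<le> \<alpha> * (\<bar>l - s\<bar> + d)" using p \<alpha> by (intro mult_left_mono) linarith+
   then show "min (f l) (left_limit f l) \<le> f s + \<alpha> * \<bar>l - s\<bar> + e"
    using rat[of p] p(3) ad unfolding distrib_left by linarith
  qed
 qed
 ultimately show ?L unfolding contact_set_iff[OF f \<alpha>] by (intro bexI[of _ l]) auto
qed

text \<open>The default value \<open>Inf {}\<close> is taken when there is no contact after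
0.\<close>
lemma contact_time_less_iff:
 assumes f: "cadlag_on UNIV f" and \<alpha>: "0 \<le> \<alpha>"
 defines "H \<equiv> \<lambda>(a::rat) (b::rat). \<forall>n::nat. \<exists>q::rat. of_rat a - 1 / real (Suc n) < of_rat q \<and> of_rat q < of_rat b + 1 / real (Suc n) \<and>
   (\<forall>s::rat. f (of_rat q) \<le> f (of_rat s) + \<alpha> * \<bar>of_rat q - of_rat s\<bar> + 1 / real (Suc n))"
 shows "contact_time \<alpha> f < y \<longleftrightarrow>
  (\<exists>a b::rat. 0 < a \<and> of_rat b < y \<and> H a b) \<or> (\<not> (\<exists>a b::rat. 0 < a \<and> H a b) \<and> Inf {} < y)"
proof -
 let ?Z = "contact_set \<alpha> f \<inter> {0<..}"
 have H: "H a b \<longleftrightarrow> (\<exists>t\<in>{of_rat a..of_rat b}. t \<in> contact_set \<alpha> f)" for a b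
  unfolding H_def by (rule contact_between_iff[OF f \<alpha>, symmetric])
 have up: "(\<exists>a b::rat. 0 < a \<and> of_rat b < z \<and> H a b) \<longleftrightarrow> (\<exists>t\<in>?Z. t < z)" for z
 proof
  assume "\<exists>a b::rat. 0 < a \<and> of_rat b < z \<and> H a b"
  then obtain a b :: rat and t where ab: "0 < a" "of_rat b < z" and t: "of_rat a \<le> t" "t \<le> of_rat b" "t \<in> contact_set \<alpha> f"
   unfolding H by auto
  have "0 < (of_rat a::real)" using ab by simp
  then have "0 < t" "t < z" using ab t by linarith+
  then show "\<exists>t\<in>?Z. t < z" using t by auto
 next
  assume "\<exists>t\<in>?Z. t < z"
  then obtain t where t: "t \<in> contact_set \<alpha> f" "0 < t" "t < z" by auto
  obtain a :: rat where a: "0 < (of_rat a::real)" "of_rat a < t" using of_rat_dense[OF t(2)] by blast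
  obtain b :: rat where b: "t < of_rat b" "of_rat b < z" using of_rat_dense[OF t(3)] by blast
  show "\<exists>a b::rat. 0 < a \<and> of_rat b < z \<and> H a b"
   unfolding H using a b t by (intro exI[of _ a] exI[of _ b]) auto
 qed
 have ne: "(\<exists>a b::rat. 0 < a \<and> H a b) \<longleftrightarrow> ?Z \<noteq> {}"
 proof
  assume "\<exists>a b::rat. 0 < a \<and> H a b"
  then obtain a b where ab: "0 < a" "H a b" by blast
  obtain z where "of_rat b < (z::real)" using gt_ex by blast
  then show "?Z \<noteq> {}" using up[of z] ab by blast
 next
  assume "?Z \<noteq> {}"
  then obtain t where "t \<in> ?Z" by blast
  then have "\<exists>t'\<in>?Z. t' < t + 1" by (intro bexI[of _ t]) auto
  then show "\<exists>a b::rat. 0 < a \<and> H a b" using up[of "t + 1"] by blast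
 qed
 have bdd: "bdd_below ?Z" by (rule bdd_belowI[of _ 0]) auto
 show ?thesis
 proof (cases "?Z = {}")
  case True
  then show ?thesis using up[of y] ne unfolding contact_time_def by auto
 next
  case False
  then show ?thesis using up[of y] ne cInf_less_iff[OF False bdd, of y] unfolding contact_time_def by auto
 qed
qed

lemma cadlag_countable_jumps:
 assumes f: "cadlag_on UNIV f"
 shows "countable {t. left_limit f t \<noteq> f t}"
proof -
 define J where "J m k = {t\<in>{- real k..real k}. 1 / real (Suc m) < \<bar>left_limit f t - f t\<bar>}" for m k :: nat
 have "finite (J m k)" for m k
 proof (rule ccontr)
  assume "infinite (J m k)"
  moreover have "J m k \<subseteq> {- real k..real k}" unfolding J_def by blast
  ultimately obtain x where x: "x islimpt J m k"
   using Heine_Borel_imp_Bolzano_Weierstrass[OF compact_Icc, of "J m k" "- real k" "real k"] by blast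
  define e where "e = 1 / (2 * real (Suc m))"
  have e: "0 < e" "2 * e = 1 / real (Suc m)" by (simp_all add: e_def field_simps)
  obtain d1 where d1: "0 < d1" "\<And>s. x \<le> s \<Longrightarrow> s < x + d1 \<Longrightarrow> \<bar>f s - f x\<bar> < e"
   using cadlag_right_eps[OF f e(1), of x] by metis
  obtain d2 where d2: "0 < d2" "\<And>s. x - d2 < s \<Longrightarrow> s < x \<Longrightarrow> \<bar>f s - left_limit f x\<bar> < e"
   using cadlag_left_eps[OF f e(1), of x] by metis
  obtain t where t: "t \<in> J m k" "t \<noteq> x" "dist t x < min d1 d2"
   using x d1(1) d2(1) unfolding islimpt_approachable by (metis min_less_iff_conj)
  have near: "\<bar>left_limit f t - c\<bar> \<le> e" if "r < t" "\<And>s. r < s \<Longrightarrow> s < t \<Longrightarrow> \<bar>f s - c\<bar> < e" for r c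
  proof -
   have "eventually (\<lambda>s. \<bar>f s - c\<bar> \<le> e) (at_left t)"
    unfolding eventually_at_left_field using that by (meson less_imp_le)
   then show ?thesis
    by (intro tendsto_upperbound[OF tendsto_rabs[OF tendsto_diff[OF cadlag_tendsto_left[OF f] tendsto_const]]]) simp_all
  qed
  have "\<bar>left_limit f t - f t\<bar> \<le> 2 * e"
  proof (cases "x < t")
   case True
   have "\<bar>left_limit f t - f x\<bar> \<le> e"
    by (rule near[OF True]) (use d1(2) t in \<open>auto simp: dist_real_def\<close>)
   moreover have "\<bar>f t - f x\<bar> < e" using d1(2)[of t] True t by (auto simp: dist_real_def)
   ultimately show ?thesis by linarith
  next
   case False
   then have "t < x" using t by simp
   have "\<bar>left_limit f t - left_limit f x\<bar> \<le> e"
    by (rule near[of "x - d2"]) (use d2(2) t \<open>t < x\<close> in \<open>auto simp: dist_real_def\<close>)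
   moreover have "\<bar>f t - left_limit f x\<bar> < e" using d2(2)[of t] \<open>t < x\<close> t by (auto simp: dist_real_def)
   ultimately show ?thesis by linarith
  qed
  then show False using t(1) e(2) by (simp add: J_def)
 qed
 moreover have "{t. left_limit f t \<noteq> f t} \<subseteq> (\<Union>m k. J m k)"
 proof
  fix t assume "t \<in> {t. left_limit f t \<noteq> f t}"
  then have "0 < \<bar>left_limit f t - f t\<bar>" by simp
  then obtain m where "1 / real (Suc m) < \<bar>left_limit f t - f t\<bar>" using nat_approx_posE by blast
  moreover obtain k :: nat where "\<bar>t\<bar> \<le> real k" using real_arch_simple by blast
  ultimately have "t \<in> J m k" unfolding J_def by (simp add: abs_le_iff)
  then show "t \<in> (\<Union>m k. J m k)" by blast
 qed
 ultimately show ?thesis by (meson countable_UN countable_finite countable_subset countableI_type)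
qed

lemma cadlag_isCont:
 assumes f: "cadlag_on UNIV f" and "left_limit f t = f t"
 shows "isCont f t"
 unfolding isCont_def filterlim_at_split
 using cadlag_tendsto_left[OF f, of t] cadlag_tendsto_right[OF f, of t] assms(2) by simp

lemma pred_const_imp: "(C \<Longrightarrow> Measurable.pred A P) \<Longrightarrow> Measurable.pred A (\<lambda>x. C \<longrightarrow> P x)"
 by (cases C) simp_all

context regular_levy begin

lemma contact_time_measurable[measurable]: "(\<lambda>\<xi>. contact_time \<alpha> (\<lambda>t. X t \<xi>)) \<in> borel_measurable M"
proof (rule borel_measurableI_less)
 fix y :: real
 define H where "H \<xi> (a::rat) (b::rat) \<longleftrightarrow> (\<forall>n::nat. \<exists>q::rat. of_rat a - 1 / real (Suc n) < of_rat q \<and> of_rat q < of_rat b + 1 / real (Suc n) \<and>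
   (\<forall>s::rat. X (of_rat q) \<xi> \<le> X (of_rat s) \<xi> + \<alpha> * \<bar>of_rat q - of_rat s\<bar> + 1 / real (Suc n)))" for \<xi> a b
 have [measurable]: "Measurable.pred M (\<lambda>\<xi>. H \<xi> a b)" for a b
  unfolding H_def by (intro pred_intros_countable pred_const_conj) measurable
 have "{\<xi>\<in>space M. contact_time \<alpha> (\<lambda>t. X t \<xi>) < y} = {\<xi>\<in>space M.
  (\<exists>a b::rat. 0 < a \<and> of_rat b < y \<and> H \<xi> a b) \<or> (\<not> (\<exists>a b::rat. 0 < a \<and> H \<xi> a b) \<and> Inf {} < y)}"
  unfolding H_def by (intro Collect_cong conj_cong refl contact_time_less_iff X_cadlag less_imp_le[OF alpha])
 also have "\<dots> \<in> sets M" by measurable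
 finally show "{\<xi>\<in>space M. contact_time \<alpha> (\<lambda>t. X t \<xi>) < y} \<in> sets M" .
qed

definition N :: "nat \<Rightarrow> 'a \<Rightarrow> nat" where "N n \<xi> = (LEAST k. lattice_stop \<alpha> (\<lambda>t. X t \<xi>) n k)"
text \<open>The lattice approximation of the contact time.\<close>
definition T :: "nat \<Rightarrow> 'a \<Rightarrow> real" where "T n \<xi> = real (N n \<xi>) / 2 ^ n"
definition D :: "'a \<Rightarrow> real" where "D \<xi> = contact_time \<alpha> (\<lambda>t. X t \<xi>)"

definition R :: "nat \<Rightarrow> (real \<Rightarrow> real) set" where
 "R n = {w\<in>space path_space. \<forall>j::nat. 0 \<le> w (real j / 2 ^ n) + \<alpha> * (real j / 2 ^ n)}"

text \<open>\<open>k/2\<^sup>n\<close> is past \<open>S\<close> and no earlier lattice time could be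
the lattice approximation, as far as the path until \<open>k/2\<^sup>n\<close> shows: each earlier
candidate has already been undercut.\<close>
definition pre :: "nat \<Rightarrow> nat \<Rightarrow> 'a set" where
 "pre n k = {\<xi>\<in>space M. hit \<alpha> (\<lambda>t. X t \<xi>) (real k / 2 ^ n) \<and>
  (\<forall>j. j < k \<longrightarrow> \<not> (hit \<alpha> (\<lambda>t. X t \<xi>) (real j / 2 ^ n) \<and>
    (\<forall>i. j \<le> i \<and> i \<le> k \<longrightarrow> W (real j / 2 ^ n) \<xi> \<le> W (real i / 2 ^ n) \<xi>)))}"

lemma D_measurable[measurable]: "D \<in> borel_measurable M"
 unfolding D_def[abs_def] by measurable

lemma R_sets[measurable]: "R n \<in> sets path_space"
 unfolding R_def by measurable

lemma lattice_le: "j \<le> k \<Longrightarrow> real j / 2 ^ n \<le> real k / 2 ^ n"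
 by (simp add: divide_right_mono)

lemma pre_past: "pre n k \<in> sets (past (real k / 2 ^ n))"
proof -
 let ?P = "past (real k / 2 ^ n)"
 have hit: "Measurable.pred ?P (\<lambda>\<xi>. hit \<alpha> (\<lambda>t. X t \<xi>) (real j / 2 ^ n))" if "j \<le> k" for j
  by (rule measurable_past_mono[OF hit_past lattice_le[OF that]]) simp
 have le: "Measurable.pred ?P (\<lambda>\<xi>. j \<le> i \<and> i \<le> k \<longrightarrow> W (real j / 2 ^ n) \<xi> \<le> W (real i / 2 ^ n) \<xi>)" for i j
 proof (rule pred_const_imp)
  assume ij: "j \<le> i \<and> i \<le> k"
  have m: "Measurable.pred ?P (\<lambda>\<xi>. X x \<xi> + c \<le> X y \<xi> + d)" if "x \<le> real k / 2 ^ n" "y \<le> real k / 2 ^ n" for x y c d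
  proof -
   have [measurable]: "X x \<in> borel_measurable ?P" "X y \<in> borel_measurable ?P" using that by (auto intro: X_past)
   show ?thesis by measurable
  qed
  have "j \<le> k" "i \<le> k" using ij by simp_all
  show "Measurable.pred ?P (\<lambda>\<xi>. W (real j / 2 ^ n) \<xi> \<le> W (real i / 2 ^ n) \<xi>)"
   by (rule m[OF lattice_le[OF \<open>j \<le> k\<close>] lattice_le[OF \<open>i \<le> k\<close>]])
 qed
 have j: "Measurable.pred ?P (\<lambda>\<xi>. j < k \<longrightarrow> \<not> (hit \<alpha> (\<lambda>t. X t \<xi>) (real j / 2 ^ n) \<and>
    (\<forall>i. j \<le> i \<and> i \<le> k \<longrightarrow> W (real j / 2 ^ n) \<xi> \<le> W (real i / 2 ^ n) \<xi>)))" for j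
  by (rule pred_const_imp) (intro pred_intros_logic pred_intros_countable hit le; rule less_imp_le; assumption)
 have "Measurable.pred ?P (\<lambda>\<xi>. hit \<alpha> (\<lambda>t. X t \<xi>) (real k / 2 ^ n) \<and>
  (\<forall>j. j < k \<longrightarrow> \<not> (hit \<alpha> (\<lambda>t. X t \<xi>) (real j / 2 ^ n) \<and>
    (\<forall>i. j \<le> i \<and> i \<le> k \<longrightarrow> W (real j / 2 ^ n) \<xi> \<le> W (real i / 2 ^ n) \<xi>))))"
  by (rule pred_intros_logic(3)[OF hit[OF order_refl] pred_intros_countable(1)[OF j]])
 then show ?thesis unfolding pred_def pre_def space_past .
qed

lemma fut_R_iff: "fut (real k / 2 ^ n) \<xi> \<in> R n \<longleftrightarrow> (\<forall>j\<ge>k. W (real k / 2 ^ n) \<xi> \<le> W (real j / 2 ^ n) \<xi>)"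
proof -
 have *: "0 \<le> fut (real k / 2 ^ n) \<xi> (real i / 2 ^ n) + \<alpha> * (real i / 2 ^ n)
   \<longleftrightarrow> W (real k / 2 ^ n) \<xi> \<le> W (real (k + i) / 2 ^ n) \<xi>" for i
 proof -
  have "real (k + i) / 2 ^ n = real k / 2 ^ n + real i / 2 ^ n" by (simp add: add_divide_distrib)
  then show ?thesis by (simp add: fut_eval distrib_left) linarith
 qed
 show ?thesis
  unfolding R_def using * by (auto simp: space_PiM le_iff_add)
qed

lemma lattice_stop_iff:
 "lattice_stop \<alpha> (\<lambda>t. X t \<xi>) n k \<longleftrightarrow> hit \<alpha> (\<lambda>t. X t \<xi>) (real k / 2 ^ n) \<and> fut (real k / 2 ^ n) \<xi> \<in> R n"
 unfolding lattice_stop_def fut_R_iff ..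

text \<open>An earlier lattice time that has not been undercut until \<open>k/2\<^sup>n\<close> will
not be undercut later either, when the path stays above its value at \<open>k/2\<^sup>n\<close>.
Hence the event splits into one of the past and one of the future.\<close>
lemma N_eq_iff:
 assumes w: "\<xi> \<in> space M" and ex: "\<exists>k. lattice_stop \<alpha> (\<lambda>t. X t \<xi>) n k"
 shows "N n \<xi> = k \<longleftrightarrow> \<xi> \<in> pre n k \<and> fut (real k / 2 ^ n) \<xi> \<in> R n"
proof
 assume k: "N n \<xi> = k"
 have stop: "lattice_stop \<alpha> (\<lambda>t. X t \<xi>) n k" using LeastI_ex[OF ex] k by (simp add: N_def)
 have "\<not> lattice_stop \<alpha> (\<lambda>t. X t \<xi>) n j" if "j < k" for j
  using not_less_Least[of j "lattice_stop \<alpha> (\<lambda>t. X t \<xi>) n"] that k by (simp add: N_def)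
 moreover have "lattice_stop \<alpha> (\<lambda>t. X t \<xi>) n j"
  if "j < k" "hit \<alpha> (\<lambda>t. X t \<xi>) (real j / 2 ^ n)" "\<forall>i. j \<le> i \<and> i \<le> k \<longrightarrow> W (real j / 2 ^ n) \<xi> \<le> W (real i / 2 ^ n) \<xi>" for j
  unfolding lattice_stop_def
 proof (intro conjI allI impI)
  fix i assume "j \<le> i"
  show "W (real j / 2 ^ n) \<xi> \<le> W (real i / 2 ^ n) \<xi>"
  proof (cases "i \<le> k")
   case True then show ?thesis using that \<open>j \<le> i\<close> by blast
  next
   case False
   have "W (real j / 2 ^ n) \<xi> \<le> W (real k / 2 ^ n) \<xi>" using that by simp
   also have "\<dots> \<le> W (real i / 2 ^ n) \<xi>" using stop False unfolding lattice_stop_def by simp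
   finally show ?thesis .
  qed
 qed (rule that)
 ultimately have "\<forall>j. j < k \<longrightarrow> \<not> (hit \<alpha> (\<lambda>t. X t \<xi>) (real j / 2 ^ n) \<and>
    (\<forall>i. j \<le> i \<and> i \<le> k \<longrightarrow> W (real j / 2 ^ n) \<xi> \<le> W (real i / 2 ^ n) \<xi>))" by blast
 then show "\<xi> \<in> pre n k \<and> fut (real k / 2 ^ n) \<xi> \<in> R n"
  using stop w unfolding pre_def lattice_stop_iff by blast
next
 assume k: "\<xi> \<in> pre n k \<and> fut (real k / 2 ^ n) \<xi> \<in> R n"
 show "N n \<xi> = k"
  unfolding N_def
 proof (rule Least_equality)
  show "lattice_stop \<alpha> (\<lambda>t. X t \<xi>) n k" using k unfolding lattice_stop_iff pre_def by blast
  fix j assume j: "lattice_stop \<alpha> (\<lambda>t. X t \<xi>) n j"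
  show "k \<le> j"
  proof (rule ccontr)
   assume "\<not> k \<le> j"
   then have "j < k" by simp
   then show False using j k unfolding lattice_stop_def pre_def by blast
  qed
 qed
qed

text \<open>Sum over the values of the lattice time and integrate the future out; the future factor
is the same for each value.\<close>
lemma lattice_formula:
 fixes G :: "nat \<Rightarrow> 'a \<Rightarrow> ennreal" and \<Psi> :: "(real \<Rightarrow> real) \<Rightarrow> ennreal"
 assumes G: "\<And>k. G k \<in> borel_measurable (past (real k / 2 ^ n))" and \<Psi>[measurable]: "\<Psi> \<in> borel_measurable path_space"
 shows "(\<integral>\<^sup>+\<xi>. G (N n \<xi>) \<xi> * \<Psi> (fut (T n \<xi>) \<xi>) \<partial>M) =
  (\<Sum>k. \<integral>\<^sup>+\<xi>. indicator (pre n k) \<xi> * G k \<xi> \<partial>M) * (\<integral>\<^sup>+\<xi>. indicator (R n) (fut 0 \<xi>) * \<Psi> (fut 0 \<xi>) \<partial>M)"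
proof -
 let ?f = "\<lambda>k \<xi>. (indicator (pre n k) \<xi> * G k \<xi>) * (indicator (R n) (fut (real k / 2 ^ n) \<xi>) * \<Psi> (fut (real k / 2 ^ n) \<xi>))"
 have preG: "(\<lambda>\<xi>. indicator (pre n k) \<xi> * G k \<xi>) \<in> borel_measurable (past (real k / 2 ^ n))" for k
  using G pre_past by (intro borel_measurable_times_ennreal borel_measurable_indicator)
 have preGM[measurable]: "(\<lambda>\<xi>. indicator (pre n k) \<xi> * G k \<xi>) \<in> borel_measurable M" for k
  by (rule measurable_past_M[OF preG])
 have "(\<integral>\<^sup>+\<xi>. G (N n \<xi>) \<xi> * \<Psi> (fut (T n \<xi>) \<xi>) \<partial>M) = (\<integral>\<^sup>+\<xi>. (\<Sum>k. ?f k \<xi>) \<partial>M)"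
 proof (rule nn_integral_cong_AE)
  show "AE \<xi> in M. G (N n \<xi>) \<xi> * \<Psi> (fut (T n \<xi>) \<xi>) = (\<Sum>k. ?f k \<xi>)"
   using AE_good_path AE_space
  proof eventually_elim
   case (elim \<xi>)
   have ex: "\<exists>k. lattice_stop \<alpha> (\<lambda>t. X t \<xi>) n k" by (rule good_path.lattice_stop_exists[OF elim(1), of n]) blast
   note iff = N_eq_iff[OF elim(2) ex]
   have "(\<Sum>k. ?f k \<xi>) = (\<Sum>k\<in>{N n \<xi>}. ?f k \<xi>)"
   proof (rule suminf_finite)
    fix k assume "k \<notin> {N n \<xi>}"
    then have "\<not> (\<xi> \<in> pre n k \<and> fut (real k / 2 ^ n) \<xi> \<in> R n)" using iff[of k] by auto
    then show "?f k \<xi> = 0" by (auto simp: indicator_def)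
   qed simp
   also have "\<dots> = G (N n \<xi>) \<xi> * \<Psi> (fut (T n \<xi>) \<xi>)"
    using iff[of "N n \<xi>"] by (simp add: T_def)
   finally show ?case by simp
  qed
 qed
 also have "\<dots> = (\<Sum>k. \<integral>\<^sup>+\<xi>. ?f k \<xi> \<partial>M)" by (rule nn_integral_suminf) measurable
 also have "\<dots> = (\<Sum>k. (\<integral>\<^sup>+\<xi>. indicator (pre n k) \<xi> * G k \<xi> \<partial>M) * (\<integral>\<^sup>+\<xi>. indicator (R n) (fut 0 \<xi>) * \<Psi> (fut 0 \<xi>) \<partial>M))"
 proof (rule suminf_cong)
  fix k
  have [measurable]: "(\<lambda>\<xi>. indicator (pre n k) \<xi> * G k \<xi>) \<in> borel_measurable (past (real k / 2 ^ n))" by (rule preG)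
  have "(\<integral>\<^sup>+\<xi>. ?f k \<xi> \<partial>M) = (\<integral>\<^sup>+\<xi>. (\<integral>\<^sup>+\<xi>'. (indicator (pre n k) \<xi> * G k \<xi>) * (indicator (R n) (fut 0 \<xi>') * \<Psi> (fut 0 \<xi>')) \<partial>M) \<partial>M)"
   by (rule nn_integral_fut_past[where F="\<lambda>\<xi> w. (indicator (pre n k) \<xi> * G k \<xi>) * (indicator (R n) w * \<Psi> w)"]) (simp, measurable)
  also have "\<dots> = (\<integral>\<^sup>+\<xi>. (indicator (pre n k) \<xi> * G k \<xi>) * (\<integral>\<^sup>+\<xi>'. indicator (R n) (fut 0 \<xi>') * \<Psi> (fut 0 \<xi>') \<partial>M) \<partial>M)"
   by (intro nn_integral_cong nn_integral_cmult) measurable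
  also have "\<dots> = (\<integral>\<^sup>+\<xi>. indicator (pre n k) \<xi> * G k \<xi> \<partial>M) * (\<integral>\<^sup>+\<xi>. indicator (R n) (fut 0 \<xi>) * \<Psi> (fut 0 \<xi>) \<partial>M)"
   by (rule nn_integral_multc) measurable
  finally show "(\<integral>\<^sup>+\<xi>. ?f k \<xi> \<partial>M) = \<dots>" .
 qed
 also have "\<dots> = (\<Sum>k. \<integral>\<^sup>+\<xi>. indicator (pre n k) \<xi> * G k \<xi> \<partial>M) * (\<integral>\<^sup>+\<xi>. indicator (R n) (fut 0 \<xi>) * \<Psi> (fut 0 \<xi>) \<partial>M)"
  by (rule ennreal_suminf_multc)
 finally show ?thesis .
qed

lemma lattice_independence:
 fixes G :: "nat \<Rightarrow> 'a \<Rightarrow> ennreal" and \<Psi> :: "(real \<Rightarrow> real) \<Rightarrow> ennreal"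
 assumes G: "\<And>k. G k \<in> borel_measurable (past (real k / 2 ^ n))" and \<Psi>: "\<Psi> \<in> borel_measurable path_space"
 shows "(\<integral>\<^sup>+\<xi>. G (N n \<xi>) \<xi> * \<Psi> (fut (T n \<xi>) \<xi>) \<partial>M) =
  (\<integral>\<^sup>+\<xi>. G (N n \<xi>) \<xi> \<partial>M) * (\<integral>\<^sup>+\<xi>. \<Psi> (fut (T n \<xi>) \<xi>) \<partial>M)"
proof -
 let ?S = "\<lambda>G :: nat \<Rightarrow> 'a \<Rightarrow> ennreal. (\<Sum>k. \<integral>\<^sup>+\<xi>. indicator (pre n k) \<xi> * G k \<xi> \<partial>M)"
 let ?I = "\<lambda>\<Psi> :: (real \<Rightarrow> real) \<Rightarrow> ennreal. (\<integral>\<^sup>+\<xi>. indicator (R n) (fut 0 \<xi>) * \<Psi> (fut 0 \<xi>) \<partial>M)"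
 have 1: "(\<integral>\<^sup>+\<xi>. G (N n \<xi>) \<xi> * \<Psi> (fut (T n \<xi>) \<xi>) \<partial>M) = ?S G * ?I \<Psi>" by (rule lattice_formula[OF G \<Psi>])
 have 2: "(\<integral>\<^sup>+\<xi>. G (N n \<xi>) \<xi> \<partial>M) = ?S G * ?I (\<lambda>_. 1)" using lattice_formula[OF G borel_measurable_const[of 1]] by (simp only: mult_1_right)
 have 3: "(\<integral>\<^sup>+\<xi>. \<Psi> (fut (T n \<xi>) \<xi>) \<partial>M) = ?S (\<lambda>_ _. 1) * ?I \<Psi>" by (rule lattice_formula[where G="\<lambda>_ _. 1", unfolded mult_1_left, OF borel_measurable_const \<Psi>])
 (* The two normalising factors are inverse to each other. *)
 have 4: "1 = ?S (\<lambda>_ _. 1) * ?I (\<lambda>_. 1)" using lattice_formula[where G="\<lambda>_ _. 1" and n=n, OF borel_measurable_const borel_measurable_const[of 1]] by (simp only: mult_1_right mult_1_left nn_integral_const emeasure_space_1)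
 have "?S G * ?I \<Psi> = (?S G * ?I \<Psi>) * (?S (\<lambda>_ _. 1) * ?I (\<lambda>_. 1))" by (subst 4[symmetric]) simp
 also have "\<dots> = (?S G * ?I (\<lambda>_. 1)) * (?S (\<lambda>_ _. 1) * ?I \<Psi>)" by (simp only: mult_ac)
 finally show ?thesis unfolding 1 2 3 .
qed

end

section \<open>The Markov identity on the lattice\<close>

lemma pred_ball_countable:
 assumes "countable L" "\<And>i. i \<in> L \<Longrightarrow> Measurable.pred A (\<lambda>x. P x i)"
 shows "Measurable.pred A (\<lambda>x. \<forall>i\<in>L. P x i)"
proof (cases "L = {}")
 case False
 have "(\<forall>i\<in>L. P x i) \<longleftrightarrow> (\<forall>n. P x (from_nat_into L n))" for x
  using from_nat_into[OF False] from_nat_into_surj[OF assms(1)] by metis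
 then show ?thesis using assms(2) from_nat_into[OF False] by (simp only:) (intro pred_intros_countable; blast)
qed simp

context regular_levy begin

lemma N_measurable[measurable]: "N n \<in> measurable M (count_space UNIV)"
proof -
 have "Measurable.pred M (\<lambda>\<xi>. hit \<alpha> (\<lambda>t. X t \<xi>) (real k / 2 ^ n))" for k
  by (rule measurable_past_M[OF hit_past]) simp
 moreover have "Measurable.pred M (\<lambda>\<xi>. fut (real k / 2 ^ n) \<xi> \<in> R n)" for k by measurable
 ultimately have "Measurable.pred M (\<lambda>\<xi>. lattice_stop \<alpha> (\<lambda>t. X t \<xi>) n k)" for k
  unfolding lattice_stop_iff by (rule pred_intros_logic(3))
 then show ?thesis unfolding N_def[abs_def] by (rule measurable_Least)
qed

lemma T_measurable[measurable]: "T n \<in> borel_measurable M"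
proof -
 have "(\<lambda>\<xi>. real (N n \<xi>)) \<in> borel_measurable M" by (rule measurable_compose[OF N_measurable]) simp
 then show ?thesis unfolding T_def[abs_def] by (rule borel_measurable_divide[OF _ borel_measurable_const])
qed

lemma fut_random_measurable[measurable]:
 assumes [measurable]: "S \<in> borel_measurable M"
 shows "(\<lambda>\<xi>. fut (S \<xi>) \<xi>) \<in> measurable M path_space"
 unfolding fut_def by (rule process_measurable_path_space) measurable

text \<open>The expectation of \<open>\<psi>\<close> at time \<open>\<tau>\<close> for the process
started at x, restricted to the event that it is nonnegative at the times in L. For L a lattice this
is the kernel of the approximation, for L dense that of the limit.\<close>
definition surv_mean :: "real set \<Rightarrow> (real \<Rightarrow> ennreal) \<Rightarrow> real \<Rightarrow> real \<Rightarrow> ennreal" where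
 "surv_mean L \<psi> \<tau> x = (\<integral>\<^sup>+\<xi>. (if \<forall>r\<in>L. 0 \<le> x + W r \<xi> then \<psi> (x + W \<tau> \<xi>) else 0) \<partial>M)"

lemma surv_mean_measurable:
 assumes L: "countable L" and [measurable]: "\<psi> \<in> borel_measurable borel"
 shows "surv_mean L \<psi> \<tau> \<in> borel_measurable borel"
proof -
 have [measurable]: "Measurable.pred (borel \<Otimes>\<^sub>M M) (\<lambda>p. \<forall>r\<in>L. 0 \<le> fst p + W r (snd p))"
  by (rule pred_ball_countable[OF L]) measurable
 have "(\<lambda>x. \<integral>\<^sup>+\<xi>. (\<lambda>p. if \<forall>r\<in>L. 0 \<le> fst p + W r (snd p) then \<psi> (fst p + W \<tau> (snd p)) else 0) (x, \<xi>) \<partial>M) \<in> borel_measurable borel"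
  by (rule borel_measurable_nn_integral_fst) measurable
 then show ?thesis by (simp add: surv_mean_def[abs_def])
qed

lemma surv_mean_le_1: "(\<And>y. \<psi> y \<le> 1) \<Longrightarrow> surv_mean L \<psi> \<tau> x \<le> 1"
 unfolding surv_mean_def by (rule order_trans[OF nn_integral_mono[of M _ "\<lambda>_. 1"]]) (auto simp: emeasure_space_1)

lemma freeze_surv_mean:
 assumes u: "0 \<le> u" and \<tau>: "0 \<le> \<tau>" and L: "countable L" "L \<subseteq> {0..}" and [measurable]: "\<psi> \<in> borel_measurable borel"
  and A[measurable]: "A \<in> borel_measurable (past u)"
 shows "(\<integral>\<^sup>+\<xi>. A \<xi> * (if \<forall>r\<in>L. 0 \<le> (x + W u \<xi>) + (fut u \<xi> r + \<alpha> * r)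
   then \<psi> ((x + W u \<xi>) + (fut u \<xi> \<tau> + \<alpha> * \<tau>)) else 0) \<partial>M) = (\<integral>\<^sup>+\<xi>. A \<xi> * surv_mean L \<psi> \<tau> (x + W u \<xi>) \<partial>M)"
proof -
 have [measurable]: "X u \<in> borel_measurable (past u)" by (rule X_past) simp
 let ?K = "\<lambda>\<xi> w. if \<forall>r\<in>L. 0 \<le> (x + W u \<xi>) + (w r + \<alpha> * r) then \<psi> ((x + W u \<xi>) + (w \<tau> + \<alpha> * \<tau>)) else 0"
 have K[measurable]: "(\<lambda>p. ?K (fst p) (snd p)) \<in> borel_measurable (past u \<Otimes>\<^sub>M path_space)"
 proof -
  have [measurable]: "Measurable.pred (past u \<Otimes>\<^sub>M path_space) (\<lambda>p. \<forall>r\<in>L. 0 \<le> (x + W u (fst p)) + (snd p r + \<alpha> * r))"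
   by (rule pred_ball_countable[OF L(1)]) measurable
  show ?thesis by measurable
 qed
 have "(\<integral>\<^sup>+\<xi>. A \<xi> * ?K \<xi> (fut u \<xi>) \<partial>M) = (\<integral>\<^sup>+\<xi>. (\<integral>\<^sup>+\<xi>'. A \<xi> * ?K \<xi> (fut 0 \<xi>') \<partial>M) \<partial>M)"
  by (rule nn_integral_fut_past[OF u, where F="\<lambda>\<xi> w. A \<xi> * ?K \<xi> w"])
   (intro borel_measurable_times_ennreal K measurable_compose[OF measurable_fst A])
 also have "\<dots> = (\<integral>\<^sup>+\<xi>. A \<xi> * surv_mean L \<psi> \<tau> (x + W u \<xi>) \<partial>M)"
 proof (intro nn_integral_cong)
  fix \<xi> assume w: "\<xi> \<in> space M"
  have K0: "(\<lambda>\<xi>'. ?K \<xi> (fut 0 \<xi>')) \<in> borel_measurable M"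
  proof -
   have [measurable]: "Measurable.pred M (\<lambda>\<xi>'. \<forall>r\<in>L. 0 \<le> (x + W u \<xi>) + (fut 0 \<xi>' r + \<alpha> * r))"
    by (rule pred_ball_countable[OF L(1)]) measurable
   show ?thesis by measurable
  qed
  have "(\<integral>\<^sup>+\<xi>'. A \<xi> * ?K \<xi> (fut 0 \<xi>') \<partial>M) = A \<xi> * (\<integral>\<^sup>+\<xi>'. ?K \<xi> (fut 0 \<xi>') \<partial>M)"
   by (rule nn_integral_cmult[OF K0])
  also have "(\<integral>\<^sup>+\<xi>'. ?K \<xi> (fut 0 \<xi>') \<partial>M) = surv_mean L \<psi> \<tau> (x + W u \<xi>)"
   unfolding surv_mean_def
  proof (intro nn_integral_cong)
   fix \<xi>' assume w': "\<xi>' \<in> space M"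
   have "fut 0 \<xi>' r = X r \<xi>'" if "r \<in> L" for r using fut_eval(1)[OF w'] that L(2) by auto
   then show "?K \<xi> (fut 0 \<xi>') = (if \<forall>r\<in>L. 0 \<le> x + W u \<xi> + W r \<xi>' then \<psi> (x + W u \<xi> + W \<tau> \<xi>') else 0)"
    using fut_eval(1)[OF w' \<tau>] by simp
  qed
  finally show "(\<integral>\<^sup>+\<xi>'. A \<xi> * ?K \<xi> (fut 0 \<xi>') \<partial>M) = A \<xi> * surv_mean L \<psi> \<tau> (x + W u \<xi>)" .
 qed
 finally show ?thesis .
qed

definition tail_lattice :: "nat \<Rightarrow> real \<Rightarrow> real set" where
 "tail_lattice n s = (\<lambda>j::nat. real j / 2 ^ n - s) ` {j. s \<le> real j / 2 ^ n}"

lemma tail_lattice: "countable (tail_lattice n s)" "tail_lattice n s \<subseteq> {0..}"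
 unfolding tail_lattice_def by auto

text \<open>Nonnegativity on the lattice splits into the lattice times before s, which belong to the
past of s, and those from s on, which are integrated out.\<close>
lemma lattice_survival_kernel:
 assumes s: "0 \<le> s" and \<tau>: "0 \<le> \<tau>" and \<phi>: "(\<lambda>\<xi>. \<phi> (fut 0 \<xi>)) \<in> borel_measurable (past s)"
  and [measurable]: "\<psi> \<in> borel_measurable borel" "\<psi>' \<in> borel_measurable borel"
 shows "(\<integral>\<^sup>+\<xi>. indicator (R n) (fut 0 \<xi>) * (\<phi> (fut 0 \<xi>) * \<psi> (fut 0 \<xi> (s + \<tau>) + \<alpha> * (s + \<tau>)) * \<psi>' (fut 0 \<xi> s + \<alpha> * s)) \<partial>M)
  = (\<integral>\<^sup>+\<xi>. (if \<forall>j\<in>{j::nat. real j / 2 ^ n < s}. 0 \<le> W (real j / 2 ^ n) \<xi> then \<phi> (fut 0 \<xi>) * \<psi>' (W s \<xi>) else 0)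
    * surv_mean (tail_lattice n s) \<psi> \<tau> (0 + W s \<xi>) \<partial>M)"
  (is "?l = (\<integral>\<^sup>+\<xi>. ?A \<xi> * _ \<partial>M)")
proof -
 have [measurable]: "X s \<in> borel_measurable (past s)" by (rule X_past) simp
 note \<phi>[measurable]
 have [measurable]: "Measurable.pred (past s) (\<lambda>\<xi>. \<forall>j\<in>{j::nat. real j / 2 ^ n < s}. 0 \<le> W (real j / 2 ^ n) \<xi>)"
 proof (rule pred_ball_countable)
  fix j :: nat assume j: "j \<in> {j. real j / 2 ^ n < s}"
  have m: "Measurable.pred (past s) (\<lambda>\<xi>. 0 \<le> X u \<xi> + \<alpha> * u)" if "u < s" for u
  proof -
   have [measurable]: "X u \<in> borel_measurable (past s)" using that by (intro X_past) simp
   show ?thesis by measurable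
  qed
  show "Measurable.pred (past s) (\<lambda>\<xi>. 0 \<le> W (real j / 2 ^ n) \<xi>)" by (rule m) (use j in blast)
 qed simp
 have A: "?A \<in> borel_measurable (past s)" by measurable
 have "?l = (\<integral>\<^sup>+\<xi>. ?A \<xi> * (if \<forall>r\<in>tail_lattice n s. 0 \<le> (0 + W s \<xi>) + (fut s \<xi> r + \<alpha> * r)
   then \<psi> ((0 + W s \<xi>) + (fut s \<xi> \<tau> + \<alpha> * \<tau>)) else 0) \<partial>M)"
 proof (intro nn_integral_cong)
  fix \<xi> assume w: "\<xi> \<in> space M"
  have 0: "fut 0 \<xi> r = X r \<xi>" if "0 \<le> r" for r using fut_eval(1)[OF w that] .
  have tail: "(0 + W s \<xi>) + (fut s \<xi> r + \<alpha> * r) = W (s + r) \<xi>" if "0 \<le> r" for r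
   using fut_eval(2)[OF that, of s \<xi>] by (simp add: distrib_left)
  have "fut 0 \<xi> \<in> R n \<longleftrightarrow> (\<forall>j::nat. 0 \<le> W (real j / 2 ^ n) \<xi>)"
   unfolding R_def using 0 by (simp add: space_PiM)
  also have "\<dots> \<longleftrightarrow> (\<forall>j\<in>{j::nat. real j / 2 ^ n < s}. 0 \<le> W (real j / 2 ^ n) \<xi>) \<and>
    (\<forall>j\<in>{j::nat. s \<le> real j / 2 ^ n}. 0 \<le> W (real j / 2 ^ n) \<xi>)" using le_less_linear[of s] by blast
  also have "(\<forall>j\<in>{j::nat. s \<le> real j / 2 ^ n}. 0 \<le> W (real j / 2 ^ n) \<xi>) \<longleftrightarrow>
    (\<forall>r\<in>tail_lattice n s. 0 \<le> (0 + W s \<xi>) + (fut s \<xi> r + \<alpha> * r))"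
  proof -
   have "(0 \<le> (0 + W s \<xi>) + (fut s \<xi> (real j / 2 ^ n - s) + \<alpha> * (real j / 2 ^ n - s))) \<longleftrightarrow> 0 \<le> W (real j / 2 ^ n) \<xi>"
    if "s \<le> real j / 2 ^ n" for j :: nat
   proof -
    have r: "0 \<le> real j / 2 ^ n - s" "s + (real j / 2 ^ n - s) = real j / 2 ^ n" using that by simp_all
    show ?thesis unfolding tail[OF r(1)] r(2) ..
   qed
   then show ?thesis unfolding tail_lattice_def by auto
  qed
  finally have R: "fut 0 \<xi> \<in> R n \<longleftrightarrow> (\<forall>j\<in>{j::nat. real j / 2 ^ n < s}. 0 \<le> W (real j / 2 ^ n) \<xi>) \<and>
    (\<forall>r\<in>tail_lattice n s. 0 \<le> (0 + W s \<xi>) + (fut s \<xi> r + \<alpha> * r))" .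
  show "indicator (R n) (fut 0 \<xi>) * (\<phi> (fut 0 \<xi>) * \<psi> (fut 0 \<xi> (s + \<tau>) + \<alpha> * (s + \<tau>)) * \<psi>' (fut 0 \<xi> s + \<alpha> * s)) =
   ?A \<xi> * (if \<forall>r\<in>tail_lattice n s. 0 \<le> (0 + W s \<xi>) + (fut s \<xi> r + \<alpha> * r)
   then \<psi> ((0 + W s \<xi>) + (fut s \<xi> \<tau> + \<alpha> * \<tau>)) else 0)"
   unfolding indicator_def R tail[OF \<tau>] 0[OF s] 0[OF add_nonneg_nonneg[OF s \<tau>]] by (simp add: mult_ac)
 qed
 also have "\<dots> = (\<integral>\<^sup>+\<xi>. ?A \<xi> * surv_mean (tail_lattice n s) \<psi> \<tau> (0 + W s \<xi>) \<partial>M)"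
  by (rule freeze_surv_mean[OF s \<tau> tail_lattice _ A]) measurable
 finally show ?thesis .
qed

text \<open>Both sides are multiplied by the same factor under the decomposition at the lattice
time. In the product of the two kernels at time s, one comes from integrating out the future and the
other from the integrand, and the identity exchanges them.\<close>
lemma lattice_markov:
 assumes s: "0 \<le> s" and \<tau>: "0 \<le> \<tau>" and \<phi>: "(\<lambda>\<xi>. \<phi> (fut 0 \<xi>)) \<in> borel_measurable (past s)"
  and [measurable]: "\<phi> \<in> borel_measurable path_space" "\<psi> \<in> borel_measurable borel"
 defines "Y \<equiv> \<lambda>n r \<xi>. fut (T n \<xi>) \<xi> r + \<alpha> * r"
 shows "(\<integral>\<^sup>+\<xi>. \<phi> (fut (T n \<xi>) \<xi>) * \<psi> (Y n (s + \<tau>) \<xi>) * surv_mean (tail_lattice n s) (\<lambda>_. 1) \<tau> (Y n s \<xi>) \<partial>M) =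
  (\<integral>\<^sup>+\<xi>. \<phi> (fut (T n \<xi>) \<xi>) * surv_mean (tail_lattice n s) \<psi> \<tau> (Y n s \<xi>) \<partial>M)"
proof -
 let ?k = "\<lambda>\<psi>. surv_mean (tail_lattice n s) \<psi> \<tau>"
 have k[measurable]: "?k \<psi> \<in> borel_measurable borel" "?k (\<lambda>_. 1) \<in> borel_measurable borel"
  by (intro surv_mean_measurable tail_lattice; measurable)+
 let ?P1 = "\<lambda>w :: real \<Rightarrow> real. \<phi> w * \<psi> (w (s + \<tau>) + \<alpha> * (s + \<tau>)) * ?k (\<lambda>_. 1) (w s + \<alpha> * s)"
 let ?P2 = "\<lambda>w :: real \<Rightarrow> real. \<phi> w * 1 * ?k \<psi> (w s + \<alpha> * s)"
 let ?I = "\<lambda>\<Psi> :: (real \<Rightarrow> real) \<Rightarrow> ennreal. (\<integral>\<^sup>+\<xi>. indicator (R n) (fut 0 \<xi>) * \<Psi> (fut 0 \<xi>) \<partial>M)"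
 have if_swap: "(if C then a * b else 0) * c = (if C then a * c else 0) * (b :: ennreal)" for C a b c
  by (simp add: mult_ac)
 have I: "?I ?P1 = ?I ?P2"
  unfolding lattice_survival_kernel[OF s \<tau> \<phi> assms(5) k(2)] 
   lattice_survival_kernel[OF s \<tau> \<phi> borel_measurable_const k(1)]
  by (rule nn_integral_cong) (simp only: add_0, rule if_swap)
 have P: "?P1 \<in> borel_measurable path_space" "?P2 \<in> borel_measurable path_space" by measurable
 note F = lattice_formula[where G="\<lambda>_ _. 1" and n=n, unfolded mult_1_left, OF borel_measurable_const]
 have "(\<integral>\<^sup>+\<xi>. ?P1 (fut (T n \<xi>) \<xi>) \<partial>M) = (\<integral>\<^sup>+\<xi>. ?P2 (fut (T n \<xi>) \<xi>) \<partial>M)"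
  unfolding F[OF P(1)] F[OF P(2)] I ..
 then show ?thesis unfolding Y_def mult_1_right .
qed

end

section \<open>Continuity of the survivor kernel\<close>

context regular_levy begin

abbreviation "rats_nonneg \<equiv> (of_rat :: rat \<Rightarrow> real) ` {0..}"

lemma survival_rat_iff:
 assumes w: "\<xi> \<in> space M"
 shows "(\<forall>r\<in>rats_nonneg. c \<le> W r \<xi>) \<longleftrightarrow> (\<forall>t\<ge>0. c \<le> W t \<xi>)"
proof
 assume r: "\<forall>r\<in>rats_nonneg. c \<le> W r \<xi>"
 show "\<forall>t\<ge>0. c \<le> W t \<xi>"
 proof (intro allI impI, rule field_le_epsilon)
  fix t e :: real assume "0 \<le> t" "0 < e"
  have "t < t + 1" by simp
  then obtain q :: rat where q: "t < of_rat q" "\<bar>W (of_rat q) \<xi> - W t \<xi>\<bar> < e"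
   by (rule cadlag_rat_right[OF W_cadlag[OF w] \<open>0 < e\<close>])
  have "0 \<le> (of_rat q :: real)" using q(1) \<open>0 \<le> t\<close> by linarith
  then have "of_rat q \<in> rats_nonneg" by (intro imageI) simp
  then have "c \<le> W (of_rat q) \<xi>" using r by (rule bspec[rotated])
  then show "c \<le> W t \<xi> + e" using q(2) by linarith
 qed
qed auto

text \<open>The event that \<open>x + W\<close> stays nonnegative is stable under small changes of x
and of the set of times unless the infimum of \<open>W\<close> is exactly \<open>-x\<close>, which
has probability 0.\<close>
lemma surv_mean_tendsto:
 assumes x: "0 < x" and xn: "xn \<longlonglongrightarrow> x"
  and L: "\<And>n. countable (L n)" "\<And>n. L n \<subseteq> {0..}"
  and dense: "\<And>a b. 0 \<le> a \<Longrightarrow> a < b \<Longrightarrow> eventually (\<lambda>n. \<exists>r\<in>L n. a < r \<and> r < b) sequentially"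
  and \<psi>[measurable]: "\<psi> \<in> borel_measurable borel" and cont: "\<And>yn y. yn \<longlonglongrightarrow> y \<Longrightarrow> (\<lambda>n. \<psi> (yn n)) \<longlonglongrightarrow> \<psi> y"
  and le1: "\<And>y. \<psi> y \<le> 1"
 shows "(\<lambda>n. surv_mean (L n) \<psi> \<tau> (xn n)) \<longlonglongrightarrow> surv_mean rats_nonneg \<psi> \<tau> x"
 unfolding surv_mean_def
proof (rule nn_integral_dominated_convergence[where w="\<lambda>_. 1"])
 have pm: "Measurable.pred M (\<lambda>\<xi>. \<forall>r\<in>L. 0 \<le> y + W r \<xi>)" if "countable L" for L y
  by (rule pred_ball_countable[OF that]) measurable
 note [measurable] = pm[OF L(1)] pm[of rats_nonneg]
 show "(\<lambda>\<xi>. if \<forall>r\<in>L n. 0 \<le> xn n + W r \<xi> then \<psi> (xn n + W \<tau> \<xi>) else 0) \<in> borel_measurable M" for n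
  by measurable
 show "(\<lambda>\<xi>. if \<forall>r\<in>rats_nonneg. 0 \<le> x + W r \<xi> then \<psi> (x + W \<tau> \<xi>) else 0) \<in> borel_measurable M"
  by (intro measurable_If pm) (simp_all, measurable)
 show "(\<integral>\<^sup>+ \<xi>. 1 \<partial>M) < \<infinity>" by (simp add: emeasure_space_1)
 show "AE \<xi> in M. (if \<forall>r\<in>L n. 0 \<le> xn n + W r \<xi> then \<psi> (xn n + W \<tau> \<xi>) else 0) \<le> 1" for n
  using le1 by auto
 show "AE \<xi> in M. (\<lambda>n. if \<forall>r\<in>L n. 0 \<le> xn n + W r \<xi> then \<psi> (xn n + W \<tau> \<xi>) else 0)
  \<longlonglongrightarrow> (if \<forall>r\<in>rats_nonneg. 0 \<le> x + W r \<xi> then \<psi> (x + W \<tau> \<xi>) else 0)"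
  using AE_future_inf_no_atom[OF x] AE_space
 proof eventually_elim
  case (elim \<xi>)
  have eq: "0 \<le> x + y \<longleftrightarrow> - x \<le> y" for y by (rule iffI; linarith)
  have surv: "(\<forall>r\<in>rats_nonneg. 0 \<le> x + W r \<xi>) \<longleftrightarrow> (\<forall>t\<ge>0. - x \<le> W t \<xi>)"
   unfolding survival_rat_iff[OF elim(2), symmetric] eq ..
  show ?case
  proof (cases "\<forall>t\<ge>0. - x \<le> W t \<xi>")
   case True
   have "ereal (- x) \<le> future_inf (fut 0 \<xi>)"
    unfolding future_inf_def
   proof (rule INF_greatest)
    fix q :: rat assume "q \<in> {q. 0 \<le> q}"
    then have q: "0 \<le> (of_rat q :: real)" by simp
    show "ereal (- x) \<le> ereal (fut 0 \<xi> (of_rat q) + \<alpha> * of_rat q)"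
     using True q fut_eval(1)[OF elim(2) q] by simp
   qed
   then have "ereal (- x) < future_inf (fut 0 \<xi>)" using elim(1) by (simp add: less_le)
   then obtain z where z: "ereal (- x) < ereal z" "ereal z < future_inf (fut 0 \<xi>)" using ereal_dense2 by blast
   have Wz: "\<forall>t\<ge>0. z \<le> W t \<xi>"
    unfolding survival_rat_iff[OF elim(2), symmetric]
   proof
    fix r assume "r \<in> rats_nonneg"
    then obtain q :: rat where q: "r = of_rat q" "0 \<le> q" by auto
    have r0: "0 \<le> r" using q by simp
    have "future_inf (fut 0 \<xi>) \<le> ereal (fut 0 \<xi> (of_rat q) + \<alpha> * of_rat q)"
     unfolding future_inf_def by (rule INF_lower) (use q in simp)
    then have "ereal z < ereal (W r \<xi>)" using z(2) fut_eval(1)[OF elim(2) r0] unfolding q(1) by (metis less_le_trans)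
    then show "z \<le> W r \<xi>" by simp
   qed
   have "- z < x" using z(1) by simp
   then have ev: "eventually (\<lambda>n. - z < xn n) sequentially" using xn by (rule order_tendstoD(1)[rotated])
   have "(\<lambda>n. \<psi> (xn n + W \<tau> \<xi>)) \<longlonglongrightarrow> \<psi> (x + W \<tau> \<xi>)" by (intro cont tendsto_intros xn)
   moreover have "eventually (\<lambda>n. \<psi> (xn n + W \<tau> \<xi>) = (if \<forall>r\<in>L n. 0 \<le> xn n + W r \<xi> then \<psi> (xn n + W \<tau> \<xi>) else 0)) sequentially"
    using ev
   proof eventually_elim
    case (elim n)
    have "0 \<le> xn n + W r \<xi>" if "r \<in> L n" for r
    proof -
     have "0 \<le> r" using L(2) that by auto
     then have "z \<le> W r \<xi>" using Wz by blast
     then show ?thesis using elim by linarith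
    qed
    then show ?case by simp
   qed
   ultimately show ?thesis unfolding surv using True by (simp add: Lim_transform_eventually)
  next
   case False
   then obtain t where t: "0 \<le> t" "W t \<xi> < - x" by (auto simp: not_le)
   define e where "e = (- x - W t \<xi>) / 2"
   have e: "0 < e" "x + W t \<xi> = - (2 * e)" using t by (simp_all add: e_def field_simps)
   obtain d where d: "0 < d" "\<And>s. t \<le> s \<Longrightarrow> s < t + d \<Longrightarrow> \<bar>W s \<xi> - W t \<xi>\<bar> < e"
    using cadlag_right_eps[OF W_cadlag[OF elim(2)] e(1), of t] by metis
   have "eventually (\<lambda>n. \<exists>r\<in>L n. t < r \<and> r < t + d) sequentially" by (rule dense) (use t d in simp_all)
   moreover have "eventually (\<lambda>n. xn n < x + e) sequentially" by (rule order_tendstoD(2)[OF xn]) (use e in simp)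
   ultimately have "eventually (\<lambda>n. 0 = (if \<forall>r\<in>L n. 0 \<le> xn n + W r \<xi> then \<psi> (xn n + W \<tau> \<xi>) else 0)) sequentially"
   proof eventually_elim
    case (elim n)
    then obtain r where r: "r \<in> L n" "t < r" "r < t + d" by blast
    have "\<bar>W r \<xi> - W t \<xi>\<bar> < e" using d(2)[of r] r by simp
    then have "xn n + W r \<xi> < 0" using elim(2) e(2) by linarith
    then have "\<not> (\<forall>r\<in>L n. 0 \<le> xn n + W r \<xi>)" using r(1) by (meson not_le)
    then show ?case by (rule if_not_P[symmetric])
   qed
   then have "(\<lambda>n. if \<forall>r\<in>L n. 0 \<le> xn n + W r \<xi> then \<psi> (xn n + W \<tau> \<xi>) else 0) \<longlonglongrightarrow> 0"
    by (rule Lim_transform_eventually[OF tendsto_const])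
   then show ?thesis unfolding surv if_not_P[OF False] .
  qed
 qed
qed (rule borel_measurable_const)

lemma dense_rats_nonneg: "0 \<le> a \<Longrightarrow> a < b \<Longrightarrow> \<exists>r\<in>rats_nonneg. a < r \<and> r < b"
proof -
 assume "0 \<le> a" "a < b"
 then obtain q :: rat where q: "a < of_rat q" "of_rat q < b" using of_rat_dense by blast
 have "0 \<le> (of_rat q :: real)" using q(1) \<open>0 \<le> a\<close> by linarith
 then have "0 \<le> q" by simp
 then show ?thesis using q by (intro bexI[of _ "of_rat q"]) auto
qed

lemma dense_tail_lattice:
 assumes s: "0 \<le> s" and ab: "0 \<le> a" "a < b"
 shows "eventually (\<lambda>n. \<exists>r\<in>tail_lattice n s. a < r \<and> r < b) sequentially"
proof -
 have "(\<lambda>n. (1/2::real) ^ n) \<longlonglongrightarrow> 0" by (rule LIMSEQ_power_zero) simp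
 then have "eventually (\<lambda>n. (1/2::real) ^ n < b - a) sequentially" by (rule order_tendstoD(2)) (use ab in simp)
 then show ?thesis
 proof eventually_elim
  case (elim n)
  define j where "j = Suc (nat \<lfloor>(s + a) * 2 ^ n\<rfloor>)"
  have "0 \<le> (s + a) * 2 ^ n" using s ab by simp
  then have j: "(s + a) * 2 ^ n < real j" "real j \<le> (s + a) * 2 ^ n + 1"
   unfolding j_def by linarith+
  have 1: "s + a < real j / 2 ^ n" using j(1) by (simp add: field_simps)
  have "real j / 2 ^ n \<le> ((s + a) * 2 ^ n + 1) / 2 ^ n" by (rule divide_right_mono[OF j(2)]) simp
  also have "\<dots> = (s + a) + (1/2) ^ n" by (simp add: add_divide_distrib power_one_over)
  finally have 2: "real j / 2 ^ n < s + b" using elim by linarith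
  have "real j / 2 ^ n - s \<in> tail_lattice n s" unfolding tail_lattice_def using 1 ab by (intro imageI) simp
  then show ?case using 1 2 by (intro bexI[of _ "real j / 2 ^ n - s"]) linarith+
 qed
qed

end

section \<open>Passage from the lattice to the contact time\<close>

text \<open>Continuous approximations of the indicator of the half-line below b.\<close>
definition ramp :: "nat \<Rightarrow> real \<Rightarrow> real \<Rightarrow> real" where
 "ramp m b x = min 1 (max 0 (real m * (b - x)))"

lemma ramp_range: "0 \<le> ramp m b x" "ramp m b x \<le> 1"
 by (auto simp: ramp_def)

lemma ramp_measurable[measurable]: "ramp m b \<in> borel_measurable borel"
 unfolding ramp_def[abs_def] by measurable

lemma ramp_tendsto: "(f \<longlongrightarrow> x) F \<Longrightarrow> ((\<lambda>n. ramp m b (f n)) \<longlongrightarrow> ramp m b x) F"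
 unfolding ramp_def by (intro tendsto_intros)

lemma ramp_indicator: "(\<lambda>m. ramp m b x) \<longlonglongrightarrow> indicator {..<b} x"
proof (cases "x < b")
 case True
 have "eventually (\<lambda>m. 1 / (b - x) \<le> real m) sequentially"
  using filterlim_real_sequentially by (simp add: filterlim_at_top)
 then have "eventually (\<lambda>m. ramp m b x = 1) sequentially"
 proof eventually_elim
  case (elim m)
  then have "1 \<le> real m * (b - x)" using True by (simp add: field_simps)
  then show ?case by (simp add: ramp_def)
 qed
 then show ?thesis using True by (simp add: tendsto_eventually)
next
 case False
 then have "real m * (b - x) \<le> 0" for m by (simp add: mult_nonneg_nonpos)
 then have "ramp m b x = 0" for m by (simp add: ramp_def max_absorb1)
 then show ?thesis using False by simp
qed

lemma tendsto_real_iff_nat: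
 fixes f :: "nat \<Rightarrow> real"
 shows "f \<longlonglongrightarrow> l \<longleftrightarrow> (\<forall>m::nat. \<exists>i. \<forall>n\<ge>i. \<bar>f n - l\<bar> \<le> 1 / real (Suc m))"
proof
 assume "f \<longlonglongrightarrow> l"
 then show "\<forall>m::nat. \<exists>i. \<forall>n\<ge>i. \<bar>f n - l\<bar> \<le> 1 / real (Suc m)"
  unfolding LIMSEQ_iff real_norm_def by (meson less_imp_le of_nat_0_less_iff zero_less_Suc zero_less_divide_1_iff)
next
 assume R: "\<forall>m::nat. \<exists>i. \<forall>n\<ge>i. \<bar>f n - l\<bar> \<le> 1 / real (Suc m)"
 show "f \<longlonglongrightarrow> l"
 proof (rule LIMSEQ_I)
  fix r :: real assume "0 < r"
  then obtain m :: nat where m: "1 / real (Suc m) < r" using nat_approx_posE by blast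
  from R obtain i where "\<forall>n\<ge>i. \<bar>f n - l\<bar> \<le> 1 / real (Suc m)" by blast
  then show "\<exists>no. \<forall>n\<ge>no. norm (f n - l) < r" using m unfolding real_norm_def by (meson le_less_trans)
 qed
qed

lemma tendsto_mult_le_1:
 fixes f g :: "nat \<Rightarrow> ennreal"
 assumes "f \<longlonglongrightarrow> a" "g \<longlonglongrightarrow> b" "a \<le> 1" "b \<le> 1"
 shows "(\<lambda>n. f n * g n) \<longlonglongrightarrow> a * b"
proof -
 have "a \<noteq> top" "b \<noteq> top" using assms(3,4) by (auto simp: top_unique)
 then show ?thesis by (intro tendsto_mult_ennreal[OF assms(1,2)]) simp
qed

lemma (in prob_space) nn_integral_bounded_convergence:
 fixes F :: "nat \<Rightarrow> 'a \<Rightarrow> ennreal"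
 assumes "\<And>n. F n \<in> borel_measurable M" "G \<in> borel_measurable M" "\<And>n \<xi>. F n \<xi> \<le> 1"
  and "AE \<xi> in M. (\<lambda>n. F n \<xi>) \<longlonglongrightarrow> G \<xi>"
 shows "(\<lambda>n. \<integral>\<^sup>+\<xi>. F n \<xi> \<partial>M) \<longlonglongrightarrow> (\<integral>\<^sup>+\<xi>. G \<xi> \<partial>M)"
 by (rule nn_integral_dominated_convergence[where w="\<lambda>_. 1"]) (use assms in \<open>auto simp: emeasure_space_1\<close>)

lemma (in prob_space) product_formula_limit:
 fixes F G :: "nat \<Rightarrow> 'a \<Rightarrow> real"
 assumes m: "\<And>n. F n \<in> borel_measurable M" "\<And>n. G n \<in> borel_measurable M" "F' \<in> borel_measurable M" "G' \<in> borel_measurable M"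
  and r: "\<And>n \<xi>. 0 \<le> F n \<xi>" "\<And>n \<xi>. F n \<xi> \<le> 1" "\<And>n \<xi>. 0 \<le> G n \<xi>" "\<And>n \<xi>. G n \<xi> \<le> 1" "\<And>\<xi>. F' \<xi> \<le> 1" "\<And>\<xi>. G' \<xi> \<le> 1"
  and lim: "AE \<xi> in M. (\<lambda>n. F n \<xi>) \<longlonglongrightarrow> F' \<xi>" "AE \<xi> in M. (\<lambda>n. G n \<xi>) \<longlonglongrightarrow> G' \<xi>"
  and eq: "\<And>n. (\<integral>\<^sup>+\<xi>. ennreal (G n \<xi> * F n \<xi>) \<partial>M) = (\<integral>\<^sup>+\<xi>. ennreal (G n \<xi>) \<partial>M) * (\<integral>\<^sup>+\<xi>. ennreal (F n \<xi>) \<partial>M)"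
 shows "(\<integral>\<^sup>+\<xi>. ennreal (G' \<xi> * F' \<xi>) \<partial>M) = (\<integral>\<^sup>+\<xi>. ennreal (G' \<xi>) \<partial>M) * (\<integral>\<^sup>+\<xi>. ennreal (F' \<xi>) \<partial>M)"
proof -
 note [measurable] = m
 have 1: "(\<lambda>n. \<integral>\<^sup>+\<xi>. ennreal (G n \<xi> * F n \<xi>) \<partial>M) \<longlonglongrightarrow> (\<integral>\<^sup>+\<xi>. ennreal (G' \<xi> * F' \<xi>) \<partial>M)"
 proof (rule nn_integral_bounded_convergence)
  show "AE \<xi> in M. (\<lambda>n. ennreal (G n \<xi> * F n \<xi>)) \<longlonglongrightarrow> ennreal (G' \<xi> * F' \<xi>)"
   using lim by eventually_elim (intro tendsto_ennrealI tendsto_mult)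
  show "ennreal (G n \<xi> * F n \<xi>) \<le> 1" for n \<xi>
   using mult_le_one[OF r(4) r(1) r(2)] by simp
 qed measurable
 have 2: "(\<lambda>n. \<integral>\<^sup>+\<xi>. ennreal (G n \<xi>) \<partial>M) \<longlonglongrightarrow> (\<integral>\<^sup>+\<xi>. ennreal (G' \<xi>) \<partial>M)"
 proof (rule nn_integral_bounded_convergence)
  show "AE \<xi> in M. (\<lambda>n. ennreal (G n \<xi>)) \<longlonglongrightarrow> ennreal (G' \<xi>)"
   using lim(2) by eventually_elim (rule tendsto_ennrealI)
  show "ennreal (G n \<xi>) \<le> 1" for n \<xi> using r by simp
 qed measurable
 have 3: "(\<lambda>n. \<integral>\<^sup>+\<xi>. ennreal (F n \<xi>) \<partial>M) \<longlonglongrightarrow> (\<integral>\<^sup>+\<xi>. ennreal (F' \<xi>) \<partial>M)"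
 proof (rule nn_integral_bounded_convergence)
  show "AE \<xi> in M. (\<lambda>n. ennreal (F n \<xi>)) \<longlonglongrightarrow> ennreal (F' \<xi>)"
   using lim(1) by eventually_elim (rule tendsto_ennrealI)
  show "ennreal (F n \<xi>) \<le> 1" for n \<xi> using r by simp
 qed measurable
 have b: "(\<integral>\<^sup>+\<xi>. ennreal (H \<xi>) \<partial>M) \<le> 1" if "\<And>\<xi>. H \<xi> \<le> 1" for H :: "'a \<Rightarrow> real"
  by (rule order_trans[OF nn_integral_mono[of M _ "\<lambda>_. 1"]]) (use that in \<open>auto simp: emeasure_space_1\<close>)
 have "(\<lambda>n. \<integral>\<^sup>+\<xi>. ennreal (G n \<xi> * F n \<xi>) \<partial>M) \<longlonglongrightarrow> (\<integral>\<^sup>+\<xi>. ennreal (G' \<xi>) \<partial>M) * (\<integral>\<^sup>+\<xi>. ennreal (F' \<xi>) \<partial>M)"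
  unfolding eq by (rule tendsto_mult_le_1[OF 2 3 b b]) (rule r)+
 then show ?thesis by (rule LIMSEQ_unique[OF 1])
qed

context regular_levy begin

definition Y :: "real \<Rightarrow> 'a \<Rightarrow> real" where "Y r \<xi> = X (r + D \<xi>) \<xi> - X (D \<xi>) \<xi> + \<alpha> * r"

definition Ylat :: "nat \<Rightarrow> real \<Rightarrow> 'a \<Rightarrow> real" where "Ylat n r \<xi> = fut (T n \<xi>) \<xi> r + \<alpha> * r"

lemma Y_measurable[measurable]: "Y r \<in> borel_measurable M"
 unfolding Y_def[abs_def] by measurable

lemma Ylat_measurable[measurable]: "Ylat n r \<in> borel_measurable M"
proof -
 have "(\<lambda>\<xi>. fut (T n \<xi>) \<xi> r) \<in> borel_measurable M"
  by (rule measurable_compose[OF fut_random_measurable[OF T_measurable]]) simp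
 then show ?thesis unfolding Ylat_def[abs_def] by (intro borel_measurable_add borel_measurable_const)
qed

lemma
 assumes "good_path \<alpha> (\<lambda>t. X t \<xi>)"
 shows T_tendsto: "(\<lambda>n. T n \<xi>) \<longlonglongrightarrow> D \<xi>" and X_T_tendsto: "(\<lambda>n. X (T n \<xi>) \<xi>) \<longlonglongrightarrow> X (D \<xi>) \<xi>"
  and Y_pos: "0 < r \<Longrightarrow> 0 < Y r \<xi>"
proof -
 have T: "T n \<xi> = good_path.lat \<alpha> (\<lambda>t. X t \<xi>) n" for n
  unfolding T_def N_def good_path.lat_def[OF assms] ..
 have D: "D \<xi> = good_path.T \<alpha> (\<lambda>t. X t \<xi>)"
  unfolding D_def good_path.contact_time_eq[OF assms] ..
 show "(\<lambda>n. T n \<xi>) \<longlonglongrightarrow> D \<xi>" unfolding T D by (rule good_path.lat_tendsto[OF assms])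
 show "(\<lambda>n. X (T n \<xi>) \<xi>) \<longlonglongrightarrow> X (D \<xi>) \<xi>" unfolding T D by (rule good_path.f_lat_tendsto[OF assms])
 assume "0 < r"
 have "X (D \<xi>) \<xi> + \<alpha> * D \<xi> < X (r + D \<xi>) \<xi> + \<alpha> * (r + D \<xi>)"
  using good_path.W_after_T[OF assms, of "r + D \<xi>"] \<open>0 < r\<close> unfolding D good_path.W_def[OF assms] by simp
 then show "0 < Y r \<xi>" unfolding Y_def by (simp add: distrib_left)
qed

lemma Ylat_tendsto:
 assumes g: "good_path \<alpha> (\<lambda>t. X t \<xi>)" and r: "0 \<le> r" and c: "isCont (\<lambda>t. X t \<xi>) (r + D \<xi>)"
 shows "(\<lambda>n. Ylat n r \<xi>) \<longlonglongrightarrow> Y r \<xi>"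
proof -
 have "(\<lambda>n. r + T n \<xi>) \<longlonglongrightarrow> r + D \<xi>" by (intro tendsto_intros T_tendsto[OF g])
 from isCont_tendsto_compose[OF c this] have 1: "(\<lambda>n. X (r + T n \<xi>) \<xi>) \<longlonglongrightarrow> X (r + D \<xi>) \<xi>" .
 have "Ylat n r \<xi> = X (r + T n \<xi>) \<xi> - X (T n \<xi>) \<xi> + \<alpha> * r" for n
  unfolding Ylat_def fut_eval(2)[OF r] by (simp add: add.commute)
 then show ?thesis unfolding Y_def by (simp only:) (intro tendsto_intros 1 X_T_tendsto[OF g])
qed

lemma Y_right_tendsto:
 assumes w: "\<xi> \<in> space M" and d: "\<delta> \<longlonglongrightarrow> 0" "\<And>k::nat. 0 < \<delta> k"
 shows "(\<lambda>k. Y (r + \<delta> k) \<xi>) \<longlonglongrightarrow> Y r \<xi>"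
proof -
 have "(\<lambda>k. r + \<delta> k + D \<xi>) \<longlonglongrightarrow> r + 0 + D \<xi>" by (intro tendsto_intros d)
 then have "filterlim (\<lambda>k. r + \<delta> k + D \<xi>) (at_right (r + D \<xi>)) sequentially"
  by (intro filterlim_at_withinI) (use d(2) in \<open>auto simp: less_imp_neq[symmetric]\<close>)
 from filterlim_compose[OF cadlag_tendsto_right[OF X_cadlag[OF w]] this]
 have 1: "(\<lambda>k. X (r + \<delta> k + D \<xi>) \<xi>) \<longlonglongrightarrow> X (r + D \<xi>) \<xi>" .
 have "(\<lambda>k. Y (r + \<delta> k) \<xi>) \<longlonglongrightarrow> X (r + D \<xi>) \<xi> - X (D \<xi>) \<xi> + \<alpha> * (r + 0)"
  unfolding Y_def by (intro tendsto_intros 1 d)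
 then show ?thesis unfolding Y_def by simp
qed

text \<open>For a fixed path the exceptional shifts form a countable set. Exchanging the two
quantifiers by Fubini requires continuity in a form that is jointly measurable, here convergence
along a fixed sequence from the left.\<close>
lemma AE_shift_continuity: "AE \<delta> in lborel. AE \<xi> in M. isCont (\<lambda>t. X t \<xi>) (r + \<delta> + D \<xi>)"
proof -
 interpret L: pair_sigma_finite lborel M ..
 define P where "P \<delta> \<xi> \<longleftrightarrow> (\<forall>m::nat. \<exists>i. \<forall>n\<ge>i. \<bar>X (r + \<delta> + D \<xi> - 1 / real (Suc n)) \<xi> - X (r + \<delta> + D \<xi>) \<xi>\<bar> \<le> 1 / real (Suc m))" for \<delta> \<xi>
 have P: "P \<delta> \<xi> \<longleftrightarrow> (\<lambda>n. X (r + \<delta> + D \<xi> - 1 / real (Suc n)) \<xi>) \<longlonglongrightarrow> X (r + \<delta> + D \<xi>) \<xi>" for \<delta> \<xi>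
  unfolding P_def tendsto_real_iff_nat ..
 have h0: "(\<lambda>n. 1 / real (Suc n)) \<longlonglongrightarrow> 0" by real_asymp
 have conv: "(\<lambda>n. t - 1 / real (Suc n)) \<longlonglongrightarrow> t" for t
  using tendsto_diff[OF tendsto_const h0] by simp
 have Pcont: "isCont (\<lambda>t. X t \<xi>) (r + \<delta> + D \<xi>) \<longleftrightarrow> P \<delta> \<xi>" if w: "\<xi> \<in> space M" for \<delta> \<xi>
 proof
  assume "isCont (\<lambda>t. X t \<xi>) (r + \<delta> + D \<xi>)"
  then show "P \<delta> \<xi>" unfolding P by (rule isCont_tendsto_compose[OF _ conv])
 next
  assume p: "P \<delta> \<xi>"
  have "filterlim (\<lambda>n. r + \<delta> + D \<xi> - 1 / real (Suc n)) (at_left (r + \<delta> + D \<xi>)) sequentially"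
   by (intro filterlim_at_withinI conv) auto
  from filterlim_compose[OF cadlag_tendsto_left[OF X_cadlag[OF w]] this]
  have "left_limit (\<lambda>t. X t \<xi>) (r + \<delta> + D \<xi>) = X (r + \<delta> + D \<xi>) \<xi>"
   using p unfolding P by (rule LIMSEQ_unique)
  then show "isCont (\<lambda>t. X t \<xi>) (r + \<delta> + D \<xi>)" by (rule cadlag_isCont[OF X_cadlag[OF w]])
 qed
 have "AE \<xi> in M. AE \<delta> in lborel. P \<delta> \<xi>"
 proof (rule AE_I2)
  fix \<xi> assume w: "\<xi> \<in> space M"
  let ?C = "{t. left_limit (\<lambda>t. X t \<xi>) t \<noteq> X t \<xi>}"
  have "countable ((\<lambda>t. t - D \<xi> - r) ` ?C)"
   by (intro countable_image cadlag_countable_jumps X_cadlag[OF w])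
  from AE_not_in[OF countable_imp_null_set_lborel[OF this]]
  show "AE \<delta> in lborel. P \<delta> \<xi>"
  proof eventually_elim
   case (elim \<delta>)
   have "r + \<delta> + D \<xi> \<notin> ?C"
   proof
    assume "r + \<delta> + D \<xi> \<in> ?C"
    then have "(r + \<delta> + D \<xi>) - D \<xi> - r \<in> (\<lambda>t. t - D \<xi> - r) ` ?C" by (rule imageI)
    then show False using elim by simp
   qed
   then have "left_limit (\<lambda>t. X t \<xi>) (r + \<delta> + D \<xi>) = X (r + \<delta> + D \<xi>) \<xi>" by blast
   from cadlag_isCont[OF X_cadlag[OF w] this] show ?case unfolding Pcont[OF w] .
  qed
 qed
 moreover have "{x \<in> space (lborel \<Otimes>\<^sub>M M). P (fst x) (snd x)} \<in> sets (lborel \<Otimes>\<^sub>M M)"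
  unfolding P_def by measurable
 ultimately have "AE \<delta> in lborel. AE \<xi> in M. P \<delta> \<xi>" using L.AE_commute[of P] by blast
 then show ?thesis
 proof eventually_elim
  case (elim \<delta>)
  then show ?case using AE_space by eventually_elim (use Pcont in blast)
 qed
qed

lemma AE_shift_avoids: "AE \<delta> in lborel. AE \<xi> in M. s - \<delta> \<noteq> D \<xi>"
proof -
 interpret L: pair_sigma_finite lborel M ..
 have "AE \<xi> in M. AE \<delta> in lborel. s - \<delta> \<noteq> D \<xi>"
 proof (rule AE_I2)
  fix \<xi>
  have "AE \<delta> in lborel. \<delta> \<notin> {s - D \<xi>}" by (rule AE_not_in[OF countable_imp_null_set_lborel]) simp
  then show "AE \<delta> in lborel. s - \<delta> \<noteq> D \<xi>" by eventually_elim auto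
 qed
 moreover have "{x \<in> space (lborel \<Otimes>\<^sub>M M). s - fst x \<noteq> D (snd x)} \<in> sets (lborel \<Otimes>\<^sub>M M)"
  by measurable
 ultimately show ?thesis using L.AE_commute[of "\<lambda>\<delta> \<xi>. s - \<delta> \<noteq> D \<xi>"] by blast
qed

lemma good_shift_sequence:
 assumes "finite J" "finite K"
 shows "\<exists>\<delta> :: nat \<Rightarrow> real. (\<forall>k. 0 < \<delta> k) \<and> \<delta> \<longlonglongrightarrow> 0 \<and>
  (\<forall>k. AE \<xi> in M. (\<forall>r\<in>J. isCont (\<lambda>t. X t \<xi>) (r + \<delta> k + D \<xi>)) \<and> (\<forall>s\<in>K. s - \<delta> k \<noteq> D \<xi>))"
proof -
 let ?P = "\<lambda>\<delta>. AE \<xi> in M. (\<forall>r\<in>J. isCont (\<lambda>t. X t \<xi>) (r + \<delta> + D \<xi>)) \<and> (\<forall>s\<in>K. s - \<delta> \<noteq> D \<xi>)"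
 have "AE \<delta> in lborel. \<forall>r\<in>J. AE \<xi> in M. isCont (\<lambda>t. X t \<xi>) (r + \<delta> + D \<xi>)"
  by (rule AE_finite_allI[OF assms(1)]) (rule AE_shift_continuity)
 moreover have "AE \<delta> in lborel. \<forall>s\<in>K. AE \<xi> in M. s - \<delta> \<noteq> D \<xi>"
  by (rule AE_finite_allI[OF assms(2)]) (rule AE_shift_avoids)
 ultimately have P: "AE \<delta> in lborel. ?P \<delta>"
 proof eventually_elim
  case (elim \<delta>)
  have "AE \<xi> in M. \<forall>r\<in>J. isCont (\<lambda>t. X t \<xi>) (r + \<delta> + D \<xi>)" by (rule AE_finite_allI[OF assms(1)]) (use elim in blast)
  moreover have "AE \<xi> in M. \<forall>s\<in>K. s - \<delta> \<noteq> D \<xi>" by (rule AE_finite_allI[OF assms(2)]) (use elim in blast)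
  ultimately show ?case by (rule AE_conjI)
 qed
 have "\<exists>\<delta>. \<forall>k::nat. 0 < \<delta> k \<and> \<delta> k < 1 / real (Suc k) \<and> ?P (\<delta> k)"
  by (intro choice allI AE_lborel_ex_between[OF P]) simp
 then obtain \<delta> where d: "\<forall>k::nat. 0 < \<delta> k \<and> \<delta> k < 1 / real (Suc k) \<and> ?P (\<delta> k)" by (elim exE)
 have h0: "(\<lambda>n. 1 / real (Suc n)) \<longlonglongrightarrow> 0" by real_asymp
 have "\<delta> \<longlonglongrightarrow> 0"
  by (rule tendsto_sandwich[OF _ _ tendsto_const h0]) (use d in \<open>auto intro!: always_eventually less_imp_le\<close>)
 then show ?thesis using d by blast
qed

end

section \<open>Independence and the Markov identity for cylinder events\<close>

lemma prod_if_01: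
 assumes "finite J"
 shows "(\<Prod>j\<in>J. if P j then 1 else (0::real)) = (if \<forall>j\<in>J. P j then 1 else 0)"
 using assms by (induction J rule: finite_induct) auto

lemma (in prob_space) nn_integral_eq_limit:
 fixes F G :: "nat \<Rightarrow> 'a \<Rightarrow> ennreal"
 assumes m: "\<And>n. F n \<in> borel_measurable M" "\<And>n. G n \<in> borel_measurable M" "F' \<in> borel_measurable M" "G' \<in> borel_measurable M"
  and r: "\<And>n \<xi>. F n \<xi> \<le> 1" "\<And>n \<xi>. G n \<xi> \<le> 1"
  and lim: "AE \<xi> in M. (\<lambda>n. F n \<xi>) \<longlonglongrightarrow> F' \<xi>" "AE \<xi> in M. (\<lambda>n. G n \<xi>) \<longlonglongrightarrow> G' \<xi>"
  and eq: "\<And>n. (\<integral>\<^sup>+\<xi>. F n \<xi> \<partial>M) = (\<integral>\<^sup>+\<xi>. G n \<xi> \<partial>M)"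
 shows "(\<integral>\<^sup>+\<xi>. F' \<xi> \<partial>M) = (\<integral>\<^sup>+\<xi>. G' \<xi> \<partial>M)"
proof (rule LIMSEQ_unique)
 show "(\<lambda>n. \<integral>\<^sup>+\<xi>. F n \<xi> \<partial>M) \<longlonglongrightarrow> (\<integral>\<^sup>+\<xi>. F' \<xi> \<partial>M)"
  by (rule nn_integral_bounded_convergence[OF m(1) m(3) r(1) lim(1)])
 show "(\<lambda>n. \<integral>\<^sup>+\<xi>. F n \<xi> \<partial>M) \<longlonglongrightarrow> (\<integral>\<^sup>+\<xi>. G' \<xi> \<partial>M)"
  unfolding eq by (rule nn_integral_bounded_convergence[OF m(2) m(4) r(2) lim(2)])
qed

lemma prod_range:
 fixes f :: "'i \<Rightarrow> real"
 assumes "\<And>j. j \<in> J \<Longrightarrow> 0 \<le> f j \<and> f j \<le> 1"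
 shows "0 \<le> (\<Prod>j\<in>J. f j)" "(\<Prod>j\<in>J. f j) \<le> 1"
 using assms by (auto intro!: prod_nonneg prod_le_1)

context regular_levy begin

text \<open>Three limits are taken one after the other: the lattice is refined for a fixed shift
\<open>\<delta>\<close>, then \<open>\<delta>\<close> tends to 0, then the ramps tend to indicators.
The product formula passes through each.\<close>
lemma independence_cylinder:
 assumes J: "finite J" "J \<subseteq> {0..}" and K: "finite K"
 shows "emeasure M {\<xi>\<in>space M. (\<forall>s\<in>K. s \<le> D \<xi> \<and> X s \<xi> < c s) \<and> (\<forall>j\<in>J. Y j \<xi> < a j)} =
  emeasure M {\<xi>\<in>space M. \<forall>s\<in>K. s \<le> D \<xi> \<and> X s \<xi> < c s} * emeasure M {\<xi>\<in>space M. \<forall>j\<in>J. Y j \<xi> < a j}"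
proof -
 define \<Phi> where "\<Phi> m \<delta> \<xi> = (\<Prod>j\<in>J. ramp m (a j) (Y (j + \<delta>) \<xi>))" for m \<delta> \<xi>
 define G where "G m \<delta> \<xi> = (\<Prod>s\<in>K. if s - \<delta> \<le> D \<xi> then ramp m (c s) (X (s - \<delta>) \<xi>) else 0)" for m \<delta> \<xi>
 have \<Phi>m: "\<Phi> m \<delta> \<in> borel_measurable M" for m \<delta>
  unfolding \<Phi>_def[abs_def] by measurable
 have Gm: "G m \<delta> \<in> borel_measurable M" for m \<delta>
  unfolding G_def[abs_def] by measurable
 have \<Phi>r: "0 \<le> \<Phi> m \<delta> \<xi>" "\<Phi> m \<delta> \<xi> \<le> 1" for m \<delta> \<xi>
  unfolding \<Phi>_def by (intro prod_range conjI ramp_range)+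
 have Gr: "0 \<le> G m \<delta> \<xi>" "G m \<delta> \<xi> \<le> 1" for m \<delta> \<xi>
  unfolding G_def by (intro prod_range; simp add: ramp_range)+
 have step1: "(\<integral>\<^sup>+\<xi>. ennreal (G m \<delta> \<xi> * \<Phi> m \<delta> \<xi>) \<partial>M) = (\<integral>\<^sup>+\<xi>. ennreal (G m \<delta> \<xi>) \<partial>M) * (\<integral>\<^sup>+\<xi>. ennreal (\<Phi> m \<delta> \<xi>) \<partial>M)"
  if d: "0 < \<delta>" and good: "AE \<xi> in M. (\<forall>r\<in>J. isCont (\<lambda>t. X t \<xi>) (r + \<delta> + D \<xi>)) \<and> (\<forall>s\<in>K. s - \<delta> \<noteq> D \<xi>)" for m \<delta>
 proof (rule product_formula_limit)
  define F where "F n \<xi> = (\<Prod>j\<in>J. ramp m (a j) (Ylat n (j + \<delta>) \<xi>))" for n \<xi>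
  define H where "H u \<xi> = (\<Prod>s\<in>K. if s - \<delta> \<le> u then ramp m (c s) (X (s - \<delta>) \<xi>) else 0)" for u \<xi>
  show "F n \<in> borel_measurable M" for n unfolding F_def[abs_def] by measurable
  show "(\<lambda>\<xi>. H (T n \<xi>) \<xi>) \<in> borel_measurable M" for n unfolding H_def[abs_def] by measurable
  show "\<Phi> m \<delta> \<in> borel_measurable M" "G m \<delta> \<in> borel_measurable M" by (rule \<Phi>m Gm)+
  show "0 \<le> F n \<xi>" "F n \<xi> \<le> 1" for n \<xi>
   unfolding F_def by (intro prod_range conjI ramp_range)+
  have Hr: "0 \<le> H u \<xi>" "H u \<xi> \<le> 1" for u \<xi>
   unfolding H_def by (intro prod_range; simp add: ramp_range)+
  show "0 \<le> H (T n \<xi>) \<xi>" "H (T n \<xi>) \<xi> \<le> 1" for n \<xi> by (rule Hr)+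
  show "\<Phi> m \<delta> \<xi> \<le> 1" "G m \<delta> \<xi> \<le> 1" for \<xi> by (rule \<Phi>r Gr)+
  show "AE \<xi> in M. (\<lambda>n. F n \<xi>) \<longlonglongrightarrow> \<Phi> m \<delta> \<xi>"
   using good AE_good_path
  proof eventually_elim
   case (elim \<xi>)
   show ?case unfolding F_def \<Phi>_def
   proof (intro tendsto_prod ramp_tendsto Ylat_tendsto elim)
    fix j assume "j \<in> J"
    then show "0 \<le> j + \<delta>" using J d by auto
    show "isCont (\<lambda>t. X t \<xi>) (j + \<delta> + D \<xi>)" using elim(1) \<open>j \<in> J\<close> by blast
   qed
  qed
  show "AE \<xi> in M. (\<lambda>n. H (T n \<xi>) \<xi>) \<longlonglongrightarrow> G m \<delta> \<xi>"
   using good AE_good_path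
  proof eventually_elim
   case (elim \<xi>)
   show ?case unfolding H_def G_def
   proof (intro tendsto_prod)
    fix s assume s: "s \<in> K"
    have lim: "(\<lambda>n. T n \<xi>) \<longlonglongrightarrow> D \<xi>" by (rule T_tendsto[OF elim(2)])
    have "eventually (\<lambda>n. (s - \<delta> \<le> T n \<xi>) = (s - \<delta> \<le> D \<xi>)) sequentially"
    proof (cases "s - \<delta> < D \<xi>")
     case True
     from order_tendstoD(1)[OF lim True] show ?thesis by eventually_elim (use True in simp)
    next
     case False
     have "s - \<delta> \<noteq> D \<xi>" using elim(1) s by blast
     then have "D \<xi> < s - \<delta>" using False by simp
     from order_tendstoD(2)[OF lim this] show ?thesis by eventually_elim (use \<open>D \<xi> < s - \<delta>\<close> in simp)
    qed
    then show "(\<lambda>n. if s - \<delta> \<le> T n \<xi> then ramp m (c s) (X (s - \<delta>) \<xi>) else 0) \<longlonglongrightarrow>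
      (if s - \<delta> \<le> D \<xi> then ramp m (c s) (X (s - \<delta>) \<xi>) else 0)"
     by (intro tendsto_eventually) (erule eventually_mono, simp)
   qed
  qed
  fix n
  have Hm: "(\<lambda>\<xi>. ennreal (H (real k / 2 ^ n) \<xi>)) \<in> borel_measurable (past (real k / 2 ^ n))" for k
  proof -
   have "H u \<in> borel_measurable (past u)" for u
    unfolding H_def[abs_def]
   proof (rule borel_measurable_prod)
    fix s assume "s \<in> K"
    show "(\<lambda>\<xi>. if s - \<delta> \<le> u then ramp m (c s) (X (s - \<delta>) \<xi>) else 0) \<in> borel_measurable (past u)"
    proof (cases "s - \<delta> \<le> u")
     case True
     then show ?thesis using measurable_compose[OF X_past[OF True] ramp_measurable] by simp
    qed simp
   qed
   from measurable_compose[OF this measurable_ennreal] show ?thesis .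
  qed
  define \<Psi> where "\<Psi> w = ennreal (\<Prod>j\<in>J. ramp m (a j) (w (j + \<delta>) + \<alpha> * (j + \<delta>)))" for w :: "real \<Rightarrow> real"
  have \<Psi>m: "\<Psi> \<in> borel_measurable path_space"
   unfolding \<Psi>_def[abs_def] by measurable
  have \<Psi>F: "\<Psi> (fut (T n \<xi>) \<xi>) = ennreal (F n \<xi>)" for \<xi>
   unfolding \<Psi>_def F_def Ylat_def ..
  from lattice_independence[where G="\<lambda>k \<xi>. ennreal (H (real k / 2 ^ n) \<xi>)" and n=n, OF Hm \<Psi>m]
  have "(\<integral>\<^sup>+\<xi>. ennreal (H (T n \<xi>) \<xi>) * ennreal (F n \<xi>) \<partial>M) =
    (\<integral>\<^sup>+\<xi>. ennreal (H (T n \<xi>) \<xi>) \<partial>M) * (\<integral>\<^sup>+\<xi>. ennreal (F n \<xi>) \<partial>M)"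
   unfolding \<Psi>F T_def[symmetric] .
  then show "(\<integral>\<^sup>+\<xi>. ennreal (H (T n \<xi>) \<xi> * F n \<xi>) \<partial>M) =
    (\<integral>\<^sup>+\<xi>. ennreal (H (T n \<xi>) \<xi>) \<partial>M) * (\<integral>\<^sup>+\<xi>. ennreal (F n \<xi>) \<partial>M)"
   by (simp only: ennreal_mult'[OF Hr(1)])
 qed
 obtain \<delta> :: "nat \<Rightarrow> real" where d0: "\<forall>k. 0 < \<delta> k" and dlim: "\<delta> \<longlonglongrightarrow> 0"
  and good: "\<forall>k. AE \<xi> in M. (\<forall>r\<in>J. isCont (\<lambda>t. X t \<xi>) (r + \<delta> k + D \<xi>)) \<and> (\<forall>s\<in>K. s - \<delta> k \<noteq> D \<xi>)"
  using good_shift_sequence[OF J(1) K] by (elim exE conjE)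
 have nojump: "AE \<xi> in M. \<forall>s\<in>K. left_limit (\<lambda>t. X t \<xi>) s = X s \<xi>"
  by (rule AE_finite_allI[OF K]) (rule AE_no_fixed_jump)
 have step2: "(\<integral>\<^sup>+\<xi>. ennreal (G m 0 \<xi> * \<Phi> m 0 \<xi>) \<partial>M) = (\<integral>\<^sup>+\<xi>. ennreal (G m 0 \<xi>) \<partial>M) * (\<integral>\<^sup>+\<xi>. ennreal (\<Phi> m 0 \<xi>) \<partial>M)" for m
 proof (rule product_formula_limit[where F="\<lambda>k. \<Phi> m (\<delta> k)" and G="\<lambda>k. G m (\<delta> k)", OF \<Phi>m Gm \<Phi>m Gm \<Phi>r Gr \<Phi>r(2) Gr(2)])
  show "AE \<xi> in M. (\<lambda>k. \<Phi> m (\<delta> k) \<xi>) \<longlonglongrightarrow> \<Phi> m 0 \<xi>"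
  proof (rule AE_I2)
   fix \<xi> assume w: "\<xi> \<in> space M"
   show "(\<lambda>k. \<Phi> m (\<delta> k) \<xi>) \<longlonglongrightarrow> \<Phi> m 0 \<xi>"
    unfolding \<Phi>_def add_0_right by (intro tendsto_prod ramp_tendsto Y_right_tendsto[OF w dlim]) (use d0 in blast)
  qed
  show "AE \<xi> in M. (\<lambda>k. G m (\<delta> k) \<xi>) \<longlonglongrightarrow> G m 0 \<xi>"
   using nojump AE_space
  proof eventually_elim
   case (elim \<xi>)
   show ?case unfolding G_def diff_0_right
   proof (intro tendsto_prod)
    fix s assume s: "s \<in> K"
    have lim: "(\<lambda>k. s - \<delta> k) \<longlonglongrightarrow> s" using tendsto_diff[OF tendsto_const dlim] by simp
    show "(\<lambda>k. if s - \<delta> k \<le> D \<xi> then ramp m (c s) (X (s - \<delta> k) \<xi>) else 0) \<longlonglongrightarrow>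
      (if s \<le> D \<xi> then ramp m (c s) (X s \<xi>) else 0)"
    proof (cases "s \<le> D \<xi>")
     case True
     then have le: "s - \<delta> k \<le> D \<xi>" for k using d0[rule_format, of k] by linarith
     have "filterlim (\<lambda>k. s - \<delta> k) (at_left s) sequentially"
      by (intro filterlim_at_withinI lim) (use d0 in \<open>auto simp: less_imp_neq[symmetric]\<close>)
     from filterlim_compose[OF cadlag_tendsto_left[OF X_cadlag[OF elim(2)]] this]
     have "(\<lambda>k. X (s - \<delta> k) \<xi>) \<longlonglongrightarrow> X s \<xi>" using elim(1) s by simp
     from ramp_tendsto[OF this] show ?thesis using True le by simp
    next
     case False
     then have "eventually (\<lambda>k. D \<xi> < s - \<delta> k) sequentially" by (intro order_tendstoD(1)[OF lim]) simp
     then have "eventually (\<lambda>k. (if s - \<delta> k \<le> D \<xi> then ramp m (c s) (X (s - \<delta> k) \<xi>) else 0) = 0) sequentially"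
      by eventually_elim simp
     then show ?thesis using False by (simp add: tendsto_eventually)
    qed
   qed
  qed
  show "(\<integral>\<^sup>+\<xi>. ennreal (G m (\<delta> k) \<xi> * \<Phi> m (\<delta> k) \<xi>) \<partial>M) =
    (\<integral>\<^sup>+\<xi>. ennreal (G m (\<delta> k) \<xi>) \<partial>M) * (\<integral>\<^sup>+\<xi>. ennreal (\<Phi> m (\<delta> k) \<xi>) \<partial>M)" for k
   by (rule step1[OF d0[rule_format] good[rule_format]])
 qed
 define PJ where "PJ \<xi> \<longleftrightarrow> (\<forall>j\<in>J. Y j \<xi> < a j)" for \<xi>
 define PK where "PK \<xi> \<longleftrightarrow> (\<forall>s\<in>K. s \<le> D \<xi> \<and> X s \<xi> < c s)" for \<xi>
 have PJm: "Measurable.pred M PJ" unfolding PJ_def[abs_def] by (rule pred_ball_countable) (use J countable_finite in auto)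
 have PKm: "Measurable.pred M PK" unfolding PK_def[abs_def] by (rule pred_ball_countable) (use K countable_finite in auto)
 note [measurable] = PJm PKm
 have "(\<integral>\<^sup>+\<xi>. ennreal ((if PK \<xi> then 1 else 0) * (if PJ \<xi> then 1 else 0)) \<partial>M) =
   (\<integral>\<^sup>+\<xi>. ennreal (if PK \<xi> then 1 else 0) \<partial>M) * (\<integral>\<^sup>+\<xi>. ennreal (if PJ \<xi> then 1 else 0) \<partial>M)"
 proof (rule product_formula_limit[where F="\<lambda>m. \<Phi> m 0" and G="\<lambda>m. G m 0", OF \<Phi>m Gm _ _ \<Phi>r Gr])
  have eJ: "(if PJ \<xi> then 1 else 0) = (\<Prod>j\<in>J. indicator {..<a j} (Y j \<xi>) :: real)" for \<xi>
   unfolding PJ_def prod_if_01[OF J(1), symmetric] by (intro prod.cong) (auto simp: indicator_def)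
  have eK: "(if PK \<xi> then 1 else 0) = (\<Prod>s\<in>K. if s \<le> D \<xi> then indicator {..<c s} (X s \<xi>) else 0 :: real)" for \<xi>
   unfolding PK_def prod_if_01[OF K, symmetric] by (intro prod.cong) (auto simp: indicator_def)
  show "AE \<xi> in M. (\<lambda>m. \<Phi> m 0 \<xi>) \<longlonglongrightarrow> (if PJ \<xi> then 1 else 0)"
   unfolding eJ \<Phi>_def add_0_right by (intro AE_I2 tendsto_prod ramp_indicator)
  show "AE \<xi> in M. (\<lambda>m. G m 0 \<xi>) \<longlonglongrightarrow> (if PK \<xi> then 1 else 0)"
   unfolding eK G_def diff_0_right
  proof (intro AE_I2 tendsto_prod)
   fix \<xi> s
   show "(\<lambda>m. if s \<le> D \<xi> then ramp m (c s) (X s \<xi>) else 0) \<longlonglongrightarrow> (if s \<le> D \<xi> then indicator {..<c s} (X s \<xi>) else 0)"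
    using ramp_indicator[of "c s" "X s \<xi>"] by (cases "s \<le> D \<xi>") simp_all
  qed
 qed (simp_all add: step2, measurable)
 moreover have "ennreal ((if P then 1 else 0) * (if Q then 1 else 0)) = (if P \<and> Q then 1 else 0)" "ennreal (if P then 1 else 0) = (if P then 1 else 0)" for P Q
  by simp_all
 moreover have "(\<integral>\<^sup>+\<xi>. (if P \<xi> then 1 else 0) \<partial>M) = emeasure M {\<xi>\<in>space M. P \<xi>}" if "Measurable.pred M P" for P
 proof -
  have "(\<integral>\<^sup>+\<xi>. (if P \<xi> then 1 else 0) \<partial>M) = (\<integral>\<^sup>+\<xi>. indicator {\<xi>\<in>space M. P \<xi>} \<xi> \<partial>M)"
   by (intro nn_integral_cong) (simp add: indicator_def)
  also have "\<dots> = emeasure M {\<xi>\<in>space M. P \<xi>}" by (rule nn_integral_indicator) (use that in \<open>simp add: pred_def\<close>)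
  finally show ?thesis .
 qed
 moreover have "Measurable.pred M (\<lambda>\<xi>. PK \<xi> \<and> PJ \<xi>)" by measurable
 ultimately have "emeasure M {\<xi>\<in>space M. PK \<xi> \<and> PJ \<xi>} = emeasure M {\<xi>\<in>space M. PK \<xi>} * emeasure M {\<xi>\<in>space M. PJ \<xi>}"
  using PJm PKm by simp
 then show ?thesis unfolding PJ_def PK_def .
qed

text \<open>The same three limits, applied to the Markov identity on the lattice.\<close>
lemma markov_cylinder:
 fixes a :: "real \<Rightarrow> real"
 assumes J: "finite J" "J \<subseteq> {0..s}" and s: "0 < s" and \<tau>: "0 \<le> \<tau>"
 defines "C \<equiv> {\<xi>\<in>space M. \<forall>j\<in>J. Y j \<xi> < a j}"
 shows "(\<integral>\<^sup>+\<xi>. indicator C \<xi> * indicator {..<b} (Y (s + \<tau>) \<xi>) * surv_mean rats_nonneg (\<lambda>_. 1) \<tau> (Y s \<xi>) \<partial>M) =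
  (\<integral>\<^sup>+\<xi>. indicator C \<xi> * surv_mean rats_nonneg (indicator {..<b}) \<tau> (Y s \<xi>) \<partial>M)"
proof -
 define \<Phi> where "\<Phi> m \<delta> \<xi> = ennreal (\<Prod>j\<in>J. ramp m (a j) (Y (j + \<delta>) \<xi>))" for m \<delta> \<xi>
 define \<psi> where "\<psi> m y = ennreal (ramp m b y)" for m y
 have \<psi>m: "\<psi> m \<in> borel_measurable borel" for m unfolding \<psi>_def[abs_def] by measurable
 have \<psi>1: "\<psi> m y \<le> 1" for m y unfolding \<psi>_def using ramp_range(2) by simp
 have \<psi>c: "(\<lambda>n. \<psi> m (yn n)) \<longlonglongrightarrow> \<psi> m y" if "yn \<longlonglongrightarrow> y" for m yn y
  unfolding \<psi>_def by (intro tendsto_ennrealI ramp_tendsto that)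
 have cQ: "countable rats_nonneg" by simp
 have km: "(\<lambda>\<xi>. surv_mean L \<phi> \<tau> (Z \<xi>)) \<in> borel_measurable M"
  if "countable L" "\<phi> \<in> borel_measurable borel" "Z \<in> borel_measurable M" for L \<phi> Z
  by (rule measurable_compose[OF that(3) surv_mean_measurable[OF that(1,2)]])
 have \<psi>Y: "(\<lambda>\<xi>. \<psi> m (Z \<xi>)) \<in> borel_measurable M" if "Z \<in> borel_measurable M" for m Z
  by (rule measurable_compose[OF that \<psi>m])
 have \<Phi>m: "\<Phi> m \<delta> \<in> borel_measurable M" for m \<delta>
  unfolding \<Phi>_def[abs_def] by measurable
 have \<Phi>1: "\<Phi> m \<delta> \<xi> \<le> 1" for m \<delta> \<xi>
 proof -
  have "(\<Prod>j\<in>J. ramp m (a j) (Y (j + \<delta>) \<xi>)) \<le> 1" by (intro prod_range conjI ramp_range)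
  then show ?thesis unfolding \<Phi>_def by simp
 qed
 have k1: "surv_mean L \<phi> \<tau> x \<le> 1" if "\<And>y. \<phi> y \<le> 1" for L \<phi> x by (rule surv_mean_le_1[OF that])
 have one: "(1::ennreal) \<le> 1" by simp
 have m3: "x * y * z \<le> 1" if "x \<le> 1" "y \<le> 1" "z \<le> 1" for x y z :: ennreal
  using mult_mono[OF mult_mono[OF that(1,2)] that(3)] by simp
 have m2: "x * y \<le> 1" if "x \<le> 1" "y \<le> 1" for x y :: ennreal
  using mult_mono[OF that] by simp
 have mm: "(\<lambda>\<xi>. f \<xi> * g \<xi>) \<in> borel_measurable M" if "f \<in> borel_measurable M" "g \<in> borel_measurable M"
  for f g :: "'a \<Rightarrow> ennreal" using that by (rule borel_measurable_times_ennreal)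
 have step1: "(\<integral>\<^sup>+\<xi>. \<Phi> m \<delta> \<xi> * \<psi> m (Y (s + \<tau> + \<delta>) \<xi>) * surv_mean rats_nonneg (\<lambda>_. 1) \<tau> (Y (s + \<delta>) \<xi>) \<partial>M) =
   (\<integral>\<^sup>+\<xi>. \<Phi> m \<delta> \<xi> * surv_mean rats_nonneg (\<psi> m) \<tau> (Y (s + \<delta>) \<xi>) \<partial>M)"
  if d: "0 < \<delta>" and good: "AE \<xi> in M. (\<forall>r\<in>insert s (insert (s + \<tau>) J). isCont (\<lambda>t. X t \<xi>) (r + \<delta> + D \<xi>)) \<and> (\<forall>s\<in>{}. s - \<delta> \<noteq> D \<xi>)" for m \<delta>
 proof -
  define F where "F n \<xi> = ennreal (\<Prod>j\<in>J. ramp m (a j) (Ylat n (j + \<delta>) \<xi>))" for n \<xi>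
  have Fm: "F n \<in> borel_measurable M" for n unfolding F_def[abs_def] by measurable
  have F1: "F n \<xi> \<le> 1" for n \<xi>
  proof -
   have "(\<Prod>j\<in>J. ramp m (a j) (Ylat n (j + \<delta>) \<xi>)) \<le> 1" by (intro prod_range conjI ramp_range)
   then show ?thesis unfolding F_def by simp
  qed
  let ?L = "\<lambda>n. tail_lattice n (s + \<delta>)"
  have sd: "0 \<le> s + \<delta>" "0 \<le> s + \<tau> + \<delta>" "0 < s + \<delta>" using s d \<tau> by simp_all
  have lim: "AE \<xi> in M. (\<lambda>n. F n \<xi>) \<longlonglongrightarrow> \<Phi> m \<delta> \<xi> \<and> (\<lambda>n. Ylat n (s + \<delta>) \<xi>) \<longlonglongrightarrow> Y (s + \<delta>) \<xi>
    \<and> (\<lambda>n. Ylat n (s + \<tau> + \<delta>) \<xi>) \<longlonglongrightarrow> Y (s + \<tau> + \<delta>) \<xi> \<and> 0 < Y (s + \<delta>) \<xi>"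
   using good AE_good_path
  proof eventually_elim
   case (elim \<xi>)
   have c: "isCont (\<lambda>t. X t \<xi>) (r + \<delta> + D \<xi>)" if "r \<in> insert s (insert (s + \<tau>) J)" for r using elim(1) that by blast
   have "(\<lambda>n. F n \<xi>) \<longlonglongrightarrow> \<Phi> m \<delta> \<xi>"
    unfolding F_def \<Phi>_def
   proof (intro tendsto_ennrealI tendsto_prod ramp_tendsto Ylat_tendsto elim)
    fix j assume "j \<in> J"
    then show "0 \<le> j + \<delta>" using J d by auto
    show "isCont (\<lambda>t. X t \<xi>) (j + \<delta> + D \<xi>)" by (rule c) (use \<open>j \<in> J\<close> in blast)
   qed
   moreover have "(\<lambda>n. Ylat n (s + \<delta>) \<xi>) \<longlonglongrightarrow> Y (s + \<delta>) \<xi>" by (intro Ylat_tendsto elim sd c) blast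
   moreover have "(\<lambda>n. Ylat n (s + \<tau> + \<delta>) \<xi>) \<longlonglongrightarrow> Y (s + \<tau> + \<delta>) \<xi>" by (intro Ylat_tendsto elim sd c) blast
   moreover have "0 < Y (s + \<delta>) \<xi>" by (rule Y_pos[OF elim(2) sd(3)])
   ultimately show ?case by blast
  qed
  have kl: "(\<lambda>n. surv_mean (?L n) \<phi> \<tau> (xn n)) \<longlonglongrightarrow> surv_mean rats_nonneg \<phi> \<tau> x"
   if "0 < x" "xn \<longlonglongrightarrow> x" "\<phi> \<in> borel_measurable borel" "\<And>yn y. yn \<longlonglongrightarrow> y \<Longrightarrow> (\<lambda>n. \<phi> (yn n)) \<longlonglongrightarrow> \<phi> y" "\<And>y. \<phi> y \<le> 1" for x xn \<phi>
   by (rule surv_mean_tendsto[OF that(1,2) tail_lattice dense_tail_lattice[OF sd(1)] that(3,4,5)])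
  show ?thesis
  proof (rule nn_integral_eq_limit)
   show "(\<lambda>\<xi>. F n \<xi> * \<psi> m (Ylat n (s + \<tau> + \<delta>) \<xi>) * surv_mean (?L n) (\<lambda>_. 1) \<tau> (Ylat n (s + \<delta>) \<xi>)) \<in> borel_measurable M" for n
    by (intro mm Fm \<psi>Y km tail_lattice Ylat_measurable borel_measurable_const)
   show "(\<lambda>\<xi>. F n \<xi> * surv_mean (?L n) (\<psi> m) \<tau> (Ylat n (s + \<delta>) \<xi>)) \<in> borel_measurable M" for n
    by (intro mm Fm \<psi>m km tail_lattice Ylat_measurable)
   show "(\<lambda>\<xi>. \<Phi> m \<delta> \<xi> * \<psi> m (Y (s + \<tau> + \<delta>) \<xi>) * surv_mean rats_nonneg (\<lambda>_. 1) \<tau> (Y (s + \<delta>) \<xi>)) \<in> borel_measurable M"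
    by (intro mm \<Phi>m \<psi>Y km cQ Y_measurable borel_measurable_const)
   show "(\<lambda>\<xi>. \<Phi> m \<delta> \<xi> * surv_mean rats_nonneg (\<psi> m) \<tau> (Y (s + \<delta>) \<xi>)) \<in> borel_measurable M"
    by (intro mm \<Phi>m \<psi>m km cQ Y_measurable)
   show "F n \<xi> * \<psi> m (Ylat n (s + \<tau> + \<delta>) \<xi>) * surv_mean (?L n) (\<lambda>_. 1) \<tau> (Ylat n (s + \<delta>) \<xi>) \<le> 1" for n \<xi>
    by (intro m3 F1 \<psi>1 k1 one)
   show "F n \<xi> * surv_mean (?L n) (\<psi> m) \<tau> (Ylat n (s + \<delta>) \<xi>) \<le> 1" for n \<xi>
    by (intro m2 F1 k1 \<psi>1)
   show "AE \<xi> in M. (\<lambda>n. F n \<xi> * \<psi> m (Ylat n (s + \<tau> + \<delta>) \<xi>) * surv_mean (?L n) (\<lambda>_. 1) \<tau> (Ylat n (s + \<delta>) \<xi>)) \<longlonglongrightarrow>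
     \<Phi> m \<delta> \<xi> * \<psi> m (Y (s + \<tau> + \<delta>) \<xi>) * surv_mean rats_nonneg (\<lambda>_. 1) \<tau> (Y (s + \<delta>) \<xi>)"
    using lim
   proof eventually_elim
    case (elim \<xi>)
    have "(\<lambda>n. F n \<xi>) \<longlonglongrightarrow> \<Phi> m \<delta> \<xi>" using elim by blast
    moreover have "(\<lambda>n. \<psi> m (Ylat n (s + \<tau> + \<delta>) \<xi>)) \<longlonglongrightarrow> \<psi> m (Y (s + \<tau> + \<delta>) \<xi>)" by (rule \<psi>c) (use elim in blast)
    moreover have "(\<lambda>n. surv_mean (?L n) (\<lambda>_. 1) \<tau> (Ylat n (s + \<delta>) \<xi>)) \<longlonglongrightarrow> surv_mean rats_nonneg (\<lambda>_. 1) \<tau> (Y (s + \<delta>) \<xi>)"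
     by (rule kl) (use elim in \<open>blast, blast, simp_all\<close>)
    ultimately show ?case by (intro tendsto_mult_le_1 m2 \<Phi>1 \<psi>1 k1 one)
   qed
   show "AE \<xi> in M. (\<lambda>n. F n \<xi> * surv_mean (?L n) (\<psi> m) \<tau> (Ylat n (s + \<delta>) \<xi>)) \<longlonglongrightarrow>
     \<Phi> m \<delta> \<xi> * surv_mean rats_nonneg (\<psi> m) \<tau> (Y (s + \<delta>) \<xi>)"
    using lim
   proof eventually_elim
    case (elim \<xi>)
    have "(\<lambda>n. F n \<xi>) \<longlonglongrightarrow> \<Phi> m \<delta> \<xi>" using elim by blast
    moreover have "(\<lambda>n. surv_mean (?L n) (\<psi> m) \<tau> (Ylat n (s + \<delta>) \<xi>)) \<longlonglongrightarrow> surv_mean rats_nonneg (\<psi> m) \<tau> (Y (s + \<delta>) \<xi>)"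
     by (rule kl[OF _ _ \<psi>m \<psi>c \<psi>1]) (use elim in blast)+
    ultimately show ?case by (intro tendsto_mult_le_1 \<Phi>1 \<psi>1 k1)
   qed
   fix n
   define \<phi> where "\<phi> w = ennreal (\<Prod>j\<in>J. ramp m (a j) (w (j + \<delta>) + \<alpha> * (j + \<delta>)))" for w :: "real \<Rightarrow> real"
   have \<phi>m: "\<phi> \<in> borel_measurable path_space" unfolding \<phi>_def[abs_def] by measurable
   have \<phi>F: "\<phi> (fut (T n \<xi>) \<xi>) = F n \<xi>" for \<xi> unfolding \<phi>_def F_def Ylat_def ..
   have \<phi>p: "(\<lambda>\<xi>. \<phi> (fut 0 \<xi>)) \<in> borel_measurable (past (s + \<delta>))"
    unfolding \<phi>_def
   proof (intro measurable_compose[OF borel_measurable_prod measurable_ennreal] measurable_compose[OF borel_measurable_add ramp_measurable] borel_measurable_const)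
    fix j assume "j \<in> J"
    then have "max 0 (j + \<delta>) \<le> s + \<delta>" using J(2) sd(1) by auto
    then show "(\<lambda>\<xi>. fut 0 \<xi> (j + \<delta>)) \<in> borel_measurable (past (s + \<delta>))"
     unfolding fut_def add_0 by (intro borel_measurable_diff X_past sd)
   qed
   have e: "s + \<delta> + \<tau> = s + \<tau> + \<delta>" by simp
   from lattice_markov[OF sd(1) \<tau> \<phi>p \<phi>m \<psi>m[of m], of n, folded Ylat_def, unfolded \<phi>F e]
   show "(\<integral>\<^sup>+\<xi>. F n \<xi> * \<psi> m (Ylat n (s + \<tau> + \<delta>) \<xi>) * surv_mean (?L n) (\<lambda>_. 1) \<tau> (Ylat n (s + \<delta>) \<xi>) \<partial>M) =
    (\<integral>\<^sup>+\<xi>. F n \<xi> * surv_mean (?L n) (\<psi> m) \<tau> (Ylat n (s + \<delta>) \<xi>) \<partial>M)" .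
  qed
 qed
 have fin: "finite (insert s (insert (s + \<tau>) J))" using J(1) by simp
 obtain \<delta> :: "nat \<Rightarrow> real" where d0: "\<forall>k. 0 < \<delta> k" and dlim: "\<delta> \<longlonglongrightarrow> 0"
  and good: "\<forall>k. AE \<xi> in M. (\<forall>r\<in>insert s (insert (s + \<tau>) J). isCont (\<lambda>t. X t \<xi>) (r + \<delta> k + D \<xi>)) \<and> (\<forall>s\<in>{}. s - \<delta> k \<noteq> D \<xi>)"
  using good_shift_sequence[OF fin finite.emptyI] by (elim exE conjE)
 have cQ0: "rats_nonneg \<subseteq> {0..}" by auto
 have dQ: "eventually (\<lambda>n::nat. \<exists>r\<in>rats_nonneg. x < r \<and> r < y) sequentially" if "0 \<le> x" "x < y" for x y
  using dense_rats_nonneg[OF that] by (intro always_eventually allI)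
 have kQ: "(\<lambda>n. surv_mean rats_nonneg \<phi> \<tau> (xn n)) \<longlonglongrightarrow> surv_mean rats_nonneg \<phi> \<tau> x"
  if "0 < x" "xn \<longlonglongrightarrow> x" "\<phi> \<in> borel_measurable borel" "\<And>yn y. yn \<longlonglongrightarrow> y \<Longrightarrow> (\<lambda>n. \<phi> (yn n)) \<longlonglongrightarrow> \<phi> y" "\<And>y. \<phi> y \<le> 1" for x xn \<phi>
  by (rule surv_mean_tendsto[OF that(1,2) cQ cQ0 dQ that(3,4,5)])
 have step2: "(\<integral>\<^sup>+\<xi>. \<Phi> m 0 \<xi> * \<psi> m (Y (s + \<tau>) \<xi>) * surv_mean rats_nonneg (\<lambda>_. 1) \<tau> (Y s \<xi>) \<partial>M) =
   (\<integral>\<^sup>+\<xi>. \<Phi> m 0 \<xi> * surv_mean rats_nonneg (\<psi> m) \<tau> (Y s \<xi>) \<partial>M)" for m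
 proof (rule nn_integral_eq_limit)
  have lim: "AE \<xi> in M. (\<lambda>k. \<Phi> m (\<delta> k) \<xi>) \<longlonglongrightarrow> \<Phi> m 0 \<xi> \<and> (\<lambda>k. Y (s + \<delta> k) \<xi>) \<longlonglongrightarrow> Y s \<xi>
    \<and> (\<lambda>k. Y (s + \<tau> + \<delta> k) \<xi>) \<longlonglongrightarrow> Y (s + \<tau>) \<xi> \<and> 0 < Y s \<xi>"
   using AE_space AE_good_path
  proof eventually_elim
   case (elim \<xi>)
   note Yr = Y_right_tendsto[OF elim(1) dlim d0[rule_format]]
   have "(\<lambda>k. \<Phi> m (\<delta> k) \<xi>) \<longlonglongrightarrow> \<Phi> m 0 \<xi>"
    unfolding \<Phi>_def add_0_right by (intro tendsto_ennrealI tendsto_prod ramp_tendsto Yr)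
   then show ?case using Yr[of s] Yr[of "s + \<tau>"] Y_pos[OF elim(2) s] by blast
  qed
  show "(\<lambda>\<xi>. \<Phi> m (\<delta> k) \<xi> * \<psi> m (Y (s + \<tau> + \<delta> k) \<xi>) * surv_mean rats_nonneg (\<lambda>_. 1) \<tau> (Y (s + \<delta> k) \<xi>)) \<in> borel_measurable M" for k
   by (intro mm \<Phi>m \<psi>Y km cQ Y_measurable borel_measurable_const)
  show "(\<lambda>\<xi>. \<Phi> m (\<delta> k) \<xi> * surv_mean rats_nonneg (\<psi> m) \<tau> (Y (s + \<delta> k) \<xi>)) \<in> borel_measurable M" for k
   by (intro mm \<Phi>m \<psi>m km cQ Y_measurable)
  show "(\<lambda>\<xi>. \<Phi> m 0 \<xi> * \<psi> m (Y (s + \<tau>) \<xi>) * surv_mean rats_nonneg (\<lambda>_. 1) \<tau> (Y s \<xi>)) \<in> borel_measurable M"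
   by (intro mm \<Phi>m \<psi>Y km cQ Y_measurable borel_measurable_const)
  show "(\<lambda>\<xi>. \<Phi> m 0 \<xi> * surv_mean rats_nonneg (\<psi> m) \<tau> (Y s \<xi>)) \<in> borel_measurable M"
   by (intro mm \<Phi>m \<psi>m km cQ Y_measurable)
  show "\<Phi> m (\<delta> k) \<xi> * \<psi> m (Y (s + \<tau> + \<delta> k) \<xi>) * surv_mean rats_nonneg (\<lambda>_. 1) \<tau> (Y (s + \<delta> k) \<xi>) \<le> 1" for k \<xi>
   by (intro m3 \<Phi>1 \<psi>1 k1 one)
  show "\<Phi> m (\<delta> k) \<xi> * surv_mean rats_nonneg (\<psi> m) \<tau> (Y (s + \<delta> k) \<xi>) \<le> 1" for k \<xi>
   by (intro m2 \<Phi>1 k1 \<psi>1)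
  show "AE \<xi> in M. (\<lambda>k. \<Phi> m (\<delta> k) \<xi> * \<psi> m (Y (s + \<tau> + \<delta> k) \<xi>) * surv_mean rats_nonneg (\<lambda>_. 1) \<tau> (Y (s + \<delta> k) \<xi>)) \<longlonglongrightarrow>
    \<Phi> m 0 \<xi> * \<psi> m (Y (s + \<tau>) \<xi>) * surv_mean rats_nonneg (\<lambda>_. 1) \<tau> (Y s \<xi>)"
   using lim
  proof eventually_elim
   case (elim \<xi>)
   have "(\<lambda>k. \<Phi> m (\<delta> k) \<xi>) \<longlonglongrightarrow> \<Phi> m 0 \<xi>" using elim by blast
   moreover have "(\<lambda>k. \<psi> m (Y (s + \<tau> + \<delta> k) \<xi>)) \<longlonglongrightarrow> \<psi> m (Y (s + \<tau>) \<xi>)" by (rule \<psi>c) (use elim in blast)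
   moreover have "(\<lambda>k. surv_mean rats_nonneg (\<lambda>_. 1) \<tau> (Y (s + \<delta> k) \<xi>)) \<longlonglongrightarrow> surv_mean rats_nonneg (\<lambda>_. 1) \<tau> (Y s \<xi>)"
    by (rule kQ) (use elim in \<open>blast, blast, simp_all\<close>)
   ultimately show ?case by (intro tendsto_mult_le_1 m2 \<Phi>1 \<psi>1 k1 one)
  qed
  show "AE \<xi> in M. (\<lambda>k. \<Phi> m (\<delta> k) \<xi> * surv_mean rats_nonneg (\<psi> m) \<tau> (Y (s + \<delta> k) \<xi>)) \<longlonglongrightarrow>
    \<Phi> m 0 \<xi> * surv_mean rats_nonneg (\<psi> m) \<tau> (Y s \<xi>)"
   using lim
  proof eventually_elim
   case (elim \<xi>)
   have "(\<lambda>k. \<Phi> m (\<delta> k) \<xi>) \<longlonglongrightarrow> \<Phi> m 0 \<xi>" using elim by blast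
   moreover have "(\<lambda>k. surv_mean rats_nonneg (\<psi> m) \<tau> (Y (s + \<delta> k) \<xi>)) \<longlonglongrightarrow> surv_mean rats_nonneg (\<psi> m) \<tau> (Y s \<xi>)"
    by (rule kQ[OF _ _ \<psi>m \<psi>c \<psi>1]) (use elim in blast)+
   ultimately show ?case by (intro tendsto_mult_le_1 \<Phi>1 \<psi>1 k1)
  qed
  show "(\<integral>\<^sup>+\<xi>. \<Phi> m (\<delta> k) \<xi> * \<psi> m (Y (s + \<tau> + \<delta> k) \<xi>) * surv_mean rats_nonneg (\<lambda>_. 1) \<tau> (Y (s + \<delta> k) \<xi>) \<partial>M) =
   (\<integral>\<^sup>+\<xi>. \<Phi> m (\<delta> k) \<xi> * surv_mean rats_nonneg (\<psi> m) \<tau> (Y (s + \<delta> k) \<xi>) \<partial>M)" for k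
   by (rule step1[OF d0[rule_format] good[rule_format]])
 qed
 have Cm[measurable]: "C \<in> sets M"
 proof -
  have "Measurable.pred M (\<lambda>\<xi>. \<forall>j\<in>J. Y j \<xi> < a j)" by (rule pred_ball_countable) (use J countable_finite in auto)
  then show ?thesis unfolding C_def pred_def .
 qed
 have \<Phi>lim: "(\<lambda>m. \<Phi> m 0 \<xi>) \<longlonglongrightarrow> indicator C \<xi>" if w: "\<xi> \<in> space M" for \<xi>
 proof -
  have "(\<lambda>m. \<Prod>j\<in>J. ramp m (a j) (Y j \<xi>)) \<longlonglongrightarrow> (\<Prod>j\<in>J. indicator {..<a j} (Y j \<xi>))"
   by (intro tendsto_prod ramp_indicator)
  also have "(\<Prod>j\<in>J. indicator {..<a j} (Y j \<xi>)) = (\<Prod>j\<in>J. if Y j \<xi> < a j then 1 else (0::real))"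
   by (intro prod.cong) (auto simp: indicator_def)
  also have "\<dots> = indicator C \<xi>" unfolding prod_if_01[OF J(1)] C_def using w by (simp add: indicator_def)
  finally show ?thesis unfolding \<Phi>_def add_0_right ennreal_indicator[symmetric] by (rule tendsto_ennrealI)
 qed
 have \<psi>lim: "(\<lambda>m. \<psi> m y) \<longlonglongrightarrow> indicator {..<b} y" for y
  unfolding \<psi>_def ennreal_indicator[symmetric] by (intro tendsto_ennrealI ramp_indicator)
 have ind1: "indicator A x \<le> (1::ennreal)" for A and x :: 'z by (simp add: indicator_def)
 have indb: "(indicator {..<b} :: real \<Rightarrow> ennreal) \<in> borel_measurable borel" by simp
 have klim: "(\<lambda>m. surv_mean rats_nonneg (\<psi> m) \<tau> x) \<longlonglongrightarrow> surv_mean rats_nonneg (indicator {..<b}) \<tau> x" for x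
  unfolding surv_mean_def
 proof (rule nn_integral_bounded_convergence)
  have iflim: "(\<lambda>m. if P then f m else 0) \<longlonglongrightarrow> (if P then l else 0)" if "f \<longlonglongrightarrow> l" for P and f :: "nat \<Rightarrow> ennreal" and l
   using that by (cases P) simp_all
  have pm: "Measurable.pred M (\<lambda>\<xi>. \<forall>r\<in>rats_nonneg. 0 \<le> x + W r \<xi>)"
   by (rule pred_ball_countable[OF cQ]) measurable
  have Wm: "(\<lambda>\<xi>. x + W \<tau> \<xi>) \<in> borel_measurable M" by measurable
  show "(\<lambda>\<xi>. if \<forall>r\<in>rats_nonneg. 0 \<le> x + W r \<xi> then \<psi> m (x + W \<tau> \<xi>) else 0) \<in> borel_measurable M" for m
   by (rule measurable_If[OF \<psi>Y[OF Wm] borel_measurable_const pm[unfolded pred_def]])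
  show "(\<lambda>\<xi>. if \<forall>r\<in>rats_nonneg. 0 \<le> x + W r \<xi> then indicator {..<b} (x + W \<tau> \<xi>) else 0 :: ennreal) \<in> borel_measurable M"
   by (rule measurable_If[OF measurable_compose[OF Wm indb] borel_measurable_const pm[unfolded pred_def]])
  show "(if \<forall>r\<in>rats_nonneg. 0 \<le> x + W r \<xi> then \<psi> m (x + W \<tau> \<xi>) else 0) \<le> 1" for m \<xi> using \<psi>1 by auto
  show "AE \<xi> in M. (\<lambda>m. if \<forall>r\<in>rats_nonneg. 0 \<le> x + W r \<xi> then \<psi> m (x + W \<tau> \<xi>) else 0) \<longlonglongrightarrow>
    (if \<forall>r\<in>rats_nonneg. 0 \<le> x + W r \<xi> then indicator {..<b} (x + W \<tau> \<xi>) else 0)"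
  proof (rule AE_I2)
   fix \<xi>
   show "(\<lambda>m. if \<forall>r\<in>rats_nonneg. 0 \<le> x + W r \<xi> then \<psi> m (x + W \<tau> \<xi>) else 0) \<longlonglongrightarrow>
    (if \<forall>r\<in>rats_nonneg. 0 \<le> x + W r \<xi> then indicator {..<b} (x + W \<tau> \<xi>) else 0)"
    by (rule iflim[OF \<psi>lim])
  qed
 qed
 show ?thesis
 proof (rule nn_integral_eq_limit[where F="\<lambda>m \<xi>. \<Phi> m 0 \<xi> * \<psi> m (Y (s + \<tau>) \<xi>) * surv_mean rats_nonneg (\<lambda>_. 1) \<tau> (Y s \<xi>)"
   and G="\<lambda>m \<xi>. \<Phi> m 0 \<xi> * surv_mean rats_nonneg (\<psi> m) \<tau> (Y s \<xi>)"])
  have Cm': "(indicator C :: 'a \<Rightarrow> ennreal) \<in> borel_measurable M" by simp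
  show "(\<lambda>\<xi>. \<Phi> m 0 \<xi> * \<psi> m (Y (s + \<tau>) \<xi>) * surv_mean rats_nonneg (\<lambda>_. 1) \<tau> (Y s \<xi>)) \<in> borel_measurable M" for m
   by (intro mm \<Phi>m \<psi>Y km cQ Y_measurable borel_measurable_const)
  show "(\<lambda>\<xi>. \<Phi> m 0 \<xi> * surv_mean rats_nonneg (\<psi> m) \<tau> (Y s \<xi>)) \<in> borel_measurable M" for m
   by (intro mm \<Phi>m \<psi>m km cQ Y_measurable)
  show "(\<lambda>\<xi>. indicator C \<xi> * indicator {..<b} (Y (s + \<tau>) \<xi>) * surv_mean rats_nonneg (\<lambda>_. 1) \<tau> (Y s \<xi>)) \<in> borel_measurable M"
   by (intro mm Cm' measurable_compose[OF Y_measurable indb] km cQ Y_measurable borel_measurable_const)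
  show "(\<lambda>\<xi>. indicator C \<xi> * surv_mean rats_nonneg (indicator {..<b}) \<tau> (Y s \<xi>)) \<in> borel_measurable M"
   by (intro mm Cm' indb km cQ Y_measurable)
  show "\<Phi> m 0 \<xi> * \<psi> m (Y (s + \<tau>) \<xi>) * surv_mean rats_nonneg (\<lambda>_. 1) \<tau> (Y s \<xi>) \<le> 1" for m \<xi>
   by (intro m3 \<Phi>1 \<psi>1 k1 one)
  show "\<Phi> m 0 \<xi> * surv_mean rats_nonneg (\<psi> m) \<tau> (Y s \<xi>) \<le> 1" for m \<xi>
   by (intro m2 \<Phi>1 k1 \<psi>1)
  show "AE \<xi> in M. (\<lambda>m. \<Phi> m 0 \<xi> * \<psi> m (Y (s + \<tau>) \<xi>) * surv_mean rats_nonneg (\<lambda>_. 1) \<tau> (Y s \<xi>)) \<longlonglongrightarrow>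
    indicator C \<xi> * indicator {..<b} (Y (s + \<tau>) \<xi>) * surv_mean rats_nonneg (\<lambda>_. 1) \<tau> (Y s \<xi>)"
   by (intro AE_I2 tendsto_mult_le_1 m2 \<Phi>lim \<psi>lim tendsto_const ind1 k1 one)
  show "AE \<xi> in M. (\<lambda>m. \<Phi> m 0 \<xi> * surv_mean rats_nonneg (\<psi> m) \<tau> (Y s \<xi>)) \<longlonglongrightarrow> indicator C \<xi> * surv_mean rats_nonneg (indicator {..<b}) \<tau> (Y s \<xi>)"
   by (intro AE_I2 tendsto_mult_le_1 \<Phi>lim klim ind1 k1)
  show "(\<integral>\<^sup>+\<xi>. \<Phi> m 0 \<xi> * \<psi> m (Y (s + \<tau>) \<xi>) * surv_mean rats_nonneg (\<lambda>_. 1) \<tau> (Y s \<xi>) \<partial>M) =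
   (\<integral>\<^sup>+\<xi>. \<Phi> m 0 \<xi> * surv_mean rats_nonneg (\<psi> m) \<tau> (Y s \<xi>) \<partial>M)" for m by (rule step2)
 qed
qed

end

section \<open>The transition kernel\<close>

text \<open>A path on the half-line is continued by a constant, so that the results on the whole
line apply.\<close>
lemma cadlag_on_extend:
 assumes w: "cadlag_on {0..} w"
 shows "cadlag_on UNIV (\<lambda>t. w (max 0 t))"
 unfolding cadlag_on_def
proof (intro ballI conjI)
 fix t :: real
 let ?f = "\<lambda>t. w (max 0 t)"
 show "(?f \<longlongrightarrow> ?f t) (at t within UNIV \<inter> {t<..})"
 proof (cases "0 \<le> t")
  case True
  then have "(w \<longlongrightarrow> w t) (at t within {0..} \<inter> {t<..})" using w by (simp add: cadlag_on_def)
  moreover have "{0..} \<inter> {t<..} = UNIV \<inter> {t<..}" using True by auto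
  moreover have "(?f \<longlongrightarrow> w t) (at t within UNIV \<inter> {t<..}) \<longleftrightarrow> (w \<longlongrightarrow> w t) (at t within UNIV \<inter> {t<..})"
   by (rule tendsto_cong) (use True in \<open>auto simp: eventually_at_filter max_def\<close>)
  ultimately show ?thesis using True by simp
 next
  case False
  then have "t < 0" by simp
  then have "eventually (\<lambda>s. s < 0) (at t within UNIV \<inter> {t<..})"
   by (rule order_tendstoD(2)[OF tendsto_ident_at])
  then have "eventually (\<lambda>s. ?f s = ?f t) (at t within UNIV \<inter> {t<..})"
   by eventually_elim (use \<open>t < 0\<close> in simp)
  then show ?thesis by (rule tendsto_eventually)
 qed
 show "\<exists>l. (?f \<longlongrightarrow> l) (at t within UNIV \<inter> {..<t})"
 proof (cases "0 < t")
  case True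
  then obtain l where "(w \<longlongrightarrow> l) (at t within {0..} \<inter> {..<t})" using w unfolding cadlag_on_def by fastforce
  moreover have "at t within {0..} \<inter> {..<t} = at t within UNIV \<inter> {..<t}"
   by (rule at_within_nhd[of t "{0<..}"]) (use True in auto)
  moreover have "(?f \<longlongrightarrow> l) (at t within {0..} \<inter> {..<t}) \<longleftrightarrow> (w \<longlongrightarrow> l) (at t within {0..} \<inter> {..<t})"
   by (rule tendsto_cong) (auto simp: eventually_at_filter max_def)
  ultimately show ?thesis by auto
 next
  case False
  then have "eventually (\<lambda>s. ?f s = w 0) (at t within UNIV \<inter> {..<t})"
   by (auto simp: eventually_at_filter max_def)
  then show ?thesis by (intro exI[of _ "w 0"] tendsto_eventually)
 qed
qed

lemma exit_set_iff:
 assumes w: "cadlag_on {0..} w" and R: "\<forall>q::rat. 0 < q \<and> ereal (of_rat q) < R \<longrightarrow> 0 \<le> w (of_rat q)"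
  and s: "0 < s" "ereal s < R"
 shows "0 \<le> min (w s) (left_limit w s)"
proof -
 let ?f = "\<lambda>t. w (max 0 t)"
 note f = cadlag_on_extend[OF w]
 have nn: "0 \<le> w s" if s: "0 < s" "ereal s < R" for s
 proof (rule ccontr)
  assume "\<not> 0 \<le> w s"
  then have neg: "0 < - w s" by simp
  obtain u where u: "ereal s < ereal u" "ereal u < R" using ereal_dense2[OF s(2)] by blast
  have su: "s < u" using u(1) by simp
  obtain q :: rat where q: "s < of_rat q" "of_rat q < u" "\<bar>?f (of_rat q) - ?f s\<bar> < - w s"
   using cadlag_rat_right[OF f neg su] by blast
  have q0: "0 < (of_rat q :: real)" using q(1) s(1) by linarith
  have "ereal (of_rat q) < R" using q(2) u(2) by (metis less_ereal.simps(1) less_trans)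
  then have "0 \<le> w (of_rat q)" using R q0 by simp
  then show False using q(3) q0 s(1) neg by (simp add: max_absorb2)
 qed
 have "0 \<le> left_limit ?f s"
 proof (rule left_limit_ge[OF f s(1)])
  fix u assume u: "0 < u" "u < s"
  then have "ereal u < R" using s(2) by (metis less_ereal.simps(1) less_trans)
  then show "0 \<le> ?f u" using nn[OF u(1)] u by simp
 qed
 moreover have "left_limit w s = left_limit ?f s"
 proof (rule left_limit_eq)
  have "eventually (\<lambda>t. ?f t = w t) (at_left s)"
   unfolding eventually_at_left_field using s(1) by (intro exI[of _ 0]) auto
  then show "(w \<longlongrightarrow> left_limit ?f s) (at_left s)"
   using cadlag_tendsto_left[OF f, of s] by (rule Lim_transform_eventually[rotated])
 qed
 ultimately show ?thesis using nn[OF s] by simp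
qed

lemma exit_time_le: "0 < q \<Longrightarrow> w q < 0 \<Longrightarrow> exit_time w \<le> ereal q"
 unfolding exit_time_def by (intro Inf_lower CollectI exI[of _ q]) auto

text \<open>Negative values and negative left limits are both detected at rational times, so that
survival is an event of the coordinate algebra.\<close>
lemma exit_time_gt_iff:
 assumes w: "cadlag_on {0..} w" and t: "0 \<le> t"
 shows "ereal t < exit_time w \<longleftrightarrow> (\<exists>r::rat. t < of_rat r \<and> (\<forall>q::rat. 0 < q \<and> q < r \<longrightarrow> 0 \<le> w (of_rat q)))"
proof
 assume "ereal t < exit_time w"
 then obtain u where u: "ereal t < ereal u" "ereal u < exit_time w" using ereal_dense2 by blast
 have "t < u" using u(1) by simp
 then obtain r :: rat where r: "t < of_rat r" "of_rat r < u" using of_rat_dense by blast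
 have "0 \<le> w (of_rat q)" if q: "0 < q" "q < r" for q :: rat
 proof (rule ccontr)
  assume "\<not> 0 \<le> w (of_rat q)"
  then have "exit_time w \<le> ereal (of_rat q)" using q(1) by (intro exit_time_le) simp_all
  moreover have "(of_rat q :: real) < u" using q(2) r(2) by (meson less_trans of_rat_less)
  ultimately show False using u(2) by (meson ereal_less_eq(3) less_imp_le not_less order_trans)
 qed
 then show "\<exists>r::rat. t < of_rat r \<and> (\<forall>q::rat. 0 < q \<and> q < r \<longrightarrow> 0 \<le> w (of_rat q))" using r(1) by blast
next
 assume "\<exists>r::rat. t < of_rat r \<and> (\<forall>q::rat. 0 < q \<and> q < r \<longrightarrow> 0 \<le> w (of_rat q))"
 then obtain r :: rat where r: "t < of_rat r" "\<forall>q::rat. 0 < q \<and> q < r \<longrightarrow> 0 \<le> w (of_rat q)" by blast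
 have R: "\<forall>q::rat. 0 < q \<and> ereal (of_rat q) < ereal (of_rat r) \<longrightarrow> 0 \<le> w (of_rat q)" using r(2) by (simp add: of_rat_less)
 have "ereal (of_rat r) \<le> exit_time w"
  unfolding exit_time_def
 proof (rule Inf_greatest)
  fix z assume "z \<in> {ereal t |t. 0 < t \<and> min (w t) (left_limit w t) < 0}"
  then obtain s where s: "z = ereal s" "0 < s" "min (w s) (left_limit w s) < 0" by blast
  show "ereal (of_rat r) \<le> z"
  proof (rule ccontr)
   assume "\<not> ereal (of_rat r) \<le> z"
   then have "ereal s < ereal (of_rat r)" using s(1) by simp
   from exit_set_iff[OF w R s(2) this] s(3) show False by linarith
  qed
 qed
 then show "ereal t < exit_time w" using r(1) by (meson less_ereal.simps(1) less_le_trans)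
qed

lemma exit_time_infinite_iff:
 assumes w: "cadlag_on {0..} w"
 shows "exit_time w = \<infinity> \<longleftrightarrow> (\<forall>q::rat. 0 < q \<longrightarrow> 0 \<le> w (of_rat q))"
proof
 assume inf: "exit_time w = \<infinity>"
 show "\<forall>q::rat. 0 < q \<longrightarrow> 0 \<le> w (of_rat q)"
 proof (intro allI impI, rule ccontr)
  fix q :: rat assume "0 < q" "\<not> 0 \<le> w (of_rat q)"
  then have "exit_time w \<le> ereal (of_rat q)" by (intro exit_time_le) simp_all
  then show False using inf by simp
 qed
next
 assume q: "\<forall>q::rat. 0 < q \<longrightarrow> 0 \<le> w (of_rat q)"
 have "{ereal t |t. 0 < t \<and> min (w t) (left_limit w t) < 0} = {}"
 proof (rule equals0I)
  fix z assume "z \<in> {ereal t |t. 0 < t \<and> min (w t) (left_limit w t) < 0}"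
  then obtain s where s: "0 < s" "min (w s) (left_limit w s) < 0" by blast
  have R: "\<forall>q::rat. 0 < q \<and> ereal (of_rat q) < \<infinity> \<longrightarrow> 0 \<le> w (of_rat q)" using q by blast
  have "ereal s < \<infinity>" by simp
  from exit_set_iff[OF w R s(1) this] s(2) show False by linarith
 qed
 then show "exit_time w = \<infinity>" unfolding exit_time_def by (simp only: Inf_empty top_ereal_def)
qed

lemma space_cadlag_space: "w \<in> space cadlag_space \<Longrightarrow> cadlag_on {0..} w"
 unfolding cadlag_space_def space_restrict_space by simp

lemma cadlag_space_eval[measurable]: "0 \<le> t \<Longrightarrow> (\<lambda>w. w t) \<in> borel_measurable cadlag_space"
 unfolding cadlag_space_def by (intro measurable_restrict_space1 measurable_component_singleton) simp

lemma exit_time_events: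
 "0 \<le> t \<Longrightarrow> Measurable.pred cadlag_space (\<lambda>w. ereal t < exit_time w)"
 "Measurable.pred cadlag_space (\<lambda>w. exit_time w = \<infinity>)"
proof -
 have le: "Measurable.pred cadlag_space (\<lambda>w. 0 \<le> w (of_rat q))" if "0 < q" for q :: rat
 proof -
  have [measurable]: "(\<lambda>w. w (of_rat q)) \<in> borel_measurable cadlag_space" by (rule cadlag_space_eval) (use that in simp)
  show ?thesis by measurable
 qed
 have nn: "Measurable.pred cadlag_space (\<lambda>w. 0 < q \<longrightarrow> 0 \<le> w (of_rat q))" for q :: rat
  by (rule pred_const_imp) (rule le)
 have nn': "Measurable.pred cadlag_space (\<lambda>w. 0 < q \<and> q < r \<longrightarrow> 0 \<le> w (of_rat q))" for q r :: rat
  by (rule pred_const_imp) (rule le, erule conjunct1)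
 show "Measurable.pred cadlag_space (\<lambda>w. exit_time w = \<infinity>)"
  by (rule measurable_cong[THEN iffD2, OF exit_time_infinite_iff[OF space_cadlag_space]])
   (assumption, intro pred_intros_countable nn)
 show "Measurable.pred cadlag_space (\<lambda>w. ereal t < exit_time w)" if "0 \<le> t"
  by (rule measurable_cong[THEN iffD2, OF exit_time_gt_iff[OF space_cadlag_space that]])
   (assumption, intro pred_intros_countable pred_const_conj nn')
qed

context regular_levy begin

abbreviation (input) start :: "real \<Rightarrow> 'a \<Rightarrow> real \<Rightarrow> real" where "start x \<xi> \<equiv> (\<lambda>t\<in>{0..}. x + X t \<xi> + \<alpha> * t)"

text \<open>The function h of the transform.\<close>
definition harmonic :: "real \<Rightarrow> ennreal" where "harmonic x = surv_mean rats_nonneg (\<lambda>_. 1) 0 x"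

lemma harmonic_eq: "surv_mean rats_nonneg (\<lambda>_. 1) \<tau> x = harmonic x"
 unfolding harmonic_def surv_mean_def ..

lemma harmonic_measurable[measurable]: "harmonic \<in> borel_measurable borel"
 unfolding harmonic_def[abs_def] by (rule surv_mean_measurable) simp_all

lemma survives_pred: "Measurable.pred M (\<lambda>\<xi>. \<forall>r\<in>rats_nonneg. 0 \<le> x + W r \<xi>)"
 by (rule pred_ball_countable) (simp, measurable)

lemma harmonic_prob: "harmonic x = emeasure M {\<xi>\<in>space M. \<forall>r\<in>rats_nonneg. 0 \<le> x + W r \<xi>}"
proof -
 have "harmonic x = (\<integral>\<^sup>+\<xi>. indicator {\<xi>\<in>space M. \<forall>r\<in>rats_nonneg. 0 \<le> x + W r \<xi>} \<xi> \<partial>M)"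
  unfolding harmonic_def surv_mean_def by (intro nn_integral_cong) (simp add: indicator_def)
 also have "\<dots> = emeasure M {\<xi>\<in>space M. \<forall>r\<in>rats_nonneg. 0 \<le> x + W r \<xi>}"
  by (rule nn_integral_indicator) (use survives_pred[unfolded pred_def] in simp)
 finally show ?thesis .
qed

lemma survival_prob_eq:
 assumes x: "0 < x"
 shows "ennreal (survival_prob (drift_law M X \<alpha>) x) = harmonic x"
proof -
 have "survival_prob (drift_law M X \<alpha>) x = measure M (start x -` {w\<in>space cadlag_space. exit_time w = \<infinity>} \<inter> space M)"
  unfolding survival_prob_def drift_law_def space_distr
  by (rule measure_distr[OF drift_path_measurable]) (rule exit_time_events(2)[unfolded pred_def])
 also have "start x -` {w\<in>space cadlag_space. exit_time w = \<infinity>} \<inter> space M = {\<xi>\<in>space M. \<forall>r\<in>rats_nonneg. 0 \<le> x + W r \<xi>}"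
 proof -
  have "start x \<xi> \<in> {w\<in>space cadlag_space. exit_time w = \<infinity>} \<longleftrightarrow> (\<forall>r\<in>rats_nonneg. 0 \<le> x + W r \<xi>)" if w: "\<xi> \<in> space M" for \<xi>
  proof -
   have s: "start x \<xi> \<in> space cadlag_space" by (rule measurable_space[OF drift_path_measurable w])
   have "start x \<xi> \<in> {w\<in>space cadlag_space. exit_time w = \<infinity>} \<longleftrightarrow> (\<forall>q::rat. 0 < q \<longrightarrow> 0 \<le> start x \<xi> (of_rat q))"
    using s exit_time_infinite_iff[OF space_cadlag_space[OF s]] by blast
   also have "\<dots> \<longleftrightarrow> (\<forall>r\<in>rats_nonneg. 0 \<le> x + W r \<xi>)"
   proof
    assume q: "\<forall>q::rat. 0 < q \<longrightarrow> 0 \<le> start x \<xi> (of_rat q)"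
    show "\<forall>r\<in>rats_nonneg. 0 \<le> x + W r \<xi>"
    proof
     fix r assume "r \<in> rats_nonneg"
     then obtain p :: rat where p: "r = of_rat p" "0 \<le> p" by auto
     show "0 \<le> x + W r \<xi>"
     proof (cases "p = 0")
      case True
      then show ?thesis using p X_0[OF w] x by simp
     next
      case False
      then have "0 < p" using p(2) by simp
      from q[rule_format, OF this] p show ?thesis by (simp add: add.assoc)
     qed
    qed
   next
    assume q: "\<forall>r\<in>rats_nonneg. 0 \<le> x + W r \<xi>"
    show "\<forall>q::rat. 0 < q \<longrightarrow> 0 \<le> start x \<xi> (of_rat q)"
    proof (intro allI impI)
     fix p :: rat assume p: "0 < p"
     then have "of_rat p \<in> rats_nonneg" by (intro imageI) simp
     from q[rule_format, OF this] show "0 \<le> start x \<xi> (of_rat p)" using p by (simp add: add.assoc)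
    qed
   qed
   finally show ?thesis .
  qed
  then show ?thesis by blast
 qed
 finally show ?thesis unfolding harmonic_prob emeasure_eq_measure by simp
qed

text \<open>Otherwise, from each rational time, the path would almost surely fall by more than x
below its current value; but from a time at which it is within x of its finite infimum this is
impossible.\<close>
lemma harmonic_pos:
 assumes x: "0 < x"
 shows "0 < harmonic x"
proof (rule ccontr)
 assume "\<not> 0 < harmonic x"
 then have h0: "harmonic x = 0" by (simp add: zero_less_iff_neq_zero)
 define S where "S = {w\<in>space path_space. \<forall>r\<in>rats_nonneg. 0 \<le> x + (w r + \<alpha> * r)}"
 have Sm: "S \<in> sets path_space"
  unfolding S_def by (rule pred_ball_countable[unfolded pred_def]) (simp, measurable)
 have S0: "{\<xi>\<in>space M. fut 0 \<xi> \<in> S} = {\<xi>\<in>space M. \<forall>r\<in>rats_nonneg. 0 \<le> x + W r \<xi>}"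
 proof -
  have "fut 0 \<xi> \<in> S \<longleftrightarrow> (\<forall>r\<in>rats_nonneg. 0 \<le> x + W r \<xi>)" if w: "\<xi> \<in> space M" for \<xi>
   unfolding S_def using fut_eval(1)[OF w] by (simp add: space_PiM)
  then show ?thesis by blast
 qed
 have "AE \<xi> in M. fut (of_rat q) \<xi> \<notin> S" for q :: rat
 proof -
  have "emeasure M {\<xi>\<in>space M. fut (of_rat q) \<xi> \<in> S} = 0"
   unfolding emeasure_fut[OF Sm] S0 harmonic_prob[symmetric] by (rule h0)
  moreover have "{\<xi>\<in>space M. fut (of_rat q) \<xi> \<in> S} \<in> sets M" using Sm by measurable
  ultimately have "{\<xi>\<in>space M. fut (of_rat q) \<xi> \<in> S} \<in> null_sets M" by (intro null_setsI)
  from AE_not_in[OF this] show ?thesis using AE_space by eventually_elim blast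
 qed
 then have "AE \<xi> in M. \<forall>q::rat. fut (of_rat q) \<xi> \<notin> S" unfolding AE_all_countable by blast
 moreover have "AE \<xi> in M. \<exists>K::nat. \<forall>t\<ge>0. - real K \<le> W t \<xi>"
  by (rule AE_bounded_below[OF X1]) (use mean in linarith)
 ultimately have "AE \<xi> in M. False"
 proof eventually_elim
  case (elim \<xi>)
  then obtain K :: nat where K: "\<forall>t\<ge>0. - real K \<le> W t \<xi>" by blast
  define m where "m = Inf ((\<lambda>r. W r \<xi>) ` rats_nonneg)"
  have bdd: "bdd_below ((\<lambda>r. W r \<xi>) ` rats_nonneg)" by (rule bdd_belowI2[of _ "- real K"]) (use K in auto)
  have "0 \<in> rats_nonneg" by (rule image_eqI[of _ _ 0]) simp_all
  then have ne: "(\<lambda>r. W r \<xi>) ` rats_nonneg \<noteq> {}" by blast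
  have "Inf ((\<lambda>r. W r \<xi>) ` rats_nonneg) < m + x" unfolding m_def using x by simp
  from cInf_lessD[OF ne this] obtain p where p: "p \<in> rats_nonneg" "W p \<xi> < m + x" by blast
  obtain q :: rat where q: "p = of_rat q" "0 \<le> q" using p(1) by auto
  have "fut (of_rat q) \<xi> \<notin> S" using elim by blast
  then obtain r where r: "r \<in> rats_nonneg" "x + (fut p \<xi> r + \<alpha> * r) < 0"
   unfolding S_def q(1)[symmetric] by (auto simp: space_PiM not_le)
  obtain u :: rat where u: "r = of_rat u" "0 \<le> u" using r(1) by auto
  have r0: "0 \<le> r" using u by simp
  have "p + r \<in> rats_nonneg" unfolding q(1) u(1) by (rule image_eqI[of _ _ "q + u"]) (use q u in \<open>simp_all add: of_rat_add\<close>)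
  then have "m \<le> W (p + r) \<xi>" unfolding m_def by (intro cInf_lower[OF _ bdd] imageI)
  moreover have "fut p \<xi> r + \<alpha> * r = W (p + r) \<xi> - W p \<xi>" unfolding fut_eval(2)[OF r0] by (simp add: distrib_left)
  ultimately show False using r(2) p(2) by linarith
 qed
 then show False by simp
qed

lemma harmonic_le_1: "harmonic x \<le> 1"
 unfolding harmonic_def by (rule surv_mean_le_1) simp

text \<open>On the event that the process is alive and positive at time t, the factor h is the
probability that the increments after t keep it nonnegative. Freezing the past of t merges the two
conditions into survival for all time. The value 0 at time t has to be excluded: on survival it
would be a minimum attained at a fixed time.\<close>
lemma emeasure_H_kernel:
 assumes x: "0 < x" and t: "0 \<le> t" and A: "A \<in> sets borel"
 shows "emeasure (H_kernel (drift_law M X \<alpha>) t x) A = surv_mean rats_nonneg (indicator A) t x / harmonic x"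
proof -
 let ?P = "drift_law M X \<alpha>"
 let ?E = "{w. ereal t < exit_time w}"
 have sP: "sets (?P y) = sets cadlag_space" for y unfolding drift_law_def by simp
 have "0 < ennreal (survival_prob ?P x)" unfolding survival_prob_eq[OF x] by (rule harmonic_pos[OF x])
 then have sp: "0 < survival_prob ?P x" by simp
 define g where "g y = indicator {0<..} y * (harmonic y / harmonic x)" for y
 have g: "indicator {0<..} y * ennreal (survival_prob ?P y / survival_prob ?P x) = g y" for y
 proof (cases "0 < y")
  case True
  have "ennreal (survival_prob ?P y / survival_prob ?P x) = ennreal (survival_prob ?P y) / ennreal (survival_prob ?P x)"
   by (rule divide_ennreal[symmetric]) (use sp in \<open>simp_all add: survival_prob_def\<close>)
  then show ?thesis unfolding g_def survival_prob_eq[OF x] survival_prob_eq[OF True] by simp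
 qed (simp add: g_def)
 have gm[measurable]: "g \<in> borel_measurable borel" unfolding g_def[abs_def] by measurable
 have Am[measurable]: "(indicator A :: _ \<Rightarrow> ennreal) \<in> borel_measurable borel" using A by simp
 have Em: "(indicator ?E :: _ \<Rightarrow> ennreal) \<in> borel_measurable (?P x)"
 proof -
  have "?E \<inter> space cadlag_space = {w\<in>space cadlag_space. ereal t < exit_time w}" by blast
  then have "?E \<inter> space cadlag_space \<in> sets cadlag_space"
   using exit_time_events(1)[OF t] unfolding pred_def by simp
  then have "(indicator ?E :: _ \<Rightarrow> ennreal) \<in> borel_measurable cadlag_space"
   by (simp only: borel_measurable_indicator_iff)
  then show ?thesis unfolding measurable_cong_sets[OF sP refl] .
 qed
 have evm: "(\<lambda>w. w t) \<in> borel_measurable (?P x)" unfolding measurable_cong_sets[OF sP refl] by (rule cadlag_space_eval[OF t])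
 have evm': "(\<lambda>w. w t) \<in> measurable (density (?P x) (indicator ?E)) borel"
  using evm by (simp add: measurable_cong_sets[OF sets_density refl])
 have gA: "(\<lambda>y. g y * indicator A y) \<in> borel_measurable borel" by measurable
 have gAP: "(\<lambda>w. g (w t) * indicator A (w t)) \<in> borel_measurable (?P x)" by (rule measurable_compose[OF evm gA])
 have sk: "sets (killed_law ?P t x) = sets borel" by (simp only: killed_law_def sets_distr)
 have HK: "H_kernel ?P t x = density (killed_law ?P t x) g" unfolding H_kernel_def if_P[OF x] g ..
 have "emeasure (H_kernel ?P t x) A = (\<integral>\<^sup>+y. g y * indicator A y \<partial>killed_law ?P t x)"
  unfolding HK by (rule emeasure_density) (simp_all only: measurable_cong_sets[OF sk refl] gm sk A)
 also have "\<dots> = (\<integral>\<^sup>+w. g (w t) * indicator A (w t) \<partial>density (?P x) (indicator ?E))"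
  unfolding killed_law_def by (rule nn_integral_distr[OF evm']) (simp only: measurable_distr_eq1 gA)
 also have "\<dots> = (\<integral>\<^sup>+w. indicator ?E w * (g (w t) * indicator A (w t)) \<partial>?P x)"
  by (rule nn_integral_density[OF Em gAP])
 also have "\<dots> = (\<integral>\<^sup>+\<xi>. indicator ?E (start x \<xi>) * (g (start x \<xi> t) * indicator A (start x \<xi> t)) \<partial>M)"
  unfolding drift_law_def
  by (rule nn_integral_distr[OF drift_path_measurable])
   (rule borel_measurable_times_ennreal[OF Em gAP, unfolded drift_law_def])
 also have "\<dots> = (\<integral>\<^sup>+\<xi>. ((if \<forall>r\<in>{r\<in>rats_nonneg. r < t}. 0 \<le> x + W r \<xi> then indicator (A \<inter> {0<..}) (x + W t \<xi>) else 0) / harmonic x) * surv_mean rats_nonneg (\<lambda>_. 1) 0 (x + W t \<xi>) \<partial>M)"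
 proof (intro nn_integral_cong)
  fix \<xi> assume w: "\<xi> \<in> space M"
  have s: "start x \<xi> \<in> space cadlag_space" by (rule measurable_space[OF drift_path_measurable w])
  have st: "start x \<xi> r = x + W r \<xi>" if "0 \<le> r" for r using that by (simp add: add.assoc)
  (* A positive value at t extends survival until t to a right neighbourhood of t. *)
  have iff: "start x \<xi> \<in> ?E \<longleftrightarrow> (\<forall>r\<in>{r\<in>rats_nonneg. r < t}. 0 \<le> x + W r \<xi>)" if pos: "0 < x + W t \<xi>"
  proof -
   have "start x \<xi> \<in> ?E \<longleftrightarrow> (\<exists>r::rat. t < of_rat r \<and> (\<forall>q::rat. 0 < q \<and> q < r \<longrightarrow> 0 \<le> start x \<xi> (of_rat q)))"
    using exit_time_gt_iff[OF space_cadlag_space[OF s] t] by blast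
   also have "\<dots> \<longleftrightarrow> (\<forall>r\<in>{r\<in>rats_nonneg. r < t}. 0 \<le> x + W r \<xi>)"
   proof
    assume "\<exists>r::rat. t < of_rat r \<and> (\<forall>q::rat. 0 < q \<and> q < r \<longrightarrow> 0 \<le> start x \<xi> (of_rat q))"
    then obtain r :: rat where r: "t < of_rat r" "\<forall>q::rat. 0 < q \<and> q < r \<longrightarrow> 0 \<le> start x \<xi> (of_rat q)" by blast
    show "\<forall>r\<in>{r\<in>rats_nonneg. r < t}. 0 \<le> x + W r \<xi>"
    proof
     fix u assume "u \<in> {r\<in>rats_nonneg. r < t}"
     then obtain q :: rat where q: "u = of_rat q" "0 \<le> q" "of_rat q < t" by auto
     show "0 \<le> x + W u \<xi>"
     proof (cases "q = 0")
      case True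
      then show ?thesis using q X_0[OF w] x by simp
     next
      case False
      have "(of_rat q :: real) < of_rat r" using q(3) r(1) by linarith
      then have "q < r" by (simp add: of_rat_less)
      then have "0 \<le> start x \<xi> (of_rat q)" using r(2) q(2) False by simp
      then show ?thesis using q st[of u] by simp
     qed
    qed
   next
    assume a: "\<forall>r\<in>{r\<in>rats_nonneg. r < t}. 0 \<le> x + W r \<xi>"
    obtain d where d: "0 < d" "\<And>s. t \<le> s \<Longrightarrow> s < t + d \<Longrightarrow> \<bar>W s \<xi> - W t \<xi>\<bar> < x + W t \<xi>"
     using cadlag_right_eps[OF W_cadlag[OF w] pos, of t] by metis
    obtain r :: rat where r: "t < of_rat r" "of_rat r < t + d" using of_rat_dense[of t "t + d"] d(1) by auto
    have "0 \<le> start x \<xi> (of_rat q)" if q: "0 < q" "q < r" for q :: rat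
    proof -
     have q0: "0 \<le> (of_rat q :: real)" using q by simp
     have qr: "(of_rat q :: real) < of_rat r" using q by (simp add: of_rat_less)
     have "0 \<le> x + W (of_rat q) \<xi>"
     proof (cases "of_rat q < t")
      case True
      have "of_rat q \<in> rats_nonneg" by (rule imageI) (use q in simp)
      then show ?thesis using a True by blast
     next
      case False
      then have "\<bar>W (of_rat q) \<xi> - W t \<xi>\<bar> < x + W t \<xi>" using d(2)[of "of_rat q"] qr r(2) by linarith
      then show ?thesis by linarith
     qed
     then show ?thesis unfolding st[OF q0] .
    qed
    then show "\<exists>r::rat. t < of_rat r \<and> (\<forall>q::rat. 0 < q \<and> q < r \<longrightarrow> 0 \<le> start x \<xi> (of_rat q))" using r(1) by blast
   qed
   finally show ?thesis .
  qed
  show "indicator ?E (start x \<xi>) * (g (start x \<xi> t) * indicator A (start x \<xi> t)) =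
   ((if \<forall>r\<in>{r\<in>rats_nonneg. r < t}. 0 \<le> x + W r \<xi> then indicator (A \<inter> {0<..}) (x + W t \<xi>) else 0) / harmonic x) * surv_mean rats_nonneg (\<lambda>_. 1) 0 (x + W t \<xi>)"
  proof (cases "0 < x + W t \<xi>")
   case True
   show ?thesis unfolding st[OF t] g_def harmonic_eq indicator_def[of ?E] iff[OF True] using True
    by (simp add: indicator_def divide_ennreal_def mult_ac)
  next
   case False
   then have "g (x + W t \<xi>) = 0" "indicator (A \<inter> {0<..}) (x + W t \<xi>) = (0 :: ennreal)" by (simp_all add: g_def)
   then show ?thesis unfolding st[OF t] by (simp only: mult_zero_left mult_zero_right ennreal_zero_divide if_cancel)
  qed
 qed
 also have "\<dots> = (\<integral>\<^sup>+\<xi>. ((if \<forall>r\<in>{r\<in>rats_nonneg. r < t}. 0 \<le> x + W r \<xi> then indicator (A \<inter> {0<..}) (x + W t \<xi>) else 0) / harmonic x) *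
   (if \<forall>r\<in>rats_nonneg. 0 \<le> (x + W t \<xi>) + (fut t \<xi> r + \<alpha> * r) then 1 else 0) \<partial>M)"
 proof (rule freeze_surv_mean[symmetric, OF t order_refl])
  show "countable rats_nonneg" "rats_nonneg \<subseteq> {0..}" "(\<lambda>_. 1 :: ennreal) \<in> borel_measurable borel" by auto
  have Xp: "X r \<in> borel_measurable (past t)" if "r \<le> t" for r by (rule X_past[OF that])
  have 1: "Measurable.pred (past t) (\<lambda>\<xi>. \<forall>r\<in>{r\<in>rats_nonneg. r < t}. 0 \<le> x + W r \<xi>)"
  proof (rule pred_ball_countable)
   show "countable {r\<in>rats_nonneg. r < t}" by (rule countable_subset[of _ rats_nonneg]) auto
   fix r assume "r \<in> {r\<in>rats_nonneg. r < t}"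
   then have [measurable]: "X r \<in> borel_measurable (past t)" by (intro Xp) simp
   show "Measurable.pred (past t) (\<lambda>\<xi>. 0 \<le> x + W r \<xi>)" by measurable
  qed
  have [measurable]: "X t \<in> borel_measurable (past t)" by (rule Xp) simp
  have 2: "(\<lambda>\<xi>. indicator (A \<inter> {0<..}) (x + W t \<xi>) :: ennreal) \<in> borel_measurable (past t)"
   using A by measurable
  show "(\<lambda>\<xi>. (if \<forall>r\<in>{r\<in>rats_nonneg. r < t}. 0 \<le> x + W r \<xi> then indicator (A \<inter> {0<..}) (x + W t \<xi>) else 0) / harmonic x) \<in> borel_measurable (past t)"
   by (intro borel_measurable_divide_ennreal borel_measurable_const measurable_If 1[unfolded pred_def] 2)
 qed
 also have "\<dots> = (\<integral>\<^sup>+\<xi>. (if \<forall>r\<in>rats_nonneg. 0 \<le> x + W r \<xi> then indicator A (x + W t \<xi>) else 0) / harmonic x \<partial>M)"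
 proof (rule nn_integral_cong_AE)
  have "AE \<xi> in M. (\<forall>r\<in>rats_nonneg. 0 \<le> x + W r \<xi>) \<longrightarrow> 0 < x + W t \<xi>"
   using AE_dips_left[of t] AE_space
  proof eventually_elim
   case (elim \<xi>)
   show ?case
   proof
    assume "\<forall>r\<in>rats_nonneg. 0 \<le> x + W r \<xi>"
    then have "\<forall>r\<in>rats_nonneg. - x \<le> W r \<xi>" by (intro ballI) (drule bspec, assumption, linarith)
    then have s: "\<forall>s\<ge>0. - x \<le> W s \<xi>" unfolding survival_rat_iff[OF elim(2)] .
    show "0 < x + W t \<xi>"
    proof (cases "t = 0")
     case True then show ?thesis using x X_0[OF elim(2)] by simp
    next
     case False
     then have "0 < t" using t by simp
     then obtain s where "0 < s" "W s \<xi> < W t \<xi>" using elim(1) by blast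
     moreover have "- x \<le> W s \<xi>" using s \<open>0 < s\<close> by simp
     ultimately show ?thesis by linarith
    qed
   qed
  qed
  then show "AE \<xi> in M. ((if \<forall>r\<in>{r\<in>rats_nonneg. r < t}. 0 \<le> x + W r \<xi> then indicator (A \<inter> {0<..}) (x + W t \<xi>) else 0) / harmonic x) *
   (if \<forall>r\<in>rats_nonneg. 0 \<le> (x + W t \<xi>) + (fut t \<xi> r + \<alpha> * r) then 1 else 0) =
   (if \<forall>r\<in>rats_nonneg. 0 \<le> x + W r \<xi> then indicator A (x + W t \<xi>) else 0) / harmonic x"
   using AE_space
  proof eventually_elim
   case (elim \<xi>)
   have f: "(x + W t \<xi>) + (fut t \<xi> r + \<alpha> * r) = x + W (t + r) \<xi>" if "0 \<le> r" for r
    unfolding fut_eval(2)[OF that] by (simp add: distrib_left)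
   have s: "(\<forall>r\<in>rats_nonneg. 0 \<le> x + W r \<xi>) \<longleftrightarrow> (\<forall>s\<ge>0. 0 \<le> x + W s \<xi>)"
   proof -
    have eq: "0 \<le> x + y \<longleftrightarrow> - x \<le> y" for y by (rule iffI; linarith)
    show ?thesis unfolding eq by (rule survival_rat_iff[OF elim(2)])
   qed
   have split: "(\<forall>r\<in>{r\<in>rats_nonneg. r < t}. 0 \<le> x + W r \<xi>) \<and> (\<forall>r\<in>rats_nonneg. 0 \<le> (x + W t \<xi>) + (fut t \<xi> r + \<alpha> * r)) \<longleftrightarrow> (\<forall>r\<in>rats_nonneg. 0 \<le> x + W r \<xi>)"
   proof
    assume a: "(\<forall>r\<in>{r\<in>rats_nonneg. r < t}. 0 \<le> x + W r \<xi>) \<and> (\<forall>r\<in>rats_nonneg. 0 \<le> (x + W t \<xi>) + (fut t \<xi> r + \<alpha> * r))"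
    have tail: "\<forall>r\<in>rats_nonneg. 0 \<le> x + W (t + r) \<xi>"
    proof
     fix r assume r: "r \<in> rats_nonneg"
     then have "0 \<le> r" by auto
     from f[OF this] a r show "0 \<le> x + W (t + r) \<xi>" by (metis (no_types, lifting))
    qed
    show "\<forall>r\<in>rats_nonneg. 0 \<le> x + W r \<xi>"
    proof
     fix r assume r: "r \<in> rats_nonneg"
     show "0 \<le> x + W r \<xi>"
     proof (cases "r < t")
      case True then show ?thesis using a r by blast
     next
      case False
      then have rt: "0 \<le> r - t" by simp
      show ?thesis
      proof (rule ccontr)
       assume "\<not> 0 \<le> x + W r \<xi>"
       then have e: "0 < - (x + W r \<xi>)" by simp
       obtain d where d: "0 < d" "\<And>s. r \<le> s \<Longrightarrow> s < r + d \<Longrightarrow> \<bar>W s \<xi> - W r \<xi>\<bar> < - (x + W r \<xi>)"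
        using cadlag_right_eps[OF W_cadlag[OF elim(2)] e, of r] by metis
       obtain q :: rat where q: "r - t < of_rat q" "of_rat q < r - t + d" using of_rat_dense[of "r - t" "r - t + d"] d(1) by auto
       have "0 \<le> (of_rat q :: real)" using q(1) rt by linarith
       then have "of_rat q \<in> rats_nonneg" by (intro imageI) simp
       with tail have "0 \<le> x + W (t + of_rat q) \<xi>" by blast
       moreover have "\<bar>W (t + of_rat q) \<xi> - W r \<xi>\<bar> < - (x + W r \<xi>)" using q by (intro d(2)) linarith+
       ultimately show False by linarith
      qed
     qed
    qed
   next
    assume "\<forall>r\<in>rats_nonneg. 0 \<le> x + W r \<xi>"
    then have all: "\<forall>s\<ge>0. 0 \<le> x + W s \<xi>" unfolding s .
    show "(\<forall>r\<in>{r\<in>rats_nonneg. r < t}. 0 \<le> x + W r \<xi>) \<and> (\<forall>r\<in>rats_nonneg. 0 \<le> (x + W t \<xi>) + (fut t \<xi> r + \<alpha> * r))"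
    proof (intro conjI ballI)
     fix r assume "r \<in> rats_nonneg"
     then have r0: "0 \<le> r" by auto
     show "0 \<le> (x + W t \<xi>) + (fut t \<xi> r + \<alpha> * r)" unfolding f[OF r0] using all r0 t by simp
    next
     fix r assume "r \<in> {r\<in>rats_nonneg. r < t}"
     then have "0 \<le> r" by auto
     then show "0 \<le> x + W r \<xi>" using all by blast
    qed
   qed
   have comb: "((if P then a else 0) / harmonic x) * (if Q then 1 else 0) = (if S then b else 0) / harmonic x"
    if "P \<and> Q \<longleftrightarrow> S" "S \<Longrightarrow> a = b" for P Q S and a b :: ennreal
    using that by (cases P; cases Q) simp_all
   show ?case
   proof (rule comb[OF split])
    assume "\<forall>r\<in>rats_nonneg. 0 \<le> x + W r \<xi>"
    then have "0 < x + W t \<xi>" using elim(1) by blast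
    then show "indicator (A \<inter> {0<..}) (x + W t \<xi>) = (indicator A (x + W t \<xi>) :: ennreal)" by (simp add: indicator_def)
   qed
  qed
 qed
 also have "\<dots> = surv_mean rats_nonneg (indicator A) t x / harmonic x"
  unfolding surv_mean_def
 proof (rule nn_integral_divide)
  have 2: "(\<lambda>\<xi>. indicator A (x + W t \<xi>) :: ennreal) \<in> borel_measurable M" using A by measurable
  show "(\<lambda>\<xi>. if \<forall>r\<in>rats_nonneg. 0 \<le> x + W r \<xi> then indicator A (x + W t \<xi>) else 0 :: ennreal) \<in> borel_measurable M"
   by (intro measurable_If 2 borel_measurable_const survives_pred[unfolded pred_def])
 qed
 finally show ?thesis .
qed

end

section \<open>Independence, entrance laws and the Markov property\<close>

lemma sets_borel_lessThan: "sets (borel :: real measure) = sigma_sets UNIV (range lessThan)"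
 by (subst borel_Iio) simp

lemma Int_stable_range_lessThan: "Int_stable (range lessThan :: real set set)"
proof (rule Int_stableI)
 fix a b :: "real set" assume "a \<in> range lessThan" "b \<in> range lessThan"
 then obtain x y where "a = {..<x}" "b = {..<y}" by blast
 then have "a \<inter> b = {..<min x y}" by auto
 then show "a \<inter> b \<in> range lessThan" by blast
qed

lemma space_cemetery_borel[simp]: "space cemetery_borel = UNIV"
 by (simp add: cemetery_borel_def)

text \<open>The cemetery point need not be among the generators: it is the complement of the union
of the half-lines.\<close>
lemma sets_cemetery_borel: "sets cemetery_borel = sigma_sets UNIV (range (\<lambda>a. Some ` {..<a}))"
proof -
 let ?E = "range (\<lambda>a::real. Some ` {..<a})"
 let ?N = "sigma UNIV ?E"
 have sN: "sets ?N = sigma_sets UNIV ?E" by simp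
 have basic: "Some ` {..<a} \<in> sets ?N" for a :: real unfolding sN by (rule sigma_sets.Basic) blast
 have all: "range Some \<in> sets ?N"
 proof -
  have "range Some = (\<Union>n::nat. Some ` {..<real n})"
   using reals_Archimedean2 by (auto simp: image_iff)
  moreover have "(\<Union>n::nat. Some ` {..<real n}) \<in> sets ?N" by (rule sets.countable_nat_UN) (use basic in blast)
  ultimately show ?thesis by simp
 qed
 have image: "Some ` C \<in> sets ?N" if "C \<in> sigma_sets UNIV (range lessThan)" for C :: "real set"
  using that
 proof (induction rule: sigma_sets.induct)
  case (Compl C)
  have "Some ` (UNIV - C) = range Some - Some ` C" by auto
  then show ?case using sets.Diff[OF all Compl.IH] by simp
 next
  case (Union C)
  then show ?case unfolding image_UN by (intro sets.countable_nat_UN) blast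
 qed (use basic in \<open>auto intro: sigma_sets.Empty\<close>)
 have "B \<in> sets ?N" if "Some -` B \<in> sets borel" for B :: "real option set"
 proof -
  have 1: "Some ` (Some -` B) \<in> sets ?N" using that unfolding sets_borel_lessThan by (rule image)
  have None: "{None :: real option} = UNIV - range Some" by (auto simp: UNIV_option_conv)
  have 2: "{None} \<in> sets ?N" unfolding None using sets.compl_sets[OF all] by (simp only: space_measure_of_conv)
  have "B = Some ` (Some -` B) \<or> B = Some ` (Some -` B) \<union> {None}"
  proof (cases "None \<in> B")
   case True
   have "B = Some ` (Some -` B) \<union> {None}"
   proof (rule set_eqI)
    fix z show "z \<in> B \<longleftrightarrow> z \<in> Some ` (Some -` B) \<union> {None}" using True by (cases z) auto
   qed
   then show ?thesis by blast
  next
   case False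
   have "B = Some ` (Some -` B)"
   proof (rule set_eqI)
    fix z show "z \<in> B \<longleftrightarrow> z \<in> Some ` (Some -` B)" using False by (cases z) auto
   qed
   then show ?thesis by blast
  qed
  then show ?thesis using 1 sets.Un[OF 1 2] by metis
 qed
 then have "{B :: real option set. Some -` B \<in> sets borel} \<subseteq> sets ?N" by blast
 from sets.sigma_sets_subset[OF this]
 have le: "sigma_sets UNIV {B :: real option set. Some -` B \<in> sets borel} \<subseteq> sigma_sets UNIV ?E"
  unfolding space_measure_of_conv sN .
 have ge: "sigma_sets UNIV ?E \<subseteq> sigma_sets UNIV {B :: real option set. Some -` B \<in> sets borel}"
 proof (rule sigma_sets_mono')
  show "?E \<subseteq> {B. Some -` B \<in> sets borel}" by (auto simp: inj_vimage_image_eq)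
 qed
 have "sets cemetery_borel = sigma_sets UNIV {B :: real option set. Some -` B \<in> sets borel}"
  unfolding cemetery_borel_def by (rule sets_measure_of) simp
 then show ?thesis using le ge by (simp only: subset_antisym)
qed

context regular_levy begin

definition Xpost :: "real \<Rightarrow> 'a \<Rightarrow> real" where "Xpost t \<xi> = X (t + D \<xi>) \<xi> - X (D \<xi>) \<xi>"

lemma Y_eq: "Y t \<xi> = Xpost t \<xi> + \<alpha> * t"
 by (simp add: Y_def Xpost_def)

text \<open>On both sides it suffices to consider cylinders over half-lines, and these are covered
by the product formula.\<close>
lemma indep_post_pre:
 "indep_set (sets (process_algebra M {0..} borel Xpost)) (sets (process_algebra M UNIV cemetery_borel (killed_after D X)))"
proof -
 let ?E1 = "range lessThan :: real set set"
 let ?E2 = "range (\<lambda>a::real. Some ` {..<a})"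
 let ?G1 = "cylinder_events M {0..} ?E1 Xpost"
 let ?G2 = "cylinder_events M UNIV ?E2 (killed_after D X)"
 have 1: "sets (process_algebra M {0..} borel Xpost) = sigma_sets (space M) ?G1"
  by (rule sets_process_algebra) (simp_all add: sets_borel_lessThan)
 have 2: "sets (process_algebra M UNIV cemetery_borel (killed_after D X)) = sigma_sets (space M) ?G2"
  by (rule sets_process_algebra) (simp_all add: sets_cemetery_borel)
 have form1: "\<exists>J a. finite J \<and> J \<subseteq> {0..} \<and> A = {\<xi>\<in>space M. \<forall>j\<in>J. Y j \<xi> < a j}" if "A \<in> ?G1" for A
 proof -
  obtain J B where A: "A = {\<xi>\<in>space M. \<forall>j\<in>J. Xpost j \<xi> \<in> B j}" "finite J" "J \<subseteq> {0..}" "\<forall>j\<in>J. B j \<in> ?E1"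
   using \<open>A \<in> ?G1\<close> unfolding cylinder_events_def by blast
  have "\<forall>j\<in>J. \<exists>a. B j = {..<a}" using A(4) by blast
  from bchoice[OF this] obtain a where a: "\<forall>j\<in>J. B j = {..<a j}" by blast
  have "A = {\<xi>\<in>space M. \<forall>j\<in>J. Y j \<xi> < a j + \<alpha> * j}"
   unfolding A(1) using a by (auto simp: Y_eq)
  then show ?thesis using A(2,3) by (intro exI[of _ J] exI[of _ "\<lambda>j. a j + \<alpha> * j"]) blast
 qed
 have form2: "\<exists>K c. finite K \<and> A = {\<xi>\<in>space M. \<forall>s\<in>K. s \<le> D \<xi> \<and> X s \<xi> < c s}" if "A \<in> ?G2" for A
 proof -
  obtain K B where A: "A = {\<xi>\<in>space M. \<forall>s\<in>K. killed_after D X s \<xi> \<in> B s}" "finite K" "\<forall>s\<in>K. B s \<in> ?E2"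
   using \<open>A \<in> ?G2\<close> unfolding cylinder_events_def by blast
  have "\<forall>s\<in>K. \<exists>c. B s = Some ` {..<c}" using A(3) by blast
  from bchoice[OF this] obtain c where c: "\<forall>s\<in>K. B s = Some ` {..<c s}" by blast
  have "A = {\<xi>\<in>space M. \<forall>s\<in>K. s \<le> D \<xi> \<and> X s \<xi> < c s}"
   unfolding A(1) using c by (auto simp: killed_after_def image_iff split: if_splits)
  then show ?thesis using A(2) by blast
 qed
 have m1: "{\<xi>\<in>space M. \<forall>j\<in>J. Y j \<xi> < a j} \<in> events" if "finite J" for J a
  by (rule pred_ball_countable[unfolded pred_def]) (use that countable_finite in auto)
 have m2: "{\<xi>\<in>space M. \<forall>s\<in>K. s \<le> D \<xi> \<and> X s \<xi> < c s} \<in> events" if "finite K" for K c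
  by (rule pred_ball_countable[unfolded pred_def]) (use that countable_finite in auto)
 have "indep_set ?G1 ?G2"
 proof (rule indep_setI)
  show "?G1 \<subseteq> events" using form1 m1 by blast
  show "?G2 \<subseteq> events" using form2 m2 by blast
  fix A B assume "A \<in> ?G1" "B \<in> ?G2"
  obtain J a where A: "finite J" "J \<subseteq> {0..}" "A = {\<xi>\<in>space M. \<forall>j\<in>J. Y j \<xi> < a j}" using form1[OF \<open>A \<in> ?G1\<close>] by blast
  obtain K c where B: "finite K" "B = {\<xi>\<in>space M. \<forall>s\<in>K. s \<le> D \<xi> \<and> X s \<xi> < c s}" using form2[OF \<open>B \<in> ?G2\<close>] by blast
  have "A \<inter> B = {\<xi>\<in>space M. (\<forall>s\<in>K. s \<le> D \<xi> \<and> X s \<xi> < c s) \<and> (\<forall>j\<in>J. Y j \<xi> < a j)}" unfolding A(3) B(2) by blast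
  then have "emeasure M (A \<inter> B) = emeasure M B * emeasure M A"
   using independence_cylinder[OF A(1,2) B(1), of c a] unfolding A(3) B(2) by simp
  then have "ennreal (prob (A \<inter> B)) = ennreal (prob B * prob A)"
   by (simp add: emeasure_eq_measure ennreal_mult)
  then show "prob (A \<inter> B) = prob A * prob B" by (simp add: mult.commute)
 qed
 moreover have "Int_stable ?G1" by (rule Int_stable_cylinder_events[OF Int_stable_range_lessThan])
 moreover have "Int_stable ?G2"
 proof (rule Int_stable_cylinder_events, rule Int_stableI)
  fix a b :: "real option set" assume "a \<in> ?E2" "b \<in> ?E2"
  then obtain x y where "a = Some ` {..<x}" "b = Some ` {..<y}" by blast
  then have "a \<inter> b = Some ` {..<min x y}" by auto
  then show "a \<inter> b \<in> ?E2" by blast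
 qed
 ultimately show ?thesis unfolding 1 2 by (rule indep_set_sigma_sets)
qed

abbreviation "Ypast s \<equiv> process_algebra M {0..s} borel Y"

lemma Ypast_subset: "sets (Ypast s) \<subseteq> sets M"
 by (rule sets_process_algebra_subset) auto

lemma Y_Ypast: "0 \<le> r \<Longrightarrow> r \<le> s \<Longrightarrow> Y r \<in> borel_measurable (Ypast s)"
 by (rule measurable_process_algebra) auto

lemma surv_mean_ind_measurable: "A \<in> sets borel \<Longrightarrow> surv_mean rats_nonneg (indicator A) \<tau> \<in> borel_measurable borel"
 by (rule surv_mean_measurable) auto

lemma surv_mean_mono: "(\<And>y. \<phi> y \<le> \<psi> y) \<Longrightarrow> surv_mean L \<phi> \<tau> x \<le> surv_mean L \<psi> \<tau> x"
 unfolding surv_mean_def by (rule nn_integral_mono) simp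

lemma surv_mean_ind_le_harmonic: "surv_mean rats_nonneg (indicator A) \<tau> x \<le> harmonic x"
 unfolding harmonic_eq[of \<tau>, symmetric] by (rule surv_mean_mono) (simp add: indicator_def)

text \<open>Both sides are finite measures in A that agree on half-lines.\<close>
lemma markov_cylinder_borel:
 assumes C: "C \<in> cylinder_events M {0..s} (range lessThan) Y" and s: "0 < s" and \<tau>: "0 \<le> \<tau>" and A: "A \<in> sets borel"
 shows "(\<integral>\<^sup>+\<xi>. indicator C \<xi> * (indicator A (Y (s + \<tau>) \<xi>) * harmonic (Y s \<xi>)) \<partial>M) =
  (\<integral>\<^sup>+\<xi>. indicator C \<xi> * surv_mean rats_nonneg (indicator A) \<tau> (Y s \<xi>) \<partial>M)"
proof -
 obtain J B where J: "C = {\<xi>\<in>space M. \<forall>j\<in>J. Y j \<xi> \<in> B j}" "finite J" "J \<subseteq> {0..s}" "\<forall>j\<in>J. B j \<in> range lessThan"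
  using C unfolding cylinder_events_def by blast
 have "\<forall>j\<in>J. \<exists>a. B j = {..<a}" using J(4) by blast
 from bchoice[OF this] obtain a where a: "\<forall>j\<in>J. B j = {..<a j}" by blast
 have Ca: "C = {\<xi>\<in>space M. \<forall>j\<in>J. Y j \<xi> < a j}" unfolding J(1) using a by auto
 have Cm[measurable]: "C \<in> sets M"
  unfolding Ca by (rule pred_ball_countable[unfolded pred_def]) (use J(2) countable_finite in auto)
 let ?N1 = "density M (\<lambda>\<xi>. indicator C \<xi> * harmonic (Y s \<xi>))"
 let ?d = "\<lambda>p. indicator C (fst p) * (if \<forall>r\<in>rats_nonneg. 0 \<le> Y s (fst p) + W r (snd p) then 1 else 0 :: ennreal)"
 let ?N2 = "density (M \<Otimes>\<^sub>M M) ?d"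
 let ?m1 = "distr ?N1 borel (Y (s + \<tau>))"
 let ?f = "\<lambda>p. Y s (fst p) + W \<tau> (snd p)"
 let ?m2 = "distr ?N2 borel ?f"
 have surv: "Measurable.pred (M \<Otimes>\<^sub>M M) (\<lambda>p. \<forall>r\<in>rats_nonneg. 0 \<le> Y s (fst p) + W r (snd p))"
  by (rule pred_ball_countable) (simp, measurable)
 have fm: "?f \<in> borel_measurable (M \<Otimes>\<^sub>M M)" by measurable
 have dm: "?d \<in> borel_measurable (M \<Otimes>\<^sub>M M)"
  by (intro borel_measurable_times_ennreal measurable_If surv[unfolded pred_def] borel_measurable_const
    measurable_compose[OF measurable_fst borel_measurable_indicator[OF Cm]])
 have e1: "emeasure ?m1 A = (\<integral>\<^sup>+\<xi>. indicator C \<xi> * (indicator A (Y (s + \<tau>) \<xi>) * harmonic (Y s \<xi>)) \<partial>M)" if A: "A \<in> sets borel" for A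
 proof -
  have "Y (s + \<tau>) \<in> measurable ?N1 borel" by simp
  then have "emeasure ?m1 A = emeasure ?N1 (Y (s + \<tau>) -` A \<inter> space M)" using A by (simp add: emeasure_distr)
  also have "\<dots> = (\<integral>\<^sup>+\<xi>. (indicator C \<xi> * harmonic (Y s \<xi>)) * indicator (Y (s + \<tau>) -` A \<inter> space M) \<xi> \<partial>M)"
  proof (rule emeasure_density)
   show "(\<lambda>\<xi>. indicator C \<xi> * harmonic (Y s \<xi>)) \<in> borel_measurable M" by measurable
   show "Y (s + \<tau>) -` A \<inter> space M \<in> sets M" by (rule measurable_sets[OF Y_measurable A])
  qed
  also have "\<dots> = (\<integral>\<^sup>+\<xi>. indicator C \<xi> * (indicator A (Y (s + \<tau>) \<xi>) * harmonic (Y s \<xi>)) \<partial>M)"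
   by (intro nn_integral_cong) (simp add: indicator_def)
  finally show ?thesis .
 qed
 have e2: "emeasure ?m2 A = (\<integral>\<^sup>+\<xi>. indicator C \<xi> * surv_mean rats_nonneg (indicator A) \<tau> (Y s \<xi>) \<partial>M)" if A: "A \<in> sets borel" for A
 proof -
  have fA: "?f -` A \<inter> space (M \<Otimes>\<^sub>M M) \<in> sets (M \<Otimes>\<^sub>M M)" by (rule measurable_sets[OF fm A])
  have "?f \<in> measurable ?N2 borel" using fm by simp
  then have "emeasure ?m2 A = emeasure ?N2 (?f -` A \<inter> space (M \<Otimes>\<^sub>M M))" using A by (simp only: emeasure_distr space_density)
  also have "\<dots> = (\<integral>\<^sup>+p. ?d p * indicator (?f -` A \<inter> space (M \<Otimes>\<^sub>M M)) p \<partial>(M \<Otimes>\<^sub>M M))"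
   by (rule emeasure_density[OF dm fA])
  also have "\<dots> = (\<integral>\<^sup>+\<xi>. (\<integral>\<^sup>+\<xi>'. ?d (\<xi>, \<xi>') * indicator (?f -` A \<inter> space (M \<Otimes>\<^sub>M M)) (\<xi>, \<xi>') \<partial>M) \<partial>M)"
   by (rule nn_integral_fst[symmetric]) (intro borel_measurable_times_ennreal dm borel_measurable_indicator fA)
  also have "\<dots> = (\<integral>\<^sup>+\<xi>. indicator C \<xi> * surv_mean rats_nonneg (indicator A) \<tau> (Y s \<xi>) \<partial>M)"
  proof (intro nn_integral_cong)
   fix \<xi> assume w: "\<xi> \<in> space M"
   have km: "(\<lambda>\<xi>'. if \<forall>r\<in>rats_nonneg. 0 \<le> Y s \<xi> + W r \<xi>' then indicator A (Y s \<xi> + W \<tau> \<xi>') else 0 :: ennreal) \<in> borel_measurable M"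
   proof (intro measurable_If borel_measurable_const survives_pred[unfolded pred_def])
    show "(\<lambda>\<xi>'. indicator A (Y s \<xi> + W \<tau> \<xi>') :: ennreal) \<in> borel_measurable M" using A by measurable
   qed
   have "(\<integral>\<^sup>+\<xi>'. ?d (\<xi>, \<xi>') * indicator (?f -` A \<inter> space (M \<Otimes>\<^sub>M M)) (\<xi>, \<xi>') \<partial>M) =
    (\<integral>\<^sup>+\<xi>'. indicator C \<xi> * (if \<forall>r\<in>rats_nonneg. 0 \<le> Y s \<xi> + W r \<xi>' then indicator A (Y s \<xi> + W \<tau> \<xi>') else 0) \<partial>M)"
    by (intro nn_integral_cong) (use w in \<open>simp add: indicator_def space_pair_measure\<close>)
   also have "\<dots> = indicator C \<xi> * surv_mean rats_nonneg (indicator A) \<tau> (Y s \<xi>)"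
    unfolding surv_mean_def by (rule nn_integral_cmult[OF km])
   finally show "(\<integral>\<^sup>+\<xi>'. ?d (\<xi>, \<xi>') * indicator (?f -` A \<inter> space (M \<Otimes>\<^sub>M M)) (\<xi>, \<xi>') \<partial>M) = \<dots>" .
  qed
  finally show ?thesis .
 qed
 have "?m1 = ?m2"
 proof (rule measure_eqI_generator_eq[OF Int_stable_range_lessThan, of UNIV])
  fix S :: "real set" assume "S \<in> range lessThan"
  then obtain b where S: "S = {..<b}" by blast
  have Sb: "S \<in> sets borel" unfolding S by simp
  show "emeasure ?m1 S = emeasure ?m2 S"
   unfolding e1[OF Sb] e2[OF Sb] unfolding S
   using markov_cylinder[OF J(2,3) s \<tau>, of a b, folded Ca] by (simp only: harmonic_eq mult.assoc)
  next
  show "range (\<lambda>n::nat. {..<real n}) \<subseteq> range lessThan" by auto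
  show "(\<Union>n::nat. {..<real n}) = UNIV" using reals_Archimedean2 by auto
  fix n :: nat
  have "emeasure ?m1 {..<real n} \<le> (\<integral>\<^sup>+\<xi>. 1 \<partial>M)"
   unfolding e1[OF borel_open[OF open_lessThan]]
  proof (intro nn_integral_mono)
   fix \<xi>
   have "indicator C \<xi> * (indicator {..<real n} (Y (s + \<tau>) \<xi>) * harmonic (Y s \<xi>)) \<le> harmonic (Y s \<xi>)" by (simp add: indicator_def)
   then show "indicator C \<xi> * (indicator {..<real n} (Y (s + \<tau>) \<xi>) * harmonic (Y s \<xi>)) \<le> 1" using harmonic_le_1 by (rule order_trans)
  qed
  then show "emeasure ?m1 {..<real n} \<noteq> \<infinity>" by (auto simp: emeasure_space_1 top_unique)
 qed (simp_all add: sets_borel_lessThan)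
 then have "emeasure ?m1 A = emeasure ?m2 A" by simp
 then show ?thesis unfolding e1[OF A] e2[OF A] .
qed

text \<open>Both sides of the cylinder identity are measures in the cylinder, and so they agree on
the past of s; then h is moved to the other side by taking \<open>u/h\<close> as integrand.\<close>
lemma markov_identity:
 assumes s: "0 < s" and \<tau>: "0 \<le> \<tau>" and A: "A \<in> sets borel" and u: "u \<in> borel_measurable (Ypast s)"
 shows "(\<integral>\<^sup>+\<xi>. u \<xi> * indicator A (Y (s + \<tau>) \<xi>) \<partial>M) = (\<integral>\<^sup>+\<xi>. u \<xi> * emeasure (H_kernel (drift_law M X \<alpha>) \<tau> (Y s \<xi>)) A \<partial>M)"
proof -
 let ?F = "Ypast s"
 let ?g1 = "\<lambda>\<xi>. indicator A (Y (s + \<tau>) \<xi>) * harmonic (Y s \<xi>)"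
 let ?g2 = "\<lambda>\<xi>. surv_mean rats_nonneg (indicator A) \<tau> (Y s \<xi>)"
 let ?n = "\<lambda>g. distr (density M g) ?F (\<lambda>\<xi>. \<xi>)"
 have idM: "(\<lambda>\<xi>. \<xi>) \<in> measurable M ?F"
  using Ypast_subset[of s] sets.sets_into_space[of _ ?F] by (auto simp: measurable_def Int_absorb2)
 have id: "(\<lambda>\<xi>. \<xi>) \<in> measurable (density M g) ?F" for g using idM by simp
 have g1: "?g1 \<in> borel_measurable M" using A by measurable
 have g2: "?g2 \<in> borel_measurable M" by (rule measurable_compose[OF Y_measurable surv_mean_ind_measurable[OF A]])
 have int: "(\<integral>\<^sup>+\<xi>. v \<xi> \<partial>?n g) = (\<integral>\<^sup>+\<xi>. g \<xi> * v \<xi> \<partial>M)" if v: "v \<in> borel_measurable ?F" and g: "g \<in> borel_measurable M" for v g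
 proof -
  have vM: "v \<in> borel_measurable M" using measurable_compose[OF idM v] by simp
  have "(\<integral>\<^sup>+\<xi>. v \<xi> \<partial>?n g) = (\<integral>\<^sup>+\<xi>. v \<xi> \<partial>density M g)"
   by (rule nn_integral_distr[OF id]) (simp only: measurable_distr_eq1 v)
  also have "\<dots> = (\<integral>\<^sup>+\<xi>. g \<xi> * v \<xi> \<partial>M)" by (rule nn_integral_density[OF g vM])
  finally show ?thesis .
 qed
 have em: "emeasure (?n g) S = (\<integral>\<^sup>+\<xi>. indicator S \<xi> * g \<xi> \<partial>M)" if "S \<in> sets ?F" "g \<in> borel_measurable M" for S g
 proof -
  have "emeasure (?n g) S = (\<integral>\<^sup>+\<xi>. indicator S \<xi> \<partial>?n g)" using that(1) by simp
  also have "\<dots> = (\<integral>\<^sup>+\<xi>. g \<xi> * indicator S \<xi> \<partial>M)" by (rule int) (use that in simp_all)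
  finally show ?thesis by (simp only: mult.commute)
 qed
 let ?G = "cylinder_events M {0..s} (range lessThan) Y"
 have sF: "sets ?F = sigma_sets (space M) ?G"
  by (rule sets_process_algebra) (simp_all add: sets_borel_lessThan)
 have G_F: "S \<in> sets ?F" if "S \<in> ?G" for S unfolding sF using that by (rule sigma_sets.Basic)
 have spG: "space M \<in> ?G"
  unfolding cylinder_events_def by (intro CollectI exI[of _ "{}"] exI) auto
 have nn: "?n ?g1 = ?n ?g2"
 proof (rule measure_eqI_generator_eq[OF Int_stable_cylinder_events[OF Int_stable_range_lessThan] cylinder_events_subset])
  fix S assume S: "S \<in> ?G"
  show "emeasure (?n ?g1) S = emeasure (?n ?g2) S"
   unfolding em[OF G_F[OF S] g1] em[OF G_F[OF S] g2] by (rule markov_cylinder_borel[OF S s \<tau> A])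
 next
  show "range (\<lambda>_::nat. space M) \<subseteq> ?G" using spG by auto
  fix n :: nat
  have "emeasure (?n ?g1) (space M) \<le> (\<integral>\<^sup>+\<xi>. 1 \<partial>M)"
   unfolding em[OF G_F[OF spG] g1]
  proof (intro nn_integral_mono)
   fix \<xi>
   have "indicator (space M) \<xi> * (indicator A (Y (s + \<tau>) \<xi>) * harmonic (Y s \<xi>)) \<le> harmonic (Y s \<xi>)" by (simp add: indicator_def)
   then show "indicator (space M) \<xi> * (indicator A (Y (s + \<tau>) \<xi>) * harmonic (Y s \<xi>)) \<le> 1" using harmonic_le_1 by (rule order_trans)
  qed
  then show "emeasure (?n ?g1) (space M) \<noteq> \<infinity>" by (auto simp: emeasure_space_1 top_unique)
 qed (simp_all add: sF)
 have v: "(\<lambda>\<xi>. u \<xi> / harmonic (Y s \<xi>)) \<in> borel_measurable ?F"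
 proof -
  have "Y s \<in> borel_measurable ?F" by (rule Y_Ypast) (use s in simp_all)
  from measurable_compose[OF this harmonic_measurable] show ?thesis by (rule borel_measurable_divide_ennreal[OF u])
 qed
 have eq: "(\<integral>\<^sup>+\<xi>. ?g1 \<xi> * (u \<xi> / harmonic (Y s \<xi>)) \<partial>M) = (\<integral>\<^sup>+\<xi>. ?g2 \<xi> * (u \<xi> / harmonic (Y s \<xi>)) \<partial>M)"
  unfolding int[OF v g1, symmetric] int[OF v g2, symmetric] nn ..
 have "(\<integral>\<^sup>+\<xi>. u \<xi> * indicator A (Y (s + \<tau>) \<xi>) \<partial>M) = (\<integral>\<^sup>+\<xi>. ?g1 \<xi> * (u \<xi> / harmonic (Y s \<xi>)) \<partial>M)"
 proof (rule nn_integral_cong_AE)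
  show "AE \<xi> in M. u \<xi> * indicator A (Y (s + \<tau>) \<xi>) = ?g1 \<xi> * (u \<xi> / harmonic (Y s \<xi>))"
   using AE_good_path
  proof eventually_elim
   case (elim \<xi>)
   have p: "0 < harmonic (Y s \<xi>)" by (rule harmonic_pos[OF Y_pos[OF elim s]])
   have l: "harmonic (Y s \<xi>) < top" using harmonic_le_1[of "Y s \<xi>"] by (rule le_less_trans) simp
   have "harmonic (Y s \<xi>) * (u \<xi> / harmonic (Y s \<xi>)) = u \<xi>"
    using p l by (simp add: ennreal_times_divide ennreal_mult_divide_eq mult.commute[of "harmonic (Y s \<xi>)"])
   then show ?case by (simp only: mult.assoc mult.commute[of "u \<xi>"])
  qed
 qed
 also note eq
 also have "(\<integral>\<^sup>+\<xi>. ?g2 \<xi> * (u \<xi> / harmonic (Y s \<xi>)) \<partial>M) = (\<integral>\<^sup>+\<xi>. u \<xi> * emeasure (H_kernel (drift_law M X \<alpha>) \<tau> (Y s \<xi>)) A \<partial>M)"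
 proof (rule nn_integral_cong_AE)
  show "AE \<xi> in M. ?g2 \<xi> * (u \<xi> / harmonic (Y s \<xi>)) = u \<xi> * emeasure (H_kernel (drift_law M X \<alpha>) \<tau> (Y s \<xi>)) A"
   using AE_good_path
  proof eventually_elim
   case (elim \<xi>)
   show ?case unfolding emeasure_H_kernel[OF Y_pos[OF elim s] \<tau> A] by (simp add: divide_ennreal_def mult_ac)
  qed
 qed
 finally show ?thesis .
qed

lemma emeasure_H_kernel_measurable:
 assumes t: "0 \<le> t" and A: "A \<in> sets borel"
 shows "(\<lambda>x. emeasure (H_kernel (drift_law M X \<alpha>) t x) A) \<in> borel_measurable borel"
proof -
 have "emeasure (H_kernel (drift_law M X \<alpha>) t x) A = (if 0 < x then surv_mean rats_nonneg (indicator A) t x / harmonic x else 0)" for x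
  using emeasure_H_kernel[OF _ t A] by (simp add: H_kernel_def)
 moreover have "(\<lambda>x. if 0 < x then surv_mean rats_nonneg (indicator A) t x / harmonic x else 0) \<in> borel_measurable borel"
  using surv_mean_ind_measurable[OF A, of t] by measurable
 ultimately show ?thesis by simp
qed

lemma emeasure_H_kernel_le_1:
 assumes t: "0 \<le> t" and A: "A \<in> sets borel"
 shows "emeasure (H_kernel (drift_law M X \<alpha>) t x) A \<le> 1"
proof (cases "0 < x")
 case True
 have p: "harmonic x \<noteq> 0" using harmonic_pos[OF True] by simp
 have l: "harmonic x \<noteq> top" using harmonic_le_1[of x] by (auto simp: top_unique)
 have "surv_mean rats_nonneg (indicator A) t x / harmonic x \<le> harmonic x / harmonic x" by (rule divide_right_mono_ennreal[OF surv_mean_ind_le_harmonic])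
 also have "\<dots> = 1" using p l by (simp add: ennreal_divide_self less_top)
 finally show ?thesis unfolding emeasure_H_kernel[OF True t A] .
qed (simp add: H_kernel_def)

text \<open>The Markov identity with the constant integrand 1.\<close>
lemma entrance_laws_H: "entrance_laws (H_kernel (drift_law M X \<alpha>)) (\<lambda>t. distr M borel (Y t))"
 unfolding entrance_laws_def
proof (intro conjI allI impI ballI)
 fix t :: real
 show "prob_space (distr M borel (Y t))" by (rule prob_space_distr) simp
 show "sets (distr M borel (Y t)) = sets borel" by simp
next
 fix s t :: real and A :: "real set" assume s: "0 < s" and t: "0 \<le> t" and A: "A \<in> sets borel"
 have "emeasure (distr M borel (Y (s + t))) A = emeasure M (Y (s + t) -` A \<inter> space M)" using A by (simp add: emeasure_distr)
 also have "\<dots> = (\<integral>\<^sup>+\<xi>. indicator (Y (s + t) -` A \<inter> space M) \<xi> \<partial>M)" by (rule nn_integral_indicator[symmetric, OF measurable_sets[OF Y_measurable A]])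
 also have "\<dots> = (\<integral>\<^sup>+\<xi>. 1 * indicator A (Y (s + t) \<xi>) \<partial>M)" by (intro nn_integral_cong) (simp add: indicator_def)
 also have "\<dots> = (\<integral>\<^sup>+\<xi>. 1 * emeasure (H_kernel (drift_law M X \<alpha>) t (Y s \<xi>)) A \<partial>M)"
  by (rule markov_identity[OF s t A]) simp
 also have "\<dots> = (\<integral>\<^sup>+x. emeasure (H_kernel (drift_law M X \<alpha>) t x) A \<partial>distr M borel (Y s))"
  unfolding mult_1_left
  by (rule nn_integral_distr[OF Y_measurable, symmetric]) (simp only: measurable_distr_eq1 emeasure_H_kernel_measurable[OF t A])
 finally show "emeasure (distr M borel (Y (s + t))) A = (\<integral>\<^sup>+x. emeasure (H_kernel (drift_law M X \<alpha>) t x) A \<partial>distr M borel (Y s))" .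
qed

lemma markovian_Y: "markovian M Y (H_kernel (drift_law M X \<alpha>)) (\<lambda>t. distr M borel (Y t))"
 unfolding markovian_def
proof (intro conjI allI impI ballI)
 fix s t :: real and A :: "real set" assume st: "0 < s \<and> s < t" and A: "A \<in> sets borel"
 define \<tau> where "\<tau> = t - s"
 have s: "0 < s" and \<tau>: "0 \<le> \<tau>" and t: "s + \<tau> = t" using st by (simp_all add: \<tau>_def)
 let ?F = "Ypast s"
 interpret finite_measure_subalgebra M ?F
  by unfold_locales (use Ypast_subset in \<open>simp add: subalgebra_def\<close>)
 define q where "q \<xi> = emeasure (H_kernel (drift_law M X \<alpha>) \<tau> (Y s \<xi>)) A" for \<xi>
 have q1: "q \<xi> \<le> 1" for \<xi> unfolding q_def by (rule emeasure_H_kernel_le_1[OF \<tau> A])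
 then have qtop: "q \<xi> < top" for \<xi> by (rule le_less_trans) simp
 have qF: "q \<in> borel_measurable ?F"
 proof -
  have "Y s \<in> borel_measurable ?F" by (rule Y_Ypast) (use s in simp_all)
  from measurable_compose[OF this emeasure_H_kernel_measurable[OF \<tau> A]] show ?thesis unfolding q_def[abs_def] .
 qed
 have q: "measure (H_kernel (drift_law M X \<alpha>) (t - s) (Y s \<xi>)) A = enn2real (q \<xi>)" for \<xi>
  unfolding q_def measure_def \<tau>_def ..
 let ?f = "indicator (Y t -` A \<inter> space M) :: 'a \<Rightarrow> real"
 let ?g = "\<lambda>\<xi>. enn2real (q \<xi>)"
 have gF: "?g \<in> borel_measurable ?F" using qF by measurable
 have gM: "?g \<in> borel_measurable M" using subalg gF by (rule measurable_from_subalg)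
 have YA: "Y t -` A \<inter> space M \<in> sets M" by (rule measurable_sets[OF Y_measurable A])
 have fM: "?f \<in> borel_measurable M" using YA by simp
 have gb: "0 \<le> ?g \<xi>" "?g \<xi> \<le> 1" for \<xi>
 proof -
  show "?g \<xi> \<le> 1" using enn2real_mono[OF q1[of \<xi>]] by simp
 qed simp
 show "AE \<xi> in M. real_cond_exp M ?F ?f \<xi> = measure (H_kernel (drift_law M X \<alpha>) (t - s) (Y s \<xi>)) A"
  unfolding q
 proof (rule real_cond_exp_charact)
  show "integrable M ?f" using YA by (simp add: integrable_real_indicator emeasure_eq_measure)
  show "integrable M ?g" by (rule integrable_const_bound[of _ 1]) (use gb gM in auto)
  show "?g \<in> borel_measurable ?F" by (rule gF)
  fix S assume S: "S \<in> sets ?F"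
  then have SM: "S \<in> sets M" using Ypast_subset by blast
  have conv: "set_lebesgue_integral M S h = enn2real (\<integral>\<^sup>+\<xi>. indicator S \<xi> * ennreal (h \<xi>) \<partial>M)"
   if "h \<in> borel_measurable M" "\<And>\<xi>. 0 \<le> h \<xi>" for h
  proof -
   have "set_lebesgue_integral M S h = enn2real (\<integral>\<^sup>+\<xi>. ennreal (indicator S \<xi> * h \<xi>) \<partial>M)"
    unfolding set_lebesgue_integral_def real_scaleR_def
    by (rule integral_eq_nn_integral) (use that SM in auto)
   also have "(\<integral>\<^sup>+\<xi>. ennreal (indicator S \<xi> * h \<xi>) \<partial>M) = (\<integral>\<^sup>+\<xi>. indicator S \<xi> * ennreal (h \<xi>) \<partial>M)"
    by (intro nn_integral_cong) (simp add: indicator_def)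
   finally show ?thesis .
  qed
  have "(\<integral>\<^sup>+\<xi>. indicator S \<xi> * ennreal (?f \<xi>) \<partial>M) = (\<integral>\<^sup>+\<xi>. indicator S \<xi> * indicator A (Y (s + \<tau>) \<xi>) \<partial>M)"
   unfolding t by (intro nn_integral_cong) (simp add: indicator_def)
  also have "\<dots> = (\<integral>\<^sup>+\<xi>. indicator S \<xi> * q \<xi> \<partial>M)"
   unfolding q_def by (rule markov_identity[OF s \<tau> A]) (use S in simp)
  also have "\<dots> = (\<integral>\<^sup>+\<xi>. indicator S \<xi> * ennreal (?g \<xi>) \<partial>M)"
   using qtop by simp
  finally show "set_lebesgue_integral M S ?f = set_lebesgue_integral M S ?g"
   by (simp only: conv[OF fM indicator_pos_le] conv[OF gM gb(1)])
 qed
qed simp_all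

end

theorem theorem3p5:
  fixes M :: "'a measure" and X :: "real \<Rightarrow> 'a \<Rightarrow> real" and \<alpha> :: real
    and D :: "'a \<Rightarrow> real" and Xpost :: "real \<Rightarrow> 'a \<Rightarrow> real"
    and Ptilde :: "real \<Rightarrow> (real \<Rightarrow> real) measure"
  defines "D \<equiv> (\<lambda>\<omega>. contact_time \<alpha> (\<lambda>t. X t \<omega>))"
    and "Xpost \<equiv> (\<lambda>t \<omega>. X (t + D \<omega>) \<omega> - X (D \<omega>) \<omega>)"
    and "Ptilde \<equiv> drift_law M X \<alpha>"
  assumes "\<alpha> > 0"
    and "two_sided_levy M X"
    and "\<not> (\<exists>a. AE \<omega> in M. \<forall>t. X t \<omega> = a * t)"
    and "integrable M (X 1)"
    and "\<bar>\<integral>\<omega>. X 1 \<omega> \<partial>M\<bar> < \<alpha>"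
    and "regular_for_positive (Ptilde 0)"
  shows "prob_space.indep_set M
           (sets (process_algebra M {0..} borel Xpost))
           (sets (process_algebra M UNIV cemetery_borel (killed_after D X)))
         \<and> (\<exists>Q. entrance_laws (H_kernel Ptilde) Q \<and>
              markovian M (\<lambda>t \<omega>. Xpost t \<omega> + \<alpha> * t) (H_kernel Ptilde) Q)"
proof -
  interpret L: regular_levy M X \<alpha>
    by unfold_locales (use assms in \<open>simp_all add: Ptilde_def\<close>)
  have D: "D = L.D" unfolding D_def by (simp add: fun_eq_iff L.D_def)
  have post: "Xpost = L.Xpost" unfolding Xpost_def D by (simp add: fun_eq_iff L.Xpost_def)
  have Y: "(\<lambda>t \<omega>. Xpost t \<omega> + \<alpha> * t) = L.Y" unfolding post by (simp add: fun_eq_iff L.Y_eq)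
  show ?thesis
    unfolding Y unfolding post D Ptilde_def
    using L.indep_post_pre L.entrance_laws_H L.markovian_Y by blast
qed

end
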